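(* Let $E\in\mathscr K$ with endpoints $l=\inf E$, $r=\sup E$, let $\mu$ be a fully supported Radon measure on $E$, and let $({\mathscr E},{\mathscr F})$ be the regular Dirichlet form on $L^2(E,\mu)$ of a quasidiffusion on $E$: \[ {\mathscr F}=\{f\in L^2(E,\mu)\cap H^1_e(E): f(j)=0 \text{ whenever } j\notin E \text{ and } |j|<\infty \text{ for } j=l \text{ or } r\}, \] \[ {\mathscr E}(f,g)=\frac12\int_E f'(x)g'(x)\,dx+\frac12\sum_{k\ge1}\frac{(f(b_k)-f(a_k))(g(b_k)-g(a_k))}{b_k-a_k}. \] Then a bilinear form $({\mathscr E}',{\mathscr F}')$ is a Fukushima subspace of $({\mathscr E},{\mathscr F})$ if and only if there is $\mathbf s\in\mathscr S$ such that \[ {\mathscr F}'=\{f\in L^2(E,\mu)\cap H^1_{e,\mathbf s}(E): f(j)=0 \text{ whenever } j\notin E \text{ and } |\mathbf s(j)|<\infty \text{ for } j=l \text{ or } r\}, \] \[ {\mathscr E}'(f,g)=\frac12\int_E \frac{df}{d\mathbf s}\frac{dg}{d\mathbf s}\,d\mathbf s+\frac12\sum_{k\ge1}\frac{(f(b_k)-f(a_k))(g(b_k)-g(a_k))}{\mathbf s(b_k)-\mathbf s(a_k)},\quad f,g\in{\mathscr F}'. \]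
   Context: $\mathscr K$ denotes the family of sets $E\subset\mathbb R$ such that $E\cup\{l,r\}$ is closed in $[-\infty,\infty]$, where $l=\inf E$, $r=\sup E$; assume $l<r$. $I$ is the interval with endpoints $l,r$ containing $l$ (resp. $r$) iff $l\in E$ (resp. $r\in E$); $I\setminus E=\bigcup_{k\ge1}(a_k,b_k)$ (disjoint open intervals). $H^1_e(E)$ is the set of restrictions to $E$ of absolutely continuous $f$ on $(l,r)$ with $f'\in L^2((l,r))$; $f(j)$ at an endpoint means the limit. For a continuous strictly increasing $\mathbf s$ on $E$, its extended scale function $\bar{\mathbf s}$ on $[l,r]$ equals $\mathbf s$ on $E$, is linear on each $(a_k,b_k)$ with $\bar{\mathbf s}(x)=\mathbf s(a_k)+\frac{\mathbf s(b_k)-\mathbf s(a_k)}{b_k-a_k}(x-a_k)$, and $\bar{\mathbf s}(l)=\lim_{x\downarrow l}\mathbf s(x)$, $\bar{\mathbf s}(r)=\lim_{x\uparrow r}\mathbf s(x)$. $d\bar{\mathbf s}$ is its Lebesgue–Stieltjes measure and $d\mathbf s$ its restriction to $E$. For $f\in C(I)$, $f\ll\bar{\mathbf s}$ means $f=g\circ\bar{\mathbf s}$ with $g$ absolutely continuous on $\bar{\mathbf s}(I)$, and $df/d\bar{\mathbf s}:=g'\circ\bar{\mathbf s}$. $H^1_{e,\mathbf s}(E)=\{f|_E: f\in C(I), f\ll\bar{\mathbf s}, df/d\bar{\mathbf s}\in L^2(I,d\bar{\mathbf s})\}$ and for $h=f|_E$, $dh/d\mathbf s:=(df/d\bar{\mathbf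 s})|_E$. $\mathscr S$ is the set of functions $\mathbf s=\bar{\mathbf s}|_E$ where $\bar{\mathbf s}$ (the extended scale function of $\mathbf s$) is strictly increasing and absolutely continuous with $\bar{\mathbf s}'\in\{0,1\}$ a.e. and $\bar{\mathbf s}'(x)=1$ for all $x\in I\setminus E$. A Fukushima subspace of $({\mathscr E},{\mathscr F})$ is a regular Dirichlet form $({\mathscr E}',{\mathscr F}')$ on $L^2(E,\mu)$ with ${\mathscr F}'\subset{\mathscr F}$ and ${\mathscr E}'={\mathscr E}$ on ${\mathscr F}'\times{\mathscr F}'$. *)

theory Defs
  imports "HOL-Analysis.Analysis"
begin

type_synonym rfun = "real \<Rightarrow> real"

definition lft :: "real set \<Rightarrow> ereal" where
  "lft E = Inf (ereal ` E)"

definition rgt :: "real set \<Rightarrow> ereal" where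
  "rgt E = Sup (ereal ` E)"

definition class_K :: "real set \<Rightarrow> bool" where
  "class_K E \<longleftrightarrow> closed (ereal ` E \<union> {lft E, rgt E}) \<and> lft E < rgt E"

definition Ival :: "real set \<Rightarrow> real set" where
  "Ival E = E \<union> {x. lft E < ereal x \<and> ereal x < rgt E}"

text \<open>The gaps (a_k,b_k): the connected components of I minus E, as pairs of endpoints.\<close>
definition gaps :: "real set \<Rightarrow> (real \<times> real) set" where
  "gaps E = {(a, b). a \<in> E \<and> b \<in> E \<and> a < b \<and> {a<..<b} \<inter> E = {}}"

definition left_filter :: "real set \<Rightarrow> real filter" where
  "left_filter E = (if lft E = -\<infinity> then at_bot else at_right (real_of_ereal (lft E)))"

definition right_filter :: "real set \<Rightarrow> real filter" where
  "right_filter E = (if rgt E = \<infinity> then at_top else at_left (real_of_ereal (rgt E)))"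

definition abs_cont_on :: "real set \<Rightarrow> rfun \<Rightarrow> bool" where
  "abs_cont_on S f \<longleftrightarrow>
     (\<forall>e>0. \<exists>d>0. \<forall>(n::nat) (a::nat \<Rightarrow> real) b.
        (\<forall>i<n. a i \<in> S \<and> b i \<in> S \<and> a i \<le> b i) \<and>
        disjoint_family_on (\<lambda>i. {a i<..<b i}) {..<n} \<and> (\<Sum>i<n. b i - a i) < d
        \<longrightarrow> (\<Sum>i<n. \<bar>f (b i) - f (a i)\<bar>) < e)"

definition loc_abs_cont_on :: "real set \<Rightarrow> rfun \<Rightarrow> bool" where
  "loc_abs_cont_on J f \<longleftrightarrow> (\<forall>c d. {c..d} \<subseteq> J \<longrightarrow> abs_cont_on {c..d} f)"

definition radon_on :: "real set \<Rightarrow> real measure \<Rightarrow> bool" where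
  "radon_on E \<mu> \<longleftrightarrow> (\<forall>K. compact K \<and> K \<subseteq> E \<longrightarrow> emeasure \<mu> K < \<infinity>)"

definition full_support :: "real set \<Rightarrow> real measure \<Rightarrow> bool" where
  "full_support E \<mu> \<longleftrightarrow> (\<forall>U. open U \<and> U \<inter> E \<noteq> {} \<longrightarrow> emeasure \<mu> (U \<inter> E) > 0)"

text \<open>Elements of L2(E,mu) are represented by functions; equality of L2 elements is
  mu-a.e. equality.\<close>
definition L2 :: "real measure \<Rightarrow> rfun set" where
  "L2 \<mu> = {f. f \<in> borel_measurable \<mu> \<and> integrable \<mu> (\<lambda>x. (f x)\<^sup>2)}"

definition E1 :: "real measure \<Rightarrow> (rfun \<Rightarrow> rfun \<Rightarrow> real) \<Rightarrow> rfun \<Rightarrow> real" where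
  "E1 \<mu> Ef f = Ef f f + (\<integral>x. (f x)\<^sup>2 \<partial>\<mu>)"

text \<open>A Dirichlet form on L2(mu): a densely defined, nonnegative, symmetric, closed,
  Markovian (unit contraction operates) bilinear form.  F is a set of representatives
  closed under mu-a.e. modification and Ef depends only on the a.e. classes.\<close>
definition dirichlet_form :: "real measure \<Rightarrow> rfun set \<Rightarrow> (rfun \<Rightarrow> rfun \<Rightarrow> real) \<Rightarrow> bool" where
  "dirichlet_form \<mu> F Ef \<longleftrightarrow>
     F \<subseteq> L2 \<mu> \<and>
     (\<forall>f\<in>F. \<forall>g\<in>L2 \<mu>. (AE x in \<mu>. f x = g x) \<longrightarrow> g \<in> F) \<and>
     (\<forall>f\<in>F. \<forall>g\<in>F. \<forall>h\<in>F. (AE x in \<mu>. f x = g x) \<longrightarrow> Ef f h = Ef g h) \<and>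
     (\<lambda>x. 0) \<in> F \<and>
     (\<forall>f\<in>F. \<forall>g\<in>F. (\<lambda>x. f x + g x) \<in> F) \<and>
     (\<forall>c. \<forall>f\<in>F. (\<lambda>x. c * f x) \<in> F) \<and>
     (\<forall>f\<in>F. \<forall>g\<in>F. \<forall>h\<in>F. Ef (\<lambda>x. f x + g x) h = Ef f h + Ef g h) \<and>
     (\<forall>c. \<forall>f\<in>F. \<forall>g\<in>F. Ef (\<lambda>x. c * f x) g = c * Ef f g) \<and>
     (\<forall>f\<in>F. \<forall>g\<in>F. Ef f g = Ef g f) \<and>
     (\<forall>f\<in>F. 0 \<le> Ef f f) \<and>
     (\<forall>f\<in>L2 \<mu>. \<forall>e>0. \<exists>g\<in>F. (\<integral>x. (f x - g x)\<^sup>2 \<partial>\<mu>) < e) \<and>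
     (\<forall>u::nat \<Rightarrow> rfun. (\<forall>n. u n \<in> F) \<and>
         (\<forall>e>0. \<exists>N. \<forall>m\<ge>N. \<forall>n\<ge>N. E1 \<mu> Ef (\<lambda>x. u n x - u m x) < e)
       \<longrightarrow> (\<exists>f\<in>F. (\<lambda>n. E1 \<mu> Ef (\<lambda>x. u n x - f x)) \<longlonglongrightarrow> 0)) \<and>
     (\<forall>f\<in>F. (\<lambda>x. min 1 (max 0 (f x))) \<in> F \<and>
        Ef (\<lambda>x. min 1 (max 0 (f x))) (\<lambda>x. min 1 (max 0 (f x))) \<le> Ef f f)"

definition Cc_on :: "real set \<Rightarrow> rfun set" where
  "Cc_on E = {f. continuous_on E f \<and> (\<exists>K. compact K \<and> K \<subseteq> E \<and> (\<forall>x\<in>E - K. f x = 0))}"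

definition regular_dirichlet_form ::
  "real set \<Rightarrow> real measure \<Rightarrow> rfun set \<Rightarrow> (rfun \<Rightarrow> rfun \<Rightarrow> real) \<Rightarrow> bool" where
  "regular_dirichlet_form E \<mu> F Ef \<longleftrightarrow>
     dirichlet_form \<mu> F Ef \<and>
     (\<forall>f\<in>F. \<forall>e>0. \<exists>g\<in>F \<inter> Cc_on E. E1 \<mu> Ef (\<lambda>x. f x - g x) < e) \<and>
     (\<forall>f\<in>Cc_on E. \<forall>e>0. \<exists>g\<in>F \<inter> Cc_on E. \<forall>x\<in>E. \<bar>f x - g x\<bar> < e)"

definition fukushima_subspace ::
  "real set \<Rightarrow> real measure \<Rightarrow> rfun set \<Rightarrow> (rfun \<Rightarrow> rfun \<Rightarrow> real)
     \<Rightarrow> rfun set \<Rightarrow> (rfun \<Rightarrow> rfun \<Rightarrow> real) \<Rightarrow> bool" where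
  "fukushima_subspace E \<mu> F Ef F' Ef' \<longleftrightarrow>
     regular_dirichlet_form E \<mu> F' Ef' \<and> F' \<subseteq> F \<and> (\<forall>f\<in>F'. \<forall>g\<in>F'. Ef' f g = Ef f g)"

definition H1e_rep :: "real set \<Rightarrow> rfun \<Rightarrow> bool" where
  "H1e_rep E g \<longleftrightarrow> loc_abs_cont_on (Ival E) g \<and>
     set_integrable lborel (Ival E) (\<lambda>x. (deriv g x)\<^sup>2)"

definition qd_domain :: "real set \<Rightarrow> real measure \<Rightarrow> rfun set" where
  "qd_domain E \<mu> = {f \<in> L2 \<mu>. \<exists>g. H1e_rep E g \<and> (AE x in \<mu>. f x = g x) \<and>
      (lft E \<notin> ereal ` E \<and> \<bar>lft E\<bar> \<noteq> \<infinity> \<longrightarrow> (g \<longlongrightarrow> 0) (left_filter E)) \<and>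
      (rgt E \<notin> ereal ` E \<and> \<bar>rgt E\<bar> \<noteq> \<infinity> \<longrightarrow> (g \<longlongrightarrow> 0) (right_filter E))}"

definition qd_form :: "real set \<Rightarrow> real measure \<Rightarrow> rfun \<Rightarrow> rfun \<Rightarrow> real" where
  "qd_form E \<mu> f h =
     (let gf = (SOME g. H1e_rep E g \<and> (AE x in \<mu>. f x = g x));
          gh = (SOME g. H1e_rep E g \<and> (AE x in \<mu>. h x = g x))
      in 1/2 * (LINT x:E|lborel. deriv gf x * deriv gh x)
         + 1/2 * infsum (\<lambda>p. (gf (snd p) - gf (fst p)) * (gh (snd p) - gh (fst p))
                              / (snd p - fst p)) (gaps E))"

text \<open>The extended scale function of s, defined on [l,r] (as a real function; beyond a
  finite endpoint it is continued by the constant endpoint value, which only serves to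
  define its Lebesgue-Stieltjes measure on the whole line).\<close>
definition ext_scale :: "real set \<Rightarrow> rfun \<Rightarrow> rfun" where
  "ext_scale E s x =
    (if x \<in> E then s x
     else if ereal x \<le> lft E then
       (if real_of_ereal (lft E) \<in> E then s (real_of_ereal (lft E))
        else Lim (at (real_of_ereal (lft E)) within E) s)
     else if rgt E \<le> ereal x then
       (if real_of_ereal (rgt E) \<in> E then s (real_of_ereal (rgt E))
        else Lim (at (real_of_ereal (rgt E)) within E) s)
     else (let p = (THE p. p \<in> gaps E \<and> fst p < x \<and> x < snd p)
           in s (fst p) + (s (snd p) - s (fst p)) / (snd p - fst p) * (x - fst p)))"

definition ls_measure :: "real set \<Rightarrow> rfun \<Rightarrow> real measure" where
  "ls_measure E s = interval_measure (ext_scale E s)"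

definition scale_S :: "real set \<Rightarrow> rfun set" where
  "scale_S E = {s. continuous_on E s \<and> strict_mono_on E s \<and>
      strict_mono_on (Ival E) (ext_scale E s) \<and>
      loc_abs_cont_on (Ival E) (ext_scale E s) \<and>
      (AE x in lborel. x \<in> Ival E \<longrightarrow>
          (ext_scale E s has_real_derivative 0) (at x) \<or>
          (ext_scale E s has_real_derivative 1) (at x)) \<and>
      (\<forall>x \<in> Ival E - E. (ext_scale E s has_real_derivative 1) (at x))}"

text \<open>f = g o sbar on I with g absolutely continuous on sbar(I) and
  df/dsbar = g' o sbar in L2(I, dsbar).\<close>
definition H1es_rep :: "real set \<Rightarrow> rfun \<Rightarrow> rfun \<Rightarrow> bool" where
  "H1es_rep E s g \<longleftrightarrow> loc_abs_cont_on (ext_scale E s ` Ival E) g \<and>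
     set_integrable (ls_measure E s) (Ival E) (\<lambda>x. (deriv g (ext_scale E s x))\<^sup>2)"

definition qds_domain :: "real set \<Rightarrow> real measure \<Rightarrow> rfun \<Rightarrow> rfun set" where
  "qds_domain E \<mu> s = {f \<in> L2 \<mu>. \<exists>g. H1es_rep E s g \<and>
      (AE x in \<mu>. f x = g (ext_scale E s x)) \<and>
      (lft E \<notin> ereal ` E \<and> (\<exists>c. (ext_scale E s \<longlongrightarrow> c) (left_filter E))
         \<longrightarrow> ((\<lambda>x. g (ext_scale E s x)) \<longlongrightarrow> 0) (left_filter E)) \<and>
      (rgt E \<notin> ereal ` E \<and> (\<exists>c. (ext_scale E s \<longlongrightarrow> c) (right_filter E))
         \<longrightarrow> ((\<lambda>x. g (ext_scale E s x)) \<longlongrightarrow> 0) (right_filter E))}"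

definition qds_form :: "real set \<Rightarrow> real measure \<Rightarrow> rfun \<Rightarrow> rfun \<Rightarrow> rfun \<Rightarrow> real" where
  "qds_form E \<mu> s f h =
     (let gf = (SOME g. H1es_rep E s g \<and> (AE x in \<mu>. f x = g (ext_scale E s x)));
          gh = (SOME g. H1es_rep E s g \<and> (AE x in \<mu>. h x = g (ext_scale E s x)))
      in 1/2 * (LINT x:E|ls_measure E s. deriv gf (ext_scale E s x) * deriv gh (ext_scale E s x))
         + 1/2 * infsum (\<lambda>p. (gf (ext_scale E s (snd p)) - gf (ext_scale E s (fst p)))
                            * (gh (ext_scale E s (snd p)) - gh (ext_scale E s (fst p)))
                            / (s (snd p) - s (fst p))) (gaps E))"

end

theory Submission
 imports Defs "HOL-Analysis.Analysis"
begin

text \<open>Call a Borel set A admissible if it lies between the union of the gaps and I and meets every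
 interval of I in positive measure. Let dom A consist of the functions of L2 that have a square integrable
 density vanishing off A (and the boundary values 0 at endpoints near which A has finite measure), with
 form f g equal to half the integral of the product of the densities. The quasidiffusion is the case A = I.
 For s in S and A = {sbar' = 1} we have d sbar = 1_A dx, and sbar pushes this measure forward to Lebesgue
 measure, so the form attached to s is dom A. Every dom A is regular by truncation and cut-off.

 Conversely let F be a Fukushima subspace. Regularity and the unit contraction allow us to cut an element of F
 at a point p of E where it vanishes. Project the indicator of a window [a, b] with a, b in E onto the closure of
 the restricted densities of F; cutting at all p turns orthogonality of the error 1 - q into (1 - q) f' = 0
 almost everywhere, for all f in F. Hence densities of F live on A, the union of the gaps and of the sets {q = 1}.
 If f is in dom A, then the error of the same projection for f' kills every density of F, so it
 vanishes on A, and f is approximated by elements of F.\<close>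

text \<open>Elements of L2 carry information only on \<open>E\<close>, whereas densities live on all
  of \<open>I\<close>. Averaging a density over each gap selects one representative, lowers the
  energy and turns the jump sum into an integral, so that a single L2 space of densities serves all
  the forms; constancy on gaps is also why cutting at points of \<open>E\<close> suffices. A
  Fukushima subspace is only known to be stable under sums, multiples and the unit contraction.
  Projections take place in L2 of Lebesgue measure on a window, while the subspace is closed in a
  norm that also involves \<open>mu\<close>. The two are reconciled by correcting values at both
  ends of the window: the function is then recovered from its density, and windows have finite
  \<open>mu\<close> measure. Finally, the definitions speak of \<open>deriv\<close>, an arbitrary
  number where no derivative exists, so measurability of derivatives and the fundamental theorem for
  absolutely continuous functions have to come beforehand.\<close>

notation LIMSEQ (infix "---->" 60)

abbreviation sqn :: "'a measure => ('a => real) => real" where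
 "sqn M q == \<integral>x. (q x)^2 \<partial>M"

abbreviation sqd :: "'a measure => ('a => real) => ('a => real) => real" where
 "sqd M f g == \<integral>x. (f x - g x)^2 \<partial>M"

lemmas bintegral_cong = Bochner_Integration.integral_cong[OF refl]

section \<open>Lebesgue differentiation and completeness\<close>

text \<open>Weigh the excess of \<open>h\<close> over \<open>p\<close> as a measure. It vanishes on
  \<open>{h < p}\<close>, so by outer regularity some open set around that part of a bounded window
  has excess below \<open>e * (q - p)\<close>. A disjoint Vitali family of intervals inside it, each
  with mean above \<open>q\<close>, has excess at least \<open>q - p\<close> times its length, hence
  total length at most \<open>e\<close>.\<close>

lemma vitali_density_bound:
 fixes h :: "real => real"
 assumes h: "integrable lborel h" and pq: "p < q"
 shows "negligible {x. h x < p & (ALL d>0. EX y z. y <= x & x <= z & y < z & z - y < d &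
   (LBINT t:{y..z}. h t) > q * (z - y))}"
proof -
 have hm[measurable]: "h : borel_measurable borel"
  using h by auto
 have hs: "set_integrable lborel {y..z} h" for y z
  using integrable_mult_indicator[OF _ h, of "{y..z}"] by (simp add: set_integrable_def)
 define P where "P x = (ALL d>0. EX y z. y <= x & x <= z & y < z & z - y < d & (LBINT t:{y..z}. h t) > q * (z - y))" for x
 define S where "S n = {x\<in>{- real n<..<real n}. h x < p & P x}" for n :: nat
 have "negligible (S n)" for n
  unfolding negligible_outer_le
 proof (intro allI impI)
  fix e :: real assume e: "e > 0"
  define w where "w x = indicator {- real n<..<real n} x * max 0 (h x - p)" for x
  have wm[measurable]: "w : borel_measurable borel"
   unfolding w_def by measurable
  have wint: "integrable lborel w"
  proof (rule Bochner_Integration.integrable_bound)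
   show "integrable lborel (%x. \<bar>h x\<bar> + \<bar>p\<bar> * indicator {- real n<..<real n} x)"
    using h by (intro Bochner_Integration.integrable_add integrable_abs integrable_mult_right integrable_real_indicator) auto
   show "AE x in lborel. norm (w x) <= norm (\<bar>h x\<bar> + \<bar>p\<bar> * indicator {- real n<..<real n} x)"
    by (auto simp: w_def indicator_def)
  qed simp
  have w0: "0 <= w x" for x by (simp add: w_def)
  define N where "N = density lborel (%x. ennreal (w x))"
  have Nfin: "emeasure N (space N) ~= \<infinity>"
  proof -
   have "emeasure N (space N) = (\<integral>\<^sup>+x. ennreal (w x) \<partial>lborel)"
    by (simp add: N_def emeasure_density)
   also have "\<dots> = ennreal (integral\<^sup>L lborel w)"
    by (rule nn_integral_eq_integral[OF wint]) (simp add: w0)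
   finally show ?thesis by simp
  qed
  define T where "T = {x\<in>{- real n<..<real n}. h x < p}"
  have Tm[measurable]: "T : sets borel" unfolding T_def by measurable
  have "emeasure N T = (\<integral>\<^sup>+x. ennreal (w x) * indicator T x \<partial>lborel)"
   by (simp add: N_def emeasure_density)
  also have "\<dots> = (\<integral>\<^sup>+(x::real). 0 \<partial>lborel)"
   by (rule nn_integral_cong) (auto simp: w_def T_def indicator_def)
  finally have NT: "emeasure N T = 0" by simp
  have "emeasure N T = (INF U \<in> {U. T <= U & open U}. emeasure N U)"
   by (rule outer_regular[OF _ Nfin]) (auto simp: N_def)
  hence "(INF U \<in> {U. T <= U & open U}. emeasure N U) < ennreal (e * (q - p))"
   using NT e pq by auto
  then obtain U0 where U0: "T <= U0" "open U0" "emeasure N U0 < ennreal (e * (q - p))"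
   by (auto simp: INF_less_iff)
  define U where "U = U0 Int {- real n<..<real n}"
  have U: "T <= U" "open U" "U <= {- real n<..<real n}"
   using U0 by (auto simp: U_def T_def)
  have NU: "emeasure N U < ennreal (e * (q - p))"
   using U0 by (intro le_less_trans[OF emeasure_mono U0(3)]) (auto simp: U_def N_def)
  define K where "K = {(c, r). r > 0 & cball c r <= U & (LBINT t:cball c r. h t) > q * (2 * r)}"
  have Sd: "EX i. i : K & x : cball (fst i) (snd i) & snd i < d" if x: "x : S n" and d: "0 < d" for x d
  proof -
   have "x : U" using x U(1) by (auto simp: S_def T_def)
   then obtain d' where d': "d' > 0" "cball x d' <= U"
    using U(2) open_contains_cball by blast
   have "P x" using x by (simp add: S_def)
   then obtain y z where yz: "y <= x" "x <= z" "y < z" "z - y < min d d'"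
    "(LBINT t:{y..z}. h t) > q * (z - y)"
    unfolding P_def using d d'(1) by (auto dest!: spec[of _ "min d d'"] simp del: min_less_iff_conj)
   \<comment> \<open>The covering theorem speaks of balls; an interval containing \<open>x\<close>
     is a ball around its own midpoint, which need not be \<open>x\<close>.\<close>
   have cb: "cball ((y + z)/2) ((z - y)/2) = {y..z}"
    by (auto simp: cball_eq_atLeastAtMost field_simps)
   have "{y..z} <= cball x d'" using yz by (auto simp: dist_real_def)
   hence "((y+z)/2, (z-y)/2) : K"
    using yz d' by (auto simp: K_def cb algebra_simps)
   moreover have "x : cball ((y + z)/2) ((z - y)/2)" using yz cb by auto
   ultimately show ?thesis using yz by (intro exI[of _ "((y+z)/2, (z-y)/2)"]) auto
  qed
  have K0: "0 < snd i" if "i : K" for i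
   using that by (auto simp: K_def)
  obtain C where C: "countable C" "C <= K"
   and pw: "pairwise (%i j. disjnt (cball (fst i) (snd i)) (cball (fst j) (snd j))) C"
   and neg: "negligible (S n - (\<Union>i \<in> C. cball (fst i) (snd i)))"
   using Vitali_covering_theorem_cballs[OF K0 Sd] by blast
  define W where "W = (\<Union>i \<in> C. cball (fst i) (snd i))"
  have "cball (fst i) (snd i) <= U" if "i : C" for i
  proof -
   have "i : K" using that C(2) by blast
   thus ?thesis by (cases i) (simp add: K_def)
  qed
  hence WU: "W <= U" unfolding W_def by blast
  have Wm[measurable]: "W : sets borel" unfolding W_def using C(1) by (intro sets.countable_UN'') auto
  have dj: "disjoint_family_on (%i. cball (fst i) (snd i)) C"
   using pw by (auto simp: disjoint_family_on_def pairwise_def disjnt_def)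
  have key: "ennreal (q - p) * emeasure lborel (cball (fst i) (snd i)) <= emeasure N (cball (fst i) (snd i))" if i: "i : C" for i
  proof -
   obtain c r where ir: "i = (c, r)" by (cases i)
   have r: "r > 0" "cball c r <= U" "(LBINT t:cball c r. h t) > q * (2 * r)"
    using i C(2) ir by (auto simp: K_def)
   have cs: "set_integrable lborel {c - r..c + r} (%x. p)"
   proof -
    have "integrable lborel (indicat_real {c - r..c + r})"
     by (rule integrable_real_indicator) (auto simp: emeasure_lborel_Icc_eq)
    thus ?thesis by (simp add: set_integrable_def)
   qed
   have eq: "cball c r = {c - r..c + r}" by (simp add: cball_eq_atLeastAtMost)
   have "(q - p) * (2 * r) <= (LBINT t:cball c r. h t) - p * (2 * r)"
    using r by (simp add: algebra_simps)
   also have "p * (2 * r) = (LBINT t:cball c r. p)"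
    using r by (simp add: eq set_integral_const measure_def)
   also have "(LBINT t:cball c r. h t) - (LBINT t:cball c r. p) = (LBINT t:cball c r. h t - p)"
    unfolding eq by (rule set_integral_diff(2)[symmetric, OF hs cs])
   also have "\<dots> <= (LBINT t:cball c r. w t)"
   proof (rule set_integral_mono)
    show "set_integrable lborel (cball c r) (%t. h t - p)"
      unfolding eq by (rule set_integral_diff(1)[OF hs cs])
    show "set_integrable lborel (cball c r) w"
     using integrable_mult_indicator[OF _ wint, of "cball c r"] by (auto simp: set_integrable_def)
    show "h x - p <= w x" if "x : cball c r" for x
    proof -
     have "x : {- real n<..<real n}" using that r(2) U(3) by blast
     thus ?thesis by (simp add: w_def)
    qed
   qed
   finally have "ennreal ((q - p) * (2 * r)) <= ennreal (LBINT t:cball c r. w t)"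
    by (rule ennreal_leI)
   also have "\<dots> = (\<integral>\<^sup>+t. ennreal (indicator (cball c r) t * w t) \<partial>lborel)"
    unfolding set_lebesgue_integral_def
    using integrable_mult_indicator[OF _ wint, of "cball c r"]
    by (subst nn_integral_eq_integral) (auto simp: w0)
   also have "\<dots> = emeasure N (cball c r)"
    by (auto simp: N_def emeasure_density intro!: nn_integral_cong split: split_indicator)
   finally show ?thesis
    using r pq by (simp add: ir eq ennreal_mult' del: ennreal_mult'')
  qed
  have "ennreal (q - p) * emeasure lborel W = (\<integral>\<^sup>+i. ennreal (q - p) * emeasure lborel (cball (fst i) (snd i)) \<partial>count_space C)"
   unfolding W_def by (subst emeasure_UN_countable[OF _ C(1) dj]) (auto simp: nn_integral_cmult)
  also have "\<dots> <= (\<integral>\<^sup>+i. emeasure N (cball (fst i) (snd i)) \<partial>count_space C)"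
   by (rule nn_integral_mono) (use key in auto)
  also have "\<dots> = emeasure N W"
   unfolding W_def by (subst emeasure_UN_countable[OF _ C(1) dj]) (auto simp: N_def)
  also have "\<dots> <= emeasure N U"
   by (rule emeasure_mono[OF WU]) (use U in \<open>auto simp: N_def\<close>)
  also have "\<dots> < ennreal (q - p) * ennreal e"
   using NU pq e by (simp add: ennreal_mult'[symmetric] mult.commute)
  finally have finlt: "ennreal (q - p) * emeasure lborel W < ennreal (q - p) * ennreal e" .
  have We: "emeasure lborel W <= ennreal e"
  proof (rule ccontr)
   assume "~ emeasure lborel W <= ennreal e"
   hence "ennreal (q - p) * ennreal e <= ennreal (q - p) * emeasure lborel W"
    by (intro mult_left_mono) auto
   with finlt show False by simp
  qed
  have "S n <= (S n - W) Un W" by blast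
  moreover have "(S n - W) Un W : lmeasurable"
  proof -
   have "emeasure lborel W < \<infinity>" using le_less_trans[OF We ennreal_less_top] by simp
   hence "W : lmeasurable" by (intro fmeasurableI) (auto simp: emeasure_completion)
   moreover have "S n - W : lmeasurable"
    using neg unfolding W_def by (rule negligible_imp_measurable)
   ultimately show ?thesis by (intro fmeasurable.Un)
  qed
  moreover have "measure lebesgue ((S n - W) Un W) <= e"
  proof -
   have "emeasure lebesgue ((S n - W) Un W) = emeasure lebesgue W"
   proof -
    have "W : sets lebesgue" "S n - W : null_sets lebesgue"
     using neg Wm by (simp_all add: W_def negligible_iff_null_sets)
    thus ?thesis by (metis Un_commute emeasure_Un_null_set)
   qed
   hence "measure lebesgue ((S n - W) Un W) = measure lebesgue W" by (simp add: measure_def)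
   also have "\<dots> <= e" using We e by (simp add: measure_def emeasure_completion enn2real_leI)
   finally show ?thesis .
  qed
  ultimately show "EX T. S n <= T & T : lmeasurable & measure lebesgue T <= e" by blast
 qed
 hence "negligible (\<Union>n. S n)" by (intro negligible_countable_Union) auto
 moreover have "{x. h x < p & P x} <= (\<Union>n. S n)"
 proof
  fix x assume x: "x : {x. h x < p & P x}"
  obtain n where "\<bar>x\<bar> < real n" using reals_Archimedean2 by blast
  hence "x : S n" using x by (auto simp: S_def)
  thus "x : (\<Union>n. S n)" by blast
 qed
 ultimately show ?thesis unfolding P_def by (rule negligible_subset)
qed

text \<open>If the bound failed at \<open>x\<close> for some \<open>e\<close>, two rationals
  \<open>p < q\<close> strictly between \<open>h x\<close> and \<open>h x + e\<close> would place
  \<open>x\<close> in one of countably many null sets.\<close>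

lemma AE_avg_le:
 fixes h :: "real => real"
 assumes h: "integrable lborel h"
 shows "AE x in lborel. ALL e>0. EX d>0. ALL y z. y <= x & x <= z & y < z & z - y < d
   --> (LBINT t:{y..z}. h t) <= (h x + e) * (z - y)"
proof -
 define B where "B p q = {x. h x < p & (ALL d>0. EX y z. y <= x & x <= z & y < z & z - y < d &
   (LBINT t:{y..z}. h t) > q * (z - y))}" for p q
 have "negligible (\<Union>(p,q)\<in>{(p,q). p : \<rat> & q : \<rat> & p < q}. B p q)"
 proof (rule negligible_countable_Union)
  have "countable (\<rat> \<times> \<rat> :: (real \<times> real) set)" by (intro countable_SIGMA countable_rat)
  hence "countable {(p,q::real). p : \<rat> & q : \<rat> & p < q}"
   by (rule countable_subset[rotated]) auto
  thus "countable ((%(p, q). B p q) ` {(p,q). p : \<rat> & q : \<rat> & p < q})" by (rule countable_image)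
  show "negligible X" if "X : (%(p, q). B p q) ` {(p,q). p : \<rat> & q : \<rat> & p < q}" for X
   using that vitali_density_bound[OF h] by (auto simp: B_def)
 qed
 hence "AE x in lebesgue. x ~: (\<Union>(p,q)\<in>{(p,q). p : \<rat> & q : \<rat> & p < q}. B p q)"
  unfolding negligible_iff_null_sets by (rule AE_not_in)
 hence ae: "AE x in lborel. x ~: (\<Union>(p,q)\<in>{(p,q). p : \<rat> & q : \<rat> & p < q}. B p q)"
  by (simp add: AE_completion_iff)
 show ?thesis
  using ae
 proof (eventually_elim, intro allI impI)
  fix x e :: real assume x: "x ~: (\<Union>(p,q)\<in>{(p,q). p : \<rat> & q : \<rat> & p < q}. B p q)" and e: "e > 0"
  obtain p where p: "p : \<rat>" "h x < p" "p < h x + e" using Rats_dense_in_real[of "h x" "h x + e"] e by auto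
  obtain q where q: "q : \<rat>" "p < q" "q < h x + e" using Rats_dense_in_real[of p "h x + e"] p by auto
  have "x ~: B p q" using x p q by auto
  hence "~ (ALL d>0. EX y z. y <= x & x <= z & y < z & z - y < d & (LBINT t:{y..z}. h t) > q * (z - y))"
   using p by (simp add: B_def)
  then obtain d where d0: "d > 0" "~ (EX y z. y <= x & x <= z & y < z & z - y < d & (LBINT t:{y..z}. h t) > q * (z - y))"
   by blast
  have d: "(LBINT t:{y..z}. h t) <= q * (z - y)" if "y <= x" "x <= z" "y < z" "z - y < d" for y z
   using d0(2) that by (meson not_le)
  show "EX d>0. ALL y z. y <= x & x <= z & y < z & z - y < d --> (LBINT t:{y..z}. h t) <= (h x + e) * (z - y)"
  proof (intro exI conjI allI impI)
   fix y z assume yz: "y <= x & x <= z & y < z & z - y < d"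
   have "(LBINT t:{y..z}. h t) <= q * (z - y)" using d yz by auto
   also have "\<dots> <= (h x + e) * (z - y)" using q yz by (intro mult_right_mono) auto
   finally show "(LBINT t:{y..z}. h t) <= (h x + e) * (z - y)" .
  qed (rule d0)
 qed
qed

text \<open>The one-sided mean estimate is applied to \<open>h\<close> and to \<open>-h\<close>. The
  quantifier over \<open>G\<close> stands inside the almost everywhere statement: the exceptional
  set depends on \<open>h\<close> alone, and \<open>G\<close> has to be a primitive only near
  \<open>x\<close>, so functions controlled merely on a subinterval can be treated.\<close>

lemma lebesgue_differentiation:
 fixes h :: "real => real"
 assumes h: "integrable lborel h"
 shows "AE x in lborel. ALL G. (EX d>0. ALL y z. x - d < y & y <= z & z < x + d --> G z - G y = (LBINT t:{y..z}. h t))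
   --> (G has_real_derivative h x) (at x)"
 using AE_avg_le[OF h] AE_avg_le[OF integrable_minus[OF h]]
proof (eventually_elim, intro allI impI)
 fix x G
 assume 1: "ALL e>0. EX d>0. ALL y z. y <= x & x <= z & y < z & z - y < d
   --> (LBINT t:{y..z}. h t) <= (h x + e) * (z - y)"
 and 2: "ALL e>0. EX d>0. ALL y z. y <= x & x <= z & y < z & z - y < d
   --> (LBINT t:{y..z}. - h t) <= (- h x + e) * (z - y)"
 and "EX d>0. ALL y z. x - d < y & y <= z & z < x + d --> G z - G y = (LBINT t:{y..z}. h t)"
 then obtain d0 where d0: "d0 > 0" and G: "!!y z. x - d0 < y ==> y <= z ==> z < x + d0 ==> G z - G y = (LBINT t:{y..z}. h t)"
  by blast
 have hs: "set_integrable lborel {y..z} h" for y z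
  using integrable_mult_indicator[OF _ h, of "{y..z}"] by (simp add: set_integrable_def)
 show "(G has_real_derivative h x) (at x)"
  unfolding has_field_derivative_iff LIM_eq
 proof (intro allI impI)
  fix r :: real assume r: "r > 0"
  obtain d1 where d1: "d1 > 0" "!!y z. y <= x ==> x <= z ==> y < z ==> z - y < d1
   ==> (LBINT t:{y..z}. h t) <= (h x + r/2) * (z - y)" using 1[rule_format, of "r/2"] r by auto
  obtain d2 where d2: "d2 > 0" "!!y z. y <= x ==> x <= z ==> y < z ==> z - y < d2
   ==> (LBINT t:{y..z}. - h t) <= (- h x + r/2) * (z - y)" using 2[rule_format, of "r/2"] r by auto
  show "EX s>0. ALL y. y ~= x & norm (y - x) < s --> norm ((G y - G x) / (y - x) - h x) < r"
  proof (intro exI[of _ "min d0 (min d1 d2)"] conjI allI impI)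
   show "0 < min d0 (min d1 d2)" using d0 d1 d2 by auto
   fix y assume y: "y ~= x & norm (y - x) < min d0 (min d1 d2)"
   define a b where "a = min x y" and "b = max x y"
   have ab: "a <= x" "x <= b" "a < b" "b - a < d1" "b - a < d2" "x - d0 < a" "b < x + d0"
    using y by (auto simp: a_def b_def)
   \<comment> \<open>The difference quotient is symmetric in its two points, so they may be
     sorted.\<close>
   have quo: "(G y - G x) / (y - x) = (G b - G a) / (b - a)"
   proof (cases "x <= y")
    case False
    thus ?thesis
     using minus_divide_divide[of "G x - G y" "x - y"] by (simp add: a_def b_def)
   qed (simp add: a_def b_def)
   have Gab: "G b - G a = (LBINT t:{a..b}. h t)" using G ab by auto
   have u: "G b - G a <= (h x + r/2) * (b - a)" using d1(2)[OF ab(1-4)] Gab by simp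
   have "- (G b - G a) <= (- h x + r/2) * (b - a)"
    using d2(2)[OF ab(1-3) ab(5)] Gab set_integral_uminus[OF hs] by simp
   hence l: "(h x - r/2) * (b - a) <= G b - G a" by (simp add: algebra_simps)
   have "(G b - G a) / (b - a) <= h x + r/2" "h x - r/2 <= (G b - G a) / (b - a)"
    using u l ab by (auto simp: pos_divide_le_eq pos_le_divide_eq)
   thus "norm ((G y - G x) / (y - x) - h x) < r"
    unfolding quo using r by auto
  qed
 qed
qed

text \<open>The limit is given explicitly as a pointwise \<open>lim\<close> along a subsequence, and
  not just up to null sets. Identities shared by all \<open>u n\<close> at given points, such as
  vanishing off a set or equality of two values, therefore pass to the limit at every point, even
  where the sequence diverges in a way common to both points.\<close>

lemma L2_complete:
 fixes u :: "nat => 'a => real"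
 assumes [measurable]: "!!n. u n : borel_measurable M"
  and int: "!!n. integrable M (%x. (u n x)^2)"
  and cau: "!!e. e > 0 ==> EX N. ALL m>=N. ALL n>=N. sqd M (u n) (u m) < e"
 obtains r where "strict_mono r"
  "(%x. lim (%j. u (r j) x)) : borel_measurable M"
  "AE x in M. (%j. u (r j) x) ----> lim (%j. u (r j) x)"
  "integrable M (%x. (lim (%j. u (r j) x))^2)"
  "(%n. \<integral>x. (u n x - lim (%j. u (r j) x))^2 \<partial>M) ----> 0"
proof -
 have intd: "integrable M (%x. (u n x - u m x)^2)" for n m
 proof (rule Bochner_Integration.integrable_bound)
  show "integrable M (%x. 2 * (u n x)^2 + 2 * (u m x)^2)" using int by auto
  show "AE x in M. norm ((u n x - u m x)^2) <= norm (2 * (u n x)^2 + 2 * (u m x)^2)"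
  proof (rule AE_I2)
   fix x
   have "(u n x - u m x)^2 <= 2 * (u n x)^2 + 2 * (u m x)^2"
    using zero_le_power2[of "u n x + u m x"] by (simp add: power2_eq_square algebra_simps)
   thus "norm ((u n x - u m x)^2) <= norm (2 * (u n x)^2 + 2 * (u m x)^2)" by simp
  qed
 qed measurable
 \<comment> \<open>The rate 1/8 leaves room for the weight \<open>2^j\<close>: the weighted squares
   have integrals at most \<open>(1/4)^j\<close>, and
   \<open>|D j x| <= 2^j * (D j x)^2 + (1/2)^j\<close> turns summability of weighted squares into
   absolute summability.\<close>
 have "EX N. ALL m>=N. ALL n>=N. sqd M (u n) (u m) < (1/8)^j" for j
  by (rule cau) simp
 then obtain N where N: "!!j m n. m >= N j ==> n >= N j ==> sqd M (u n) (u m) < (1/8)^j"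
  by metis
 define r where "r j = (\<Sum>i\<le>j. N i) + j" for j
 have rm: "strict_mono r"
  by (rule strict_monoI_Suc) (simp add: r_def)
 have rN: "N j <= r j" for j
  unfolding r_def by (rule trans_le_add1) (rule member_le_sum, auto)
 have rN': "N j <= r (Suc j)" for j
  using rN[of j] rm by (meson Suc_n_not_le_n le_trans nat_le_linear strict_mono_less_eq)
 define D where "D j x = u (r (Suc j)) x - u (r j) x" for j x
 have Dm[measurable]: "D j : borel_measurable M" for j unfolding D_def by measurable
 have Dint: "(\<integral>\<^sup>+x. ennreal (2^j * (D j x)^2) \<partial>M) <= ennreal ((1/4)^j)" for j
 proof -
  have "(\<integral>\<^sup>+x. ennreal (2^j * (D j x)^2) \<partial>M) = ennreal (\<integral>x. 2^j * (D j x)^2 \<partial>M)"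
   by (rule nn_integral_eq_integral) (use intd in \<open>auto simp: D_def\<close>)
  also have "(\<integral>x. 2^j * (D j x)^2 \<partial>M) = 2^j * sqn M (D j)" by simp
  also have "\<dots> <= 2^j * (1/8)^j"
   using N[OF rN rN'] by (intro mult_left_mono) (auto simp: D_def less_imp_le)
  also have "\<dots> = (1/4)^j" by (simp add: power_mult_distrib[symmetric])
  finally show ?thesis by (simp add: ennreal_leI)
 qed
 have "(\<integral>\<^sup>+x. (\<Sum>j. ennreal (2^j * (D j x)^2)) \<partial>M) = (\<Sum>j. \<integral>\<^sup>+x. ennreal (2^j * (D j x)^2) \<partial>M)"
  by (rule nn_integral_suminf) measurable
 also have "\<dots> <= (\<Sum>j. ennreal ((1/4)^j))"
  by (rule suminf_le) (use Dint in auto)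
 also have "\<dots> = ennreal (\<Sum>j. (1/4)^j)"
  by (rule suminf_ennreal2) (auto simp: summable_geometric)
 finally have "(\<integral>\<^sup>+x. (\<Sum>j. ennreal (2^j * (D j x)^2)) \<partial>M) ~= \<infinity>" by (auto simp: top_unique)
 hence "AE x in M. (\<Sum>j. ennreal (2^j * (D j x)^2)) ~= \<infinity>"
  by (intro nn_integral_PInf_AE) measurable
 hence aec: "AE x in M. (%j. u (r j) x) ----> lim (%j. u (r j) x)"
 proof eventually_elim
  case (elim x)
  hence s1: "summable (%j. 2^j * (D j x)^2)" by (intro summable_suminf_not_top) auto
  have "summable (%j. 2^j * (D j x)^2 + (1/2)^j)"
   by (intro summable_add s1) (simp add: summable_geometric)
  hence "summable (%j. D j x)"
  proof (rule summable_comparison_test'[where N=0])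
   fix j
   have "0 <= (2^j * \<bar>D j x\<bar> - 1)^2 * (1/2)^j" by simp
   also have "\<dots> = 2^j * (D j x)^2 + (1/2)^j - 2 * \<bar>D j x\<bar>"
    by (simp add: power2_eq_square algebra_simps power_divide)
   finally show "norm (D j x) <= 2^j * (D j x)^2 + (1/2)^j" by simp
  qed
  hence "(%n. \<Sum>j<n. D j x) ----> (\<Sum>j. D j x)" by (rule summable_LIMSEQ)
  moreover have "(\<Sum>j<n. D j x) = u (r n) x - u (r 0) x" for n
   unfolding D_def by (rule sum_lessThan_telescope)
  ultimately have "(%n. u (r n) x - u (r 0) x + u (r 0) x) ----> (\<Sum>j. D j x) + u (r 0) x"
   by (intro tendsto_add) auto
  hence "convergent (%j. u (r j) x)" by (auto simp: convergent_def)
  thus ?case by (simp add: convergent_LIMSEQ_iff)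
 qed
 define U where "U x = lim (%j. u (r j) x)" for x
 have Um[measurable]: "U : borel_measurable M" unfolding U_def by measurable
 \<comment> \<open>Fatou along the subsequence transfers the Cauchy bound to the limit
   \<open>U\<close>; integrability of the difference is then a consequence.\<close>
 have fat: "(\<integral>\<^sup>+x. ennreal ((u n x - U x)^2) \<partial>M) <= ennreal e"
  if e: "e > 0" and n: "ALL m>=K. ALL n>=K. sqd M (u n) (u m) < e" "n >= K" for n e K
 proof -
  have "(\<integral>\<^sup>+x. ennreal ((u n x - U x)^2) \<partial>M) = (\<integral>\<^sup>+x. liminf (%j. ennreal ((u n x - u (r j) x)^2)) \<partial>M)"
  proof (rule nn_integral_cong_AE)
   show "AE x in M. ennreal ((u n x - U x)^2) = liminf (%j. ennreal ((u n x - u (r j) x)^2))"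
    using aec
   proof eventually_elim
    case (elim x)
    have "(%j. ennreal ((u n x - u (r j) x)^2)) ----> ennreal ((u n x - U x)^2)"
     unfolding U_def by (intro tendsto_ennrealI tendsto_intros elim)
    thus ?case by (intro lim_imp_Liminf[symmetric]) auto
   qed
  qed
  also have "\<dots> <= liminf (%j. \<integral>\<^sup>+x. ennreal ((u n x - u (r j) x)^2) \<partial>M)"
   by (rule nn_integral_liminf) measurable
  also have "\<dots> <= ennreal e"
  proof (rule Liminf_le)
   show "\<forall>\<^sub>F j in sequentially. (\<integral>\<^sup>+x. ennreal ((u n x - u (r j) x)^2) \<partial>M) <= ennreal e"
   proof (rule eventually_sequentiallyI[of K])
    fix j assume "K <= j"
    hence "K <= r j" using seq_suble[OF rm, of j] by linarith
    hence "sqd M (u n) (u (r j)) < e" using n by auto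
    thus "(\<integral>\<^sup>+x. ennreal ((u n x - u (r j) x)^2) \<partial>M) <= ennreal e"
     by (subst nn_integral_eq_integral[OF intd]) (auto intro: ennreal_leI)
   qed
  qed simp
  finally show ?thesis .
 qed
 have fatint: "integrable M (%x. (u n x - U x)^2)"
  if e: "e > 0" and n: "ALL m>=K. ALL n>=K. sqd M (u n) (u m) < e" "n >= K" for n e K
  using fat[OF e n] by (intro integrableI_bounded) (auto intro: le_less_trans)
 have lim0: "(%n. sqd M (u n) U) ----> 0"
 proof (rule LIMSEQ_I)
  fix e :: real assume e: "e > 0"
  hence e2: "e/2 > 0" by simp
  obtain K where K: "ALL m>=K. ALL n>=K. sqd M (u n) (u m) < e/2" using cau[OF e2] by blast
  show "EX no. ALL n>=no. norm (sqd M (u n) U - 0) < e"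
  proof (intro exI allI impI)
   fix n assume n: "n >= K"
   have "ennreal (sqd M (u n) U) <= ennreal (e/2)"
    using fat[OF e2 K n] nn_integral_eq_integral[OF fatint[OF e2 K n]] by simp
   hence "sqd M (u n) U <= e/2" using e by simp
   moreover have "0 <= sqd M (u n) U" by simp
   ultimately show "norm (sqd M (u n) U - 0) < e" using e by simp
  qed
 qed
 have Uint: "integrable M (%x. (U x)^2)"
 proof -
  obtain K where K: "ALL m>=K. ALL n>=K. sqd M (u n) (u m) < 1" using cau[of 1] by auto
  have *: "integrable M (%x. (u K x - U x)^2)" by (rule fatint[OF _ K]) auto
  show ?thesis
  proof (rule Bochner_Integration.integrable_bound)
   show "integrable M (%x. 2 * (u K x)^2 + 2 * (u K x - U x)^2)" using int * by auto
   show "AE x in M. norm ((U x)^2) <= norm (2 * (u K x)^2 + 2 * (u K x - U x)^2)"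
   proof (rule AE_I2)
    fix x
    have "(U x)^2 <= 2 * (u K x)^2 + 2 * (u K x - U x)^2"
     using zero_le_power2[of "2 * u K x - U x"] by (simp add: power2_eq_square algebra_simps)
    thus "norm ((U x)^2) <= norm (2 * (u K x)^2 + 2 * (u K x - U x)^2)" by simp
   qed
  qed measurable
 qed
 show ?thesis
  by (rule that[OF rm]) (use Um aec Uint lim0 in \<open>simp_all add: U_def[abs_def]\<close>)
qed

section \<open>Borel measurability of derivatives\<close>

lemma ex_one_over_Suc_less: "(d::real) > 0 ==> EX m::nat. 1 / (real m + 1) < d"
 by (erule nat_approx_posE) (auto simp: add.commute)

text \<open>Differentiability at \<open>x\<close> is a Cauchy condition on difference quotients, and
  by continuity of \<open>g\<close> rational increments suffice to test it. So the set of
  differentiability is cut out by countably many Borel conditions, and there the derivative is a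
  limit of quotients along \<open>1 / (n + 1)\<close>.\<close>

lemma borel_measurable_deriv_on:
 fixes g :: "real => real"
 assumes J: "open J" and cont: "continuous_on J g"
 shows "(%x. indicator J x * deriv g x) : borel_measurable borel"
proof -
 define G where "G x = indicator J x *\<^sub>R g x" for x
 have Jm[measurable]: "J : sets borel" using J by simp
 have [measurable]: "G : borel_measurable borel"
  unfolding G_def by (rule borel_measurable_continuous_on_indicator) (use assms in auto)
 define Q where "Q s x = (G (x + s) - G x) / s" for s x
 have [measurable]: "Q s : borel_measurable borel" for s unfolding Q_def by measurable
 define P where "P x \<longleftrightarrow> (ALL n::nat. EX m::nat. ALL s t::rat.
   0 < \<bar>real_of_rat s\<bar> & \<bar>real_of_rat s\<bar> < 1 / (real m + 1) & 0 < \<bar>real_of_rat t\<bar> & \<bar>real_of_rat t\<bar> < 1 / (real m + 1) -->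
   \<bar>Q (real_of_rat s) x - Q (real_of_rat t) x\<bar> <= 1 / (real n + 1))" for x
 have [measurable]: "Measurable.pred borel P" unfolding P_def by measurable
 \<comment> \<open>Where no derivative exists, \<open>deriv\<close> chooses from the empty
   predicate, so its value is the same at all such points.\<close>
 define c :: real where "c = (SOME D. False)"
 have dQ: "(g has_real_derivative D) (at x) \<longleftrightarrow> ((%s. Q s x) \<longlongrightarrow> D) (at 0)" if x: "x : J" for x D
 proof -
  obtain d where d: "d > 0" "ball x d <= J" using J x open_contains_ball by blast
  have "(g has_real_derivative D) (at x) \<longleftrightarrow> ((%s. (g (x + s) - g x) / s) \<longlongrightarrow> D) (at 0)"
   by (simp add: DERIV_def)
  also have "\<dots> \<longleftrightarrow> ((%s. Q s x) \<longlongrightarrow> D) (at 0)"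
  proof (rule tendsto_cong)
   show "\<forall>\<^sub>F s in at 0. (g (x + s) - g x) / s = Q s x"
    unfolding eventually_at
   proof (intro exI[of _ d] conjI ballI impI)
    fix s :: real assume "s ~= 0 & dist s 0 < d"
    hence "x + s : J" using d by (auto simp: dist_real_def intro!: subsetD[OF d(2)])
    thus "(g (x + s) - g x) / s = Q s x" using x by (simp add: Q_def G_def)
   qed (rule d)
  qed
  finally show ?thesis .
 qed
 have PD: "P x \<longleftrightarrow> (EX D. (g has_real_derivative D) (at x))" if x: "x : J" for x
 proof
  assume "EX D. (g has_real_derivative D) (at x)"
  then obtain D where D: "((%s. Q s x) \<longlongrightarrow> D) (at 0)" using dQ[OF x] by blast
  show "P x"
   unfolding P_def
  proof
   fix n :: nat
   have "EX d>0. ALL s. s ~= 0 & \<bar>s\<bar> < d --> \<bar>Q s x - D\<bar> < 1 / (real n + 1) / 2"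
    using D unfolding LIM_eq by (auto dest!: spec[of _ "1 / (real n + 1) / 2"])
   then obtain d where d: "d > 0" "!!s. 0 < \<bar>s\<bar> ==> \<bar>s\<bar> < d ==> \<bar>Q s x - D\<bar> < 1 / (real n + 1) / 2" by auto
   obtain m where m: "1 / (real m + 1) < d" using ex_one_over_Suc_less d(1) by blast
   show "EX m::nat. ALL s t::rat.
   0 < \<bar>real_of_rat s\<bar> & \<bar>real_of_rat s\<bar> < 1 / (real m + 1) & 0 < \<bar>real_of_rat t\<bar> & \<bar>real_of_rat t\<bar> < 1 / (real m + 1) -->
   \<bar>Q (real_of_rat s) x - Q (real_of_rat t) x\<bar> <= 1 / (real n + 1)"
   proof (intro exI allI impI)
    fix s t :: rat
    assume "0 < \<bar>real_of_rat s\<bar> & \<bar>real_of_rat s\<bar> < 1 / (real m + 1) & 0 < \<bar>real_of_rat t\<bar> & \<bar>real_of_rat t\<bar> < 1 / (real m + 1)"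
    hence "\<bar>Q (real_of_rat s) x - D\<bar> < 1 / (real n + 1) / 2" "\<bar>Q (real_of_rat t) x - D\<bar> < 1 / (real n + 1) / 2"
     by (intro d(2); use m in linarith)+
    moreover have "\<bar>a - c\<bar> < k / 2 ==> \<bar>b - c\<bar> < k / 2 ==> \<bar>a - b\<bar> <= k" for a b c k :: real by linarith
    ultimately show "\<bar>Q (real_of_rat s) x - Q (real_of_rat t) x\<bar> <= 1 / (real n + 1)" by blast
   qed
  qed
 next
  assume P: "P x"
  obtain d where d: "d > 0" "ball x d <= J" using J x open_contains_ball by blast
  have ext: "EX dl>0. ALL s t. 0 < \<bar>s\<bar> & \<bar>s\<bar> < dl & 0 < \<bar>t\<bar> & \<bar>t\<bar> < dl --> \<bar>Q s x - Q t x\<bar> < e" if e: "e > 0" for e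
  proof -
   obtain n where n: "1 / (real n + 1) < e / 3" using ex_one_over_Suc_less[of "e / 3"] e by auto
   obtain m where m: "!!s t::rat.
   0 < \<bar>real_of_rat s\<bar> & \<bar>real_of_rat s\<bar> < 1 / (real m + 1) & 0 < \<bar>real_of_rat t\<bar> & \<bar>real_of_rat t\<bar> < 1 / (real m + 1) ==>
   \<bar>Q (real_of_rat s) x - Q (real_of_rat t) x\<bar> <= 1 / (real n + 1)"
    using P unfolding P_def by meson
   define dl where "dl = min d (1 / (real m + 1))"
   have dl: "dl > 0" using d by (simp add: dl_def)
   \<comment> \<open>For a nonzero increment the quotient is continuous in that increment, so a
     nearby rational increment gives almost the same quotient.\<close>
   have near: "EX s'::rat. 0 < \<bar>real_of_rat s'\<bar> & \<bar>real_of_rat s'\<bar> < 1 / (real m + 1) & \<bar>Q (real_of_rat s') x - Q s x\<bar> < e / 3"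
    if s: "0 < \<bar>s\<bar>" "\<bar>s\<bar> < dl" for s
   proof -
    have xs: "x + s : J" using s by (auto simp: dist_real_def dl_def intro!: subsetD[OF d(2)])
    have "isCont G (x + s)"
    proof -
     have "isCont g (x + s)" using cont J xs continuous_on_eq_continuous_at by blast
     moreover have "\<forall>\<^sub>F y in nhds (x + s). g y = G y"
      using eventually_nhds_in_open[OF J xs] by eventually_elim (simp add: G_def)
     ultimately show ?thesis using isCont_cong by blast
    qed
    hence "isCont (%s. Q s x) s" unfolding Q_def using s by (intro continuous_intros isCont_o2[of _ "%s. x + s" G]) auto
    hence "EX et>0. ALL s'. \<bar>s' - s\<bar> < et --> \<bar>Q s' x - Q s x\<bar> < e / 3"
     using e by (auto simp: continuous_at_eps_delta dist_real_def dest!: spec[of _ "e/3"] simp del: less_divide_eq_numeral1)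
    then obtain et where et: "et > 0" "!!s'. \<bar>s' - s\<bar> < et ==> \<bar>Q s' x - Q s x\<bar> < e / 3" by blast
    define k where "k = min et (min \<bar>s\<bar> (dl - \<bar>s\<bar>))"
    have k: "k > 0" using et s by (simp add: k_def)
    obtain s' where s': "s - k < real_of_rat s'" "real_of_rat s' < s + k"
     using of_rat_dense[of "s - k" "s + k"] k by auto
    have "0 < \<bar>real_of_rat s'\<bar>" "\<bar>real_of_rat s'\<bar> < dl" "\<bar>real_of_rat s' - s\<bar> < et"
     using s' unfolding k_def by linarith+
    thus ?thesis using et(2) by (intro exI[of _ s']) (auto simp: dl_def)
   qed
   show ?thesis
   proof (intro exI conjI allI impI)
    fix s t assume st: "0 < \<bar>s\<bar> & \<bar>s\<bar> < dl & 0 < \<bar>t\<bar> & \<bar>t\<bar> < dl"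
    obtain s' where s': "0 < \<bar>real_of_rat s'\<bar>" "\<bar>real_of_rat s'\<bar> < 1 / (real m + 1)" "\<bar>Q (real_of_rat s') x - Q s x\<bar> < e / 3"
     using near st by blast
    obtain t' where t': "0 < \<bar>real_of_rat t'\<bar>" "\<bar>real_of_rat t'\<bar> < 1 / (real m + 1)" "\<bar>Q (real_of_rat t') x - Q t x\<bar> < e / 3"
     using near st by blast
    have "\<bar>Q (real_of_rat s') x - Q (real_of_rat t') x\<bar> <= 1 / (real n + 1)" using m s' t' by blast
    thus "\<bar>Q s x - Q t x\<bar> < e" using s'(3) t'(3) n by linarith
   qed (rule dl)
  qed
  define a where "a n = Q (1 / (real n + 1)) x" for n :: nat
  have sm: "EX N. ALL n>=N. 1 / (real n + 1) < dl" if pos: "dl > 0" for dl :: real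
  proof -
   obtain N where N: "1 / (real N + 1) < dl" using ex_one_over_Suc_less[OF pos] by blast
   have "1 / (real n + 1) <= 1 / (real N + 1)" if "n >= N" for n using that by (simp add: field_simps)
   thus ?thesis using N by (meson le_less_trans)
  qed
  have "Cauchy a"
  proof (rule CauchyI)
   fix e :: real assume "e > 0"
   then obtain dl where dl: "dl > 0" "!!s t. 0 < \<bar>s\<bar> & \<bar>s\<bar> < dl & 0 < \<bar>t\<bar> & \<bar>t\<bar> < dl ==> \<bar>Q s x - Q t x\<bar> < e" using ext by meson
   obtain N where "ALL n>=N. 1 / (real n + 1) < dl" using sm dl by blast
   thus "EX M. ALL m>=M. ALL n>=M. norm (a m - a n) < e"
    unfolding a_def by (intro exI[of _ N]) (auto intro!: dl)
  qed
  then obtain L where L: "a ----> L" by (auto simp: Cauchy_convergent_iff convergent_def)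
  have "((%s. Q s x) \<longlongrightarrow> L) (at 0)"
   unfolding LIM_eq
  proof (intro allI impI)
   fix e :: real assume e: "e > 0"
   then obtain dl where dl: "dl > 0" "!!s t. 0 < \<bar>s\<bar> & \<bar>s\<bar> < dl & 0 < \<bar>t\<bar> & \<bar>t\<bar> < dl ==> \<bar>Q s x - Q t x\<bar> < e/2" using ext[of "e/2"] by (auto simp: half_gt_zero)
   obtain N where N: "ALL n>=N. 1 / (real n + 1) < dl" using sm dl by blast
   obtain N' where N': "ALL n>=N'. norm (a n - L) < e/2" using LIMSEQ_D[OF L, of "e/2"] e by auto
   define n where "n = max N N'"
   show "EX s>0. ALL y. y ~= 0 & norm (y - 0) < s --> norm (Q y x - L) < e"
   proof (intro exI conjI allI impI)
    fix y :: real assume y: "y ~= 0 & norm (y - 0) < dl"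
    have "\<bar>Q y x - a n\<bar> < e/2" unfolding a_def using y N by (intro dl) (auto simp: n_def)
    moreover have "\<bar>a n - L\<bar> < e/2" using N' by (auto simp: n_def)
    ultimately show "norm (Q y x - L) < e" by (simp add: abs_if split: if_splits)
   qed (rule dl)
  qed
  thus "EX D. (g has_real_derivative D) (at x)" using dQ[OF x] by blast
 qed
 have "indicator J x * deriv g x = indicator J x * (if P x then lim (%n. Q (1 / (real n + 1)) x) else c)" for x
 proof (cases "x : J")
  case x: True
  show ?thesis
  proof (cases "P x")
   case True
   then obtain D where D: "(g has_real_derivative D) (at x)" using PD[OF x] by blast
   have t: "filterlim (%n. 1 / (real n + 1)) (at 0) sequentially"
    unfolding filterlim_at using LIMSEQ_inverse_real_of_nat by (auto simp: inverse_eq_divide add.commute)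
   have "(%n. Q (1 / (real n + 1)) x) ----> D"
    using filterlim_compose[OF D[unfolded dQ[OF x]] t] .
   thus ?thesis using True D by (simp add: limI DERIV_imp_deriv)
  next
   case False
   hence "deriv g x = c" using PD[OF x] by (simp add: deriv_def c_def)
   thus ?thesis using False by simp
  qed
 qed simp
 thus ?thesis by (simp only:) measurable
qed

section \<open>Absolutely continuous functions\<close>

text \<open>Absolute continuity is stated for families indexed by an initial segment of the
  naturals. Components of an open set and families of families come with other finite index sets; a
  bijection carries the bound over.\<close>

lemma abs_cont_on_finite:
 fixes J :: "'i set"
 assumes d: "!!(n::nat) (a::nat => real) b. (ALL i<n. a i : S & b i : S & a i <= b i) ==>
    disjoint_family_on (%i. {a i<..<b i}) {..<n} ==> (\<Sum>i<n. b i - a i) < d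
    ==> (\<Sum>i<n. \<bar>f (b i) - f (a i)\<bar>) < e"
  and J: "finite J" "!!i. i : J ==> a i : S & b i : S & a i <= b i"
  "disjoint_family_on (%i. {a i<..<b i}) J" "(\<Sum>i\<in>J. b i - a i) < d"
 shows "(\<Sum>i\<in>J. \<bar>f (b i) - f (a i)\<bar>) < (e::real)"
proof -
 obtain h where h: "bij_betw h {..<card J} J"
  using ex_bij_betw_nat_finite[OF J(1)] by (auto simp: atLeast0LessThan)
 have 1: "(\<Sum>i<card J. \<bar>f (b (h i)) - f (a (h i))\<bar>) = (\<Sum>i\<in>J. \<bar>f (b i) - f (a i)\<bar>)"
  by (rule sum.reindex_bij_betw[OF h])
 have 2: "(\<Sum>i<card J. b (h i) - a (h i)) = (\<Sum>i\<in>J. b i - a i)"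
  by (rule sum.reindex_bij_betw[OF h])
 have "(\<Sum>i<card J. \<bar>f (b (h i)) - f (a (h i))\<bar>) < e"
 proof (rule d)
  have hJ: "h i : J" if "i < card J" for i using h that by (auto simp: bij_betw_def)
  thus "ALL i<card J. a (h i) : S & b (h i) : S & a (h i) <= b (h i)" using J(2) by auto
  show "disjoint_family_on (%i. {a (h i)<..<b (h i)}) {..<card J}"
   unfolding disjoint_family_on_def
  proof (intro ballI impI)
   fix m n assume "m : {..<card J}" "n : {..<card J}" "m ~= n"
   hence "h m : J" "h n : J" "h m ~= h n" using hJ h by (auto simp: bij_betw_def inj_on_def)
   thus "{a (h m)<..<b (h m)} Int {a (h n)<..<b (h n)} = {}"
    using J(3) unfolding disjoint_family_on_def by blast
  qed
  show "(\<Sum>i<card J. b (h i) - a (h i)) < d" using 2 J(4) by simp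
 qed
 thus ?thesis using 1 by simp
qed

text \<open>Variation is measured over finite disjoint families of possibly degenerate subintervals
  instead of ordered partitions. This is the shape used in \<open>abs_cont_on\<close>, and no
  sorting of division points is ever needed.\<close>

definition vsums :: "(real => real) => real => real => real set" where
 "vsums f x y = {(\<Sum>i<n. \<bar>f (b i) - f (a i)\<bar>) | (n::nat) a b.
  (ALL i<n. x <= a i & a i <= b i & b i <= y) & disjoint_family_on (%i. {a i<..<b i}) {..<n}}"

lemma vsumsI:
 fixes n :: nat
 shows "(!!i. i < n ==> x <= a i & a i <= b i & b i <= y) ==>
  disjoint_family_on (%i. {a i<..<b i}) {..<n} ==> (\<Sum>i<n. \<bar>f (b i) - f (a i)\<bar>) : vsums f x y"
 unfolding vsums_def by (rule CollectI, rule exI[of _ n], rule exI[of _ a], rule exI[of _ b]) auto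

lemma vsums_0: "0 : vsums f x y"
proof -
 have "(\<Sum>i<(0::nat). \<bar>f x - f x\<bar>) : vsums f x y"
  by (rule vsumsI) (auto simp: disjoint_family_on_def)
 thus ?thesis by simp
qed

lemma vsums_mono:
 assumes "x' <= x" "y <= y'" "s : vsums f x y"
 shows "s : vsums f x' y'"
proof -
 obtain n :: nat and a b where ab: "s = (\<Sum>i<n. \<bar>f (b i) - f (a i)\<bar>)"
  "!!i. i < n ==> x <= a i & a i <= b i & b i <= y" "disjoint_family_on (%i. {a i<..<b i}) {..<n}"
  using assms(3) unfolding vsums_def by blast
 show ?thesis unfolding ab(1) by (rule vsumsI[OF _ ab(3)]) (use ab(2) assms in force)
qed

lemma vsums_append:
 assumes "s : vsums f c x" "c <= x" "x <= y"
 shows "s + \<bar>f y - f x\<bar> : vsums f c y"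
proof -
 obtain n :: nat and a b where ab: "s = (\<Sum>i<n. \<bar>f (b i) - f (a i)\<bar>)"
  "!!i. i < n ==> c <= a i & a i <= b i & b i <= x" "disjoint_family_on (%i. {a i<..<b i}) {..<n}"
  using assms(1) unfolding vsums_def by blast
 define a' b' where "a' = a(n := x)" and "b' = b(n := y)"
 have "(\<Sum>i<Suc n. \<bar>f (b' i) - f (a' i)\<bar>) : vsums f c y"
 proof (rule vsumsI)
  show "c <= a' i & a' i <= b' i & b' i <= y" if "i < Suc n" for i
   using that ab(2)[of i] assms by (auto simp: a'_def b'_def less_Suc_eq)
  show "disjoint_family_on (%i. {a' i<..<b' i}) {..<Suc n}"
   unfolding disjoint_family_on_def
  proof (intro ballI impI)
   fix i j assume ij: "i : {..<Suc n}" "j : {..<Suc n}" "i ~= j"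
   show "{a' i<..<b' i} Int {a' j<..<b' j} = {}"
   proof (cases "i < n & j < n")
    case True
    thus ?thesis using ab(3) ij unfolding disjoint_family_on_def by (auto simp: a'_def b'_def)
   next
    case False
    thus ?thesis using ij ab(2)[of i] ab(2)[of j]
     by (auto simp: a'_def b'_def)
   qed
  qed
 qed
 moreover have "(\<Sum>i<Suc n. \<bar>f (b' i) - f (a' i)\<bar>) = s + \<bar>f y - f x\<bar>"
  unfolding ab(1) sum.lessThan_Suc by (simp add: a'_def b'_def)
 ultimately show ?thesis by simp
qed

text \<open>Clamping the intervals of a family at \<open>x\<close> splits it without any re-indexing.\<close>
lemma vsums_split:
 assumes "s : vsums f c y" "c <= x" "x <= y"
 obtains s1 s2 where "s1 : vsums f c x" "s2 : vsums f x y" "s <= s1 + s2"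
proof -
 obtain n :: nat and a b where ab: "s = (\<Sum>i<n. \<bar>f (b i) - f (a i)\<bar>)"
  "!!i. i < n ==> c <= a i & a i <= b i & b i <= y" "disjoint_family_on (%i. {a i<..<b i}) {..<n}"
  using assms(1) unfolding vsums_def by blast
 let ?s1 = "\<Sum>i<n. \<bar>f (min (b i) x) - f (min (a i) x)\<bar>"
 let ?s2 = "\<Sum>i<n. \<bar>f (max (b i) x) - f (max (a i) x)\<bar>"
 have dj: "disjoint_family_on (%i. {a' i<..<b' i}) {..<n}"
  if "!!i. i < n ==> {a' i<..<b' i} <= {a i<..<b i}" for a' b'
  unfolding disjoint_family_on_def
 proof (intro ballI impI)
  fix i j assume ij: "i : {..<n}" "j : {..<n}" "i ~= j"
  hence "{a i<..<b i} Int {a j<..<b j} = {}" using ab(3) unfolding disjoint_family_on_def by blast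
  thus "{a' i<..<b' i} Int {a' j<..<b' j} = {}" using that[of i] that[of j] ij by blast
 qed
 have "?s1 : vsums f c x"
  by (rule vsumsI, use ab(2) assms in \<open>fastforce simp: min_def\<close>, rule dj) auto
 moreover have "?s2 : vsums f x y"
  by (rule vsumsI, use ab(2) assms in \<open>fastforce simp: max_def\<close>, rule dj) auto
 moreover have "s <= ?s1 + ?s2"
  unfolding ab(1) sum.distrib[symmetric]
 proof (rule sum_mono)
  fix i assume "i : {..<n}"
  hence "a i <= b i" using ab(2) by auto
  thus "\<bar>f (b i) - f (a i)\<bar> <= \<bar>f (min (b i) x) - f (min (a i) x)\<bar> + \<bar>f (max (b i) x) - f (max (a i) x)\<bar>"
   by (cases "b i <= x"; cases "a i <= x") (auto simp: min_def max_def)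
 qed
 ultimately show ?thesis using that by blast
qed

definition vari :: "(real => real) => real => real => real" where
 "vari f x y = Sup (vsums f x y)"

text \<open>Advance in steps of half the \<open>dl\<close> that belongs to the bound 1. A disjoint
  family within one step has variation sum at most 1, and splitting at the step points adds up these
  bounds.\<close>

lemma abs_cont_vsums_bounded:
 assumes ac: "abs_cont_on {c..d} f" and cd: "c <= d"
 shows "bdd_above (vsums f c d)"
proof -
 obtain dl where dl: "dl > 0" and ac1: "!!(n::nat) (a::nat => real) b. (ALL i<n. a i : {c..d} & b i : {c..d} & a i <= b i) ==>
    disjoint_family_on (%i. {a i<..<b i}) {..<n} ==> (\<Sum>i<n. b i - a i) < dl
    ==> (\<Sum>i<n. \<bar>f (b i) - f (a i)\<bar>) < 1"
  using ac unfolding abs_cont_on_def by (meson zero_less_one)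
 define et where "et = dl / 2"
 have et: "et > 0" using dl by (simp add: et_def)
 have small: "s <= 1" if s: "s : vsums f x y" and xy: "c <= x" "x <= y" "y <= d" "y - x <= et" for s x y
 proof -
  obtain n :: nat and a b where ab: "s = (\<Sum>i<n. \<bar>f (b i) - f (a i)\<bar>)"
   "!!i. i < n ==> x <= a i & a i <= b i & b i <= y" "disjoint_family_on (%i. {a i<..<b i}) {..<n}"
   using s unfolding vsums_def by blast
  have "(\<Sum>i<n. b i - a i) = measure lborel (\<Union>i<n. {a i<..<b i})"
  proof -
   have "measure lborel (\<Union>i<n. {a i<..<b i}) = (\<Sum>i<n. measure lborel {a i<..<b i})"
    using ab(2,3) by (intro measure_finite_Union) auto
   also have "\<dots> = (\<Sum>i<n. b i - a i)" using ab(2) by (intro sum.cong) auto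
   finally show ?thesis by simp
  qed
  also have "\<dots> <= measure lborel {x..y}"
   using ab(2) by (intro measure_mono_fmeasurable) (force, auto simp: fmeasurable_def emeasure_lborel_Icc_eq)
  also have "\<dots> < dl" using xy et by (simp add: et_def)
  finally have "(\<Sum>i<n. b i - a i) < dl" .
  hence "(\<Sum>i<n. \<bar>f (b i) - f (a i)\<bar>) < 1"
   by (intro ac1 ab(3)) (use ab(2) xy in force)+
  thus ?thesis using ab(1) by simp
 qed
 have "ALL y s. c <= y & y <= d & y - c <= real j * et & s : vsums f c y --> s <= real j + 1" for j
 proof (induction j)
  case 0
  thus ?case using small[of _ c] et by auto
 next
  case (Suc j)
  show ?case
  proof (intro allI impI)
   fix y s assume ys: "c <= y & y <= d & y - c <= real (Suc j) * et & s : vsums f c y"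
   define x where "x = max c (y - et)"
   have x: "c <= x" "x <= y" "x <= d" "y - x <= et" "x - c <= real j * et"
    using ys et by (auto simp: x_def algebra_simps)
   obtain s1 s2 where s: "s1 : vsums f c x" "s2 : vsums f x y" "s <= s1 + s2"
    using vsums_split[of s f c y x] ys x by blast
   have "s1 <= real j + 1" using Suc x s by blast
   moreover have "s2 <= 1" using small[OF s(2)] x ys by auto
   ultimately show "s <= real (Suc j) + 1" using s(3) by simp
  qed
 qed
 moreover obtain j :: nat where "(d - c) / et <= real j" using real_arch_simple by blast
 hence "d - c <= real j * et" using et by (simp add: pos_divide_le_eq)
 ultimately show ?thesis using cd unfolding bdd_above_def by blast
qed

text \<open>Radon-Nikodym for the Stieltjes measure of \<open>F\<close>. A Lebesgue null set lies in
  an open set of measure below \<open>dl\<close>; absolute continuity over finitely many of its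
  components, followed by a monotone limit over all of them, makes its Stieltjes measure at most
  \<open>e\<close>.\<close>

lemma mono_abs_cont_density:
 assumes ac: "abs_cont_on {c..d} F" and cd: "c <= d" and mono: "mono_on {c..d} F"
 shows "EX h. integrable lborel h & (ALL x:{c..d}. F x - F c = (LBINT t:{c..x}. h t))"
proof -
 \<comment> \<open>Freezing \<open>F\<close> outside \<open>{c..d}\<close> gives a monotone function
   on the whole line, as the Stieltjes measure requires.\<close>
 define G where "G x = F (max c (min d x))" for x
 have Gmono: "G x <= G y" if "x <= y" for x y
  unfolding G_def by (rule mono_onD[OF mono]) (use cd that in auto)
 define small where "small e dl \<longleftrightarrow> (ALL (J::real set set) a b. finite J & (ALL i:J. a i <= b i) &
  disjoint_family_on (%i. {a i<..<b i}) J & (\<Sum>i\<in>J. b i - a i) < dl --> (\<Sum>i\<in>J. \<bar>G (b i) - G (a i)\<bar>) < e)" for e dl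
 have small_ex: "EX dl>0. small e dl" if e: "e > 0" for e
 proof -
  obtain dl where dl: "dl > 0" and ac1: "!!(n::nat) (a::nat => real) b. (ALL i<n. a i : {c..d} & b i : {c..d} & a i <= b i) ==>
     disjoint_family_on (%i. {a i<..<b i}) {..<n} ==> (\<Sum>i<n. b i - a i) < dl
     ==> (\<Sum>i<n. \<bar>F (b i) - F (a i)\<bar>) < e"
   using ac e unfolding abs_cont_on_def by meson
  show ?thesis
   unfolding small_def
  proof (intro exI conjI allI impI)
   fix J :: "real set set" and a b :: "real set => real"
   assume J: "finite J & (ALL i:J. a i <= b i) & disjoint_family_on (%i. {a i<..<b i}) J & (\<Sum>i\<in>J. b i - a i) < dl"
   let ?k = "%x. max c (min d x)"
   have "(\<Sum>i\<in>J. \<bar>F (?k (b i)) - F (?k (a i))\<bar>) < e"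
   proof (rule abs_cont_on_finite[OF ac1])
    show "?k (a i) : {c..d} & ?k (b i) : {c..d} & ?k (a i) <= ?k (b i)" if "i : J" for i
     using J that cd by auto
    show "disjoint_family_on (%i. {?k (a i)<..<?k (b i)}) J"
     unfolding disjoint_family_on_def
    proof (intro ballI impI)
     fix i j assume ij: "i : J" "j : J" "i ~= j"
     have "{?k (a i)<..<?k (b i)} <= {a i<..<b i}" for i by auto
     moreover have "{a i<..<b i} Int {a j<..<b j} = {}" using J ij unfolding disjoint_family_on_def by blast
     ultimately show "{?k (a i)<..<?k (b i)} Int {?k (a j)<..<?k (b j)} = {}" by blast
    qed
    have "(\<Sum>i\<in>J. ?k (b i) - ?k (a i)) <= (\<Sum>i\<in>J. b i - a i)"
     by (rule sum_mono) (use J in \<open>auto simp: max_def min_def\<close>)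
    thus "(\<Sum>i\<in>J. ?k (b i) - ?k (a i)) < dl" using J by linarith
   qed (use J in auto)
   thus "(\<Sum>i\<in>J. \<bar>G (b i) - G (a i)\<bar>) < e" by (simp add: G_def)
  qed (rule dl)
 qed
 have Gcont: "continuous_on UNIV G"
  unfolding continuous_on_iff
 proof (intro ballI allI impI)
  fix x e :: real assume e: "e > 0"
  obtain dl where dl: "dl > 0" and sd: "small e dl"
    using small_ex[OF e] by blast
   have s: "(\<Sum>i\<in>J. \<bar>G (b i) - G (a i)\<bar>) < e"
    if "finite J" "!!i. i : J ==> a i <= b i" "disjoint_family_on (%i. {a i<..<b i}) J" "(\<Sum>i\<in>J. b i - a i) < dl"
    for J :: "real set set" and a b
    using sd[unfolded small_def, rule_format, of J a b] that by simp
  show "EX d>0. ALL x':UNIV. dist x' x < d --> dist (G x') (G x) < e"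
  proof (intro exI conjI ballI impI)
   fix x' assume "dist x' x < dl"
   thus "dist (G x') (G x) < e"
    using s[of "{{}}" "%_. min x x'" "%_. max x x'"]
    by (cases "x <= x'") (auto simp: dist_real_def disjoint_family_on_def abs_minus_commute)
  qed (rule dl)
 qed
 define m where "m = interval_measure G"
 have mIcc: "emeasure m {a..b} = ennreal (G b - G a)" if "a <= b" for a b
  unfolding m_def by (rule emeasure_interval_measure_Icc[OF that Gmono Gcont])
 have sm: "sets m = sets borel" "space m = UNIV" by (simp_all add: m_def)
 have "absolutely_continuous lborel m"
  unfolding absolutely_continuous_def
 proof
  fix N assume N: "N : null_sets (lborel :: real measure)"
  have eN: "emeasure m N <= ennreal e" if e: "e > 0" for e
  proof -
   obtain dl where dl: "dl > 0" and sd: "small e dl"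
    using small_ex[OF e] by blast
   have s: "(\<Sum>i\<in>J. \<bar>G (b i) - G (a i)\<bar>) < e"
    if "finite J" "!!i. i : J ==> a i <= b i" "disjoint_family_on (%i. {a i<..<b i}) J" "(\<Sum>i\<in>J. b i - a i) < dl"
    for J :: "real set set" and a b
    using sd[unfolded small_def, rule_format, of J a b] that by simp
   have "N : sets borel" using N by (auto simp: null_sets_def)
   then obtain U where U: "open U" "N <= U" "emeasure lborel (U - N) < ennreal dl"
    using outer_regular_lborel[of N dl] dl by (auto simp: less_imp_le)
   have Udl: "emeasure lborel U < ennreal dl"
    using emeasure_Diff_null_set[OF N, of U] U by (simp add: borel_open)
   define CU where "CU = components U"
   have fin: "emeasure m (\<Union>J) <= ennreal e" if J: "finite J" "J <= CU" for J
   proof -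
    have Jo: "open C" "connected C" "C ~= {}" "C <= U" if "C : J" for C
     using J that U(1) in_components_connected in_components_nonempty in_components_subset open_components
     unfolding CU_def by blast+
    \<comment> \<open>An unbounded component would contain an interval longer than
      \<open>dl\<close>, against the bound on \<open>U\<close>.\<close>
    have bb: "bounded C" if CJ: "C : J" for C
    proof (rule ccontr)
     assume nb: "~ bounded C"
     have "emeasure lborel C = \<infinity>"
     proof -
      obtain x where x: "x : C" using Jo[OF CJ] by blast
      have "EX y:C. \<bar>y - x\<bar> > K" for K
      proof -
       have "~ (ALL y:C. dist x y <= K)" using nb unfolding bounded_def by blast
       thus ?thesis by (auto simp: dist_real_def not_le abs_minus_commute)
      qed
      then obtain y where y: "y : C" "\<bar>y - x\<bar> > dl" by blast
      have sub: "{min x y..max x y} <= C"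
       by (rule connected_contains_Icc[OF Jo(2)[OF CJ]]) (use x y in \<open>auto simp: min_def max_def\<close>)
      have "ennreal dl <= emeasure lborel {min x y..max x y}" using y by (auto simp: ennreal_leI min_def max_def)
      also have "\<dots> <= emeasure lborel U"
       using sub Jo(4)[OF CJ] U(1) by (intro emeasure_mono) auto
      finally show ?thesis using Udl by simp
     qed
     moreover have "emeasure lborel C <= emeasure lborel U"
      using Jo(4)[OF CJ] U(1) by (intro emeasure_mono) auto
     ultimately show False using Udl by (simp add: top_unique)
    qed
    define a b where "a C = Inf C" and "b C = Sup C" for C :: "real set"
    have sub1: "C <= {a C..b C}" "a C <= b C" if CJ: "C : J" for C
    proof -
     have "bdd_below C" "bdd_above C" using bb[OF CJ] bounded_imp_bdd_below bounded_imp_bdd_above by auto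
     thus "C <= {a C..b C}" unfolding a_def b_def by (auto intro: cInf_lower cSup_upper)
     thus "a C <= b C" using Jo(3)[OF CJ] by force
    qed
    have sub2: "{a C<..<b C} <= C" if CJ: "C : J" for C
    proof
     fix x assume x: "x : {a C<..<b C}"
     have bd: "bdd_below C" "bdd_above C" using bb[OF CJ] bounded_imp_bdd_below bounded_imp_bdd_above by auto
     obtain y where y: "y : C" "y < x" using x cInf_less_iff[OF Jo(3)[OF CJ] bd(1)] by (auto simp: a_def)
     obtain z where z: "z : C" "x < z" using x less_cSup_iff[OF Jo(3)[OF CJ] bd(2)] by (auto simp: b_def)
     show "x : C" using connected_contains_Icc[OF Jo(2)[OF CJ] y(1) z(1)] y(2) z(2) by auto
    qed
    have djC: "disjoint_family_on (%C. C) J"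
     using J pairwise_disjoint_components[of U] unfolding disjoint_family_on_def pairwise_def CU_def by blast
    have dj: "disjoint_family_on (%C. {a C<..<b C}) J"
     using djC sub2 unfolding disjoint_family_on_def by blast
    have "ennreal (\<Sum>C\<in>J. b C - a C) = (\<Sum>C\<in>J. emeasure lborel {a C<..<b C})"
     using sub1 by (subst sum_ennreal[symmetric]) (auto intro!: sum.cong)
    also have "\<dots> = emeasure lborel (\<Union>C\<in>J. {a C<..<b C})"
     using J dj by (intro sum_emeasure) auto
    also have "\<dots> <= emeasure lborel U"
    proof (rule emeasure_mono)
     show "(\<Union>C\<in>J. {a C<..<b C}) <= U" using sub2 Jo(4) by blast
    qed (use U(1) in simp)
    finally have "ennreal (\<Sum>C\<in>J. b C - a C) < ennreal dl" using Udl by simp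
    hence "(\<Sum>C\<in>J. b C - a C) < dl" using dl by (simp add: ennreal_less_iff sum_nonneg sub1)
    hence lt: "(\<Sum>C\<in>J. \<bar>G (b C) - G (a C)\<bar>) < e"
     by (intro s dj J) (use sub1 in auto)
    have "emeasure m (\<Union>J) <= (\<Sum>C\<in>J. emeasure m C)"
     using emeasure_subadditive_finite[OF J(1), of "%C. C" m] Jo(1) by (force simp: sm)
    also have "\<dots> <= (\<Sum>C\<in>J. ennreal \<bar>G (b C) - G (a C)\<bar>)"
    proof (rule sum_mono)
     fix C assume C: "C : J"
     have "emeasure m C <= emeasure m {a C..b C}" using sub1[OF C] by (intro emeasure_mono) (auto simp: sm)
     also have "\<dots> = ennreal (G (b C) - G (a C))" using sub1[OF C] by (intro mIcc)
     also have "\<dots> <= ennreal \<bar>G (b C) - G (a C)\<bar>" by (intro ennreal_leI) auto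
     finally show "emeasure m C <= ennreal \<bar>G (b C) - G (a C)\<bar>" .
    qed
    also have "\<dots> = ennreal (\<Sum>C\<in>J. \<bar>G (b C) - G (a C)\<bar>)" by (rule sum_ennreal) auto
    also have "\<dots> <= ennreal e" using lt by (intro ennreal_leI) auto
    finally show ?thesis .
   qed
   have Uo: "open C" if "C : CU" for C using that U(1) open_components unfolding CU_def by blast
   have cc: "countable CU"
    unfolding CU_def
    by (rule countable_disjoint_open_subsets)
     (use U(1) open_components pairwise_disjoint_components[of U] in \<open>auto simp: pairwise_def disjnt_def\<close>)
   have "emeasure m U <= ennreal e"
   proof (cases "CU = {}")
    case True
    hence "U = {}" using Union_components[of U] by (simp add: CU_def)
    thus ?thesis by simp
   next
    case False
    define A where "A n = (\<Union>(from_nat_into CU ` {..<n}))" for n :: nat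
    have r: "range (from_nat_into CU) = CU" using False cc by (rule range_from_nat_into)
    have Ae: "emeasure m (A n) <= ennreal e" for n
     unfolding A_def by (rule fin) (use r in auto)
    have "(\<Union>n. A n) = U"
    proof -
     have "(\<Union>n. A n) = (\<Union>n. from_nat_into CU n)" unfolding A_def by auto
     also have "\<dots> = \<Union>CU" using r by simp
     finally show ?thesis by (simp add: CU_def)
    qed
    moreover have "(SUP n. emeasure m (A n)) = emeasure m (\<Union>n. A n)"
    proof (rule SUP_emeasure_incseq)
     have "open (A n)" for n unfolding A_def using r Uo by (intro open_Union) auto
     thus "range A <= sets m" by (auto simp: sm)
     show "incseq A" unfolding A_def by (intro incseq_SucI Union_mono image_mono) auto
    qed
    ultimately show ?thesis using SUP_least[of UNIV "%n. emeasure m (A n)" "ennreal e"] Ae by simp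
   qed
   moreover have "emeasure m N <= emeasure m U"
    using U(1) by (intro emeasure_mono U(2)) (auto simp: sm)
   ultimately show ?thesis by simp
  qed
  have "emeasure m N <= 0" by (rule ennreal_le_epsilon) (use eN in simp)
  thus "N : null_sets m" using N by (auto simp: null_sets_def sm)
 qed
 then obtain h where hm[measurable]: "h : borel_measurable lborel" and h: "density lborel h = m"
  using sigma_finite_measure.Radon_Nikodym[OF sigma_finite_lborel, of m] sm(1) by auto
 \<comment> \<open>The Radon-Nikodym density takes extended values; on \<open>{c..d}\<close> it is
   finite almost everywhere because its integral there is \<open>F d - F c\<close>.\<close>
 define k where "k x = enn2real (h x * indicator {c..d} x)" for x
 have km[measurable]: "k : borel_measurable lborel" unfolding k_def by measurable
 have hint: "(\<integral>\<^sup>+x. h x * indicator {c..y} x \<partial>lborel) = ennreal (F y - F c)" if y: "y : {c..d}" for y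
 proof -
  have "(\<integral>\<^sup>+x. h x * indicator {c..y} x \<partial>lborel) = emeasure m {c..y}"
   unfolding h[symmetric] by (simp add: emeasure_density)
  also have "\<dots> = ennreal (F y - F c)" using mIcc[of c y] y cd by (simp add: G_def)
  finally show ?thesis .
 qed
 have "(\<integral>\<^sup>+x. h x * indicator {c..d} x \<partial>lborel) ~= \<infinity>" using hint[of d] cd by simp
 hence ae: "AE x in lborel. h x * indicator {c..d} x ~= \<infinity>"
  by (intro nn_integral_PInf_AE) measurable
 have kint: "(\<integral>\<^sup>+x. ennreal (indicator {c..y} x * k x) \<partial>lborel) = ennreal (F y - F c)" if y: "y : {c..d}" for y
  unfolding hint[OF y, symmetric]
 proof (rule nn_integral_cong_AE)
  show "AE x in lborel. ennreal (indicator {c..y} x * k x) = h x * indicator {c..y} x"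
   using ae
  proof eventually_elim
   case (elim x)
   thus ?case using y by (auto simp: k_def indicator_def less_top)
  qed
 qed
 have kd: "indicator {c..d} x * k x = k x" for x by (auto simp: k_def indicator_def)
 have "integrable lborel k"
  using kint[of d] cd unfolding kd by (intro integrableI_nn_integral_finite[of _ _ "F d - F c"]) (auto simp: k_def)
 moreover have "F x - F c = (LBINT t:{c..x}. k t)" if x: "x : {c..d}" for x
 proof -
  have "(LBINT t:{c..x}. k t) = enn2real (\<integral>\<^sup>+t. ennreal (indicator {c..x} t * k t) \<partial>lborel)"
   unfolding set_lebesgue_integral_def by (subst integral_eq_nn_integral) (auto simp: k_def)
  also have "\<dots> = F x - F c" unfolding kint[OF x] using mono_onD[OF mono, of c x] x by simp
  finally show ?thesis by simp
 qed
 ultimately show ?thesis by blast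
qed

text \<open>Jordan decomposition: the variation \<open>V\<close> from \<open>c\<close> and the
  function \<open>V - f\<close> are both monotone and absolutely continuous, so each has a density,
  and \<open>f\<close> is their difference.\<close>

lemma abs_cont_density:
 assumes ac: "abs_cont_on {c..d} f" and cd: "c <= d"
 obtains h where "integrable lborel h"
  "!!x y. c <= x ==> x <= y ==> y <= d ==> f y - f x = (LBINT t:{x..y}. h t)"
proof -
 have bdd: "bdd_above (vsums f x y)" if "c <= x" "y <= d" for x y
  using abs_cont_vsums_bounded[OF ac cd] vsums_mono[OF that, of _ f] by (meson bdd_above_mono subsetI)
 define V where "V x = vari f c x" for x
 have up: "s <= vari f x y" if "s : vsums f x y" "c <= x" "y <= d" for s x y
  unfolding vari_def using that bdd by (intro cSup_upper) auto
 have V1: "\<bar>f y - f x\<bar> <= V y - V x" if "c <= x" "x <= y" "y <= d" for x y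
 proof -
  have "V x <= V y - \<bar>f y - f x\<bar>"
   unfolding V_def vari_def[of f c x]
  proof (rule cSup_least)
   show "vsums f c x ~= {}" using vsums_0 by blast
   fix s assume "s : vsums f c x"
   hence "s + \<bar>f y - f x\<bar> : vsums f c y" using that by (intro vsums_append) auto
   thus "s <= vari f c y - \<bar>f y - f x\<bar>" using up[of "s + \<bar>f y - f x\<bar>" c y] that by simp
  qed
  thus ?thesis by simp
 qed
 have V2: "V y - V x <= vari f x y" if xy: "c <= x" "x <= y" "y <= d" for x y
 proof -
  have "V y <= V x + vari f x y"
   unfolding V_def vari_def[of f c y]
  proof (rule cSup_least)
   show "vsums f c y ~= {}" using vsums_0 by blast
   fix s assume sV: "s : vsums f c y"
   obtain s1 s2 where s: "s1 : vsums f c x" "s2 : vsums f x y" "s <= s1 + s2"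
    by (rule vsums_split[OF sV xy(1,2)])
   thus "s <= vari f c x + vari f x y" using up[OF s(1)] up[OF s(2)] xy by auto
  qed
  thus ?thesis by simp
 qed
 have acV: "abs_cont_on {c..d} V"
  unfolding abs_cont_on_def
 proof (intro allI impI)
  fix e :: real assume e: "e > 0"
  hence e2: "e/2 > 0" by simp
  obtain dl where dl: "dl > 0" and ac1: "!!(n::nat) (a::nat => real) b. (ALL i<n. a i : {c..d} & b i : {c..d} & a i <= b i) ==>
     disjoint_family_on (%i. {a i<..<b i}) {..<n} ==> (\<Sum>i<n. b i - a i) < dl
     ==> (\<Sum>i<n. \<bar>f (b i) - f (a i)\<bar>) < e/2"
   using ac e2 unfolding abs_cont_on_def by meson
  show "EX dl>0. ALL (n::nat) a b. (ALL i<n. a i : {c..d} & b i : {c..d} & a i <= b i) &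
    disjoint_family_on (%i. {a i<..<b i}) {..<n} & (\<Sum>i<n. b i - a i) < dl
    --> (\<Sum>i<n. \<bar>V (b i) - V (a i)\<bar>) < e"
  proof (intro exI conjI allI impI)
   fix n :: nat and a b :: "nat => real"
   assume A: "(ALL i<n. a i : {c..d} & b i : {c..d} & a i <= b i) &
    disjoint_family_on (%i. {a i<..<b i}) {..<n} & (\<Sum>i<n. b i - a i) < dl"
   \<comment> \<open>Each \<open>s i\<close> misses the variation over its interval by less than
     \<open>et\<close>; the \<open>n\<close> errors together stay within
     \<open>e / 2\<close>.\<close>
   define et where "et = e / 2 / (real n + 1)"
   have et: "et > 0" using e by (simp add: et_def)
   have "EX s:vsums f (a i) (b i). vari f (a i) (b i) - et < s" for i
    unfolding vari_def by (rule less_cSupD) (use vsums_0 et in auto)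
   then obtain s where s: "!!i. s i : vsums f (a i) (b i)" "!!i. vari f (a i) (b i) - et < s i" by metis
   define Q where "Q i m al be \<longleftrightarrow> s i = (\<Sum>j<(m::nat). \<bar>f (be j) - f (al j)\<bar>) &
    (ALL j<m. a i <= al j & al j <= be j & be j <= b i) &
    disjoint_family_on (%j. {al j<..<be j}) {..<m}" for i m al be
   have "ALL i. EX m al be. Q i m al be"
    using s(1) unfolding vsums_def Q_def by blast
   then obtain m al be where Q: "!!i. Q i (m i) (al i) (be i)" by metis
   have sm: "s i = (\<Sum>j<m i. \<bar>f (be i j) - f (al i j)\<bar>)"
    "j < m i ==> a i <= al i j & al i j <= be i j & be i j <= b i"
    "disjoint_family_on (%j. {al i j<..<be i j}) {..<m i}" for i j
    using Q[of i] unfolding Q_def by blast+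
   \<comment> \<open>All near-optimal subfamilies together form one disjoint family of total length
     below \<open>dl\<close>, to which absolute continuity of \<open>f\<close> applies at
     once.\<close>
   define J where "J = (SIGMA i:{..<n}. {..<m i})"
   have len: "(\<Sum>j<m i. be i j - al i j) <= b i - a i" if "i < n" for i
   proof -
    have ab: "a i <= b i" using A that by auto
    have "ennreal (\<Sum>j<m i. be i j - al i j) = (\<Sum>j<m i. emeasure lborel {al i j<..<be i j})"
     using sm(2) by (subst sum_ennreal[symmetric]) (auto intro!: sum.cong)
    also have "\<dots> = emeasure lborel (\<Union>j<m i. {al i j<..<be i j})"
     using sm(3) by (intro sum_emeasure) auto
    also have "\<dots> <= emeasure lborel {a i..b i}"
     using sm(2) by (intro emeasure_mono) (force)+
    finally show ?thesis using ab by (simp add: ennreal_le_iff)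
   qed
   have "(\<Sum>(i,j)\<in>J. \<bar>f (be i j) - f (al i j)\<bar>) < e/2"
   proof -
    have "(\<Sum>p\<in>J. \<bar>f (case_prod be p) - f (case_prod al p)\<bar>) < e/2"
    proof (rule abs_cont_on_finite[OF ac1])
     show "finite J" unfolding J_def by auto
     show "case_prod al p : {c..d} & case_prod be p : {c..d} & case_prod al p <= case_prod be p" if "p : J" for p
     proof -
      obtain i j where p: "p = (i, j)" "i < n" "j < m i" using \<open>p : J\<close> by (auto simp: J_def)
      show ?thesis using A sm(2)[OF p(3)] p by auto
     qed
     show "disjoint_family_on (%p. {case_prod al p<..<case_prod be p}) J"
      unfolding disjoint_family_on_def
     proof (intro ballI impI)
      fix p q assume pq: "p : J" "q : J" "p ~= q"
      obtain i j where p: "p = (i, j)" "i < n" "j < m i" using pq(1) by (auto simp: J_def)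
      obtain i' j' where q: "q = (i', j')" "i' < n" "j' < m i'" using pq(2) by (auto simp: J_def)
      show "{case_prod al p<..<case_prod be p} Int {case_prod al q<..<case_prod be q} = {}"
      proof (cases "i = i'")
       case True
       hence "j ~= j'" using pq p q by auto
       thus ?thesis using sm(3)[of i] p q True unfolding disjoint_family_on_def by auto
      next
       case False
       hence "{a i<..<b i} Int {a i'<..<b i'} = {}" using A p q unfolding disjoint_family_on_def by blast
       moreover have "{al i j<..<be i j} <= {a i<..<b i}" using sm(2)[OF p(3)] by auto
       moreover have "{al i' j'<..<be i' j'} <= {a i'<..<b i'}" using sm(2)[OF q(3)] by auto
       ultimately show ?thesis unfolding p q prod.case by blast
      qed
     qed
     have "(\<Sum>p\<in>J. case_prod be p - case_prod al p) = (\<Sum>i<n. \<Sum>j<m i. be i j - al i j)"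
      unfolding J_def by (subst sum.Sigma) (auto intro!: sum.cong)
     also have "\<dots> <= (\<Sum>i<n. b i - a i)" using len by (intro sum_mono) auto
     finally show "(\<Sum>p\<in>J. case_prod be p - case_prod al p) < dl" using A by linarith
    qed
    thus ?thesis by (simp add: case_prod_beta)
   qed
   also have "(\<Sum>(i,j)\<in>J. \<bar>f (be i j) - f (al i j)\<bar>) = (\<Sum>i<n. s i)"
    unfolding J_def sm(1) by (subst sum.Sigma) auto
   finally have ss: "(\<Sum>i<n. s i) < e/2" .
   have "(\<Sum>i<n. \<bar>V (b i) - V (a i)\<bar>) <= (\<Sum>i<n. s i + et)"
   proof (rule sum_mono)
    fix i assume "i : {..<n}"
    hence i: "c <= a i" "a i <= b i" "b i <= d" using A by auto
    show "\<bar>V (b i) - V (a i)\<bar> <= s i + et" using V1[OF i] V2[OF i] s(2)[of i] by linarith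
   qed
   also have "\<dots> = (\<Sum>i<n. s i) + real n * et" by (simp add: sum.distrib)
   also have "real n * et <= e/2" using e by (simp add: et_def field_simps)
   finally show "(\<Sum>i<n. \<bar>V (b i) - V (a i)\<bar>) < e" using ss by linarith
  qed (rule dl)
 qed
 have acVf: "abs_cont_on {c..d} (%x. V x - f x)"
  unfolding abs_cont_on_def
 proof (intro allI impI)
  fix e :: real assume e: "e > 0"
  hence e2: "e/2 > 0" by simp
  obtain dl where dl: "dl > 0" and ac1: "!!(n::nat) (a::nat => real) b. (ALL i<n. a i : {c..d} & b i : {c..d} & a i <= b i) ==>
     disjoint_family_on (%i. {a i<..<b i}) {..<n} ==> (\<Sum>i<n. b i - a i) < dl
     ==> (\<Sum>i<n. \<bar>V (b i) - V (a i)\<bar>) < e/2"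
   using acV e2 unfolding abs_cont_on_def by meson
  show "EX dl>0. ALL (n::nat) a b. (ALL i<n. a i : {c..d} & b i : {c..d} & a i <= b i) &
    disjoint_family_on (%i. {a i<..<b i}) {..<n} & (\<Sum>i<n. b i - a i) < dl
    --> (\<Sum>i<n. \<bar>V (b i) - f (b i) - (V (a i) - f (a i))\<bar>) < e"
  proof (intro exI conjI allI impI)
   fix n :: nat and a b :: "nat => real"
   assume A: "(ALL i<n. a i : {c..d} & b i : {c..d} & a i <= b i) &
    disjoint_family_on (%i. {a i<..<b i}) {..<n} & (\<Sum>i<n. b i - a i) < dl"
   have "(\<Sum>i<n. \<bar>V (b i) - f (b i) - (V (a i) - f (a i))\<bar>) <= (\<Sum>i<n. 2 * \<bar>V (b i) - V (a i)\<bar>)"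
   proof (rule sum_mono)
    fix i assume "i : {..<n}"
    hence i: "c <= a i" "a i <= b i" "b i <= d" using A by auto
    have "\<bar>p - q - (p' - q')\<bar> <= 2 * \<bar>p - p'\<bar>" if "\<bar>q - q'\<bar> <= p - p'" for p q p' q' :: real
     using that by (auto simp: abs_if split: if_splits)
    thus "\<bar>V (b i) - f (b i) - (V (a i) - f (a i))\<bar> <= 2 * \<bar>V (b i) - V (a i)\<bar>" using V1[OF i] by blast
   qed
   also have "\<dots> = 2 * (\<Sum>i<n. \<bar>V (b i) - V (a i)\<bar>)" by (simp add: sum_distrib_left)
   also have "\<dots> < e" using ac1[of n a b] A by simp
   finally show "(\<Sum>i<n. \<bar>V (b i) - f (b i) - (V (a i) - f (a i))\<bar>) < e" .
  qed (rule dl)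
 qed
 have "mono_on {c..d} V"
  by (rule mono_onI) (use V1 in force)
 then obtain h1 where h1: "integrable lborel h1" "!!x. x : {c..d} ==> V x - V c = (LBINT t:{c..x}. h1 t)"
  using mono_abs_cont_density[OF acV cd] by blast
 have "mono_on {c..d} (%x. V x - f x)"
  by (rule mono_onI) (use V1 in force)
 then obtain h2 where h2: "integrable lborel h2" "!!x. x : {c..d} ==> (V x - f x) - (V c - f c) = (LBINT t:{c..x}. h2 t)"
  using mono_abs_cont_density[OF acVf cd] by blast
 have si: "set_integrable lborel {x..y} g" if "integrable lborel g" for x y and g :: "real => real"
  using integrable_mult_indicator[OF _ that, of "{x..y}"] by (simp add: set_integrable_def)
 define h where "h x = h1 x - h2 x" for x
 have hi: "integrable lborel h" unfolding h_def using h1 h2 by auto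
 have 0: "f x - f c = (LBINT t:{c..x}. h t)" if "x : {c..d}" for x
  unfolding h_def using h1(2)[OF that] h2(2)[OF that] set_integral_diff(2)[OF si[OF h1(1)] si[OF h2(1)]]
  by simp
 show ?thesis
 proof (rule that[OF hi])
  fix x y assume xy: "c <= x" "x <= y" "y <= d"
  have "(LBINT t:{c..y}. h t) = (LBINT t:{c..x} Un {x<..y}. h t)" using xy by (simp add: ivl_disj_un_two)
  also have "\<dots> = (LBINT t:{c..x}. h t) + (LBINT t:{x<..y}. h t)"
   by (rule set_integral_Un) (use hi in \<open>auto simp: set_integrable_def intro!: integrable_mult_indicator[where 'b=real, simplified]\<close>)
  also have "(LBINT t:{x<..y}. h t) = (LBINT t:{x..y}. h t)"
   unfolding set_lebesgue_integral_def
   by (rule integral_cong_AE) (use hi AE_lborel_singleton[of x] in \<open>auto simp: indicator_def elim!: eventually_mono\<close>)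
  finally show "f y - f x = (LBINT t:{x..y}. h t)" using 0[of x] 0[of y] xy by simp
 qed
qed

section \<open>Cauchy-Schwarz and square integrable functions on the line\<close>

abbreviation pint :: "(real => real) => real => real => real" where
 "pint q x y \<equiv> (LBINT t:{x..y}. q t)"

lemma quadratic_nonneg_discriminant:
 fixes a b c :: real
 assumes "!!t. 0 <= a - 2 * t * b + t^2 * c" "c >= 0"
 shows "b^2 <= a * c"
proof (cases "c = 0")
 case True
 have "b = 0"
 proof (rule ccontr)
  assume "b ~= 0"
  \<comment> \<open>With \<open>c = 0\<close> this value of \<open>t\<close> makes the quadratic
    expression equal to -1.\<close>
  thus False using assms(1)[of "(a + 1) / (2 * b)"] True by simp
 qed
 thus ?thesis using True by simp
next
 case False
 hence c: "c > 0" using assms(2) by simp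
 have "0 <= a - 2 * (b / c) * b + (b / c)^2 * c" by (rule assms)
 also have "\<dots> = a - b^2 / c" using c by (simp add: power2_eq_square field_simps)
 finally show ?thesis using c by (simp add: pos_divide_le_eq)
qed

lemma integrable_mult_of_squares:
 fixes p q :: "'a => real"
 assumes [measurable]: "p : borel_measurable M" "q : borel_measurable M"
  and "integrable M (%x. (p x)^2)" "integrable M (%x. (q x)^2)"
 shows "integrable M (%x. p x * q x)"
proof (rule Bochner_Integration.integrable_bound)
 show "integrable M (%x. (p x)^2 + (q x)^2)" using assms by auto
 show "AE x in M. norm (p x * q x) <= norm ((p x)^2 + (q x)^2)"
 proof (rule AE_I2)
  fix x
  have "2 * \<bar>p x * q x\<bar> <= (p x)^2 + (q x)^2"
   using sum_squares_bound[of "\<bar>p x\<bar>" "\<bar>q x\<bar>"] by (simp add: abs_mult)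
  thus "norm (p x * q x) <= norm ((p x)^2 + (q x)^2)" by simp
 qed
qed measurable

lemma integrable_square_add:
 fixes p q :: "'a => real"
 assumes [measurable]: "p : borel_measurable M" "q : borel_measurable M"
  and p: "integrable M (%x. (p x)^2)" and q: "integrable M (%x. (q x)^2)"
 shows "integrable M (%x. (p x + q x)^2)" "integrable M (%x. (p x - q x)^2)"
proof -
 have pq: "integrable M (%x. p x * q x)" by (rule integrable_mult_of_squares) fact+
 have "integrable M (%x. (p x)^2 + (q x)^2 + 2 * (p x * q x))" using p q pq by auto
 thus "integrable M (%x. (p x + q x)^2)" by (simp add: power2_sum mult.assoc)
 have "integrable M (%x. (p x)^2 + (q x)^2 - 2 * (p x * q x))" using p q pq by auto
 thus "integrable M (%x. (p x - q x)^2)" by (simp add: power2_diff mult.assoc)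
qed

lemma integral_Cauchy_Schwarz:
 fixes p q :: "'a => real"
 assumes [measurable]: "p : borel_measurable M" "q : borel_measurable M"
  and p: "integrable M (%x. (p x)^2)" and q: "integrable M (%x. (q x)^2)"
 shows "(\<integral>x. p x * q x \<partial>M)^2 <= sqn M p * sqn M q"
proof (rule quadratic_nonneg_discriminant)
 have pq: "integrable M (%x. p x * q x)" by (rule integrable_mult_of_squares) fact+
 fix t
 have "0 <= (\<integral>x. (p x - t * q x)^2 \<partial>M)" by simp
 also have "(%x. (p x - t * q x)^2) = (%x. (p x)^2 - 2 * t * (p x * q x) + t^2 * (q x)^2)"
  by (auto simp: power2_diff power_mult_distrib)
 also have "(\<integral>x. (p x)^2 - 2 * t * (p x * q x) + t^2 * (q x)^2 \<partial>M)
  = sqn M p - 2 * t * (\<integral>x. p x * q x \<partial>M) + t^2 * sqn M q"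
  using p q pq by simp
 finally show "0 <= sqn M p - 2 * t * (\<integral>x. p x * q x \<partial>M) + t^2 * sqn M q" .
qed simp

definition L2r :: "(real => real) => bool" where
 "L2r q \<longleftrightarrow> q : borel_measurable borel & integrable lborel (%x. (q x)^2)"

lemma L2r_meas: "L2r q ==> q : borel_measurable borel"
 and L2r_sq: "L2r q ==> integrable lborel (%x. (q x)^2)"
 by (auto simp: L2r_def)

lemma L2r_mult: "L2r p ==> L2r q ==> integrable lborel (%x. p x * q x)"
 by (intro integrable_mult_of_squares) (auto simp: L2r_def)

lemma L2r_add: "L2r p ==> L2r q ==> L2r (%x. p x + q x)"
 unfolding L2r_def by (auto intro!: integrable_square_add)

lemma L2r_diff: "L2r p ==> L2r q ==> L2r (%x. p x - q x)"
 unfolding L2r_def by (auto intro!: integrable_square_add)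

lemma L2r_cmult: "L2r p ==> L2r (%x. c * p x)"
 unfolding L2r_def by (auto simp: power_mult_distrib)

lemma L2r_bound:
 assumes "L2r m" "p : borel_measurable borel" "!!x. \<bar>p x\<bar> <= \<bar>m x\<bar>"
 shows "L2r p" "sqn lborel p <= sqn lborel m"
proof -
 have *: "(p x)^2 <= (m x)^2" for x using assms(3)[of x] by (simp add: abs_le_square_iff)
 have "integrable lborel (%x. (p x)^2)"
  using assms * by (intro Bochner_Integration.integrable_bound[OF L2r_sq[OF assms(1)]]) auto
 thus "L2r p" using assms by (simp add: L2r_def)
 thus "sqn lborel p <= sqn lborel m"
  using * by (intro integral_mono L2r_sq assms(1))
qed

lemma L2r_indicator: "L2r q ==> B : sets borel ==> L2r (%x. indicator B x * q x)"
 by (rule L2r_bound(1)[of q]) (auto simp: L2r_def indicator_def)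

lemma L2r_indicator_finite: "B : sets borel ==> emeasure lborel B < \<infinity> ==> L2r (indicator B)"
 unfolding L2r_def by (auto simp: power2_eq_square indicator_inter_arith[symmetric])

lemma L2r_set_integrable:
 assumes "L2r q" "B : sets borel" "emeasure lborel B < \<infinity>"
 shows "set_integrable lborel B q"
 using L2r_mult[OF L2r_indicator_finite[OF assms(2,3)] assms(1)] by (simp add: set_integrable_def)

lemma L2r_Icc: "L2r q ==> set_integrable lborel {x..y} q"
 by (rule L2r_set_integrable) (auto simp: emeasure_lborel_Icc_eq)

lemma L2r_set_CS:
 assumes "L2r q" "B : sets borel" "emeasure lborel B < \<infinity>"
 shows "(LBINT t:B. q t)^2 <= measure lborel B * sqn lborel q"
proof -
 have "(\<integral>t. indicator B t * q t \<partial>lborel)^2 <= (\<integral>t. (indicator B t :: real)^2 \<partial>lborel) * sqn lborel q"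
  using L2r_indicator_finite[OF assms(2,3)] assms(1) by (intro integral_Cauchy_Schwarz) (auto simp: L2r_def)
 also have "(\<integral>t. (indicator B t :: real)^2 \<partial>lborel) = measure lborel B"
  by (simp add: power2_eq_square indicator_inter_arith[symmetric])
 finally show ?thesis by (simp add: set_lebesgue_integral_def)
qed

lemma set_integral_cong_AE_ind:
 fixes f g :: "real => real"
 assumes "f : borel_measurable borel" "A : sets borel" "B : sets borel" "AE x in lborel. x : A \<longleftrightarrow> x : B"
 shows "(LBINT t:A. f t) = (LBINT t:B. f t)"
 unfolding set_lebesgue_integral_def
proof (rule integral_cong_AE)
 show "AE x in lborel. indicator A x *\<^sub>R f x = indicator B x *\<^sub>R f x"
  using assms(4) by eventually_elim (simp add: indicator_def)
qed (use assms in measurable)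

lemma pint_Ioo: "q : borel_measurable borel ==> pint q x y = (LBINT t:{x<..<y}. q t)"
 by (rule set_integral_cong_AE_ind)
  (use AE_lborel_singleton[of x] AE_lborel_singleton[of y] in \<open>auto elim!: eventually_rev_mp\<close>)

lemma pint_add:
 fixes q :: "real => real"
 assumes q: "set_integrable lborel {x..z} q" and xyz: "x <= y" "y <= z"
 shows "pint q x z = pint q x y + pint q y z"
proof -
 have "pint q x z = (LBINT t:{x..y} Un {y<..z}. q t)" using xyz by (simp add: ivl_disj_un_two)
 also have "\<dots> = pint q x y + (LBINT t:{y<..z}. q t)"
  using xyz by (intro set_integral_Un set_integrable_subset[OF q]) auto
 also have "(LBINT t:{y<..z}. q t) = pint q y z"
 proof -
  have "(LBINT t:{y<..z}. q t) = (LBINT t:{y<..z}. indicator {x..z} t * q t)"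
   unfolding set_lebesgue_integral_def using xyz by (intro Bochner_Integration.integral_cong) (auto simp: indicator_def)
  also have "\<dots> = (LBINT t:{y..z}. indicator {x..z} t * q t)"
  proof (rule set_integral_cong_AE_ind)
   show "(%t. indicator {x..z} t * q t) : borel_measurable borel" using q by (auto simp: set_integrable_def)
   show "AE t in lborel. (t : {y<..z}) = (t : {y..z})"
    using AE_lborel_singleton[of y] by eventually_elim auto
  qed auto
  also have "\<dots> = pint q y z"
   unfolding set_lebesgue_integral_def using xyz by (intro Bochner_Integration.integral_cong) (auto simp: indicator_def)
  finally show ?thesis .
 qed
 finally show ?thesis .
qed

section \<open>Absolute continuity and its densities\<close>

lemma abs_cont_continuous:
 assumes "abs_cont_on {c..d} f" shows "continuous_on {c..d} f"
 unfolding continuous_on_iff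
proof (intro ballI allI impI)
 fix x e :: real assume x: "x : {c..d}" and e: "e > 0"
 obtain dl where dl: "dl > 0" and ac: "ALL (n::nat) a b. (ALL i<n. a i : {c..d} & b i : {c..d} & a i <= b i) &
    disjoint_family_on (%i. {a i<..<b i}) {..<n} & (\<Sum>i<n. b i - a i) < dl --> (\<Sum>i<n. \<bar>f (b i) - f (a i)\<bar>) < e"
  using assms e unfolding abs_cont_on_def by auto
 show "EX dl>0. ALL x':{c..d}. dist x' x < dl --> dist (f x') (f x) < e"
 proof (intro exI conjI ballI impI)
  fix x' assume x': "x' : {c..d}" "dist x' x < dl"
  have "(\<Sum>i<(1::nat). \<bar>f (max x x') - f (min x x')\<bar>) < e"
   by (rule ac[rule_format, of 1 "%_. min x x'" "%_. max x x'"])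
    (use x x' in \<open>auto simp: disjoint_family_on_def dist_real_def\<close>)
  thus "dist (f x') (f x) < e"
   by (cases "x <= x'") (auto simp: dist_real_def max_def min_def abs_minus_commute)
 qed (rule dl)
qed

text \<open>Cauchy-Schwarz over the union of the intervals bounds the square of the sum of
  increments by total length times \<open>N\<close>, the squared norm of \<open>m\<close>. Hence the
  choice \<open>e^2 / (N + 1)\<close>, where the 1 avoids a division by zero.\<close>

lemma abs_cont_on_of_bound:
 fixes Ph :: "real => real"
 assumes m: "L2r m" and b: "!!x y. c <= x ==> x <= y ==> y <= d ==> \<bar>Ph y - Ph x\<bar> <= pint m x y"
 shows "abs_cont_on {c..d} Ph"
 unfolding abs_cont_on_def
proof (intro allI impI)
 fix e :: real assume e: "e > 0"
 define N where "N = sqn lborel m"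
 have N: "N >= 0" by (simp add: N_def)
 show "EX dl>0. ALL (n::nat) a b. (ALL i<n. a i : {c..d} & b i : {c..d} & a i <= b i) &
    disjoint_family_on (%i. {a i<..<b i}) {..<n} & (\<Sum>i<n. b i - a i) < dl --> (\<Sum>i<n. \<bar>Ph (b i) - Ph (a i)\<bar>) < e"
 proof (intro exI conjI allI impI)
  show "e^2 / (N + 1) > 0" using e N by simp
  fix n :: nat and a b :: "nat => real"
  assume A: "(ALL i<n. a i : {c..d} & b i : {c..d} & a i <= b i) &
    disjoint_family_on (%i. {a i<..<b i}) {..<n} & (\<Sum>i<n. b i - a i) < e^2 / (N + 1)"
  define B where "B = (\<Union>i<n. {a i<..<b i})"
  have mm: "m : borel_measurable borel" by (rule L2r_meas[OF m])
  have "(\<Sum>i<n. \<bar>Ph (b i) - Ph (a i)\<bar>) <= (\<Sum>i<n. LBINT t:{a i<..<b i}. m t)"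
   by (rule sum_mono) (use A assms(2) pint_Ioo[OF mm] in auto)
  also have "\<dots> = (LBINT t:B. m t)"
   unfolding B_def using A by (intro set_integral_finite_Union[symmetric] L2r_set_integrable[OF m]) auto
  finally have 1: "(\<Sum>i<n. \<bar>Ph (b i) - Ph (a i)\<bar>) <= (LBINT t:B. m t)" .
  have mB: "measure lborel B = (\<Sum>i<n. b i - a i)"
  proof -
   have "measure lborel B = (\<Sum>i<n. measure lborel {a i<..<b i})"
    unfolding B_def using A by (intro measure_finite_Union) auto
   also have "\<dots> = (\<Sum>i<n. b i - a i)" using A by (intro sum.cong) auto
   finally show ?thesis .
  qed
  have Bf: "emeasure lborel B < \<infinity>"
  proof -
   have "emeasure lborel B <= emeasure lborel {c..d}"
    unfolding B_def using A by (intro emeasure_mono) force+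
   also have "\<dots> < \<infinity>" by (simp add: emeasure_lborel_Icc_eq)
   finally show ?thesis .
  qed
  have "(LBINT t:B. m t)^2 <= measure lborel B * N"
   unfolding N_def by (rule L2r_set_CS[OF m _ Bf]) (auto simp: B_def)
  also have "\<dots> <= measure lborel B * (N + 1)" by (simp add: mult_left_mono)
  also have "\<dots> < e^2" using A N by (simp add: mB pos_less_divide_eq)
  finally have "(LBINT t:B. m t) < e" using e by (meson less_imp_le power_less_imp_less_base)
  thus "(\<Sum>i<n. \<bar>Ph (b i) - Ph (a i)\<bar>) < e" using 1 by linarith
 qed
qed

text \<open>By Lebesgue differentiation the density found through the variation is the derivative
  almost everywhere. Only interior points are controlled: at \<open>c\<close> and \<open>d\<close>
  the number \<open>deriv g\<close> depends on \<open>g\<close> outside the interval.\<close>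

lemma abs_cont_deriv:
 fixes g :: "real => real"
 assumes ac: "abs_cont_on {c..d} g" and cd: "c <= d"
 shows "set_integrable lborel {c..d} (deriv g)"
  and "!!x y. c <= x ==> x <= y ==> y <= d ==> g y - g x = pint (deriv g) x y"
  and "AE t in lborel. t : {c<..<d} --> (g has_real_derivative deriv g t) (at t)"
proof -
 obtain h where h: "integrable lborel h" and gh: "!!x y. c <= x ==> x <= y ==> y <= d ==> g y - g x = pint h x y"
  using abs_cont_density[OF ac cd] by blast
 have D: "AE t in lborel. t : {c<..<d} --> (g has_real_derivative h t) (at t)"
  using lebesgue_differentiation[OF h]
 proof eventually_elim
  case (elim t)
  show ?case
  proof
   assume t: "t : {c<..<d}"
   have "EX dl>0. ALL y z. t - dl < y & y <= z & z < t + dl --> g z - g y = pint h y z"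
    by (rule exI[of _ "min (t - c) (d - t)"]) (use t gh in auto)
   thus "(g has_real_derivative h t) (at t)" using elim by blast
  qed
 qed
 hence dh: "AE t in lborel. t : {c<..<d} --> deriv g t = h t"
  by eventually_elim (auto intro: DERIV_imp_deriv)
 show "AE t in lborel. t : {c<..<d} --> (g has_real_derivative deriv g t) (at t)"
  using D dh by eventually_elim auto
 have m1: "(%t. indicator {c<..<d} t * deriv g t) : borel_measurable borel"
  by (rule borel_measurable_deriv_on)
   (auto intro: continuous_on_subset[OF abs_cont_continuous[OF ac]])
 have m2: "(%t. indicator {x..y} t *\<^sub>R deriv g t) : borel_measurable borel" if "c <= x" "y <= d" for x y
 proof -
  \<comment> \<open>Measurability is known on the open interval; the end points are added by hand,
    and \<open>{d} - {c}\<close> prevents a degenerate interval from being counted twice.\<close>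
  have "(%t. indicator {x..y} t * (indicator {c<..<d} t * deriv g t) + indicator ({c} Int {x..y}) t * deriv g c
   + indicator (({d} - {c}) Int {x..y}) t * deriv g d) : borel_measurable borel"
   using m1 by measurable
  also have "(%t. indicator {x..y} t * (indicator {c<..<d} t * deriv g t) + indicator ({c} Int {x..y}) t * deriv g c
   + indicator (({d} - {c}) Int {x..y}) t * deriv g d) = (%t. indicator {x..y} t *\<^sub>R deriv g t)"
   using that cd by (auto simp: indicator_def fun_eq_iff)
  finally show ?thesis .
 qed
 have hm: "h : borel_measurable borel" using h by auto
 have ae2: "AE t in lborel. indicator {x..y} t *\<^sub>R deriv g t = indicator {x..y} t *\<^sub>R h t" if "c <= x" "y <= d" for x y
  using dh AE_lborel_singleton[of c] AE_lborel_singleton[of d]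
  by eventually_elim (use that in \<open>auto simp: indicator_def\<close>)
 have "integrable lborel (%t. indicator {c..d} t *\<^sub>R h t)" using h by (intro integrable_mult_indicator) auto
 hence "integrable lborel (%t. indicator {c..d} t *\<^sub>R deriv g t)"
  using ae2[of c d] m2[of c d] hm by (subst integrable_cong_AE) auto
 thus "set_integrable lborel {c..d} (deriv g)" by (simp add: set_integrable_def)
 show "g y - g x = pint (deriv g) x y" if "c <= x" "x <= y" "y <= d" for x y
 proof -
  have "pint (deriv g) x y = pint h x y"
   unfolding set_lebesgue_integral_def
   using ae2[of x y] m2[of x y] hm that by (intro integral_cong_AE) auto
  thus ?thesis using gh that by simp
 qed
qed

text \<open>The constant 0 is a local primitive of \<open>j\<close>, and Lebesgue differentiation
  identifies its derivative with \<open>j t\<close>.\<close>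

lemma integral_zero_imp_AE_zero:
 fixes j :: "real => real"
 assumes j: "set_integrable lborel {c..d} j" and z: "!!x. c <= x ==> x <= d ==> pint j c x = 0"
 shows "AE t in lborel. t : {c<..<d} --> j t = 0"
proof -
 have h: "integrable lborel (%t. indicator {c..d} t * j t)" using j by (simp add: set_integrable_def)
 show ?thesis
  using lebesgue_differentiation[OF h]
 proof eventually_elim
  case (elim t)
  show ?case
  proof
   assume t: "t : {c<..<d}"
   have "((%_. 0) has_real_derivative indicator {c..d} t * j t) (at t)"
   proof (rule elim[rule_format], intro exI[of _ "min (t - c) (d - t)"] conjI allI impI)
    show "0 < min (t - c) (d - t)" using t by auto
    fix y z assume yz: "t - min (t - c) (d - t) < y & y <= z & z < t + min (t - c) (d - t)"
    hence yz': "c <= y" "y <= z" "z <= d" by auto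
    have "pint j c z = pint j c y + pint j y z"
     using yz' by (intro pint_add set_integrable_subset[OF j]) auto
    hence "pint j y z = 0" using z yz' by simp
    moreover have "(LBINT t:{y..z}. indicator {c..d} t * j t) = pint j y z"
     unfolding set_lebesgue_integral_def using yz' by (intro Bochner_Integration.integral_cong) (auto simp: indicator_def)
    ultimately show "0 - 0 = (LBINT t:{y..z}. indicator {c..d} t * j t)" by simp
   qed
   hence "indicator {c..d} t * j t = 0" by (metis DERIV_const DERIV_unique)
   thus "j t = 0" using t by simp
  qed
 qed
qed

lemma pint_const: "x <= y ==> pint (%_. c) x y = c * (y - x)"
 by (simp add: set_integral_const)

lemma set_integral_cong': "(!!x. x : A ==> f x = g x) ==> (LBINT t:A. f t) = (LBINT t:A. (g t :: real))"
 unfolding set_lebesgue_integral_def by (intro Bochner_Integration.integral_cong) (auto simp: indicator_def)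

section \<open>Gaps and exhaustion\<close>

locale classK =
 fixes E :: "real set"
 assumes K: "class_K E"
begin

abbreviation I :: "real set" where "I \<equiv> Ival E"

lemma lft_less_rgt: "lft E < rgt E"
 using K by (simp add: class_K_def)

lemma E_nonempty: "E ~= {}"
proof
 assume "E = {}"
 thus False using lft_less_rgt by (simp add: lft_def rgt_def top_ereal_def bot_ereal_def)
qed

lemma lft_le: "x : E ==> lft E <= ereal x"
 unfolding lft_def by (rule Inf_lower) auto

lemma rgt_ge: "x : E ==> ereal x <= rgt E"
 unfolding rgt_def by (rule Sup_upper) auto

lemma E_sub_I: "x : E ==> x : I"
 by (simp add: Ival_def)

lemma lft_le_I: "x : I ==> lft E <= ereal x"
 unfolding Ival_def using lft_le by (auto intro: less_imp_le)

lemma rgt_ge_I: "x : I ==> ereal x <= rgt E"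
 unfolding Ival_def using rgt_ge by (auto intro: less_imp_le)

lemma ex_E_below: "lft E < ereal x ==> EX y:E. y < x"
 unfolding lft_def Inf_less_iff by auto

lemma ex_E_above: "ereal x < rgt E ==> EX y:E. x < y"
 unfolding rgt_def less_Sup_iff by auto

lemma I_convex:
 assumes "x : I" "y : I" "x <= z" "z <= y" shows "z : I"
proof (cases "z = x | z = y")
 case False
 hence "x < z" "z < y" using assms by auto
 hence xz: "ereal x < ereal z" "ereal z < ereal y" by simp_all
 have "lft E < ereal z" using lft_le_I[OF assms(1)] xz(1) by (rule le_less_trans)
 moreover have "ereal z < rgt E" using xz(2) rgt_ge_I[OF assms(2)] by (rule less_le_trans)
 ultimately show ?thesis by (simp add: Ival_def)
qed (use assms in auto)

lemma Icc_sub_I: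
 assumes "x : I" "y : I" shows "{x..y} <= I"
proof
 fix z assume "z : {x..y}"
 thus "z : I" using I_convex[OF assms, of z] by simp
qed

text \<open>Taking the closure in the extended line can add only \<open>lft E\<close> and
  \<open>rgt E\<close>. Between two points of \<open>E\<close> neither of them is new, so this piece
  is already closed in the line.\<close>

lemma compact_E_Icc:
 assumes "al : E" "be : E" shows "compact (E Int {al..be})"
proof -
 have cl: "closed (ereal ` E Un {lft E, rgt E})" using K by (simp add: class_K_def)
 have "E Int {al..be} = ereal -` (ereal ` E Un {lft E, rgt E}) Int {al..be}"
 proof
  show "ereal -` (ereal ` E Un {lft E, rgt E}) Int {al..be} <= E Int {al..be}"
  proof
   fix x assume x: "x : ereal -` (ereal ` E Un {lft E, rgt E}) Int {al..be}"
   show "x : E Int {al..be}"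
   proof (cases "x : E")
    case False
    hence "ereal x = lft E | ereal x = rgt E" using x by auto
    thus ?thesis
    proof
     assume "ereal x = lft E"
     hence "x <= al" using lft_le[OF assms(1)] by (metis ereal_less_eq(3))
     hence "x = al" using x by simp
     thus ?thesis using assms False by simp
    next
     assume "ereal x = rgt E"
     hence "be <= x" using rgt_ge[OF assms(2)] by (metis ereal_less_eq(3))
     hence "x = be" using x by simp
     thus ?thesis using assms False by simp
    qed
   qed (use x in auto)
  qed
 qed auto
 moreover have "closed (ereal -` (ereal ` E Un {lft E, rgt E}))"
  by (rule closed_vimage[OF cl]) (auto intro: continuous_on_ereal continuous_on_id)
 ultimately show ?thesis by (simp add: closed_Int_compact)
qed

lemma gapsD: "p : gaps E ==> fst p : E & snd p : E & fst p < snd p & (ALL x:E. x <= fst p | snd p <= x)"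
 by (cases p) (force simp: gaps_def disjoint_iff not_less)

text \<open>Compactness of \<open>E\<close> between points on either side of \<open>x\<close>
  provides the nearest points of \<open>E\<close> below and above; these bound the gap.\<close>

lemma gap_ex:
 assumes "x : I" "x ~: E"
 obtains p where "p : gaps E" "fst p < x" "x < snd p"
proof -
 have lx: "lft E < ereal x" "ereal x < rgt E" using assms by (auto simp: Ival_def)
 obtain al where al: "al : E" "al < x" using ex_E_below lx by blast
 obtain be where be: "be : E" "x < be" using ex_E_above lx by blast
 have cp: "compact (E Int {al..be})" by (rule compact_E_Icc) fact+
 have cpl: "compact (E Int {al..be} Int {al..x})" and cpr: "compact (E Int {al..be} Int {x..be})"
  using cp by (auto intro: compact_Int)
 obtain a where a: "a : E Int {al..be} Int {al..x}" "!!t. t : E Int {al..be} Int {al..x} ==> t <= a"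
  using compact_attains_sup[OF cpl] al be by force
 obtain b where b: "b : E Int {al..be} Int {x..be}" "!!t. t : E Int {al..be} Int {x..be} ==> b <= t"
  using compact_attains_inf[OF cpr] al be by force
 have ab: "a < x" "x < b" using a(1) b(1) assms(2) by (auto simp: less_le)
 have "t ~: E" if "a < t" "t < b" for t
 proof
  assume "t : E"
  thus False using a(2)[of t] b(2)[of t] that a(1) b(1) by (cases "t <= x") auto
 qed
 hence "(a, b) : gaps E" using a(1) b(1) ab by (auto simp: gaps_def)
 thus ?thesis using that[of "(a, b)"] ab by auto
qed

lemma gap_unique:
 assumes "p : gaps E" "q : gaps E" "fst p < x" "x < snd p" "fst q < x" "x < snd q"
 shows "p = q"
proof -
 have "fst q <= fst p | snd p <= fst q" "snd q <= fst p | snd p <= snd q"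
  "fst p <= fst q | snd q <= fst p" "snd p <= fst q | snd q <= snd p"
  using gapsD[OF assms(1)] gapsD[OF assms(2)] by blast+
 hence "fst p = fst q" "snd p = snd q" using assms(3-) by linarith+
 thus ?thesis by (simp add: prod_eq_iff)
qed

lemma gap_inter_E:
 assumes "p : gaps E" "fst p < x" "x < snd p" shows "x ~: E"
proof
 assume "x : E"
 hence "x <= fst p | snd p <= x" using gapsD[OF assms(1)] by blast
 thus False using assms by auto
qed

lemma gap_sub_I:
 assumes "p : gaps E" shows "{fst p..snd p} <= I"
 using gapsD[OF assms] by (intro Icc_sub_I E_sub_I) auto

definition gapU :: "real set" where "gapU = (\<Union>p\<in>gaps E. {fst p<..<snd p})"

lemma gapU_eq: "gapU = I - E"
proof
 show "gapU <= I - E"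
 proof
  fix x assume "x : gapU"
  then obtain p where p: "p : gaps E" "fst p < x" "x < snd p" by (auto simp: gapU_def)
  hence "x : {fst p..snd p}" by simp
  thus "x : I - E" using gap_sub_I[OF p(1)] gap_inter_E[OF p] by blast
 qed
 show "I - E <= gapU"
 proof
  fix x assume "x : I - E"
  then obtain p where "p : gaps E" "fst p < x" "x < snd p" using gap_ex[of x] by blast
  thus "x : gapU" by (auto simp: gapU_def)
 qed
qed

lemma gaps_disjoint: "disjoint_family_on (%p. {fst p<..<snd p}) (gaps E)"
 unfolding disjoint_family_on_def
proof (intro ballI impI)
 fix p q assume pq: "p : gaps E" "q : gaps E" "p ~= q"
 show "{fst p<..<snd p} Int {fst q<..<snd q} = {}"
 proof (rule equals0I)
  fix x assume "x : {fst p<..<snd p} Int {fst q<..<snd q}"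
  thus False using gap_unique[OF pq(1,2), of x] pq(3) by simp
 qed
qed

lemma countable_gaps: "countable (gaps E)"
proof -
 have "countable ((%p. {fst p<..<snd p}) ` gaps E)"
 proof (rule countable_disjoint_open_subsets)
  show "disjoint ((%p. {fst p<..<snd p}) ` gaps E)"
   using gaps_disjoint by (auto simp: disjoint_family_on_def pairwise_def disjnt_def)
 qed auto
 moreover have "inj_on (%p. {fst p<..<snd p}) (gaps E)"
 proof (rule inj_onI)
  fix p q assume pq: "p : gaps E" "q : gaps E" "{fst p<..<snd p} = {fst q<..<snd q}"
  have m: "(fst p + snd p) / 2 : {fst p<..<snd p}" using gapsD[OF pq(1)] by auto
  hence m': "(fst p + snd p) / 2 : {fst q<..<snd q}" unfolding pq(3) .
  show "p = q" by (rule gap_unique[OF pq(1,2), of "(fst p + snd p) / 2"]) (use m m' in simp_all)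
 qed
 ultimately show ?thesis by (rule countable_image_inj_on)
qed

section \<open>Open and closed ends, and exhaustion of the interval by windows\<close>

definition Lopen :: bool where "Lopen \<longleftrightarrow> lft E ~: ereal ` E"
definition Ropen :: bool where "Ropen \<longleftrightarrow> rgt E ~: ereal ` E"

lemma Lopen_below:
 assumes Lopen "x : I" shows "EX y:E. y < x"
proof (rule ex_E_below)
 have "lft E ~= ereal x"
  using assms lft_less_rgt by (auto simp: Lopen_def Ival_def)
 thus "lft E < ereal x" using lft_le_I[OF assms(2)] by simp
qed

lemma Ropen_above:
 assumes Ropen "x : I" shows "EX y:E. x < y"
proof (rule ex_E_above)
 have "rgt E ~= ereal x"
  using assms lft_less_rgt by (auto simp: Ropen_def Ival_def)
 thus "ereal x < rgt E" using rgt_ge_I[OF assms(2)] by simp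
qed

lemma not_Lopen: "~ Lopen ==> EX m:E. lft E = ereal m & (ALL x:I. m <= x)"
proof -
 assume "~ Lopen"
 then obtain m where m: "m : E" "lft E = ereal m" by (auto simp: Lopen_def)
 have "m <= x" if "x : I" for x using lft_le_I[OF that] m(2) by simp
 with m show ?thesis by blast
qed

lemma not_Ropen: "~ Ropen ==> EX m:E. rgt E = ereal m & (ALL x:I. x <= m)"
proof -
 assume "~ Ropen"
 then obtain m where m: "m : E" "rgt E = ereal m" by (auto simp: Ropen_def)
 have "x <= m" if "x : I" for x using rgt_ge_I[OF that] m(2) by simp
 with m show ?thesis by blast
qed

text \<open>At an open end a point of \<open>E\<close> is chosen below each rational of
  \<open>I\<close>; this is cofinal because a rational lies between any \<open>x\<close> and a
  smaller point of \<open>E\<close>. Rationals outside \<open>I\<close> are replaced by a fixed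
  \<open>x0\<close>. At a closed end the constant sequence suffices.\<close>

lemma below_cofinal: "EX y::nat => real. (ALL n. y n : E) & (ALL x:I. EX n. y n <= x)"
proof (cases Lopen)
 case False
 then obtain m where "m : E" "ALL x:I. m <= x" using not_Lopen by blast
 thus ?thesis by (intro exI[of _ "%_. m"]) auto
next
 case True
 obtain x0 where x0: "x0 : E" using E_nonempty by auto
 define q where "q n = (if real_of_rat (from_nat n) : I then real_of_rat (from_nat n) else x0)" for n :: nat
 have qI: "q n : I" for n using x0 E_sub_I by (auto simp: q_def)
 hence "EX y:E. y < q n" for n using Lopen_below[OF True] by blast
 then obtain y where y: "!!n. y n : E" "!!n. y n < q n" by metis
 have "EX n. y n <= x" if x: "x : I" for x
 proof -
  obtain z where z: "z : E" "z < x" using Lopen_below[OF True x] by blast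
  obtain r where r: "z < real_of_rat r" "real_of_rat r < x" using of_rat_dense[OF z(2)] by blast
  have "real_of_rat r : I" using I_convex[OF E_sub_I[OF z(1)] x] r by simp
  hence "q (to_nat r) = real_of_rat r" by (simp add: q_def)
  thus ?thesis using y(2)[of "to_nat r"] r by (intro exI[of _ "to_nat r"]) simp
 qed
 thus ?thesis using y(1) by blast
qed

lemma above_cofinal: "EX y::nat => real. (ALL n. y n : E) & (ALL x:I. EX n. x <= y n)"
proof (cases Ropen)
 case False
 then obtain m where "m : E" "ALL x:I. x <= m" using not_Ropen by blast
 thus ?thesis by (intro exI[of _ "%_. m"]) auto
next
 case True
 obtain x0 where x0: "x0 : E" using E_nonempty by auto
 define q where "q n = (if real_of_rat (from_nat n) : I then real_of_rat (from_nat n) else x0)" for n :: nat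
 have qI: "q n : I" for n using x0 E_sub_I by (auto simp: q_def)
 hence "EX y:E. q n < y" for n using Ropen_above[OF True] by blast
 then obtain y where y: "!!n. y n : E" "!!n. q n < y n" by metis
 have "EX n. x <= y n" if x: "x : I" for x
 proof -
  obtain z where z: "z : E" "x < z" using Ropen_above[OF True x] by blast
  obtain r where r: "x < real_of_rat r" "real_of_rat r < z" using of_rat_dense[OF z(2)] by blast
  have "real_of_rat r : I" using I_convex[OF x E_sub_I[OF z(1)]] r by simp
  hence "q (to_nat r) = real_of_rat r" by (simp add: q_def)
  thus ?thesis using y(2)[of "to_nat r"] r by (intro exI[of _ "to_nat r"]) simp
 qed
 thus ?thesis using y(1) by blast
qed

lemma ex_two: "EX x:E. EX y:E. x < y"
proof -
 obtain x where x: "x : E" using E_nonempty by auto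
 have "lft E < ereal x | ereal x < rgt E" using lft_less_rgt lft_le[OF x] rgt_ge[OF x] by (metis less_le_trans not_le)
 thus ?thesis using ex_E_below ex_E_above x by blast
qed

text \<open>Windows have both end points in \<open>E\<close>, so that no gap is cut and functions on
  \<open>E\<close> have values there. They reach every point of \<open>I\<close>, including an end
  that belongs to \<open>E\<close>; one exhaustion is chosen once and for all, so all later
  constructions refer to the same windows.\<close>

definition exhausting :: "(nat => real) \<times> (nat => real) => bool" where
 "exhausting p \<longleftrightarrow> (ALL n. fst p n : E & snd p n : E & fst p n < snd p n & fst p (Suc n) <= fst p n & snd p n <= snd p (Suc n))
  & (ALL x:I. EX n. fst p n <= x & x <= snd p n)"

definition el where "el = fst (SOME p. exhausting p)"
definition er where "er = snd (SOME p. exhausting p)"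

lemma exh: "(ALL n. el n : E & er n : E & el n < er n & el (Suc n) <= el n & er n <= er (Suc n))
  & (ALL x:I. EX n. el n <= x & x <= er n)"
proof -
 obtain x0 y0 where xy0: "x0 : E" "y0 : E" "x0 < y0" using ex_two by blast
 obtain y where y: "!!n::nat. y n : E" "!!x. x : I ==> EX n. y n <= x" using below_cofinal by blast
 obtain z where z: "!!n::nat. z n : E" "!!x. x : I ==> EX n. x <= z n" using above_cofinal by blast
 define a where "a n = Min (insert x0 (y ` {..n}))" for n
 define b where "b n = Max (insert y0 (z ` {..n}))" for n
 have aE: "a n : E" for n
 proof -
  have "a n : insert x0 (y ` {..n})" unfolding a_def by (rule Min_in) auto
  thus ?thesis using y xy0 by auto
 qed
 have bE: "b n : E" for n
 proof -
  have "b n : insert y0 (z ` {..n})" unfolding b_def by (rule Max_in) auto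
  thus ?thesis using z xy0 by auto
 qed
 have ax: "a n <= x0" "b n >= y0" for n unfolding a_def b_def by auto
 have am: "a m <= a n" "b n <= b m" if "n <= m" for n m
  unfolding a_def b_def using that by (intro Min_antimono Max_mono; force)+
 have amS: "a (Suc n) <= a n" "b n <= b (Suc n)" for n by (rule am; simp)+
 have ay: "a n <= y n" "z n <= b n" for n unfolding a_def b_def by (intro Min_le Max_ge; simp)+
 have "exhausting (a, b)"
  unfolding exhausting_def
 proof (intro conjI allI ballI)
  fix n show "fst (a, b) n < snd (a, b) n" using ax[of n] xy0 by simp
 next
  fix x assume x: "x : I"
  obtain n1 where "y n1 <= x" using y x by blast
  moreover obtain n2 where "x <= z n2" using z x by blast
  ultimately have "a (max n1 n2) <= x" "x <= b (max n1 n2)"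
   using ay[of n1] ay[of n2] am[of n1 "max n1 n2"] am[of n2 "max n1 n2"] by linarith+
  thus "EX n. fst (a, b) n <= x & x <= snd (a, b) n" by auto
 qed (simp_all add: aE bE amS)
 hence "exhausting (SOME p. exhausting p)" by (rule someI)
 thus ?thesis unfolding exhausting_def el_def er_def .
qed

lemma el_E: "el n : E" and er_E: "er n : E" and el_er: "el n < er n"
 and el_Suc: "el (Suc n) <= el n" and er_Suc: "er n <= er (Suc n)"
 using conjunct1[OF exh, rule_format, of n] by simp_all

lemmas el_I = E_sub_I[OF el_E] and er_I = E_sub_I[OF er_E]

lemma el_antimono: "n <= m ==> el m <= el n"
 by (rule decseqD[OF decseq_SucI[of el, OF el_Suc]])

lemma er_mono: "n <= m ==> er n <= er m"
 by (rule incseqD[OF incseq_SucI[of er, OF er_Suc]])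

lemma exh_I:
 assumes "x : I" shows "EX N. ALL n>=N. el n <= x & x <= er n"
proof -
 obtain N where "el N <= x & x <= er N" using conjunct2[OF exh] assms by blast
 hence "el n <= x & x <= er n" if "n >= N" for n using el_antimono[OF that] er_mono[OF that] by simp
 thus ?thesis by blast
qed

lemma exh_I2:
 assumes "x : I" "y : I" obtains n where "el n <= x" "el n <= y" "x <= er n" "y <= er n"
proof -
 obtain N where N: "ALL n>=N. el n <= x & x <= er n" using exh_I[OF assms(1)] by blast
 obtain M where M: "ALL n>=M. el n <= y & y <= er n" using exh_I[OF assms(2)] by blast
 show ?thesis by (rule that[of "max N M"]) (use N M in auto)
qed

lemma I_UN: "I = (\<Union>n. {el n..er n})"
proof
 show "I <= (\<Union>n. {el n..er n})"
 proof
  fix x assume "x : I"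
  then obtain n where "el n <= x" "x <= er n" using exh_I by blast
  thus "x : (\<Union>n. {el n..er n})" by auto
 qed
 show "(\<Union>n. {el n..er n}) <= I"
  by (rule UN_least) (rule Icc_sub_I[OF el_I er_I])
qed

lemma E_UN: "E = (\<Union>n. E Int {el n..er n})"
 using I_UN E_sub_I by blast

lemma I_borel[measurable]: "I : sets borel"
 by (subst I_UN) auto

lemma E_borel[measurable]: "E : sets borel"
proof (subst E_UN, rule sets.countable_UN)
 show "range (%n. E Int {el n..er n}) <= sets borel"
  using compact_E_Icc[OF el_E er_E] by (auto intro: borel_compact)
qed

lemma el_less_interior:
 assumes "lft E < ereal x" "ereal x < rgt E" shows "EX N. ALL n>=N. el n < x & x < er n"
proof -
 obtain y where y: "y : E" "y < x" using ex_E_below assms by blast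
 obtain z where z: "z : E" "x < z" using ex_E_above assms by blast
 obtain N where N: "ALL n>=N. el n <= y & y <= er n" using exh_I[OF E_sub_I[OF y(1)]] by blast
 obtain M where M: "ALL n>=M. el n <= z & z <= er n" using exh_I[OF E_sub_I[OF z(1)]] by blast
 have "el n < x & x < er n" if "n >= max N M" for n
 proof -
  have "el n <= y" "z <= er n" using N M that by auto
  thus ?thesis using y(2) z(2) by simp
 qed
 thus ?thesis by blast
qed

lemma AE_interior: "AE x in lborel. x : I --> lft E < ereal x & ereal x < rgt E"
proof -
 have "AE x in lborel. x ~= real_of_ereal (lft E) & x ~= real_of_ereal (rgt E)"
  using AE_lborel_singleton[of "real_of_ereal (lft E)"] AE_lborel_singleton[of "real_of_ereal (rgt E)"]
  by eventually_elim auto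
 thus ?thesis
 proof eventually_elim
  case (elim x)
  show ?case
  proof
   assume x: "x : I"
   have "ereal x ~= lft E" "ereal x ~= rgt E" using elim by (auto dest: arg_cong[of _ _ real_of_ereal])
   thus "lft E < ereal x & ereal x < rgt E" using lft_le_I[OF x] rgt_ge_I[OF x] by auto
  qed
 qed
qed

lemma compact_sub_exh:
 assumes "compact C" "C <= E"
 obtains n where "C <= {el n..er n}"
proof (cases "C = {}")
 case False
 obtain s where s: "s : C" "!!t. t : C ==> s <= t" using compact_attains_inf[OF assms(1) False] by blast
 obtain t where t: "t : C" "!!u. u : C ==> u <= t" using compact_attains_sup[OF assms(1) False] by blast
 have "s : I" "t : I" using s t assms E_sub_I by auto
 then obtain n where n: "el n <= s" "t <= er n" by (rule exh_I2)
 have "C <= {el n..er n}"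
 proof
  fix u assume "u : C"
  thus "u : {el n..er n}" using s(2)[of u] t(2)[of u] n by simp
 qed
 thus ?thesis by (rule that)
qed (use that in auto)

end

section \<open>Square integrable densities\<close>

context classK
begin

lemma gapU_borel[measurable]: "gapU : sets borel"
 by (simp add: gapU_eq)

lemma has_sum_gaps:
 fixes f :: "real => real"
 assumes f: "set_integrable lborel gapU f"
 shows "((%p. LBINT t:{fst p<..<snd p}. f t) has_sum (LBINT t:gapU. f t)) (gaps E)"
proof -
 define T where "T = to_nat_on (gaps E)"
 define A where "A n = (if n : T ` gaps E then {fst (from_nat_into (gaps E) n)<..<snd (from_nat_into (gaps E) n)} else {})" for n
 have inj: "inj_on T (gaps E)" unfolding T_def by (rule inj_on_to_nat_on[OF countable_gaps])
 have AT: "A (T p) = {fst p<..<snd p}" if "p : gaps E" for p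
 proof -
  have "from_nat_into (gaps E) (T p) = p" unfolding T_def by (rule from_nat_into_to_nat_on[OF countable_gaps that])
  thus ?thesis using that by (simp add: A_def)
 qed
 have A0: "A n = {}" if "n ~: T ` gaps E" for n using that by (simp add: A_def)
 have Am: "A n : sets lborel" for n by (simp add: A_def)
 have U: "(\<Union>n. A n) = gapU"
 proof
  show "(\<Union>n. A n) <= gapU"
  proof (rule UN_least)
   fix n show "A n <= gapU"
   proof (cases "n : T ` gaps E")
    case True
    then obtain p where p: "p : gaps E" "n = T p" by blast
    thus ?thesis using AT[OF p(1)] by (auto simp: gapU_def)
   qed (simp add: A0)
  qed
  show "gapU <= (\<Union>n. A n)" unfolding gapU_def using AT by blast
 qed
 have dj: "A i Int A j = {}" if ij: "i ~= j" for i j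
 proof (cases "i : T ` gaps E & j : T ` gaps E")
  case True
  then obtain p q where pq: "p : gaps E" "i = T p" "q : gaps E" "j = T q" by blast
  hence "p ~= q" using ij by auto
  thus ?thesis using gaps_disjoint pq AT unfolding disjoint_family_on_def by simp
 qed (use A0 in auto)
 define F where "F n = (LBINT t:A n. f t)" for n
 have fA: "set_integrable lborel (A n) f" for n
  by (rule set_integrable_subset[OF f Am]) (use U in blast)
 have fi: "set_integrable lborel gapU (%t. \<bar>f t\<bar>)" by (rule set_integrable_abs[OF f])
 have fAi: "set_integrable lborel (A n) (%t. \<bar>f t\<bar>)" for n by (rule set_integrable_abs[OF fA])
 have "summable (%n. LBINT t:A n. \<bar>f t\<bar>)"
 proof (rule summableI_nonneg_bounded)
  fix n :: nat
  show "0 <= (LBINT t:A n. \<bar>f t\<bar>)" unfolding set_lebesgue_integral_def by (intro integral_nonneg_AE) auto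
  have "(\<Sum>i<n. LBINT t:A i. \<bar>f t\<bar>) = (LBINT t:(\<Union>i<n. A i). \<bar>f t\<bar>)"
   by (rule set_integral_finite_Union[symmetric]) (use fAi Am dj in \<open>auto simp: disjoint_family_on_def\<close>)
  also have "\<dots> <= (LBINT t:gapU. \<bar>f t\<bar>)"
   unfolding set_lebesgue_integral_def
  proof (rule integral_mono)
   have "set_integrable lborel (\<Union>i<n. A i) (%t. \<bar>f t\<bar>)"
    by (rule set_integrable_subset[OF fi]) (use U Am in auto)
   thus "integrable lborel (%t. indicator (\<Union>i<n. A i) t *\<^sub>R \<bar>f t\<bar>)" by (simp add: set_integrable_def)
   show "integrable lborel (%t. indicator gapU t *\<^sub>R \<bar>f t\<bar>)" using fi by (simp add: set_integrable_def)
   show "indicator (\<Union>i<n. A i) t *\<^sub>R \<bar>f t\<bar> <= indicator gapU t *\<^sub>R \<bar>f t\<bar>" for t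
    using U by (auto simp: indicator_def)
  qed
  finally show "(\<Sum>i<n. LBINT t:A i. \<bar>f t\<bar>) <= (LBINT t:gapU. \<bar>f t\<bar>)" .
 qed
 hence sn: "summable (%n. norm (F n))"
 proof (rule summable_comparison_test'[where N=0])
  show "norm (norm (F n)) <= (LBINT t:A n. \<bar>f t\<bar>)" for n
   unfolding F_def set_lebesgue_integral_def
   using integral_norm_bound[of lborel "%t. indicator (A n) t *\<^sub>R f t"] by (simp add: abs_mult)
 qed
 have "(LBINT t:(\<Union>n. A n). f t) = (\<Sum>n. F n)"
  unfolding F_def by (rule lebesgue_integral_countable_add) (use Am dj f U in auto)
 hence "F sums (LBINT t:gapU. f t)" using U summable_norm_cancel[OF sn] by (simp add: summable_sums)
 hence "(F has_sum (LBINT t:gapU. f t)) UNIV" by (rule norm_summable_imp_has_sum[OF sn])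
 hence "(F has_sum (LBINT t:gapU. f t)) (T ` gaps E)"
  by (subst (asm) has_sum_cong_neutral[of "T ` gaps E" UNIV F F]) (auto simp: F_def A0 set_lebesgue_integral_def)
 hence "((F \<circ> T) has_sum (LBINT t:gapU. f t)) (gaps E)" by (simp add: has_sum_reindex[OF inj])
 thus ?thesis
  by (subst (asm) has_sum_cong[of _ _ "%p. LBINT t:{fst p<..<snd p}. f t"]) (auto simp: F_def AT)
qed

text \<open>Vanishing off \<open>A\<close> is demanded at every point and not just almost
  everywhere, so that it survives pointwise limits. Increments of \<open>g\<close> are prescribed on
  \<open>I\<close> only; its values elsewhere are left free.\<close>

definition dens :: "real set => (real => real) => (real => real) => bool" where
 "dens A g q \<longleftrightarrow> L2r q & (ALL x. x ~: A --> q x = 0) & (ALL x:I. ALL y:I. x <= y --> g y - g x = pint q x y)"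

text \<open>Only the values on E matter. Among the functions agreeing on E, the one with density constant on every gap is linear
 there, so the gap part of the integral of a product of densities is the jump part of the form.\<close>
definition gconst :: "(real => real) => bool" where
 "gconst k \<longleftrightarrow> (ALL p:gaps E. ALL x y. fst p < x & x < snd p & fst p < y & y < snd p --> k x = k y)"

definition cdens :: "real set => (real => real) => (real => real) => bool" where
 "cdens A g k \<longleftrightarrow> dens A g k & gconst k"

lemma densD: "dens A g q ==> L2r q" "dens A g q ==> x ~: A ==> q x = 0"
  "dens A g q ==> x : I ==> y : I ==> x <= y ==> g y - g x = pint q x y"
 by (auto simp: dens_def)

lemma dens_Icc: "dens A g q ==> set_integrable lborel {x..y} q"
 by (rule L2r_Icc[OF densD(1)])

lemma dens_mono: "dens A g q ==> A <= A' ==> dens A' g q"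
 by (auto simp: dens_def)

lemma dens_add:
 assumes "dens A f p" "dens A g q" shows "dens A (%x. f x + g x) (%x. p x + q x)"
 unfolding dens_def
proof (intro conjI allI ballI impI)
 fix x y assume "x : I" "y : I" "x <= y"
 thus "f y + g y - (f x + g x) = pint (%x. p x + q x) x y"
  using densD(3)[OF assms(1), of x y] densD(3)[OF assms(2), of x y]
   set_integral_add(2)[OF dens_Icc[OF assms(1), of x y] dens_Icc[OF assms(2), of x y]] by simp
qed (use densD[OF assms(1)] densD[OF assms(2)] L2r_add in auto)

lemma dens_cmult:
 assumes "dens A f p" shows "dens A (%x. c * f x) (%x. c * p x)"
 unfolding dens_def
proof (intro conjI allI ballI impI)
 fix x y assume "x : I" "y : I" "x <= y"
 thus "c * f y - c * f x = pint (%x. c * p x) x y"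
  using densD(3)[OF assms, of x y] by (simp add: right_diff_distrib[symmetric])
qed (use densD[OF assms] L2r_cmult in auto)

lemma dens_diff:
 assumes "dens A f p" "dens A g q" shows "dens A (%x. f x - g x) (%x. p x - q x)"
 using dens_add[OF assms(1) dens_cmult[OF assms(2), of "-1"]] by simp

lemma dens_const_shift: "dens A f p ==> dens A (%x. f x + c) p"
 by (simp add: dens_def)

lemma gconst_add: "gconst p ==> gconst q ==> gconst (%x. p x + q x)"
 unfolding gconst_def by metis

lemma gconst_cmult: "gconst p ==> gconst (%x. c * p x)"
 unfolding gconst_def by metis

lemma cdens_add: "cdens A f p ==> cdens A g q ==> cdens A (%x. f x + g x) (%x. p x + q x)"
 by (simp add: cdens_def dens_add gconst_add)

lemma cdens_cmult: "cdens A f p ==> cdens A (%x. c * f x) (%x. c * p x)"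
 by (simp add: cdens_def dens_cmult gconst_cmult)

lemma cdens_diff: "cdens A f p ==> cdens A g q ==> cdens A (%x. f x - g x) (%x. p x - q x)"
 using cdens_add[of A f p "%x. (-1) * g x" "%x. (-1) * q x"] cdens_cmult[of A g q "-1"] by simp

lemma cdens_mono: "cdens A g q ==> A <= A' ==> cdens A' g q"
 by (auto simp: cdens_def intro: dens_mono)

lemma cdens_dens: "cdens A g q ==> dens A g q" and cdens_gconst: "cdens A g q ==> gconst q"
 by (auto simp: cdens_def)

lemma dens_zero: "dens A (%_. c) (%_. 0)"
 by (simp add: dens_def L2r_def set_lebesgue_integral_def)

lemma cdens_zero: "cdens A (%_. c) (%_. 0)"
 by (simp add: cdens_def dens_zero gconst_def)

text \<open>Cauchy-Schwarz with the measure of \<open>A\<close> in place of the length. Near an end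
  where \<open>A\<close> has finite measure it shows that densities close in L2 have uniformly close
  increments.\<close>

lemma dens_sq_bound:
 assumes d: "dens A g q" and A: "A : sets borel" and xy: "x : I" "y : I" "x <= y"
 shows "(g y - g x)^2 <= measure lborel (A Int {x..y}) * sqn lborel q"
proof -
 have "pint q x y = (LBINT t:A Int {x..y}. q t)"
  unfolding set_lebesgue_integral_def using densD(2)[OF d]
  by (intro Bochner_Integration.integral_cong) (auto simp: indicator_def)
 moreover have "emeasure lborel (A Int {x..y}) < \<infinity>"
  by (rule le_less_trans[OF emeasure_mono[of _ "{x..y}"]]) (auto simp: emeasure_lborel_Icc_eq)
 ultimately show ?thesis
  using L2r_set_CS[OF densD(1)[OF d], of "A Int {x..y}"] A densD(3)[OF d xy] by simp
qed

lemma dens_sq_bound':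
 assumes d: "dens A g q" and xy: "x : I" "y : I"
 shows "(g y - g x)^2 <= \<bar>y - x\<bar> * sqn lborel q"
proof -
 have *: "(g y - g x)^2 <= (y - x) * sqn lborel q" if "x : I" "y : I" "x <= y" for x y
  using dens_sq_bound[OF dens_mono[OF d subset_UNIV] _ that] that by simp
 show ?thesis
 proof (cases "x <= y")
  case False
  thus ?thesis using *[OF xy(2,1)] by (simp add: power2_commute)
 qed (use * xy in auto)
qed

lemma dens_continuous:
 assumes d: "dens A g q" shows "continuous_on I g"
 unfolding continuous_on_iff
proof (intro ballI allI impI)
 fix x e :: real assume x: "x : I" and e: "e > 0"
 define N where "N = sqn lborel q"
 have N: "N >= 0" by (simp add: N_def)
 show "EX dl>0. ALL y:I. dist y x < dl --> dist (g y) (g x) < e"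
 proof (intro exI conjI ballI impI)
  show "e^2 / (N + 1) > 0" using e N by simp
  fix y assume y: "y : I" "dist y x < e^2 / (N + 1)"
  have "(g y - g x)^2 <= \<bar>y - x\<bar> * N" unfolding N_def by (rule dens_sq_bound'[OF d x y(1)])
  also have "\<dots> <= \<bar>y - x\<bar> * (N + 1)" by (simp add: mult_left_mono)
  also have "\<dots> < e^2" using y N by (simp add: dist_real_def pos_less_divide_eq)
  finally have "\<bar>g y - g x\<bar>^2 < e^2" by simp
  thus "dist (g y) (g x) < e" using e power_less_imp_less_base[of "\<bar>g y - g x\<bar>" 2 e] by (simp add: dist_real_def)
 qed
qed

lemma dens_AE_deriv:
 assumes d: "dens A g q"
 shows "AE x in lborel. x : I --> (g has_real_derivative q x) (at x)"
proof -
 have h: "integrable lborel (%t. indicator {el n..er n} t * q t)" for n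
  using dens_Icc[OF d, of "el n" "er n"] by (simp add: set_integrable_def)
 have "AE x in lborel. ALL n. ALL G. (EX d>0. ALL y z. x - d < y & y <= z & z < x + d --> G z - G y = (LBINT t:{y..z}. indicator {el n..er n} t * q t))
   --> (G has_real_derivative indicator {el n..er n} x * q x) (at x)"
  unfolding AE_all_countable using lebesgue_differentiation[OF h] by blast
 thus ?thesis
  using AE_interior
 proof eventually_elim
  case (elim x)
  show ?case
  proof
   assume x: "x : I"
   then obtain n where n: "el n < x" "x < er n" using elim(2) el_less_interior by blast
   have "(g has_real_derivative indicator {el n..er n} x * q x) (at x)"
   proof (rule elim(1)[rule_format], intro exI[of _ "min (x - el n) (er n - x)"] conjI allI impI)
    show "0 < min (x - el n) (er n - x)" using n by simp
    fix y z assume "x - min (x - el n) (er n - x) < y & y <= z & z < x + min (x - el n) (er n - x)"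
    hence yz: "el n <= y" "y <= z" "z <= er n" by auto
    have "y : I" "z : I" using I_convex[OF el_I er_I, of n _ n] yz by auto
    hence "g z - g y = pint q y z" using densD(3)[OF d] yz by simp
    also have "\<dots> = (LBINT t:{y..z}. indicator {el n..er n} t * q t)"
     by (rule set_integral_cong') (use yz in \<open>auto simp: indicator_def\<close>)
    finally show "g z - g y = (LBINT t:{y..z}. indicator {el n..er n} t * q t)" .
   qed
   thus "(g has_real_derivative q x) (at x)" using n by simp
  qed
 qed
qed

definition J :: "real set" where "J = {x. lft E < ereal x & ereal x < rgt E}"

lemma J_open: "open J"
proof -
 have "J = ereal -` {lft E<..<rgt E}" by (auto simp: J_def)
 thus ?thesis by (simp add: open_ereal_vimage)
qed

lemma J_sub: "J <= I" by (auto simp: J_def Ival_def)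

lemma J_exh: "x : J ==> EX n. el n < x & x < er n"
 using el_less_interior by (auto simp: J_def)

lemma exh_J: assumes "el n < x" "x < er n" shows "x : J"
proof -
 have "lft E < ereal x" by (rule le_less_trans[OF lft_le[OF el_E[of n]]]) (use assms in simp)
 moreover have "ereal x < rgt E" by (rule less_le_trans[OF _ rgt_ge[OF er_E[of n]]]) (use assms in simp)
 ultimately show ?thesis by (simp add: J_def)
qed

lemma AE_J: "AE x in lborel. x : I \<longleftrightarrow> x : J"
 using AE_interior by eventually_elim (use J_sub in \<open>auto simp: J_def\<close>)

text \<open>The way to obtain densities after nonlinear operations: only increments have to be
  estimated. The bound makes \<open>Ph\<close> locally absolutely continuous, so it is the integral
  of its derivative, and comparing difference quotients with those of a primitive of
  \<open>m\<close> bounds this derivative almost everywhere.\<close>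

lemma dens_of_bound:
 assumes m: "L2r m" and m0: "!!x. 0 <= m x" and mA: "!!x. x ~: A ==> m x = 0"
  and b: "!!x y. x : I ==> y : I ==> x <= y ==> \<bar>Ph y - Ph x\<bar> <= pint m x y"
 obtains q where "dens A Ph q" "!!x. \<bar>q x\<bar> <= m x"
proof -
 have inI: "x : I" if "el n <= x" "x <= er n" for n x
  using I_convex[OF el_I er_I that] .
 have ac: "abs_cont_on {el n..er n} Ph" for n
 proof (rule abs_cont_on_of_bound[OF m])
  fix x y assume xy: "el n <= x" "x <= y" "y <= er n"
  thus "\<bar>Ph y - Ph x\<bar> <= pint m x y" using inI[of n x] inI[of n y] by (intro b) auto
 qed
 note acd = abs_cont_deriv[OF ac less_imp_le[OF el_er]]
 have contJ: "continuous_on J Ph"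
 proof (rule continuous_at_imp_continuous_on, rule ballI)
  fix x assume "x : J"
  then obtain n where n: "el n < x" "x < er n" using J_exh by blast
  have "continuous_on {el n<..<er n} Ph"
   by (rule continuous_on_subset[OF abs_cont_continuous[OF ac[of n]]]) auto
  thus "isCont Ph x" using n by (simp add: continuous_on_eq_continuous_at)
 qed
 define dq where "dq x = indicator J x * deriv Ph x" for x
 have [measurable]: "dq : borel_measurable borel" "m : borel_measurable borel"
  unfolding dq_def using borel_measurable_deriv_on[OF J_open contJ] L2r_meas[OF m] by auto
 \<comment> \<open>On the exceptional null set the derivative is replaced by 0, so that the bound by
   \<open>m\<close>, and with it the vanishing off \<open>A\<close>, holds at every point.\<close>
 define q where "q x = (if \<bar>dq x\<bar> <= m x then dq x else 0)" for x
 have qm: "\<bar>q x\<bar> <= m x" for x using m0[of x] by (auto simp: q_def)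
 have qL: "L2r q"
 proof (rule L2r_bound(1)[OF m])
  show "q : borel_measurable borel" unfolding q_def by measurable
  show "\<bar>q x\<bar> <= \<bar>m x\<bar>" for x using qm[of x] by linarith
 qed
 \<comment> \<open>A primitive of \<open>m\<close> based at \<open>el 0\<close>, with the sign
   according to the side of the base point.\<close>
 define M where "M y = (if el 0 <= y then pint m (el 0) y else - pint m y (el 0))" for y
 have Md: "M y - M x = pint m x y" if "x <= y" for x y
 proof -
  have i: "set_integrable lborel {a..b} m" for a b by (rule L2r_Icc[OF m])
  consider "el 0 <= x" | "x < el 0" "el 0 <= y" | "y < el 0" using that by linarith
  thus ?thesis
  proof cases
   case 1
   thus ?thesis using that pint_add[OF i, of "el 0" x y] by (simp add: M_def)
  next
   case 2
   thus ?thesis using that pint_add[OF i, of x "el 0" y] by (simp add: M_def)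
  next
   case 3
   thus ?thesis using that pint_add[OF i, of x y "el 0"] by (simp add: M_def)
  qed
 qed
 have "dens UNIV M m" unfolding dens_def using m Md by auto
 hence Mder: "AE x in lborel. x : I --> (M has_real_derivative m x) (at x)" by (rule dens_AE_deriv)
 have Phder: "AE x in lborel. x : J --> (Ph has_real_derivative deriv Ph x) (at x)"
 proof -
  have "AE x in lborel. ALL n. x : {el n<..<er n} --> (Ph has_real_derivative deriv Ph x) (at x)"
   unfolding AE_all_countable using acd(3) by blast
  thus ?thesis by eventually_elim (use J_exh in force)
 qed
 have bd: "AE x in lborel. x : J --> \<bar>deriv Ph x\<bar> <= m x"
  using Mder Phder
 proof eventually_elim
  case (elim x)
  show ?case
  proof
   assume x: "x : J"
   have D1: "((%y. \<bar>(Ph y - Ph x) / (y - x)\<bar>) \<longlongrightarrow> \<bar>deriv Ph x\<bar>) (at x)"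
    using elim(2) x by (intro tendsto_rabs) (simp add: has_field_derivative_iff)
   have D2: "((%y. (M y - M x) / (y - x)) \<longlongrightarrow> m x) (at x)"
    using elim(1) x J_sub by (auto simp: has_field_derivative_iff)
   have ev: "\<forall>\<^sub>F y in at x. \<bar>(Ph y - Ph x) / (y - x)\<bar> <= (M y - M x) / (y - x)"
    using eventually_at_in_open'[OF J_open x]
   proof eventually_elim
    case (elim y)
    hence y: "y : I" and xI: "x : I" using J_sub x by auto
    show ?case
    proof (cases "x <= y")
     case True
     hence "\<bar>Ph y - Ph x\<bar> <= M y - M x" using b[OF xI y] Md[of x y] by simp
     thus ?thesis using True by (simp add: abs_divide divide_right_mono)
    next
     case False
     hence "\<bar>Ph x - Ph y\<bar> <= M x - M y" using b[OF y xI] Md[of y x] by simp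
     hence "\<bar>Ph x - Ph y\<bar> / (x - y) <= (M x - M y) / (x - y)" using False by (simp add: divide_right_mono)
     moreover have "(M x - M y) / (x - y) = (M y - M x) / (y - x)"
      using minus_divide_divide[of "M y - M x" "y - x"] by simp
     moreover have "\<bar>Ph x - Ph y\<bar> / (x - y) = \<bar>(Ph y - Ph x) / (y - x)\<bar>"
      using False by (simp add: abs_divide abs_minus_commute)
     ultimately show ?thesis by simp
    qed
   qed
   show "\<bar>deriv Ph x\<bar> <= m x" by (rule tendsto_le[OF _ D2 D1 ev]) simp
  qed
 qed
 have "dens A Ph q"
  unfolding dens_def
 proof (intro conjI allI ballI impI qL)
  show "q x = 0" if "x ~: A" for x using qm[of x] mA[OF that] by simp
  fix x y assume xy: "x : I" "y : I" "x <= y"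
  obtain n where n: "el n <= x" "y <= er n" by (rule exh_I2[OF xy(1,2)])
  have "Ph y - Ph x = pint (deriv Ph) x y" using acd(2)[of n x y] n xy by simp
  also have "\<dots> = pint q x y"
   unfolding set_lebesgue_integral_def
  proof (rule integral_cong_AE)
   have "set_integrable lborel {x..y} (deriv Ph)" by (rule set_integrable_subset[OF acd(1)[of n]]) (use n in auto)
   thus "(%t. indicator {x..y} t *\<^sub>R deriv Ph t) : borel_measurable lborel" by (auto simp: set_integrable_def)
   show "(%t. indicator {x..y} t *\<^sub>R q t) : borel_measurable lborel" unfolding q_def by measurable
   show "AE t in lborel. indicator {x..y} t *\<^sub>R deriv Ph t = indicator {x..y} t *\<^sub>R q t"
    using bd AE_J
   proof eventually_elim
    case (elim t)
    have "t : I" if "t : {x..y}" using inI[of n t] that n by auto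
    thus ?case using elim by (auto simp: indicator_def q_def dq_def)
   qed
  qed
  finally show "Ph y - Ph x = pint q x y" .
 qed
 thus ?thesis using that qm by blast
qed

section \<open>Averaging a density over the gaps\<close>

definition gp :: "real => real \<times> real" where
 "gp x = (THE p. p : gaps E & fst p < x & x < snd p)"

definition slope :: "(real => real) => real \<times> real => real" where
 "slope g p = (g (snd p) - g (fst p)) / (snd p - fst p)"

text \<open>When \<open>q\<close> is a density of \<open>g\<close>, the slope over a gap is the mean
  of \<open>q\<close> there. So this is the orthogonal projection in L2 onto the functions that are
  constant on each gap.\<close>

definition Pk :: "(real => real) => (real => real) => real => real" where
 "Pk g q x = (if x : gapU then slope g (gp x) else q x)"

lemma gp_eq: "p : gaps E ==> fst p < x ==> x < snd p ==> gp x = p"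
 unfolding gp_def by (rule the_equality) (auto intro: gap_unique)

lemma Pk_gap: "p : gaps E ==> fst p < x ==> x < snd p ==> Pk g q x = slope g p"
 by (auto simp: Pk_def gp_eq gapU_def)

lemma Pk_measurable:
 assumes [measurable]: "q : borel_measurable borel" shows "Pk g q : borel_measurable borel"
proof (rule measurable_piecewise_restrict[where C="insert (- gapU) ((%p. {fst p<..<snd p}) ` gaps E)"])
 show "countable (insert (- gapU) ((%p. {fst p<..<snd p}) ` gaps E))" using countable_gaps by simp
 show "c Int space borel : sets borel" if "c : insert (- gapU) ((%p. {fst p<..<snd p}) ` gaps E)" for c
  using that gapU_borel by (auto intro: borel_comp)
 show "space borel <= \<Union> (insert (- gapU) ((%p. {fst p<..<snd p}) ` gaps E))" by (auto simp: gapU_def)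
 fix c assume "c : insert (- gapU) ((%p. {fst p<..<snd p}) ` gaps E)"
 then consider "c = - gapU" | p where "p : gaps E" "c = {fst p<..<snd p}" by blast
 thus "Pk g q : borel_measurable (restrict_space borel c)"
 proof cases
  case 1
  have "Pk g q : borel_measurable (restrict_space borel c) \<longleftrightarrow> q : borel_measurable (restrict_space borel c)"
   by (rule measurable_cong) (simp add: space_restrict_space 1 Pk_def)
  thus ?thesis by (simp add: measurable_restrict_space1)
 next
  case 2
  have "Pk g q : borel_measurable (restrict_space borel c) \<longleftrightarrow> (%_. slope g p) : borel_measurable (restrict_space borel c)"
   by (rule measurable_cong) (use 2 in \<open>simp add: space_restrict_space Pk_gap\<close>)
  thus ?thesis by simp
 qed
qed

lemma gap_integral:
 assumes d: "dens A g q" and p: "p : gaps E"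
 shows "(LBINT t:{fst p<..<snd p}. q t) = g (snd p) - g (fst p)"
 using densD(3)[OF d E_sub_I E_sub_I, of "fst p" "snd p"] gapsD[OF p] pint_Ioo[OF L2r_meas[OF densD(1)[OF d]]]
 by simp

lemma Pk_gap_integral:
 assumes p: "p : gaps E"
 shows "(LBINT t:{fst p<..<snd p}. Pk g q t) = g (snd p) - g (fst p)"
proof -
 have "(LBINT t:{fst p<..<snd p}. Pk g q t) = (LBINT t:{fst p<..<snd p}. slope g p)"
  by (rule set_integral_cong') (use p in \<open>simp add: Pk_gap\<close>)
 thus ?thesis using gapsD[OF p] by (simp add: set_integral_const slope_def)
qed

text \<open>Jensen's inequality on each gap, in the form of Cauchy-Schwarz, summed over all gaps.
  The comparison is made between measures with values in \<open>ennreal\<close>, because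
  integrability of the averaged square is itself part of the conclusion.\<close>

lemma Pk_L2:
 assumes d: "dens A g q"
 shows "L2r (Pk g q)" "sqn lborel (Pk g q) <= sqn lborel q"
proof -
 have qL: "L2r q" by (rule densD(1)[OF d])
 have qm[measurable]: "q : borel_measurable borel" by (rule L2r_meas[OF qL])
 have Pm[measurable]: "Pk g q : borel_measurable borel" by (rule Pk_measurable[OF qm])
 define N1 where "N1 = density lborel (%t. ennreal ((Pk g q t)^2))"
 define N2 where "N2 = density lborel (%t. ennreal ((q t)^2))"
 have N1: "emeasure N1 B = (\<integral>\<^sup>+t. ennreal ((Pk g q t)^2) * indicator B t \<partial>lborel)" if "B : sets borel" for B
  unfolding N1_def using that by (subst emeasure_density) auto
 have N2: "emeasure N2 B = (\<integral>\<^sup>+t. ennreal ((q t)^2) * indicator B t \<partial>lborel)" if "B : sets borel" for B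
  unfolding N2_def using that by (subst emeasure_density) auto
 have s: "sets N1 = sets borel" "sets N2 = sets borel" by (simp_all add: N1_def N2_def)
 have gap: "emeasure N1 {fst p<..<snd p} <= emeasure N2 {fst p<..<snd p}" if p: "p : gaps E" for p
 proof -
  define a b c where "a = fst p" and "b = snd p" and "c = slope g p"
  have ab: "a < b" using gapsD[OF p] by (simp add: a_def b_def)
  have Li: "L2r (%t. indicator {a<..<b} t * q t)" by (rule L2r_indicator[OF qL]) simp
  have "emeasure N1 {a<..<b} = (\<integral>\<^sup>+t. ennreal (c^2) * indicator {a<..<b} t \<partial>lborel)"
   unfolding N1[of "{a<..<b}", simplified]
   by (rule nn_integral_cong) (use p in \<open>auto simp: indicator_def Pk_gap a_def b_def c_def\<close>)
  also have "\<dots> = ennreal (c^2 * (b - a))" using ab by (simp add: nn_integral_cmult ennreal_mult)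
  also have "\<dots> <= ennreal (\<integral>t. (indicator {a<..<b} t * q t)^2 \<partial>lborel)"
  proof (rule ennreal_leI)
   have "c * (b - a) = (LBINT t:{a<..<b}. q t)" using gap_integral[OF d p] ab by (simp add: a_def b_def c_def slope_def)
   also have "\<dots> = (LBINT t:{a<..<b}. indicator {a<..<b} t * q t)" by (rule set_integral_cong') simp
   finally have "(c * (b - a))^2 <= measure lborel {a<..<b} * (\<integral>t. (indicator {a<..<b} t * q t)^2 \<partial>lborel)"
    using L2r_set_CS[OF Li, of "{a<..<b}"] ab by simp
   hence A: "(c^2 * (b - a)) * (b - a) <= (\<integral>t. (indicator {a<..<b} t * q t)^2 \<partial>lborel) * (b - a)"
    using ab by (simp add: power2_eq_square mult_ac)
   show "c^2 * (b - a) <= (\<integral>t. (indicator {a<..<b} t * q t)^2 \<partial>lborel)"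
    by (rule mult_right_le_imp_le[OF A]) (use ab in simp)
  qed
  also have "\<dots> = (\<integral>\<^sup>+t. ennreal ((indicator {a<..<b} t * q t)^2) \<partial>lborel)"
   by (rule nn_integral_eq_integral[symmetric, OF L2r_sq[OF Li]]) simp
  also have "\<dots> = emeasure N2 {a<..<b}"
   unfolding N2[of "{a<..<b}", simplified] by (rule nn_integral_cong) (auto simp: indicator_def)
  finally show ?thesis by (simp add: a_def b_def)
 qed
 have "emeasure N1 gapU <= emeasure N2 gapU"
 proof -
  have "emeasure N1 gapU = (\<integral>\<^sup>+p. emeasure N1 {fst p<..<snd p} \<partial>count_space (gaps E))"
   unfolding gapU_def by (rule emeasure_UN_countable[OF _ countable_gaps gaps_disjoint]) (simp add: s)
  also have "\<dots> <= (\<integral>\<^sup>+p. emeasure N2 {fst p<..<snd p} \<partial>count_space (gaps E))"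
   by (rule nn_integral_mono) (use gap in simp)
  also have "\<dots> = emeasure N2 gapU"
   unfolding gapU_def by (rule emeasure_UN_countable[symmetric, OF _ countable_gaps gaps_disjoint]) (simp add: s)
  finally show ?thesis .
 qed
 moreover have "emeasure N1 (- gapU) = emeasure N2 (- gapU)"
  unfolding N1[OF borel_comp[OF gapU_borel]] N2[OF borel_comp[OF gapU_borel]]
  by (rule nn_integral_cong) (simp add: Pk_def indicator_def)
 moreover have "emeasure N1 gapU + emeasure N1 (- gapU) = emeasure N1 UNIV"
  using plus_emeasure[of gapU N1 "- gapU"] gapU_borel by (simp add: s borel_comp)
 moreover have "emeasure N2 gapU + emeasure N2 (- gapU) = emeasure N2 UNIV"
  using plus_emeasure[of gapU N2 "- gapU"] gapU_borel by (simp add: s borel_comp)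
 ultimately have "emeasure N1 UNIV <= emeasure N2 UNIV" by (metis add_right_mono)
 hence le: "(\<integral>\<^sup>+t. ennreal ((Pk g q t)^2) \<partial>lborel) <= (\<integral>\<^sup>+t. ennreal ((q t)^2) \<partial>lborel)"
  using N1[of UNIV] N2[of UNIV] by simp
 have q2: "(\<integral>\<^sup>+t. ennreal ((q t)^2) \<partial>lborel) = ennreal (sqn lborel q)"
  by (rule nn_integral_eq_integral[OF L2r_sq[OF qL]]) simp
 have int: "integrable lborel (%t. (Pk g q t)^2)"
 proof (rule integrableI_bounded)
  show "(\<integral>\<^sup>+t. ennreal (norm ((Pk g q t)^2)) \<partial>lborel) < \<infinity>" using le_less_trans[OF le] q2 by simp
 qed measurable
 thus "L2r (Pk g q)" using Pm by (simp add: L2r_def)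
 have "ennreal (sqn lborel (Pk g q)) <= ennreal (sqn lborel q)"
  using le unfolding q2 by (subst nn_integral_eq_integral[symmetric, OF int]) auto
 thus "sqn lborel (Pk g q) <= sqn lborel q" by simp
qed

lemma split_gapU:
 fixes f :: "real => real"
 assumes "integrable lborel f"
 shows "(\<integral>t. f t \<partial>lborel) = (LBINT t:- gapU. f t) + (LBINT t:gapU. f t)"
proof -
 have si: "set_integrable lborel A f" if "A : sets borel" for A
  unfolding set_integrable_def by (rule integrable_mult_indicator) (use that assms in auto)
 have "(LBINT t:- gapU Un gapU. f t) = (LBINT t:- gapU. f t) + (LBINT t:gapU. f t)"
  by (rule set_integral_Un) (auto intro!: si borel_comp gapU_borel)
 thus ?thesis by (simp add: set_lebesgue_integral_def Compl_partition2)
qed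

text \<open>With both end points in \<open>E\<close> every gap is either contained in
  \<open>{x..y}\<close> or disjoint from it, and averaging preserves the integral over a whole
  gap.\<close>

lemma Pk_pint:
 assumes d: "dens A g q" and xy: "x : E" "y : E" "x <= y"
 shows "pint (Pk g q) x y = pint q x y"
proof -
 define f1 f2 where "f1 t = indicator {x..y} t * Pk g q t" and "f2 t = indicator {x..y} t * q t" for t
 have i1: "integrable lborel f1" and i2: "integrable lborel f2"
  using L2r_Icc[OF Pk_L2(1)[OF d], of x y] L2r_Icc[OF densD(1)[OF d], of x y]
  by (simp_all add: set_integrable_def f1_def[abs_def] f2_def[abs_def])
 have si: "set_integrable lborel gapU f1" "set_integrable lborel gapU f2"
  unfolding set_integrable_def using i1 i2 gapU_borel by (auto intro!: integrable_mult_indicator simp del: real_scaleR_def)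
 have eq: "(LBINT t:{fst p<..<snd p}. f1 t) = (LBINT t:{fst p<..<snd p}. f2 t)" if p: "p : gaps E" for p
 proof -
  have gp: "x <= fst p | snd p <= x" "y <= fst p | snd p <= y" using gapsD[OF p] xy by auto
  show ?thesis
  proof (cases "x <= fst p & snd p <= y")
   case True
   have "(LBINT t:{fst p<..<snd p}. f1 t) = (LBINT t:{fst p<..<snd p}. Pk g q t)"
    by (rule set_integral_cong') (use True in \<open>auto simp: f1_def\<close>)
   moreover have "(LBINT t:{fst p<..<snd p}. f2 t) = (LBINT t:{fst p<..<snd p}. q t)"
    by (rule set_integral_cong') (use True in \<open>auto simp: f2_def\<close>)
   ultimately show ?thesis using gap_integral[OF d p] Pk_gap_integral[OF p] by simp
  next
   case False
   show ?thesis by (rule set_integral_cong') (use False gp xy in \<open>auto simp: f1_def f2_def indicator_def\<close>)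
  qed
 qed
 have "((%p. LBINT t:{fst p<..<snd p}. f1 t) has_sum (LBINT t:gapU. f1 t)) (gaps E)" by (rule has_sum_gaps[OF si(1)])
 moreover have "((%p. LBINT t:{fst p<..<snd p}. f1 t) has_sum (LBINT t:gapU. f1 t)) (gaps E)
  \<longleftrightarrow> ((%p. LBINT t:{fst p<..<snd p}. f2 t) has_sum (LBINT t:gapU. f1 t)) (gaps E)"
  by (rule has_sum_cong) (rule eq)
 ultimately have "((%p. LBINT t:{fst p<..<snd p}. f2 t) has_sum (LBINT t:gapU. f1 t)) (gaps E)"
  by (simp only:)
 hence "(LBINT t:gapU. f1 t) = (LBINT t:gapU. f2 t)" using has_sum_gaps[OF si(2)] by (rule has_sum_unique)
 moreover have "(LBINT t:- gapU. f1 t) = (LBINT t:- gapU. f2 t)"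
  by (rule set_integral_cong') (simp add: f1_def f2_def Pk_def)
 ultimately have "(\<integral>t. f1 t \<partial>lborel) = (\<integral>t. f2 t \<partial>lborel)" using split_gapU[OF i1] split_gapU[OF i2] by simp
 thus ?thesis by (simp add: set_lebesgue_integral_def f1_def f2_def)
qed

lemma dens_of_L2:
 assumes k: "L2r k" and "!!x. x ~: A ==> k x = 0"
 shows "dens A (%y. c + (if x0 <= y then pint k x0 y else - pint k y x0)) k"
 unfolding dens_def
proof (intro conjI allI ballI impI)
 fix x y assume xy: "x : I" "y : I" "x <= y"
 have i: "set_integrable lborel {a..b} k" for a b by (rule L2r_Icc[OF k])
 consider "x0 <= x" | "x < x0" "x0 <= y" | "y < x0" by linarith
 thus "c + (if x0 <= y then pint k x0 y else - pint k y x0) - (c + (if x0 <= x then pint k x0 x else - pint k x x0)) = pint k x y"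
 proof cases
  case 1
  thus ?thesis using xy pint_add[OF i, of x0 x y] by simp
 next
  case 2
  thus ?thesis using xy pint_add[OF i, of x x0 y] by simp
 next
  case 3
  thus ?thesis using xy pint_add[OF i, of x y x0] by simp
 qed
qed (use assms in auto)

text \<open>Averaging changes \<open>g\<close> inside the gaps but not on \<open>E\<close>. An
  average may be nonzero on an entire gap; the hypothesis \<open>gapU <= A\<close> is what keeps the
  new density zero off \<open>A\<close>.\<close>

lemma canonical:
 assumes d: "dens A g q" and A: "gapU <= A"
 obtains g' where "cdens A g' (Pk g q)" "!!x. x : E ==> g' x = g x"
proof -
 define g' where "g' y = g (el 0) + (if el 0 <= y then pint (Pk g q) (el 0) y else - pint (Pk g q) y (el 0))" for y
 have "dens A g' (Pk g q)"
  unfolding g'_def[abs_def]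
 proof (rule dens_of_L2[OF Pk_L2(1)[OF d]])
  show "Pk g q x = 0" if "x ~: A" for x using that A densD(2)[OF d that] by (auto simp: Pk_def)
 qed
 moreover have "gconst (Pk g q)" unfolding gconst_def by (auto simp: Pk_gap)
 moreover have "g' x = g x" if x: "x : E" for x
 proof (cases "el 0 <= x")
  case True
  thus ?thesis
   using Pk_pint[OF d el_E x] densD(3)[OF d el_I E_sub_I[OF x], of 0] by (simp add: g'_def)
 next
  case False
  thus ?thesis
   using Pk_pint[OF d x el_E, of 0] densD(3)[OF d E_sub_I[OF x] el_I, of 0] by (simp add: g'_def)
 qed
 ultimately show ?thesis using that by (simp add: cdens_def)
qed

lemma cdens_slope:
 assumes d: "cdens A g k" and p: "p : gaps E" and x: "fst p < x" "x < snd p"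
 shows "k x = slope g p"
proof -
 have "(LBINT t:{fst p<..<snd p}. k t) = (LBINT t:{fst p<..<snd p}. k x)"
 proof (rule set_integral_cong')
  fix t assume "t : {fst p<..<snd p}"
  thus "k t = k x" using cdens_gconst[OF d, unfolded gconst_def, rule_format, OF p, of t x] x by simp
 qed
 also have "\<dots> = k x * (snd p - fst p)" using gapsD[OF p] by (simp add: set_integral_const)
 finally show ?thesis using gap_integral[OF cdens_dens[OF d] p] gapsD[OF p] by (simp add: slope_def)
qed

lemma cdens_gap_linear:
 assumes d: "cdens A g k" and p: "p : gaps E" and x: "fst p <= x" "x <= snd p"
 shows "g x = g (fst p) + slope g p * (x - fst p)"
proof -
 have I: "fst p : I" "x : I" using gap_sub_I[OF p] x gapsD[OF p] by auto
 have "g x - g (fst p) = (LBINT t:{fst p<..<x}. k t)"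
  using densD(3)[OF cdens_dens[OF d] I x(1)] pint_Ioo[OF L2r_meas[OF densD(1)[OF cdens_dens[OF d]]]] by simp
 also have "\<dots> = (LBINT t:{fst p<..<x}. slope g p)"
  by (rule set_integral_cong') (use cdens_slope[OF d p] x in auto)
 also have "\<dots> = slope g p * (x - fst p)" using x by (simp add: set_integral_const)
 finally show ?thesis by simp
qed

lemma cdens_eq_I:
 assumes d: "cdens A g k" "cdens A' g' k'" and eq: "!!x. x : E ==> g x = g' x" and x: "x : I"
 shows "g x = g' x"
proof (cases "x : E")
 case False
 obtain p where p: "p : gaps E" "fst p < x" "x < snd p" by (rule gap_ex[OF x False])
 have "slope g p = slope g' p" using gapsD[OF p(1)] eq by (simp add: slope_def)
 thus ?thesis using cdens_gap_linear[OF d(1) p(1), of x] cdens_gap_linear[OF d(2) p(1), of x] p gapsD[OF p(1)] eq by simp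
qed (use eq in simp)

text \<open>Agreement on \<open>E\<close> extends to \<open>I\<close> by linearity on gaps, so
  almost everywhere on \<open>I\<close> both densities are the derivative of the same function;
  outside \<open>I\<close> both vanish. The two sets \<open>A\<close> and \<open>A'\<close> may
  differ, which makes energies comparable across domains.\<close>

lemma cdens_unique:
 assumes d: "cdens A g k" "cdens A' g' k'" and A: "A <= I" "A' <= I" and eq: "!!x. x : E ==> g x = g' x"
 shows "AE x in lborel. k x = k' x"
 using dens_AE_deriv[OF cdens_dens[OF d(1)]] dens_AE_deriv[OF cdens_dens[OF d(2)]] AE_J
proof eventually_elim
 case (elim x)
 show ?case
 proof (cases "x : I")
  case False
  hence "x ~: A" "x ~: A'" using A by blast+
  thus ?thesis using densD(2)[OF cdens_dens[OF d(1)], of x] densD(2)[OF cdens_dens[OF d(2)], of x] by simp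
 next
  case True
  hence J: "x : J" using elim by simp
  have "(g has_real_derivative k' x) (at x)"
  proof (rule has_field_derivative_transform_within_open[OF _ J_open J])
   show "(g' has_real_derivative k' x) (at x)" using elim True by simp
   show "g' y = g y" if "y : J" for y using cdens_eq_I[OF d eq, of y] J_sub that by auto
  qed
  thus ?thesis using elim True DERIV_unique by blast
 qed
qed

end

section \<open>The form attached to a set\<close>

locale qd_space = classK E for E :: "real set" +
 fixes mu :: "real measure"
 assumes space_mu: "space mu = E" and sets_mu: "sets mu = sets (restrict_space borel E)"
  and rad: "radon_on E mu" and fsupp: "full_support E mu"
begin

lemma measurable_cont_E: "continuous_on E g ==> g : borel_measurable mu"
 using borel_measurable_continuous_on_restrict[of E g] measurable_cong_sets[OF sets_mu refl] by blast

lemma sets_mu_Int: "B : sets borel ==> E Int B : sets mu"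
 unfolding sets_mu by (subst sets_restrict_space) auto

lemma sets_muE: "S : sets mu ==> EX B:sets borel. S = E Int B"
 unfolding sets_mu by (subst (asm) sets_restrict_space) auto

definition Kn :: "nat => real set" where "Kn n = E Int {el n..er n}"

lemma Kn_compact: "compact (Kn n)" unfolding Kn_def by (rule compact_E_Icc[OF el_E er_E])
lemma Kn_sub: "Kn n <= E" by (simp add: Kn_def)
lemma Kn_sets[measurable]: "Kn n : sets mu" unfolding Kn_def by (rule sets_mu_Int) simp
lemma Kn_finite: "emeasure mu (Kn n) < \<infinity>"
 using rad Kn_compact Kn_sub unfolding radon_on_def by blast

lemma Kn_mono:
 assumes "n <= m" shows "Kn n <= Kn m"
 using el_antimono[OF assms] er_mono[OF assms] by (auto simp: Kn_def)

lemma Kn_UN: "(\<Union>n. Kn n) = E" using E_UN by (simp add: Kn_def)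

lemma Kn_ev: assumes "x : E" shows "\<forall>\<^sub>F n in sequentially. x : Kn n"
proof -
 obtain N where "ALL n>=N. el n <= x & x <= er n" using exh_I[OF E_sub_I[OF assms]] by blast
 thus ?thesis unfolding eventually_sequentially Kn_def using assms by auto
qed

lemma Kn_pos: "EX N. ALL n>=N. 0 < measure mu (Kn n)"
proof -
 have "0 < emeasure mu (UNIV Int E)"
  using fsupp E_nonempty unfolding full_support_def by (metis Int_UNIV_left open_UNIV)
 hence pos: "0 < emeasure mu (\<Union>n. Kn n)" by (simp add: Kn_UN)
 have "EX N. emeasure mu (Kn N) ~= 0"
 proof (rule ccontr)
  assume "~ ?thesis"
  hence "Kn n : null_sets mu" for n using Kn_sets by (intro null_setsI) auto
  hence "(\<Union>n. Kn n) : null_sets mu" by (rule null_sets_UN)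
  thus False using pos by auto
 qed
 then obtain N where N: "emeasure mu (Kn N) ~= 0" by blast
 have "0 < measure mu (Kn n)" if "n >= N" for n
 proof -
  have "emeasure mu (Kn N) <= emeasure mu (Kn n)" by (rule emeasure_mono[OF Kn_mono[OF that] Kn_sets])
  hence "emeasure mu (Kn n) ~= 0" using N by auto
  thus ?thesis using Kn_finite[of n] unfolding measure_def
   by (simp add: enn2real_positive_iff zero_less_iff_neq_zero)
 qed
 thus ?thesis by blast
qed

text \<open>Full support at work: the set where two continuous functions differ is relatively open
  in \<open>E\<close>, so it is empty or has positive measure.\<close>

lemma cont_AE_eq:
 assumes g: "continuous_on E g" and h: "continuous_on E h" and ae: "AE x in mu. g x = h x" and x: "x : E"
 shows "g x = (h x :: real)"
proof (rule ccontr)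
 assume ne: "g x ~= h x"
 have "continuous_on E (%x. g x - h x)" using g h by (rule continuous_on_diff)
 hence "openin (top_of_set E) (E Int (%x. g x - h x) -` (- {0}))"
  by (rule continuous_openin_preimage_gen) auto
 then obtain U where U: "open U" "E Int (%x. g x - h x) -` (- {0}) = E Int U" by (auto simp: openin_open)
 have "x : U" using U(2) ne x by auto
 hence pos: "0 < emeasure mu (U Int E)" using fsupp U(1) x unfolding full_support_def by blast
 have "AE y in mu. y ~: E Int U"
  using ae by eventually_elim (use U(2) in auto)
 hence "E Int U : null_sets mu"
  using AE_iff_null_sets[OF sets_mu_Int[OF borel_open[OF U(1)]]] by simp
 thus False using pos by (auto simp: Int_commute)
qed

lemma dens_cont_E: "dens A g q ==> continuous_on E g"
 by (rule continuous_on_subset[OF dens_continuous]) (auto intro: E_sub_I)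

text \<open>Point evaluation is bounded in the form norm. The modulus of continuity of order 1/2
  compares \<open>g x0\<close> with \<open>g x\<close> for \<open>x\<close> in a compact window of
  positive finite \<open>mu\<close> measure; averaging over that window gives a constant independent
  of \<open>A\<close>, \<open>g\<close> and \<open>k\<close>.\<close>

lemma dens_trace:
 assumes x0: "x0 : I"
 obtains C where "C > 0" "!!A g k. dens A g k ==> integrable mu (%x. (g x)^2) ==>
  (g x0)^2 <= C * (sqn lborel k + sqn mu g)"
proof -
 obtain N where N: "ALL n>=N. el n <= x0 & x0 <= er n" using exh_I[OF x0] by blast
 obtain M where M: "ALL n>=M. 0 < measure mu (Kn n)" using Kn_pos by blast
 define n where "n = max N M"
 have n: "el n <= x0" "x0 <= er n" "0 < measure mu (Kn n)" using N M by (auto simp: n_def)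
 define m L where "m = measure mu (Kn n)" and "L = er n - el n"
 have mL: "m > 0" "L > 0" using n el_er by (auto simp: m_def L_def)
 have "(g x0)^2 <= (2 * L + 2 / m) * (sqn lborel k + sqn mu g)"
  if d: "dens A g k" and i: "integrable mu (%x. (g x)^2)" for A g k
 proof -
  define a b where "a = sqn lborel k" and "b = sqn mu g"
  have ab: "a >= 0" "b >= 0" by (simp_all add: a_def b_def)
  have pt: "(g x0)^2 <= 2 * (g x)^2 + 2 * (L * a)" if x: "x : Kn n" for x
  proof -
   have xI: "x : I" using x Kn_sub E_sub_I by blast
   have "(g x0 - g x)^2 <= \<bar>x0 - x\<bar> * a" unfolding a_def by (rule dens_sq_bound'[OF d xI x0])
   also have "\<dots> <= L * a" using x n ab by (intro mult_right_mono) (auto simp: Kn_def L_def)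
   finally have 1: "(g x0 - g x)^2 <= L * a" .
   have "(g x0)^2 <= 2 * (g x)^2 + 2 * (g x0 - g x)^2"
    using zero_le_power2[of "g x0 - 2 * g x"] by (simp add: power2_eq_square algebra_simps)
   thus ?thesis using 1 by linarith
  qed
  have iK: "integrable mu (indicator (Kn n) :: real => real)" by (rule integrable_real_indicator[OF Kn_sets Kn_finite])
  have "m * (g x0)^2 = (\<integral>x. (g x0)^2 * indicator (Kn n) x \<partial>mu)" by (simp add: m_def space_mu Int_absorb2[OF Kn_sub])
  also have "\<dots> <= (\<integral>x. 2 * (g x)^2 + 2 * (L * a) * indicator (Kn n) x \<partial>mu)"
  proof (rule integral_mono)
   show "integrable mu (%x. (g x0)^2 * indicator (Kn n) x)" using iK by simp
   show "integrable mu (%x. 2 * (g x)^2 + 2 * (L * a) * indicator (Kn n) x)" using iK i by simp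
   show "(g x0)^2 * indicator (Kn n) x <= 2 * (g x)^2 + 2 * (L * a) * indicator (Kn n) x" for x
    using pt[of x] by (cases "x : Kn n") auto
  qed
  also have "\<dots> = 2 * b + 2 * (L * a) * m"
   using i iK by (simp add: b_def m_def)
  finally have "(g x0)^2 <= (2 * b + 2 * (L * a) * m) / m" using mL by (simp add: pos_le_divide_eq mult.commute)
  also have "\<dots> = 2 / m * b + 2 * L * a" using mL by (simp add: field_simps)
  also have "\<dots> <= 2 / m * b + 2 * L * a + (2 * L * b + 2 / m * a)" using mL ab by simp
  also have "\<dots> = (2 * L + 2 / m) * (a + b)" by (simp only: ring_distribs add_ac)
  finally show ?thesis by (simp add: a_def b_def)
 qed
 moreover have "2 * L + 2 / m > 0" using mL by (simp add: add_pos_pos)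
 ultimately show ?thesis using that by blast
qed

text \<open>LB and RB are the boundary conditions, expressed through limits along E only; finL A says that the scale with
 speed 1 on A has a finite limit at a left endpoint outside E.\<close>
definition LB :: "(real => real) => bool" where
 "LB g \<longleftrightarrow> (ALL e>0. EX x0:E. ALL x:E. x <= x0 --> \<bar>g x\<bar> < e)"
definition RB :: "(real => real) => bool" where
 "RB g \<longleftrightarrow> (ALL e>0. EX x0:E. ALL x:E. x0 <= x --> \<bar>g x\<bar> < e)"
definition finL :: "real set => bool" where
 "finL A \<longleftrightarrow> Lopen & (EX x:E. emeasure lborel (A Int {..x}) < \<infinity>)"
definition finR :: "real set => bool" where
 "finR A \<longleftrightarrow> Ropen & (EX x:E. emeasure lborel (A Int {x..}) < \<infinity>)"
definition bd :: "real set => (real => real) => bool" where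
 "bd A g \<longleftrightarrow> (finL A --> LB g) & (finR A --> RB g)"

definition dom :: "real set => (real => real) set" where
 "dom A = {f : L2 mu. EX g k. cdens A g k & (AE x in mu. f x = g x) & bd A g}"

text \<open>The choice refers to \<open>I\<close> and not to a smaller \<open>A\<close>, so
  \<open>form\<close> does not mention \<open>A\<close> and the forms on different domains are
  literally restrictions of one function. Where a density exists it is unique almost everywhere by
  \<open>cdens_unique\<close>.\<close>

definition den :: "(real => real) => real => real" where
 "den f = (SOME k. EX g. cdens I g k & (AE x in mu. f x = g x))"

definition form :: "(real => real) => (real => real) => real" where
 "form f h = 1/2 * (\<integral>t. den f t * den h t \<partial>lborel)"

lemma LB_dom: "LB g ==> (!!x. x : E ==> \<bar>h x\<bar> <= \<bar>g x\<bar>) ==> LB h"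
 unfolding LB_def by (meson le_less_trans)
lemma RB_dom: "RB g ==> (!!x. x : E ==> \<bar>h x\<bar> <= \<bar>g x\<bar>) ==> RB h"
 unfolding RB_def by (meson le_less_trans)

lemma bd_dom: "bd A g ==> (!!x. x : E ==> \<bar>h x\<bar> <= \<bar>g x\<bar>) ==> bd A h"
 unfolding bd_def using LB_dom[of g h] RB_dom[of g h] by blast

lemma LB_add: assumes "LB g" "LB h" shows "LB (%x. g x + h x)"
 unfolding LB_def
proof (intro allI impI)
 fix e :: real assume "e > 0"
 hence e2: "e/2 > 0" by simp
 obtain x0 where x0: "x0 : E" "ALL x:E. x <= x0 --> \<bar>g x\<bar> < e/2" using assms(1) e2 unfolding LB_def by blast
 obtain x1 where x1: "x1 : E" "ALL x:E. x <= x1 --> \<bar>h x\<bar> < e/2" using assms(2) e2 unfolding LB_def by blast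
 show "EX x0:E. ALL x:E. x <= x0 --> \<bar>g x + h x\<bar> < e"
 proof (rule bexI[of _ "min x0 x1"], intro ballI impI)
  fix x assume "x : E" "x <= min x0 x1"
  hence "\<bar>g x\<bar> < e/2" "\<bar>h x\<bar> < e/2" using x0 x1 by auto
  thus "\<bar>g x + h x\<bar> < e" by linarith
 qed (use x0 x1 in \<open>auto simp: min_def\<close>)
qed

lemma RB_add: assumes "RB g" "RB h" shows "RB (%x. g x + h x)"
 unfolding RB_def
proof (intro allI impI)
 fix e :: real assume "e > 0"
 hence e2: "e/2 > 0" by simp
 obtain x0 where x0: "x0 : E" "ALL x:E. x0 <= x --> \<bar>g x\<bar> < e/2" using assms(1) e2 unfolding RB_def by blast
 obtain x1 where x1: "x1 : E" "ALL x:E. x1 <= x --> \<bar>h x\<bar> < e/2" using assms(2) e2 unfolding RB_def by blast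
 show "EX x0:E. ALL x:E. x0 <= x --> \<bar>g x + h x\<bar> < e"
 proof (rule bexI[of _ "max x0 x1"], intro ballI impI)
  fix x assume "x : E" "max x0 x1 <= x"
  hence "\<bar>g x\<bar> < e/2" "\<bar>h x\<bar> < e/2" using x0 x1 by auto
  thus "\<bar>g x + h x\<bar> < e" by linarith
 qed (use x0 x1 in \<open>auto simp: max_def\<close>)
qed

lemma bd_add: "bd A g ==> bd A h ==> bd A (%x. g x + h x)"
 unfolding bd_def using LB_add[of g h] RB_add[of g h] by blast

lemma LB_cmult: assumes "LB g" shows "LB (%x. c * g x)"
 unfolding LB_def
proof (intro allI impI)
 fix e :: real assume e: "e > 0"
 hence e2: "e / (\<bar>c\<bar> + 1) > 0" by simp
 obtain x0 where x0: "x0 : E" "ALL x:E. x <= x0 --> \<bar>g x\<bar> < e / (\<bar>c\<bar> + 1)" using assms e2 unfolding LB_def by blast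
 have "\<bar>c * g x\<bar> < e" if "x : E" "x <= x0" for x
 proof -
  have "\<bar>g x\<bar> * (\<bar>c\<bar> + 1) < e" using x0(2) that by (simp add: pos_less_divide_eq)
  moreover have "\<bar>c * g x\<bar> <= \<bar>g x\<bar> * (\<bar>c\<bar> + 1)" by (simp add: abs_mult algebra_simps)
  ultimately show ?thesis by linarith
 qed
 thus "EX x0:E. ALL x:E. x <= x0 --> \<bar>c * g x\<bar> < e" using x0(1) by blast
qed

lemma RB_cmult: assumes "RB g" shows "RB (%x. c * g x)"
 unfolding RB_def
proof (intro allI impI)
 fix e :: real assume e: "e > 0"
 hence e2: "e / (\<bar>c\<bar> + 1) > 0" by simp
 obtain x0 where x0: "x0 : E" "ALL x:E. x0 <= x --> \<bar>g x\<bar> < e / (\<bar>c\<bar> + 1)" using assms e2 unfolding RB_def by blast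
 have "\<bar>c * g x\<bar> < e" if "x : E" "x0 <= x" for x
 proof -
  have "\<bar>g x\<bar> * (\<bar>c\<bar> + 1) < e" using x0(2) that by (simp add: pos_less_divide_eq)
  moreover have "\<bar>c * g x\<bar> <= \<bar>g x\<bar> * (\<bar>c\<bar> + 1)" by (simp add: abs_mult algebra_simps)
  ultimately show ?thesis by linarith
 qed
 thus "EX x0:E. ALL x:E. x0 <= x --> \<bar>c * g x\<bar> < e" using x0(1) by blast
qed

lemma bd_cmult: "bd A g ==> bd A (%x. c * g x)"
 unfolding bd_def using LB_cmult[of g c] RB_cmult[of g c] by blast

lemma LB_zero: "LB (%_. 0)" and RB_zero: "RB (%_. 0)"
 using E_nonempty by (auto simp: LB_def RB_def)

lemma bd_zero: "bd A (%_. 0)"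
 using LB_zero RB_zero by (simp add: bd_def)

lemma L2_I: "f : borel_measurable mu ==> integrable mu (%x. (f x)^2) ==> f : L2 mu"
 and L2_meas: "f : L2 mu ==> f : borel_measurable mu"
 and L2_int: "f : L2 mu ==> integrable mu (%x. (f x)^2)"
 by (auto simp: L2_def)

lemma L2_AE:
 assumes f: "f : L2 mu" and g: "g : borel_measurable mu" and ae: "AE x in mu. f x = g x"
 shows "g : L2 mu" "sqn mu g = sqn mu f"
proof -
 have [measurable]: "f : borel_measurable mu" "g : borel_measurable mu" using f g by (auto simp: L2_def)
 have ae2: "AE x in mu. (f x)^2 = (g x)^2" using ae by eventually_elim simp
 have "integrable mu (%x. (g x)^2)"
  by (rule integrable_cong_AE_imp[OF L2_int[OF f] _ ae2]) measurable
 thus "g : L2 mu" using g by (simp add: L2_def)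
 show "sqn mu g = sqn mu f"
  by (rule integral_cong_AE) (use ae2 in \<open>auto elim: eventually_mono\<close>)
qed

lemma L2_add: "f : L2 mu ==> g : L2 mu ==> (%x. f x + g x) : L2 mu"
 and L2_diff: "f : L2 mu ==> g : L2 mu ==> (%x. f x - g x) : L2 mu"
 and L2_cmult: "f : L2 mu ==> (%x. c * f x) : L2 mu"
 unfolding L2_def by (auto intro!: integrable_square_add simp: power_mult_distrib)

lemma L2_bound:
 assumes f: "f : L2 mu" and g: "g : borel_measurable mu" and ae: "AE x in mu. \<bar>g x\<bar> <= \<bar>f x\<bar>"
 shows "g : L2 mu"
proof -
 have "integrable mu (%x. (g x)^2)"
 proof (rule Bochner_Integration.integrable_bound[OF L2_int[OF f]])
  show "(%x. (g x)^2) : borel_measurable mu" using g by measurable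
  show "AE x in mu. norm ((g x)^2) <= norm ((f x)^2)"
   using ae by eventually_elim (simp add: abs_le_square_iff)
 qed
 thus ?thesis using g by (simp add: L2_def)
qed

lemma domI: "f : L2 mu ==> cdens A g k ==> AE x in mu. f x = g x ==> bd A g ==> f : dom A"
 unfolding dom_def by blast

lemma domE:
 assumes "f : dom A"
 obtains g k where "cdens A g k" "AE x in mu. f x = g x" "bd A g" "g : L2 mu"
proof -
 obtain g k where g: "cdens A g k" "AE x in mu. f x = g x" "bd A g" and f: "f : L2 mu"
  using assms unfolding dom_def by blast
 have "g : L2 mu" using L2_AE(1)[OF f _ g(2)] measurable_cont_E[OF dens_cont_E[OF cdens_dens[OF g(1)]]] by blast
 thus ?thesis using that g by blast
qed

lemma dom_L2: "f : dom A ==> f : L2 mu" by (simp add: dom_def)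

lemma den_eq:
 assumes A: "A <= I" and d: "cdens A g k" and ae: "AE x in mu. f x = g x"
 shows "AE x in lborel. den f x = k x" "L2r (den f)"
proof -
 have ex: "EX k. EX g. cdens I g k & (AE x in mu. f x = g x)" using cdens_mono[OF d A] ae by blast
 hence "EX g. cdens I g (den f) & (AE x in mu. f x = g x)" unfolding den_def by (rule someI_ex)
 then obtain g' where g': "cdens I g' (den f)" "AE x in mu. f x = g' x" by blast
 have ae': "AE x in mu. g' x = g x" using ae g'(2) by eventually_elim simp
 have "g' x = g x" if "x : E" for x
  by (rule cont_AE_eq[OF dens_cont_E[OF cdens_dens[OF g'(1)]] dens_cont_E[OF cdens_dens[OF d]] ae' that])
 thus "AE x in lborel. den f x = k x" by (intro cdens_unique[OF g'(1) d subset_refl A])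
 show "L2r (den f)" using g'(1) densD(1) cdens_dens by blast
qed

lemma form_eq:
 assumes A: "A <= I" "B <= I" and d: "cdens A g k" "cdens B g' k'"
  and ae: "AE x in mu. f x = g x" "AE x in mu. h x = g' x"
 shows "form f h = 1/2 * (\<integral>t. k t * k' t \<partial>lborel)"
proof -
 have [measurable]: "den f : borel_measurable borel" "den h : borel_measurable borel"
  "k : borel_measurable borel" "k' : borel_measurable borel"
  using den_eq(2)[OF A(1) d(1) ae(1)] den_eq(2)[OF A(2) d(2) ae(2)] d L2r_meas densD(1) cdens_dens by blast+
 have "(\<integral>t. den f t * den h t \<partial>lborel) = (\<integral>t. k t * k' t \<partial>lborel)"
 proof (rule integral_cong_AE)
  show "AE t in lborel. den f t * den h t = k t * k' t"
   using den_eq(1)[OF A(1) d(1) ae(1)] den_eq(1)[OF A(2) d(2) ae(2)] by eventually_elim simp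
 qed measurable
 thus ?thesis by (simp add: form_def)
qed

lemma form_sq_eq:
 assumes A: "A <= I" and d: "cdens A g k" and ae: "AE x in mu. f x = g x"
 shows "form f f = 1/2 * sqn lborel k"
 using form_eq[OF A A d d ae ae] by (simp add: power2_eq_square)

section \<open>Algebra of the domains and of the form\<close>

lemma dom_zero: "(%_. 0) : dom A"
 by (rule domI[OF _ cdens_zero _ bd_zero]) (auto simp: L2_def)

lemma dom_add:
 assumes "f : dom A" "g : dom A" shows "(%x. f x + g x) : dom A"
proof -
 obtain u k where u: "cdens A u k" "AE x in mu. f x = u x" "bd A u" by (rule domE[OF assms(1)])
 obtain v l where v: "cdens A v l" "AE x in mu. g x = v x" "bd A v" by (rule domE[OF assms(2)])
 have "AE x in mu. f x + g x = u x + v x" using u(2) v(2) by eventually_elim simp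
 thus ?thesis
  by (rule domI[OF L2_add[OF dom_L2[OF assms(1)] dom_L2[OF assms(2)]] cdens_add[OF u(1) v(1)] _ bd_add[OF u(3) v(3)]])
qed

lemma dom_cmult:
 assumes "f : dom A" shows "(%x. c * f x) : dom A"
proof -
 obtain u k where u: "cdens A u k" "AE x in mu. f x = u x" "bd A u" by (rule domE[OF assms(1)])
 have "AE x in mu. c * f x = c * u x" using u(2) by eventually_elim simp
 thus ?thesis
  by (rule domI[OF L2_cmult[OF dom_L2[OF assms(1)]] cdens_cmult[OF u(1)] _ bd_cmult[OF u(3)]])
qed

lemma dom_diff:
 assumes "f : dom A" "g : dom A" shows "(%x. f x - g x) : dom A"
 using dom_add[OF assms(1) dom_cmult[OF assms(2), of "-1"]] by simp

lemma form_add: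
 assumes A: "A <= I" and f: "f : dom A" and g: "g : dom A" and h: "h : dom A"
 shows "form (%x. f x + g x) h = form f h + form g h"
proof -
 obtain u k where u: "cdens A u k" "AE x in mu. f x = u x" by (rule domE[OF f])
 obtain v l where v: "cdens A v l" "AE x in mu. g x = v x" by (rule domE[OF g])
 obtain w m where w: "cdens A w m" "AE x in mu. h x = w x" by (rule domE[OF h])
 have ae: "AE x in mu. f x + g x = u x + v x" using u(2) v(2) by eventually_elim simp
 have L: "L2r k" "L2r l" "L2r m" using u(1) v(1) w(1) densD(1) cdens_dens by blast+
 have "form (%x. f x + g x) h = 1/2 * (\<integral>t. (k t + l t) * m t \<partial>lborel)"
  by (rule form_eq[OF A A cdens_add[OF u(1) v(1)] w(1) ae w(2)])
 also have "(\<integral>t. (k t + l t) * m t \<partial>lborel) = (\<integral>t. k t * m t \<partial>lborel) + (\<integral>t. l t * m t \<partial>lborel)"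
  using L2r_mult[OF L(1) L(3)] L2r_mult[OF L(2) L(3)] by (simp add: distrib_right)
 finally show ?thesis
  using form_eq[OF A A u(1) w(1) u(2) w(2)] form_eq[OF A A v(1) w(1) v(2) w(2)] by simp
qed

lemma form_cmult:
 assumes A: "A <= I" and f: "f : dom A" and h: "h : dom A"
 shows "form (%x. c * f x) h = c * form f h"
proof -
 obtain u k where u: "cdens A u k" "AE x in mu. f x = u x" by (rule domE[OF f])
 obtain w m where w: "cdens A w m" "AE x in mu. h x = w x" by (rule domE[OF h])
 have ae: "AE x in mu. c * f x = c * u x" using u(2) by eventually_elim simp
 have "form (%x. c * f x) h = 1/2 * (\<integral>t. (c * k t) * m t \<partial>lborel)"
  by (rule form_eq[OF A A cdens_cmult[OF u(1)] w(1) ae w(2)])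
 also have "(\<integral>t. (c * k t) * m t \<partial>lborel) = c * (\<integral>t. k t * m t \<partial>lborel)" by (simp add: mult.assoc)
 finally show ?thesis unfolding form_eq[OF A A u(1) w(1) u(2) w(2)] by simp
qed

lemma form_sym: "form f g = form g f"
 by (simp add: form_def mult.commute)

lemma form_nonneg: "0 <= form f f"
 by (simp add: form_def)

lemma form_diff:
 assumes "A <= I" "f : dom A" "g : dom A" "h : dom A"
 shows "form (%x. f x - g x) h = form f h - form g h"
 using form_add[OF assms(1,2) dom_cmult[OF assms(3), of "-1"] assms(4)] form_cmult[OF assms(1,3,4), of "-1"] by simp

text \<open>Averaging over gaps only lowers the L2 norm, so any density bounds the energy. This is
  what applies after a nonlinear operation, which in general destroys linearity on gaps.\<close>

lemma form_le_dens:
 assumes A: "gapU <= A" "A <= I" and f: "f : L2 mu" and d: "dens A g q" and ae: "AE x in mu. f x = g x" and b: "bd A g"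
 shows "f : dom A" "form f f <= 1/2 * sqn lborel q"
proof -
 obtain g' where g': "cdens A g' (Pk g q)" "!!x. x : E ==> g' x = g x" using canonical[OF d A(1)] by blast
 have ae': "AE x in mu. f x = g' x"
  using ae AE_space by eventually_elim (simp add: space_mu g'(2))
 have "bd A g'" by (rule bd_dom[OF b]) (simp add: g'(2))
 thus "f : dom A" by (rule domI[OF f g'(1) ae'])
 show "form f f <= 1/2 * sqn lborel q"
  using form_sq_eq[OF A(2) g'(1) ae'] Pk_L2(2)[OF d] by simp
qed

lemma dens_abs_bound:
 assumes d: "dens A g q" and xy: "x : I" "y : I" "x <= y"
 shows "\<bar>g y - g x\<bar> <= pint (%t. \<bar>q t\<bar>) x y"
 unfolding densD(3)[OF d xy] set_lebesgue_integral_def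
 using integral_norm_bound[of lborel "%t. indicator {x..y} t *\<^sub>R q t"] by (simp add: abs_mult)

text \<open>The bound by \<open>|q x|\<close> holds at every point, so \<open>q\<close> can serve as
  a dominating function for whole sequences of contractions.\<close>

lemma dens_contraction:
 assumes d: "dens A g q" and T: "!!s t. \<bar>T s - T t\<bar> <= \<bar>s - t\<bar>"
 obtains p where "dens A (%x. T (g x)) p" "!!x. \<bar>p x\<bar> <= \<bar>q x\<bar>"
proof (rule dens_of_bound[of "%t. \<bar>q t\<bar>" A "%x. T (g x)"])
 show "L2r (%t. \<bar>q t\<bar>)" by (rule L2r_bound(1)[OF densD(1)[OF d]]) (use L2r_meas[OF densD(1)[OF d]] in auto)
 show "\<bar>q x\<bar> = 0" if "x ~: A" for x using densD(2)[OF d that] by simp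
 show "\<bar>T (g y) - T (g x)\<bar> <= pint (%t. \<bar>q t\<bar>) x y" if "x : I" "y : I" "x <= y" for x y
  using T[of "g y" "g x"] dens_abs_bound[OF d that] by linarith
qed (use that in auto)

lemma L2r_int_mono: "L2r m ==> L2r p ==> (!!x. \<bar>p x\<bar> <= \<bar>m x\<bar>) ==> sqn lborel p <= sqn lborel m"
 by (rule L2r_bound(2)) (auto intro: L2r_meas)

lemma dom_contraction:
 assumes A: "gapU <= A" "A <= I" and f: "f : dom A"
  and T: "!!s t. \<bar>T s - T t\<bar> <= \<bar>s - t\<bar>" "T 0 = 0"
 shows "(%x. T (f x)) : dom A" "form (%x. T (f x)) (%x. T (f x)) <= form f f"
proof -
 obtain g k where g: "cdens A g k" "AE x in mu. f x = g x" "bd A g" "g : L2 mu" by (rule domE[OF f])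
 have T0: "\<bar>T s\<bar> <= \<bar>s\<bar>" for s using T(1)[of s 0] T(2) by simp
 have "continuous_on UNIV T"
  unfolding continuous_on_iff dist_real_def using T(1) le_less_trans by blast
 hence Tm[measurable]: "T : borel_measurable borel" by (rule borel_measurable_continuous_onI)
 have fm[measurable]: "f : borel_measurable mu" by (rule L2_meas[OF dom_L2[OF f]])
 obtain p where p: "dens A (%x. T (g x)) p" "!!x. \<bar>p x\<bar> <= \<bar>k x\<bar>" using dens_contraction[where T=T, OF cdens_dens[OF g(1)] T(1)] by blast
 have L: "(%x. T (f x)) : L2 mu" by (rule L2_bound[OF dom_L2[OF f]]) (auto simp: T0)
 have ae: "AE x in mu. T (f x) = T (g x)" using g(2) by eventually_elim simp
 have b: "bd A (%x. T (g x))" by (rule bd_dom[OF g(3) T0])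
 note * = form_le_dens[OF A L p(1) ae b]
 show "(%x. T (f x)) : dom A" by (rule *)
 have "sqn lborel p <= sqn lborel k"
  by (rule L2r_int_mono[of k p, OF densD(1)[OF cdens_dens[OF g(1)]] densD(1)[OF p(1)] p(2)])
 thus "form (%x. T (f x)) (%x. T (f x)) <= form f f"
  using *(2) form_sq_eq[OF A(2) g(1,2)] by simp
qed

lemma form_quad:
 assumes A: "A <= I" and f: "f : dom A" and g: "g : dom A"
 shows "form (%x. f x + g x) (%x. f x + g x) = form f f + 2 * form f g + form g g"
 using form_add[OF A f g dom_add[OF f g]] form_add[OF A f g f] form_add[OF A f g g]
  form_sym[of f "%x. f x + g x"] form_sym[of g "%x. f x + g x"] form_sym[of g f] by simp

lemma form_quad_diff:
 assumes A: "A <= I" and f: "f : dom A" and g: "g : dom A"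
 shows "form (%x. f x - g x) (%x. f x - g x) = form f f - 2 * form f g + form g g"
 using form_diff[OF A f g dom_diff[OF f g]] form_diff[OF A f g f] form_diff[OF A f g g]
  form_sym[of f "%x. f x - g x"] form_sym[of g "%x. f x - g x"] form_sym[of g f] by simp

abbreviation E1d where "E1d f g == E1 mu form (%x. f x - g x)"

lemma E1_nonneg: "0 <= E1 mu form f"
 unfolding E1_def by (intro add_nonneg_nonneg form_nonneg) simp

text \<open>\<open>E1\<close> is the square of a norm, hence the factors 2; they come from
  nonnegativity of the form and of the L2 integral on the difference of the two summands.\<close>

lemma E1_triangle:
 assumes A: "A <= I" and f: "f : dom A" and g: "g : dom A" and h: "h : dom A"
 shows "E1d f h <= 2 * E1d f g + 2 * E1d g h"
proof -
 define a b where "a x = f x - g x" and "b x = g x - h x" for x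
 have ab: "a : dom A" "b : dom A" using dom_diff[OF f g] dom_diff[OF g h] by (simp_all add: a_def[abs_def] b_def[abs_def])
 have eq: "(%x. f x - h x) = (%x. a x + b x)" by (auto simp: a_def b_def)
 have 1: "form (%x. a x + b x) (%x. a x + b x) <= 2 * form a a + 2 * form b b"
  using form_quad[OF A ab] form_quad_diff[OF A ab] form_nonneg[of "%x. a x - b x"] by linarith
 have ia: "integrable mu (%x. (a x)^2)" "integrable mu (%x. (b x)^2)" using ab L2_int dom_L2 by blast+
 have "(\<integral>x. (a x + b x)^2 \<partial>mu) <= (\<integral>x. 2 * (a x)^2 + 2 * (b x)^2 \<partial>mu)"
 proof (rule integral_mono)
  show "integrable mu (%x. (a x + b x)^2)" using L2_int[OF dom_L2[OF dom_add[OF ab]]] .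
  show "integrable mu (%x. 2 * (a x)^2 + 2 * (b x)^2)" using ia by simp
  show "(a x + b x)^2 <= 2 * (a x)^2 + 2 * (b x)^2" for x
   using zero_le_power2[of "a x - b x"] by (simp add: power2_eq_square algebra_simps)
 qed
 also have "\<dots> = 2 * sqn mu a + 2 * sqn mu b" using ia by simp
 finally show ?thesis using 1 unfolding eq E1_def a_def[symmetric] b_def[symmetric] by (simp add: algebra_simps)
qed

lemma E1_rep:
 assumes A: "A <= I" and d: "cdens A g k" and ae: "AE x in mu. f x = g x" and f: "f : L2 mu"
 shows "E1 mu form f = 1/2 * sqn lborel k + sqn mu g"
 using form_sq_eq[OF A d ae] L2_AE(2)[OF f measurable_cont_E[OF dens_cont_E[OF cdens_dens[OF d]]] ae]
 by (simp add: E1_def)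

lemma lim_zero_seq: "(!!j. X j = 0) ==> lim X = (0::real)"
 by (metis (no_types, lifting) ext limI tendsto_const)

text \<open>Densities and functions converge separately in their L2 spaces. The link is evaluation
  at one point: it fixes the constant of integration, so that the primitive of the limit density is
  also the limit in L2 of \<open>mu\<close>. Boundary values survive because convergence is uniform
  near an end where \<open>A\<close> has finite measure.\<close>

lemma dom_closed:
 assumes A: "A : sets borel" "A <= I" and u: "!!n. u n : dom A"
  and cau: "!!e. e > 0 ==> EX N. ALL m>=N. ALL n>=N. E1d (u n) (u m) < e"
 shows "EX f:dom A. (%n. E1d (u n) f) ----> 0"
proof -
 have "ALL n. EX p. cdens A (fst p) (snd p) & (AE x in mu. u n x = fst p x) & bd A (fst p) & fst p : L2 mu"
 proof
  fix n
  obtain g k where "cdens A g k" "AE x in mu. u n x = g x" "bd A g" "g : L2 mu" by (rule domE[OF u])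
  thus "EX p. cdens A (fst p) (snd p) & (AE x in mu. u n x = fst p x) & bd A (fst p) & fst p : L2 mu"
   by (intro exI[of _ "(g, k)"]) simp
 qed
 then obtain p where p: "!!n. cdens A (fst (p n)) (snd (p n)) & (AE x in mu. u n x = fst (p n) x) & bd A (fst (p n)) & fst (p n) : L2 mu"
  by (rule choice[elim_format]) blast
 define g k where "g n = fst (p n)" and "k n = snd (p n)" for n
 have g: "cdens A (g n) (k n)" "AE x in mu. u n x = g n x" "bd A (g n)" "g n : L2 mu" for n
  using p[of n] by (simp_all add: g_def k_def)
 have gd: "dens A (g n) (k n)" for n by (rule cdens_dens[OF g(1)])
 have kL: "L2r (k n)" for n by (rule densD(1)[OF gd])
 have E1d: "E1d (u n) (u m) = 1/2 * sqd lborel (k n) (k m) + sqd mu (g n) (g m)" for n m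
 proof (rule E1_rep[OF A(2) cdens_diff[OF g(1) g(1)]])
  show "AE x in mu. u n x - u m x = g n x - g m x" using g(2)[of n] g(2)[of m] by eventually_elim simp
  show "(%x. u n x - u m x) : L2 mu" by (rule dom_L2[OF dom_diff[OF u u]])
 qed
 have pos: "0 <= sqd lborel (k n) (k m)" "0 <= sqd mu (g n) (g m)" for n m by simp_all
 have cauk: "EX N. ALL m>=N. ALL n>=N. sqd lborel (k n) (k m) < e" if e: "e > 0" for e
 proof -
  obtain N where N: "ALL m>=N. ALL n>=N. E1d (u n) (u m) < e/2" using cau[of "e/2"] e by auto
  have "sqd lborel (k n) (k m) < e" if "m >= N" "n >= N" for n m
   using N[rule_format, OF that] E1d[of n m] pos[of n m] by linarith
  thus ?thesis by blast
 qed
 have caug: "EX N. ALL m>=N. ALL n>=N. sqd mu (g n) (g m) < e" if e: "e > 0" for e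
 proof -
  obtain N where N: "ALL m>=N. ALL n>=N. E1d (u n) (u m) < e" using cau[OF e] by auto
  have "sqd mu (g n) (g m) < e" if "m >= N" "n >= N" for n m
   using N[rule_format, OF that] E1d[of n m] pos[of n m] by linarith
  thus ?thesis by blast
 qed
 obtain r where r: "strict_mono r" "(%x. lim (%j. k (r j) x)) : borel_measurable lborel"
  "integrable lborel (%x. (lim (%j. k (r j) x))^2)"
  "(%n. \<integral>x. (k n x - lim (%j. k (r j) x))^2 \<partial>lborel) ----> 0"
  by (rule L2_complete[of k lborel]) (use kL cauk in \<open>auto simp: L2r_def\<close>)
 define kk where "kk x = lim (%j. k (r j) x)" for x
 have kkL: "L2r kk" using r by (simp add: L2r_def kk_def[abs_def])
 \<comment> \<open>The explicit limit supplied by \<open>L2_complete\<close> is used here: vanishing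
   off \<open>A\<close> and constancy on gaps pass to \<open>kk\<close> at every point.\<close>
 have kkA: "kk x = 0" if "x ~: A" for x
  unfolding kk_def by (rule lim_zero_seq) (rule densD(2)[OF gd that])
 have kkc: "gconst kk"
  unfolding gconst_def
 proof (intro ballI allI impI)
  fix q x y assume q: "q : gaps E" and xy: "fst q < x & x < snd q & fst q < y & y < snd q"
  have "k j x = k j y" for j using cdens_gconst[OF g(1)[of j], unfolded gconst_def, rule_format, OF q xy] .
  thus "kk x = kk y" by (simp add: kk_def)
 qed
 have klim: "(%n. sqd lborel (k n) kk) ----> 0" using r(4) by (simp add: kk_def)
 obtain s where s: "strict_mono s" "(%x. lim (%j. g (s j) x)) : borel_measurable mu"
  "AE x in mu. (%j. g (s j) x) ----> lim (%j. g (s j) x)"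
  "integrable mu (%x. (lim (%j. g (s j) x))^2)"
  "(%n. \<integral>x. (g n x - lim (%j. g (s j) x))^2 \<partial>mu) ----> 0"
  by (rule L2_complete[of g mu]) (use g(4) caug in \<open>auto simp: L2_def\<close>)
 \<comment> \<open>Convergence of the densities determines the limit up to a constant; the values at
   this point supply the constant.\<close>
 define x0 where "x0 = el 0"
 have x0: "x0 : I" unfolding x0_def by (rule el_I)
 obtain C where C: "C > 0" "!!A g k. dens A g k ==> integrable mu (%x. (g x)^2) ==>
  (g x0)^2 <= C * (sqn lborel k + sqn mu g)" using dens_trace[OF x0] by blast
 have "Cauchy (%n. g n x0)"
 proof (rule CauchyI)
  fix e :: real assume e: "e > 0"
  have e': "e^2 / (2 * C) > 0" using e C by simp
  obtain N where N: "ALL m>=N. ALL n>=N. E1d (u n) (u m) < e^2 / (2 * C)" using cau[OF e'] by blast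
  show "EX M. ALL m>=M. ALL n>=M. norm (g m x0 - g n x0) < e"
  proof (intro exI allI impI)
   fix m n assume mn: "N <= m" "N <= n"
   have "(g m x0 - g n x0)^2 <= C * (sqd lborel (k m) (k n) + sqd mu (g m) (g n))"
    by (rule C(2)[OF dens_diff[OF gd gd] L2_int[OF L2_diff[OF g(4) g(4)]]])
   also have "\<dots> <= C * (2 * E1d (u m) (u n))"
    using C(1) E1d[of m n] pos[of m n] by (intro mult_left_mono) auto
   also have "\<dots> < C * (2 * (e^2 / (2 * C)))" using C(1) N mn by (intro mult_strict_left_mono) auto
   also have "\<dots> = e^2" using C(1) by simp
   finally have "\<bar>g m x0 - g n x0\<bar>^2 < e^2" by simp
   thus "norm (g m x0 - g n x0) < e" using e power_less_imp_less_base[of "\<bar>g m x0 - g n x0\<bar>" 2 e] by simp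
  qed
 qed
 then obtain c where c: "(%n. g n x0) ----> c" by (auto simp: Cauchy_convergent_iff convergent_def)
 define G where "G y = c + (if x0 <= y then pint kk x0 y else - pint kk y x0)" for y
 have Gd: "dens A G kk" unfolding G_def[abs_def] by (rule dens_of_L2[OF kkL kkA])
 have Gc: "cdens A G kk" using Gd kkc by (simp add: cdens_def)
 have Gx0: "G x0 = c"
 proof -
  have "G x0 - G x0 = pint kk x0 x0" using densD(3)[OF Gd x0 x0] by simp
  thus ?thesis by (simp add: G_def)
 qed
 have dif: "dens A (%x. g n x - G x) (%x. k n x - kk x)" for n by (rule dens_diff[OF gd Gd])
 have x0lim: "(%n. g n x0 - G x0) ----> 0" using tendsto_diff[OF c tendsto_const[of c]] Gx0 by simp
 have glim: "(%n. g n x) ----> G x" if x: "x : I" for x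
 proof -
  have "(%n. ((g n x - G x) - (g n x0 - G x0))^2) ----> 0"
  proof (rule tendsto_sandwich[OF _ _ tendsto_const])
   show "(%n. \<bar>x - x0\<bar> * sqd lborel (k n) kk) ----> 0"
    using tendsto_mult[OF tendsto_const[of "\<bar>x - x0\<bar>"] klim] by simp
   show "\<forall>\<^sub>F n in sequentially. ((g n x - G x) - (g n x0 - G x0))^2 <= \<bar>x - x0\<bar> * sqd lborel (k n) kk"
    using dens_sq_bound'[OF dif x0 x] by (intro always_eventually allI)
  qed simp
  hence "(%n. \<bar>(g n x - G x) - (g n x0 - G x0)\<bar>) ----> 0"
   using tendsto_real_sqrt[of _ 0] by fastforce
  hence "(%n. (g n x - G x) - (g n x0 - G x0)) ----> 0" by (rule tendsto_rabs_zero_cancel)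
  hence "(%n. ((g n x - G x) - (g n x0 - G x0)) + (g n x0 - G x0)) ----> 0 + 0" using x0lim by (rule tendsto_add)
  thus ?thesis by (simp add: LIM_zero_iff)
 qed
 have AEG: "AE x in mu. lim (%j. g (s j) x) = G x"
  using AE_space
 proof eventually_elim
  case (elim x)
  hence "(%n. g n x) ----> G x" using glim E_sub_I by (simp add: space_mu)
  hence "(%j. g (s j) x) ----> G x" using s(1) LIMSEQ_subseq_LIMSEQ[of "%n. g n x" "G x" s] by (simp add: o_def)
  thus ?case by (rule limI)
 qed
 have Gm: "G : borel_measurable mu" by (rule measurable_cont_E[OF dens_cont_E[OF Gd]])
 have GL2: "G : L2 mu"
  by (rule L2_AE(1)[OF _ Gm AEG]) (use s in \<open>auto simp: L2_def\<close>)
 have Gint: "(%n. sqd mu (g n) G) ----> 0"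
 proof -
  have [measurable]: "g n : borel_measurable mu" for n using g(4) by (rule L2_meas)
  note [measurable] = s(2) Gm
  have "(\<integral>x. (g n x - lim (%j. g (s j) x))^2 \<partial>mu) = sqd mu (g n) G" for n
  proof (rule integral_cong_AE)
   show "AE x in mu. (g n x - lim (%j. g (s j) x))^2 = (g n x - G x)^2" using AEG by eventually_elim simp
  qed measurable
  thus ?thesis using s(5) by simp
 qed
 \<comment> \<open>On a half-line where \<open>A\<close> has finite measure, convergence at the base
   point \<open>X\<close> and of the densities yields uniform closeness.\<close>
 have small: "EX n. ALL x:E. x : S --> \<bar>g n x - G x\<bar> < e"
  if e: "e > 0" and X: "X : E" and fin: "emeasure lborel (A Int S) < \<infinity>" "S : sets borel"
   and S: "!!x. x : S ==> x : E ==> {min x X..max x X} <= S" for e X S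
 proof -
  define m where "m = measure lborel (A Int S)"
  have l1: "(%n. g n X - G X) ----> 0" using glim[OF E_sub_I[OF X]] by (simp add: LIM_zero_iff)
  have l2: "(%n. m * sqd lborel (k n) kk) ----> 0" using tendsto_mult[OF tendsto_const[of m] klim] by simp
  have "\<forall>\<^sub>F n in sequentially. \<bar>g n X - G X\<bar> < e/2 & m * sqd lborel (k n) kk < (e/2)^2"
  proof (rule eventually_conj)
   show "\<forall>\<^sub>F n in sequentially. \<bar>g n X - G X\<bar> < e/2"
    using order_tendstoD(2)[OF tendsto_rabs_zero[OF l1], of "e/2"] e by simp
   show "\<forall>\<^sub>F n in sequentially. m * sqd lborel (k n) kk < (e/2)^2"
    by (rule order_tendstoD(2)[OF l2]) (use e in simp)
  qed
  then obtain n where n: "\<bar>g n X - G X\<bar> < e/2" "m * sqd lborel (k n) kk < (e/2)^2"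
   unfolding eventually_sequentially by blast
  have "\<bar>g n x - G x\<bar> < e" if x: "x : E" "x : S" for x
  proof -
   define a b where "a = min x X" and "b = max x X"
   have ab: "a : I" "b : I" "a <= b" using x X E_sub_I by (auto simp: a_def b_def min_def max_def)
   have "((g n b - G b) - (g n a - G a))^2 <= measure lborel (A Int {a..b}) * sqd lborel (k n) kk"
    by (rule dens_sq_bound[OF dif A(1) ab])
   also have "\<dots> <= m * sqd lborel (k n) kk"
   proof (rule mult_right_mono)
    show "measure lborel (A Int {a..b}) <= m"
     unfolding m_def using S[OF x(2,1)] fin A(1) by (intro measure_mono_fmeasurable) (auto simp: fmeasurable_def a_def b_def)
   qed simp
   also have "\<dots> < (e/2)^2" by (rule n)
   finally have "\<bar>(g n b - G b) - (g n a - G a)\<bar>^2 < (e/2)^2" by simp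
   hence "\<bar>(g n b - G b) - (g n a - G a)\<bar> < e/2" by (rule power_less_imp_less_base) (use e in simp)
   hence "\<bar>(g n x - G x) - (g n X - G X)\<bar> < e/2"
    by (cases "x <= X") (simp_all add: a_def b_def abs_minus_commute)
   thus ?thesis using n(1) by linarith
  qed
  thus ?thesis by blast
 qed
 have "bd A G"
  unfolding bd_def
 proof (intro conjI impI)
  assume fl: "finL A"
  then obtain X where X: "X : E" "emeasure lborel (A Int {..X}) < \<infinity>" by (auto simp: finL_def)
  show "LB G"
   unfolding LB_def
  proof (intro allI impI)
   fix e :: real assume e: "e > 0"
   hence e2: "e/2 > 0" by simp
   obtain n where n: "ALL x:E. x : {..X} --> \<bar>g n x - G x\<bar> < e/2"
    using small[OF e2 X(1), of "{..X}"] X(2) by auto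
   have "LB (g n)" using g(3)[of n] fl by (simp add: bd_def)
   then obtain x1 where x1: "x1 : E" "ALL x:E. x <= x1 --> \<bar>g n x\<bar> < e/2" using e2 unfolding LB_def by blast
   show "EX x0:E. ALL x:E. x <= x0 --> \<bar>G x\<bar> < e"
   proof (rule bexI[of _ "min X x1"], intro ballI impI)
    fix x assume x: "x : E" "x <= min X x1"
    hence "\<bar>g n x - G x\<bar> < e/2" "\<bar>g n x\<bar> < e/2" using n x1 by auto
    thus "\<bar>G x\<bar> < e" by linarith
   qed (use X x1 in \<open>auto simp: min_def\<close>)
  qed
 next
  assume fl: "finR A"
  then obtain X where X: "X : E" "emeasure lborel (A Int {X..}) < \<infinity>" by (auto simp: finR_def)
  show "RB G"
   unfolding RB_def
  proof (intro allI impI)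
   fix e :: real assume e: "e > 0"
   hence e2: "e/2 > 0" by simp
   obtain n where n: "ALL x:E. x : {X..} --> \<bar>g n x - G x\<bar> < e/2"
    using small[OF e2 X(1), of "{X..}"] X(2) by auto
   have "RB (g n)" using g(3)[of n] fl by (simp add: bd_def)
   then obtain x1 where x1: "x1 : E" "ALL x:E. x1 <= x --> \<bar>g n x\<bar> < e/2" using e2 unfolding RB_def by blast
   show "EX x0:E. ALL x:E. x0 <= x --> \<bar>G x\<bar> < e"
   proof (rule bexI[of _ "max X x1"], intro ballI impI)
    fix x assume x: "x : E" "max X x1 <= x"
    hence "\<bar>g n x - G x\<bar> < e/2" "\<bar>g n x\<bar> < e/2" using n x1 by auto
    thus "\<bar>G x\<bar> < e" by linarith
   qed (use X x1 in \<open>auto simp: max_def\<close>)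
  qed
 qed
 hence Gdom: "G : dom A" by (intro domI[OF GL2 Gc]) auto
 have "E1d (u n) G = 1/2 * sqd lborel (k n) kk + sqd mu (g n) G" for n
 proof (rule E1_rep[OF A(2) cdens_diff[OF g(1) Gc]])
  show "AE x in mu. u n x - G x = g n x - G x" using g(2)[of n] by eventually_elim simp
  show "(%x. u n x - G x) : L2 mu" by (rule dom_L2[OF dom_diff[OF u Gdom]])
 qed
 moreover have "(%n. 1/2 * sqd lborel (k n) kk + sqd mu (g n) G) ----> 1/2 * 0 + 0"
  by (intro tendsto_add tendsto_mult tendsto_const klim Gint)
 ultimately show ?thesis using Gdom by (intro bexI[of _ G]) simp_all
qed

end

section \<open>Regularity\<close>

context qd_space
begin

definition adm :: "real set => bool" where
 "adm A \<longleftrightarrow> A : sets borel & gapU <= A & A <= I & (ALL x:I. ALL y:I. x < y --> 0 < emeasure lborel (A Int {x..y}))"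

lemma admD: "adm A ==> A : sets borel" "adm A ==> gapU <= A" "adm A ==> A <= I"
 by (auto simp: adm_def)

text \<open>At a closed end the windows eventually reach the end itself, so vanishing has to be
  asked for at open ends only.\<close>

lemma Kn_outside:
 assumes "Lopen ==> EX a:E. ALL x:E. x <= a --> h x = (0::real)"
  and "Ropen ==> EX b:E. ALL x:E. b <= x --> h x = 0"
 shows "EX n. ALL x:E - Kn n. h x = 0"
proof -
 have "EX a:E. ALL x:E. x < a --> h x = 0"
 proof (cases Lopen)
  case True
  thus ?thesis using assms(1) by force
 next
  case False
  then obtain m where "m : E" "ALL x:I. m <= x" using not_Lopen by blast
  thus ?thesis using E_sub_I by (intro bexI[of _ m]) force+
 qed
 then obtain a where a: "a : E" "!!x. x : E ==> x < a ==> h x = 0" by blast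
 have "EX b:E. ALL x:E. b < x --> h x = 0"
 proof (cases Ropen)
  case True
  thus ?thesis using assms(2) by force
 next
  case False
  then obtain m where "m : E" "ALL x:I. x <= m" using not_Ropen by blast
  thus ?thesis using E_sub_I by (intro bexI[of _ m]) force+
 qed
 then obtain b where b: "b : E" "!!x. x : E ==> b < x ==> h x = 0" by blast
 obtain n where n: "el n <= a" "b <= er n" by (rule exh_I2[OF E_sub_I[OF a(1)] E_sub_I[OF b(1)]])
 have "h x = 0" if x: "x : E - Kn n" for x
 proof -
  have "x < el n | er n < x" using x by (auto simp: Kn_def)
  thus ?thesis using a(2)[of x] b(2)[of x] n x by auto
 qed
 thus ?thesis by blast
qed

lemma Cc_L2:
 assumes "f : Cc_on E" shows "f : L2 mu"
proof -
 obtain K where K: "compact K" "K <= E" "ALL x:E - K. f x = 0" and c: "continuous_on E f"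
  using assms by (auto simp: Cc_on_def)
 have cK: "continuous_on K f" by (rule continuous_on_subset[OF c K(2)])
 have "bounded (f ` K)" by (rule compact_imp_bounded[OF compact_continuous_image[OF cK K(1)]])
 then obtain B where B: "ALL x:K. \<bar>f x\<bar> <= B" by (auto simp: bounded_iff)
 have fm[measurable]: "f : borel_measurable mu" by (rule measurable_cont_E[OF c])
 have KS: "K : sets mu" using sets_mu_Int[OF borel_compact[OF K(1)]] K(2) by (simp add: Int_absorb1)
 have Kf: "emeasure mu K < \<infinity>" using rad K unfolding radon_on_def by blast
 have "integrable mu (%x. (f x)^2)"
 proof (rule Bochner_Integration.integrable_bound)
  show "integrable mu (%x. B^2 * indicator K x)"
   by (intro integrable_mult_right integrable_real_indicator KS Kf)
  show "AE x in mu. norm ((f x)^2) <= norm (B^2 * indicator K x)"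
   using AE_space
  proof eventually_elim
   case (elim x)
   show ?case
   proof (cases "x : K")
    case True
    hence "\<bar>f x\<bar> <= \<bar>B\<bar>" using B by force
    hence "(f x)^2 <= B^2" by (simp add: abs_le_square_iff)
    thus ?thesis using True by simp
   next
    case False
    thus ?thesis using K(3) elim by (simp add: space_mu)
   qed
  qed
 qed measurable
 thus ?thesis using fm by (simp add: L2_def)
qed

lemma Cc_dom:
 assumes A: "gapU <= A" "A <= I" and d: "dens A h p"
  and l: "Lopen ==> EX a:E. ALL x:E. x <= a --> h x = 0"
  and r: "Ropen ==> EX b:E. ALL x:E. b <= x --> h x = 0"
 shows "h : Cc_on E" "h : L2 mu" "bd A h" "h : dom A"
proof -
 have c: "continuous_on E h" by (rule dens_cont_E[OF d])
 obtain n where n: "ALL x:E - Kn n. h x = 0" using Kn_outside[OF l r] by blast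
 show Cc: "h : Cc_on E" unfolding Cc_on_def using c Kn_compact Kn_sub n by blast
 show L: "h : L2 mu" by (rule Cc_L2[OF Cc])
 show b: "bd A h"
  unfolding bd_def
 proof (intro conjI impI)
  assume "finL A"
  then obtain a where "a : E" "ALL x:E. x <= a --> h x = 0" using l by (auto simp: finL_def)
  thus "LB h" unfolding LB_def by (intro allI impI bexI[of _ a]) auto
 next
  assume "finR A"
  then obtain a where "a : E" "ALL x:E. a <= x --> h x = 0" using r by (auto simp: finR_def)
  thus "RB h" unfolding RB_def by (intro allI impI bexI[of _ a]) auto
 qed
 show "h : dom A" by (rule form_le_dens(1)[OF A L d _ b]) simp
qed

definition apx :: "real set => (real => real) => bool" where
 "apx A f \<longleftrightarrow> f : dom A & (ALL e>0. EX h:dom A Int Cc_on E. E1d f h < e)"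

lemma apx_limit:
 assumes A: "A <= I" and f: "f : dom A" and h: "!!e. e > 0 ==> EX h. apx A h & E1d f h < e"
 shows "apx A f"
 unfolding apx_def
proof (intro conjI f allI impI)
 fix e :: real assume e: "e > 0"
 hence e4: "e/4 > 0" by simp
 obtain h where h: "apx A h" "E1d f h < e/4" using h[OF e4] by blast
 obtain w where w: "w : dom A" "w : Cc_on E" "E1d h w < e/4" using h(1) e4 unfolding apx_def by blast
 have "h : dom A" using h(1) by (simp add: apx_def)
 hence "E1d f w < e" using E1_triangle[OF A f _ w(1), of h] h(2) w(3) by linarith
 thus "EX h:dom A Int Cc_on E. E1d f h < e" using w by blast
qed

lemma Cc_diff:
 assumes "f : Cc_on E" "g : Cc_on E" shows "(%x. f x - g x) : Cc_on E"
proof -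
 obtain K where K: "compact K" "K <= E" "ALL x:E - K. f x = 0" "continuous_on E f" using assms(1) by (auto simp: Cc_on_def)
 obtain L where L: "compact L" "L <= E" "ALL x:E - L. g x = 0" "continuous_on E g" using assms(2) by (auto simp: Cc_on_def)
 show ?thesis unfolding Cc_on_def
  using K L by (intro CollectI conjI continuous_on_diff exI[of _ "K Un L"]) auto
qed

lemma apx_diff:
 assumes A: "A <= I" and f: "apx A f" and g: "apx A g" shows "apx A (%x. f x - g x)"
 unfolding apx_def
proof (intro conjI allI impI)
 have fd: "f : dom A" "g : dom A" using f g by (auto simp: apx_def)
 show "(%x. f x - g x) : dom A" by (rule dom_diff[OF fd])
 fix e :: real assume e: "e > 0"
 hence e4: "e/4 > 0" by simp
 obtain u where u: "u : dom A" "u : Cc_on E" "E1d f u < e/4" using f e4 unfolding apx_def by blast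
 obtain v where v: "v : dom A" "v : Cc_on E" "E1d g v < e/4" using g e4 unfolding apx_def by blast
 have "E1 mu form (%x. (f x - u x) - (g x - v x)) <= 2 * E1 mu form (%x. (f x - u x) - 0) + 2 * E1 mu form (%x. 0 - (g x - v x))"
  by (rule E1_triangle[OF A dom_diff[OF fd(1) u(1)] dom_zero dom_diff[OF fd(2) v(1)]])
 moreover have "E1 mu form (%x. 0 - (g x - v x)) = E1d g v"
 proof -
  let ?w = "%x. g x - v x"
  have w: "?w : dom A" by (rule dom_diff[OF fd(2) v(1)])
  have "form (%x. 0 - ?w x) (%x. 0 - ?w x) = form ?w ?w"
   using form_quad_diff[OF A dom_zero w] form_cmult[OF A w w, of 0] form_cmult[OF A dom_zero dom_zero, of 0] by simp
  thus ?thesis unfolding E1_def by (simp add: power2_commute)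
 qed
 ultimately have "E1 mu form (%x. (f x - g x) - (u x - v x)) < e"
  using u(3) v(3) by (simp add: algebra_simps)
 thus "EX h:dom A Int Cc_on E. E1 mu form (%x. (f x - g x) - h x) < e"
  using dom_diff[OF u(1) v(1)] Cc_diff[OF u(2) v(2)] by (intro bexI[of _ "%x. u x - v x"]) auto
qed

section \<open>Truncations in the form norm\<close>

lemma J_nbhd: "x : J ==> EX d>0. ALL y. \<bar>x - y\<bar> < d --> y : I"
 using J_open J_sub unfolding open_dist dist_real_def by (metis abs_minus_commute subsetD)

text \<open>Where \<open>g\<close> is positive, \<open>T n\<close> is eventually constant near its
  value, so the density of the truncation is eventually 0. Where \<open>g\<close> is 0 it has a
  local minimum, so its derivative is already 0. Dominated convergence with the square of
  \<open>q\<close> concludes.\<close>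

lemma dens_truncation:
 fixes T :: "nat => real => real"
 assumes A: "A <= I" and d: "dens A g q" and g0: "!!x. x : I ==> 0 <= g x"
  and T: "!!n s t. \<bar>T n s - T n t\<bar> <= \<bar>s - t\<bar>"
  and Tc: "!!t. t > 0 ==> \<forall>\<^sub>F n in sequentially. EX dl>0. ALL s. \<bar>s - t\<bar> < dl --> T n s = T n t"
 shows "EX p. (ALL n. dens A (%x. T n (g x)) (p n)) & (%n. sqn lborel (p n)) ----> 0"
proof -
 have "ALL n. EX p. dens A (%x. T n (g x)) p & (ALL x. \<bar>p x\<bar> <= \<bar>q x\<bar>)"
 proof
  fix n show "EX p. dens A (%x. T n (g x)) p & (ALL x. \<bar>p x\<bar> <= \<bar>q x\<bar>)"
   using dens_contraction[where T="T n", OF d T] by blast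
 qed
 then obtain p where p: "!!n. dens A (%x. T n (g x)) (p n)" "!!n x. \<bar>p n x\<bar> <= \<bar>q x\<bar>"
  by (rule choice[elim_format]) blast
 have ders: "AE x in lborel. ALL n. x : I --> ((%x. T n (g x)) has_real_derivative p n x) (at x)"
  unfolding AE_all_countable using dens_AE_deriv[OF p(1)] by blast
 have ae: "AE x in lborel. (%n. (p n x)^2) ----> 0"
  using ders dens_AE_deriv[OF d] AE_J
 proof eventually_elim
  case (elim x)
  show ?case
  proof (cases "x : I")
   case False
   hence "x ~: A" using A by blast
   hence "p n x = 0" for n by (rule densD(2)[OF p(1)])
   thus ?thesis by simp
  next
   case True
   hence xJ: "x : J" using elim by simp
   obtain d where d: "d > 0" "ALL y. \<bar>x - y\<bar> < d --> y : I" using J_nbhd[OF xJ] by blast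
   have Dg: "(g has_real_derivative q x) (at x)" using elim True by simp
   show ?thesis
   proof (cases "g x = 0")
    case z: True
    have "q x = 0" by (rule DERIV_local_min[OF Dg d(1)]) (use d(2) g0 z in auto)
    hence "p n x = 0" for n using p(2)[of n x] by simp
    thus ?thesis by simp
   next
    case False
    hence gp: "g x > 0" using g0[OF True] by simp
    have "\<forall>\<^sub>F n in sequentially. p n x = 0"
     using Tc[OF gp]
    proof eventually_elim
     case (elim n)
     then obtain dl where dl: "dl > 0" "!!s. \<bar>s - g x\<bar> < dl ==> T n s = T n (g x)" by blast
     have "isCont g x" by (rule DERIV_isCont[OF Dg])
     hence "\<forall>\<^sub>F y in nhds x. \<bar>g y - g x\<bar> < dl"
      using dl(1) unfolding continuous_at tendsto_at_iff_tendsto_nhds by (auto dest!: tendstoD simp: dist_real_def)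
     hence ev: "\<forall>\<^sub>F y in nhds x. T n (g y) = T n (g x)" by eventually_elim (rule dl(2))
     have "((%x. T n (g x)) has_real_derivative p n x) (at x) \<longleftrightarrow> ((%_. T n (g x)) has_real_derivative p n x) (at x)"
      by (rule DERIV_cong_ev[OF refl ev refl])
     hence "((%_. T n (g x)) has_real_derivative p n x) (at x)" using \<open>ALL n. x : I --> ((%x. T n (g x)) has_real_derivative p n x) (at x)\<close> True by blast
     thus "p n x = 0" using DERIV_unique[OF _ DERIV_const] by blast
    qed
    hence "\<forall>\<^sub>F n in sequentially. (p n x)^2 = 0" by eventually_elim simp
    thus ?thesis by (rule tendsto_eventually)
   qed
  qed
 qed
 have "(%n. sqn lborel (p n)) ----> (\<integral>x. 0 \<partial>(lborel :: real measure))"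
 proof (rule integral_dominated_convergence[where w="%x. (q x)^2"])
  show "(%x. (p n x)^2) : borel_measurable lborel" for n using L2r_meas[OF densD(1)[OF p(1)], of n] by measurable
  show "integrable lborel (%x. (q x)^2)" by (rule L2r_sq[OF densD(1)[OF d]])
  show "AE x in lborel. norm ((p n x)^2) <= (q x)^2" for n
  proof (rule AE_I2)
   fix x show "norm ((p n x)^2) <= (q x)^2" using p(2)[of n x] by (simp add: abs_le_square_iff)
  qed
 qed (use ae in auto)
 thus ?thesis using p(1) by auto
qed

text \<open>Clamping a representative makes the bounds hold at every point, as arguments with local
  minima and pointwise cut-offs require.\<close>

lemma dom_pos_rep:
 assumes f: "f : dom A" and f0: "!!x. x : E ==> 0 <= f x" and fM: "!!x. x : E ==> f x <= M" and M: "0 <= M"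
 shows "EX G q. dens A G q & (ALL x. 0 <= G x & G x <= M) & (AE x in mu. f x = G x) & bd A G"
proof -
 obtain g k where g: "cdens A g k" "AE x in mu. f x = g x" "bd A g" by (rule domE[OF f])
 let ?T = "%t. min M (max 0 t)"
 have "\<bar>?T s - ?T t\<bar> <= \<bar>s - t\<bar>" for s t by (auto simp: min_def max_def)
 then obtain q where q: "dens A (%x. ?T (g x)) q" using dens_contraction[where T="?T", OF cdens_dens[OF g(1)]] by blast
 have "AE x in mu. f x = ?T (g x)"
  using g(2) AE_space
 proof eventually_elim
  case (elim x)
  thus ?case using f0[of x] fM[of x] by (simp add: space_mu)
 qed
 moreover have "bd A (%x. ?T (g x))" by (rule bd_dom[OF g(3)]) (use M in \<open>auto simp: min_def max_def\<close>)
 ultimately show ?thesis using q M by (intro exI[of _ "%x. ?T (g x)"] exI[of _ q]) auto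
qed

lemma dom_pos_rep':
 assumes f: "f : dom A" and f0: "!!x. x : E ==> 0 <= f x"
 shows "EX G q. dens A G q & (ALL x. 0 <= G x) & (AE x in mu. f x = G x) & bd A G"
proof -
 obtain g k where g: "cdens A g k" "AE x in mu. f x = g x" "bd A g" by (rule domE[OF f])
 let ?T = "%t. max 0 t :: real"
 have "\<bar>?T s - ?T t\<bar> <= \<bar>s - t\<bar>" for s t by (auto simp: max_def)
 then obtain q where q: "dens A (%x. ?T (g x)) q" using dens_contraction[where T="?T", OF cdens_dens[OF g(1)]] by blast
 have "AE x in mu. f x = ?T (g x)"
  using g(2) AE_space
 proof eventually_elim
  case (elim x)
  thus ?case using f0[of x] by (simp add: space_mu)
 qed
 moreover have "bd A (%x. ?T (g x))" by (rule bd_dom[OF g(3)]) (auto simp: max_def)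
 ultimately show ?thesis using q by (intro exI[of _ "%x. ?T (g x)"] exI[of _ q]) auto
qed

text \<open>Covers both the thin layer above level 0 and the excess over a high level: near each
  positive value these truncations are eventually locally constant, and they tend to 0
  pointwise.\<close>

lemma E1_truncation:
 fixes T :: "nat => real => real"
 assumes A: "gapU <= A" "A <= I" and f: "f : dom A" and f0: "!!x. x : E ==> 0 <= f x"
  and T: "!!n s t. \<bar>T n s - T n t\<bar> <= \<bar>s - t\<bar>" "!!n. T n 0 = 0"
  and Tc: "!!t. t > 0 ==> \<forall>\<^sub>F n in sequentially. EX dl>0. ALL s. \<bar>s - t\<bar> < dl --> T n s = T n t"
  and Tl: "!!t. t >= 0 ==> (%n. T n t) ----> 0"
 shows "(%n. E1 mu form (%x. T n (f x))) ----> 0"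
proof -
 obtain G q where G: "dens A G q" "!!x. 0 <= G x" "AE x in mu. f x = G x" "bd A G" using dom_pos_rep'[OF f f0] by blast
 obtain p where p: "!!n. dens A (%x. T n (G x)) (p n)" "(%n. sqn lborel (p n)) ----> 0"
  using dens_truncation[where T=T, OF A(2) G(1) G(2) T(1) Tc] by blast
 have T0: "\<bar>T n s\<bar> <= \<bar>s\<bar>" for n s using T(1)[of n s 0] T(2) by simp
 have Td: "(%x. T n (f x)) : dom A" for n by (rule dom_contraction(1)[OF A f T(1) T(2)])
 have ae: "AE x in mu. T n (f x) = T n (G x)" for n using G(3) by eventually_elim simp
 have fo: "form (%x. T n (f x)) (%x. T n (f x)) <= 1/2 * sqn lborel (p n)" for n
  by (rule form_le_dens(2)[OF A dom_L2[OF Td] p(1) ae bd_dom[OF G(4) T0]])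
 have l2: "(%n. \<integral>x. (T n (f x))^2 \<partial>mu) ----> (\<integral>x. 0 \<partial>mu)"
 proof (rule integral_dominated_convergence[where w="%x. (f x)^2"])
  show "(%x. (T n (f x))^2) : borel_measurable mu" for n using L2_meas[OF dom_L2[OF Td[of n]]] by measurable
  show "integrable mu (%x. (f x)^2)" by (rule L2_int[OF dom_L2[OF f]])
  show "AE x in mu. (%n. (T n (f x))^2) ----> 0"
   using AE_space
  proof eventually_elim
   case (elim x)
   hence "(%n. T n (f x)) ----> 0" using f0 Tl by (simp add: space_mu)
   thus ?case using tendsto_power[of _ 0 sequentially 2] by fastforce
  qed
  show "AE x in mu. norm ((T n (f x))^2) <= (f x)^2" for n
   using T0 by (intro AE_I2) (simp add: abs_le_square_iff)
 qed simp
 show ?thesis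
 proof (rule tendsto_sandwich[OF _ _ tendsto_const])
  show "\<forall>\<^sub>F n in sequentially. 0 <= E1 mu form (%x. T n (f x))" using E1_nonneg by simp
  show "\<forall>\<^sub>F n in sequentially. E1 mu form (%x. T n (f x)) <= 1/2 * sqn lborel (p n) + (\<integral>x. (T n (f x))^2 \<partial>mu)"
   using fo unfolding E1_def by (intro always_eventually allI add_right_mono)
  show "(%n. 1/2 * sqn lborel (p n) + (\<integral>x. (T n (f x))^2 \<partial>mu)) ----> 0"
   using tendsto_add[OF tendsto_mult[OF tendsto_const[of "1/2"] p(2)] l2] by simp
 qed
qed

lemma E1_min_small:
 assumes A: "gapU <= A" "A <= I" and f: "f : dom A" and f0: "!!x. x : E ==> 0 <= f x"
 shows "(%n. E1 mu form (%x. min (f x) (1 / real (Suc n)))) ----> 0"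
proof (rule E1_truncation[OF A f f0])
 show "\<bar>min s (1 / real (Suc n)) - min t (1 / real (Suc n))\<bar> <= \<bar>s - t\<bar>" for n s t by (auto simp: min_def)
 show "min 0 (1 / real (Suc n)) = 0" for n by simp
 have l: "(%n. 1 / real (Suc n)) ----> 0" using LIMSEQ_inverse_real_of_nat by (simp add: inverse_eq_divide)
 show "\<forall>\<^sub>F n in sequentially. EX dl>0. ALL s. \<bar>s - t\<bar> < dl --> min s (1 / real (Suc n)) = min t (1 / real (Suc n))" if t: "t > 0" for t
  using order_tendstoD(2)[OF l t]
 proof eventually_elim
  case (elim n)
  show ?case by (rule exI[of _ "t - 1 / real (Suc n)"]) (use elim in \<open>auto simp: min_def\<close>)
 qed
 show "(%n. min t (1 / real (Suc n))) ----> 0" if "t >= 0" for t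
  using tendsto_min[OF tendsto_const[of t] l] that by simp
qed

lemma E1_excess_small:
 assumes A: "gapU <= A" "A <= I" and f: "f : dom A" and f0: "!!x. x : E ==> 0 <= f x"
 shows "(%n. E1 mu form (%x. max 0 (f x - real n))) ----> 0"
proof (rule E1_truncation[OF A f f0])
 show "\<bar>max 0 (s - real n) - max 0 (t - real n)\<bar> <= \<bar>s - t\<bar>" for n s t by (auto simp: max_def)
 show "max 0 (0 - real n) = 0" for n by simp
 have ev: "\<forall>\<^sub>F n in sequentially. t < real n" for t
  using filterlim_real_sequentially unfolding filterlim_at_top_dense by blast
 show "\<forall>\<^sub>F n in sequentially. EX dl>0. ALL s. \<bar>s - t\<bar> < dl --> max 0 (s - real n) = max 0 (t - real n)" for t
  using ev[of t]
 proof eventually_elim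
  case (elim n)
  show ?case by (rule exI[of _ "real n - t"]) (use elim in \<open>auto simp: max_def\<close>)
 qed
 show "(%n. max 0 (t - real n)) ----> 0" for t
  by (rule tendsto_eventually) (use ev[of t] in \<open>eventually_elim, simp\<close>)
qed

text \<open>At an open end where \<open>A\<close> has infinite measure no boundary condition is
  imposed, and it is the infinite measure that makes cutting cheap: a ramp rising from 0 to 1 in
  proportion to the measure of \<open>A\<close>, over total measure \<open>c\<close>, has squared
  norm \<open>1 / c\<close>. In all other cases the constant 1 serves.\<close>

lemma left_cutoff:
 assumes A: "A : sets borel" "A <= I"
 shows "EX GL kL. dens A GL kL & sqn lborel kL <= 1 / real (Suc n) & (ALL x. 0 <= GL x & GL x <= 1)
  & (ALL x. el n <= x --> GL x = 1) & (Lopen & ~ finL A --> (EX z:E. ALL x. x <= z --> GL x = 0))"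
proof (cases "Lopen & ~ finL A")
 case False
 thus ?thesis using dens_zero[of A 1] by (intro exI[of _ "%_. 1"] exI[of _ "%_. 0"]) auto
next
 case True
 hence "~ emeasure lborel (A Int {..el n}) < \<infinity>" using el_E[of n] by (auto simp: finL_def)
 hence inf: "emeasure lborel (A Int {..el n}) = \<infinity>" by (metis infinity_ennreal_def less_top)
 have U: "(\<Union>m. A Int {el m..el n}) = A Int {..el n}"
 proof
  show "A Int {..el n} <= (\<Union>m. A Int {el m..el n})"
  proof
   fix x assume x: "x : A Int {..el n}"
   then obtain m where "el m <= x" using A(2) exh_I[of x] by blast
   thus "x : (\<Union>m. A Int {el m..el n})" using x by auto
  qed
 qed auto
 have SUPeq: "(SUP m. emeasure lborel (A Int {el m..el n})) = emeasure lborel (\<Union>m. A Int {el m..el n})"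
 proof (rule SUP_emeasure_incseq)
  show "incseq (%m. A Int {el m..el n})"
  proof (rule incseq_SucI)
   fix m show "A Int {el m..el n} <= A Int {el (Suc m)..el n}" using el_Suc[of m] by auto
  qed
 qed (use A(1) in auto)
 have "(SUP m. emeasure lborel (A Int {el m..el n})) > ennreal (real (Suc n))"
  unfolding SUPeq U inf by (rule ennreal_less_top[unfolded infinity_ennreal_def[symmetric]])
 then obtain m where m: "emeasure lborel (A Int {el m..el n}) > ennreal (real (Suc n))" by (auto simp: less_SUP_iff)
 define B where "B = A Int {el m..el n}"
 have Bs[measurable]: "B : sets borel" using A(1) by (simp add: B_def)
 have Bf: "emeasure lborel (B Int S) < \<infinity>" for S
  by (rule le_less_trans[OF emeasure_mono[of _ "{el m..el n}"]]) (auto simp: emeasure_lborel_Icc_eq B_def)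
 define c where "c = measure lborel B"
 have ec: "emeasure lborel B = ennreal c" unfolding c_def using Bf[of UNIV] by (intro emeasure_eq_ennreal_measure) auto
 have "ennreal (real (Suc n)) < ennreal c" using m unfolding B_def[symmetric] ec .
 hence c: "c > real (Suc n)" by (subst (asm) ennreal_less_iff) simp_all
 hence c0: "c > 0" by linarith
 define GL where "GL y = measure lborel (B Int {..y}) / c" for y
 define kL where "kL t = 1 / c * indicator B t" for t
 have kLL: "L2r kL" unfolding kL_def by (rule L2r_cmult[OF L2r_indicator_finite[OF Bs]]) (use Bf[of UNIV] in simp)
 have mono: "measure lborel (B Int S) <= measure lborel (B Int S')" if "S <= S'" "S : sets borel" "S' : sets borel" for S S'
  using that Bf by (intro measure_mono_fmeasurable) (auto simp: fmeasurable_def)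
 have "dens A GL kL"
  unfolding dens_def
 proof (intro conjI allI impI ballI kLL)
  show "kL x = 0" if "x ~: A" for x using that by (simp add: kL_def B_def)
  fix x y assume xy: "x : I" "y : I" "x <= y"
  have "B Int {..y} = (B Int {..x}) Un (B Int {x<..y})" using xy by auto
  hence "measure lborel (B Int {..y}) = measure lborel (B Int {..x}) + measure lborel (B Int {x<..y})"
   using Bf by (subst measure_Union[symmetric]) (auto simp: less_top[symmetric])
  moreover have "measure lborel (B Int {x<..y}) = measure lborel (B Int {x..y})"
   by (rule measure_eq_AE) (use AE_lborel_singleton[of x] in \<open>auto elim: eventually_mono\<close>)
  moreover have "pint kL x y = 1 / c * measure lborel (B Int {x..y})"
   unfolding set_lebesgue_integral_def kL_def by (simp add: indicator_inter_arith[symmetric] Int_commute)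
  ultimately show "GL y - GL x = pint kL x y" by (simp add: GL_def diff_divide_distrib[symmetric])
 qed
 moreover have "sqn lborel kL <= 1 / real (Suc n)"
 proof -
  have "sqn lborel kL = (\<integral>t. (1 / c)^2 * indicator B t \<partial>lborel)"
   by (rule Bochner_Integration.integral_cong) (auto simp: kL_def indicator_def)
  also have "\<dots> = 1 / c" using c0 by (simp add: c_def[symmetric] power2_eq_square)
  also have "\<dots> <= 1 / real (Suc n)" using c by (intro divide_left_mono) auto
  finally show ?thesis .
 qed
 moreover have "0 <= GL x & GL x <= 1" for x
  using mono[of "{..x}" UNIV] c0 by (simp add: GL_def c_def[symmetric])
 moreover have "GL x = 1" if "el n <= x" for x
 proof -
  have "B Int {..x} = B" using that by (auto simp: B_def)
  thus ?thesis using c0 by (simp add: GL_def c_def[symmetric])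
 qed
 moreover have "EX z:E. ALL x. x <= z --> GL x = 0"
 proof -
  obtain z where z: "z : E" "z < el m" using Lopen_below[OF _ el_I] True by blast
  have "GL x = 0" if "x <= z" for x
  proof -
   have "B Int {..x} = {}" using that z by (auto simp: B_def)
   thus ?thesis by (simp add: GL_def)
  qed
  thus ?thesis using z by blast
 qed
 ultimately show ?thesis by blast
qed

lemma right_cutoff:
 assumes A: "A : sets borel" "A <= I"
 shows "EX GL kL. dens A GL kL & sqn lborel kL <= 1 / real (Suc n) & (ALL x. 0 <= GL x & GL x <= 1)
  & (ALL x. x <= er n --> GL x = 1) & (Ropen & ~ finR A --> (EX z:E. ALL x. z <= x --> GL x = 0))"
proof (cases "Ropen & ~ finR A")
 case False
 thus ?thesis using dens_zero[of A 1] by (intro exI[of _ "%_. 1"] exI[of _ "%_. 0"]) auto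
next
 case True
 hence "~ emeasure lborel (A Int {er n..}) < \<infinity>" using er_E[of n] by (auto simp: finR_def)
 hence inf: "emeasure lborel (A Int {er n..}) = \<infinity>" by (metis infinity_ennreal_def less_top)
 have U: "(\<Union>m. A Int {er n..er m}) = A Int {er n..}"
 proof
  show "A Int {er n..} <= (\<Union>m. A Int {er n..er m})"
  proof
   fix x assume x: "x : A Int {er n..}"
   then obtain m where "x <= er m" using A(2) exh_I[of x] by blast
   thus "x : (\<Union>m. A Int {er n..er m})" using x by auto
  qed
 qed auto
 have SUPeq: "(SUP m. emeasure lborel (A Int {er n..er m})) = emeasure lborel (\<Union>m. A Int {er n..er m})"
 proof (rule SUP_emeasure_incseq)
  show "incseq (%m. A Int {er n..er m})"
  proof (rule incseq_SucI)
   fix m show "A Int {er n..er m} <= A Int {er n..er (Suc m)}" using er_Suc[of m] by auto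
  qed
 qed (use A(1) in auto)
 have "(SUP m. emeasure lborel (A Int {er n..er m})) > ennreal (real (Suc n))"
  unfolding SUPeq U inf by (rule ennreal_less_top[unfolded infinity_ennreal_def[symmetric]])
 then obtain m where m: "emeasure lborel (A Int {er n..er m}) > ennreal (real (Suc n))" by (auto simp: less_SUP_iff)
 define B where "B = A Int {er n..er m}"
 have Bs[measurable]: "B : sets borel" using A(1) by (simp add: B_def)
 have Bf: "emeasure lborel (B Int S) < \<infinity>" for S
  by (rule le_less_trans[OF emeasure_mono[of _ "{er n..er m}"]]) (auto simp: emeasure_lborel_Icc_eq B_def)
 define c where "c = measure lborel B"
 have ec: "emeasure lborel B = ennreal c" unfolding c_def using Bf[of UNIV] by (intro emeasure_eq_ennreal_measure) auto
 have "ennreal (real (Suc n)) < ennreal c" using m unfolding B_def[symmetric] ec .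
 hence c: "c > real (Suc n)" by (subst (asm) ennreal_less_iff) simp_all
 hence c0: "c > 0" by linarith
 define GL where "GL y = measure lborel (B Int {y..}) / c" for y
 define kL where "kL t = (- 1 / c) * indicator B t" for t
 have kLL: "L2r kL" unfolding kL_def by (rule L2r_cmult[OF L2r_indicator_finite[OF Bs]]) (use Bf[of UNIV] in simp)
 have mono: "measure lborel (B Int S) <= measure lborel (B Int S')" if "S <= S'" "S : sets borel" "S' : sets borel" for S S'
  using that Bf by (intro measure_mono_fmeasurable) (auto simp: fmeasurable_def)
 have "dens A GL kL"
  unfolding dens_def
 proof (intro conjI allI impI ballI kLL)
  show "kL x = 0" if "x ~: A" for x using that by (simp add: kL_def B_def)
  fix x y assume xy: "x : I" "y : I" "x <= y"
  have "B Int {x..} = (B Int {y..}) Un (B Int {x..<y})" using xy by auto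
  hence "measure lborel (B Int {x..}) = measure lborel (B Int {y..}) + measure lborel (B Int {x..<y})"
   using Bf by (subst measure_Union[symmetric]) (auto simp: less_top[symmetric])
  moreover have "measure lborel (B Int {x..<y}) = measure lborel (B Int {x..y})"
   by (rule measure_eq_AE) (use AE_lborel_singleton[of y] in \<open>auto elim: eventually_mono\<close>)
  moreover have "pint kL x y = - 1 / c * measure lborel (B Int {x..y})"
   unfolding set_lebesgue_integral_def kL_def by (simp add: indicator_inter_arith[symmetric] Int_commute)
  ultimately show "GL y - GL x = pint kL x y" by (simp add: GL_def diff_divide_distrib[symmetric])
 qed
 moreover have "sqn lborel kL <= 1 / real (Suc n)"
 proof -
  have "sqn lborel kL = (\<integral>t. (1 / c)^2 * indicator B t \<partial>lborel)"
   by (rule Bochner_Integration.integral_cong) (auto simp: kL_def indicator_def)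
  also have "\<dots> = 1 / c" using c0 by (simp add: c_def[symmetric] power2_eq_square)
  also have "\<dots> <= 1 / real (Suc n)" using c by (intro divide_left_mono) auto
  finally show ?thesis .
 qed
 moreover have "0 <= GL x & GL x <= 1" for x
  using mono[of "{x..}" UNIV] c0 by (simp add: GL_def c_def[symmetric])
 moreover have "GL x = 1" if "x <= er n" for x
 proof -
  have "B Int {x..} = B" using that by (auto simp: B_def)
  thus ?thesis using c0 by (simp add: GL_def c_def[symmetric])
 qed
 moreover have "EX z:E. ALL x. z <= x --> GL x = 0"
 proof -
  obtain z where z: "z : E" "er m < z" using Ropen_above[OF _ er_I] True by blast
  have "GL x = 0" if "z <= x" for x
  proof -
   have "B Int {x..} = {}" using that z by (auto simp: B_def)
   thus ?thesis by (simp add: GL_def)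
  qed
  thus ?thesis using z by blast
 qed
 ultimately show ?thesis by blast
qed

text \<open>Subtracting a small level \<open>ep\<close> makes the function vanish near every open
  end, either because \<open>H\<close> tends to 0 there or because it vanishes there already. What
  is removed is the minimum of \<open>H\<close> and \<open>ep\<close>, which is small in the form
  norm.\<close>

lemma apx_vanishing:
 assumes A: "gapU <= A" "A <= I" and d: "dens A H p" and H0: "!!x. 0 <= H x" and L: "H : L2 mu" and b: "bd A H"
  and vl: "Lopen & ~ finL A ==> EX z:E. ALL x:E. x <= z --> H x = 0"
  and vr: "Ropen & ~ finR A ==> EX z:E. ALL x:E. z <= x --> H x = 0"
 shows "apx A H"
 unfolding apx_def
proof (intro conjI allI impI)
 show Hd: "H : dom A" by (rule form_le_dens(1)[OF A L d _ b]) simp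
 fix e :: real assume e: "e > 0"
 have "(%n. E1 mu form (%x. min (H x) (1 / real (Suc n)))) ----> 0" by (rule E1_min_small[OF A Hd H0])
 hence "\<forall>\<^sub>F n in sequentially. E1 mu form (%x. min (H x) (1 / real (Suc n))) < e" using e by (rule order_tendstoD)
 then obtain n where n: "E1 mu form (%x. min (H x) (1 / real (Suc n))) < e" unfolding eventually_sequentially by blast
 define ep where "ep = 1 / real (Suc n)"
 have ep: "ep > 0" by (simp add: ep_def)
 let ?T = "%t. max 0 (t - ep)"
 have "\<bar>?T s - ?T t\<bar> <= \<bar>s - t\<bar>" for s t by (auto simp: max_def)
 then obtain q where q: "dens A (%x. ?T (H x)) q" using dens_contraction[where T="?T", OF d] by blast
 have l: "EX a:E. ALL x:E. x <= a --> ?T (H x) = 0" if lo: Lopen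
 proof (cases "finL A")
  case True
  hence "LB H" using b by (simp add: bd_def)
  then obtain a where "a : E" "ALL x:E. x <= a --> \<bar>H x\<bar> < ep" using ep unfolding LB_def by blast
  thus ?thesis by (intro bexI[of _ a]) auto
 next
  case False
  then obtain a where "a : E" "ALL x:E. x <= a --> H x = 0" using vl lo by blast
  thus ?thesis using ep by (intro bexI[of _ a]) auto
 qed
 have r: "EX a:E. ALL x:E. a <= x --> ?T (H x) = 0" if ro: Ropen
 proof (cases "finR A")
  case True
  hence "RB H" using b by (simp add: bd_def)
  then obtain a where "a : E" "ALL x:E. a <= x --> \<bar>H x\<bar> < ep" using ep unfolding RB_def by blast
  thus ?thesis by (intro bexI[of _ a]) auto
 next
  case False
  then obtain a where "a : E" "ALL x:E. a <= x --> H x = 0" using vr ro by blast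
  thus ?thesis using ep by (intro bexI[of _ a]) auto
 qed
 note cc = Cc_dom[OF A q l r]
 have "(%x. H x - ?T (H x)) = (%x. min (H x) (1 / real (Suc n)))" by (auto simp: min_def max_def ep_def)
 thus "EX h:dom A Int Cc_on E. E1d H h < e"
  using n cc by (intro bexI[of _ "%x. ?T (H x)"]) auto
qed

text \<open>The cut-off acts through a minimum instead of a product: \<open>H n\<close> is the
  minimum of \<open>G\<close> and \<open>M * ct n\<close>, and \<open>Ph n\<close> is the part
  removed. The density of \<open>Ph n\<close> is at most \<open>|q - M * kct n|\<close> and vanishes
  inside the window, so its energy is controlled by the tail of \<open>q\<close> and the energy of
  the cut-off.\<close>

lemma apx_bounded:
 assumes A: "A : sets borel" "gapU <= A" "A <= I" and f: "f : dom A"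
  and f0: "!!x. x : E ==> 0 <= f x" and fM: "!!x. x : E ==> f x <= M" and M: "0 <= M"
 shows "apx A f"
proof -
 obtain G q where G: "dens A G q" "!!x. 0 <= G x & G x <= M" "AE x in mu. f x = G x" "bd A G"
  using dom_pos_rep[OF f f0 fM M] by blast
 have qL: "L2r q" by (rule densD(1)[OF G(1)])
 have GL2: "G : L2 mu" by (rule L2_AE(1)[OF dom_L2[OF f] measurable_cont_E[OF dens_cont_E[OF G(1)]] G(3)])
 have "ALL n. EX Gk. dens A (fst Gk) (snd Gk) & sqn lborel (snd Gk) <= 1 / real (Suc n) & (ALL x. 0 <= fst Gk x & fst Gk x <= 1)
  & (ALL x. el n <= x --> fst Gk x = 1) & (Lopen & ~ finL A --> (EX z:E. ALL x. x <= z --> fst Gk x = 0))"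
 proof
  fix n
  obtain GL kL where "dens A GL kL & sqn lborel kL <= 1 / real (Suc n) & (ALL x. 0 <= GL x & GL x <= 1)
  & (ALL x. el n <= x --> GL x = 1) & (Lopen & ~ finL A --> (EX z:E. ALL x. x <= z --> GL x = 0))"
   using left_cutoff[OF A(1,3), of n] by blast
  thus "EX Gk. dens A (fst Gk) (snd Gk) & sqn lborel (snd Gk) <= 1 / real (Suc n) & (ALL x. 0 <= fst Gk x & fst Gk x <= 1)
  & (ALL x. el n <= x --> fst Gk x = 1) & (Lopen & ~ finL A --> (EX z:E. ALL x. x <= z --> fst Gk x = 0))"
   by (intro exI[of _ "(GL, kL)"]) simp
 qed
 then obtain ll where "ALL n. dens A (fst (ll n)) (snd (ll n)) & sqn lborel (snd (ll n)) <= 1 / real (Suc n) & (ALL x. 0 <= fst (ll n) x & fst (ll n) x <= 1)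
  & (ALL x. el n <= x --> fst (ll n) x = 1) & (Lopen & ~ finL A --> (EX z:E. ALL x. x <= z --> fst (ll n) x = 0))"
  by (rule choice[elim_format]) blast
 hence ll: "dens A (fst (ll n)) (snd (ll n))" "sqn lborel (snd (ll n)) <= 1 / real (Suc n)" "0 <= fst (ll n) x & fst (ll n) x <= 1"
  "el n <= x ==> fst (ll n) x = 1" "Lopen & ~ finL A ==> EX z:E. ALL x. x <= z --> fst (ll n) x = 0" for n x
  by simp_all
 have "ALL n. EX Gk. dens A (fst Gk) (snd Gk) & sqn lborel (snd Gk) <= 1 / real (Suc n) & (ALL x. 0 <= fst Gk x & fst Gk x <= 1)
  & (ALL x. x <= er n --> fst Gk x = 1) & (Ropen & ~ finR A --> (EX z:E. ALL x. z <= x --> fst Gk x = 0))"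
 proof
  fix n
  obtain GL kL where "dens A GL kL & sqn lborel kL <= 1 / real (Suc n) & (ALL x. 0 <= GL x & GL x <= 1)
  & (ALL x. x <= er n --> GL x = 1) & (Ropen & ~ finR A --> (EX z:E. ALL x. z <= x --> GL x = 0))"
   using right_cutoff[OF A(1,3), of n] by blast
  thus "EX Gk. dens A (fst Gk) (snd Gk) & sqn lborel (snd Gk) <= 1 / real (Suc n) & (ALL x. 0 <= fst Gk x & fst Gk x <= 1)
  & (ALL x. x <= er n --> fst Gk x = 1) & (Ropen & ~ finR A --> (EX z:E. ALL x. z <= x --> fst Gk x = 0))"
   by (intro exI[of _ "(GL, kL)"]) simp
 qed
 then obtain rr where "ALL n. dens A (fst (rr n)) (snd (rr n)) & sqn lborel (snd (rr n)) <= 1 / real (Suc n) & (ALL x. 0 <= fst (rr n) x & fst (rr n) x <= 1)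
  & (ALL x. x <= er n --> fst (rr n) x = 1) & (Ropen & ~ finR A --> (EX z:E. ALL x. z <= x --> fst (rr n) x = 0))"
  by (rule choice[elim_format]) blast
 hence rr: "dens A (fst (rr n)) (snd (rr n))" "sqn lborel (snd (rr n)) <= 1 / real (Suc n)" "0 <= fst (rr n) x & fst (rr n) x <= 1"
  "x <= er n ==> fst (rr n) x = 1" "Ropen & ~ finR A ==> EX z:E. ALL x. z <= x --> fst (rr n) x = 0" for n x
  by simp_all
 \<comment> \<open>At each point at least one of the two ramps is 1, so their sum minus 1 is the
   smaller of them and stays between 0 and 1.\<close>
 define ct where "ct n x = fst (ll n) x + fst (rr n) x + (-1)" for n x
 define kct where "kct n x = snd (ll n) x + snd (rr n) x" for n x
 have ctd: "dens A (ct n) (kct n)" for n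
  unfolding ct_def[abs_def] kct_def[abs_def] by (rule dens_const_shift[OF dens_add[OF ll(1) rr(1)]])
 have ct01: "0 <= ct n x & ct n x <= 1" for n x
  using ll(3)[of n x] rr(3)[of n x] ll(4)[of n x] rr(4)[of x n] el_er[of n]
  by (cases "el n <= x") (auto simp: ct_def)
 have ct1: "ct n x = 1" if "el n <= x" "x <= er n" for n x using ll(4)[OF that(1)] rr(4)[OF that(2)] by (simp add: ct_def)
 have kctL: "L2r (kct n)" for n by (rule densD(1)[OF ctd])
 have kcti: "sqn lborel (kct n) <= 4 / real (Suc n)" for n
 proof -
  have L: "L2r (snd (ll n))" "L2r (snd (rr n))" using densD(1)[OF ll(1)] densD(1)[OF rr(1)] by auto
  have "sqn lborel (kct n) <= (\<integral>t. 2 * (snd (ll n) t)^2 + 2 * (snd (rr n) t)^2 \<partial>lborel)"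
  proof (rule integral_mono)
   show "integrable lborel (%t. (kct n t)^2)" by (rule L2r_sq[OF kctL])
   show "integrable lborel (%t. 2 * (snd (ll n) t)^2 + 2 * (snd (rr n) t)^2)" using L2r_sq[OF L(1)] L2r_sq[OF L(2)] by simp
   show "(kct n t)^2 <= 2 * (snd (ll n) t)^2 + 2 * (snd (rr n) t)^2" for t
    unfolding kct_def using zero_le_power2[of "snd (ll n) t - snd (rr n) t"] by (simp add: power2_eq_square algebra_simps)
  qed
  also have "\<dots> = 2 * sqn lborel (snd (ll n)) + 2 * sqn lborel (snd (rr n))" using L2r_sq[OF L(1)] L2r_sq[OF L(2)] by simp
  also have "\<dots> <= 2 * (1 / real (Suc n)) + 2 * (1 / real (Suc n))" using ll(2)[of n] rr(2)[of n] by linarith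
  finally show ?thesis by simp
 qed
 define Ph where "Ph n x = max 0 (G x - M * ct n x)" for n x
 have T1: "\<bar>max 0 s - max 0 t\<bar> <= \<bar>s - t\<bar>" for s t :: real by (auto simp: max_def)
 have "ALL n. EX p. dens A (Ph n) p & (ALL x. \<bar>p x\<bar> <= \<bar>q x - M * kct n x\<bar>)"
 proof
  fix n
  show "EX p. dens A (Ph n) p & (ALL x. \<bar>p x\<bar> <= \<bar>q x - M * kct n x\<bar>)"
   unfolding Ph_def using dens_contraction[where T="max 0", OF dens_diff[OF G(1) dens_cmult[OF ctd[of n]]] T1] by blast
 qed
 then obtain p where p: "!!n. dens A (Ph n) (p n)" "!!n x. \<bar>p n x\<bar> <= \<bar>q x - M * kct n x\<bar>"
  by (rule choice[elim_format]) blast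
 have Ph0: "Ph n x = 0" if "el n <= x" "x <= er n" for n x using ct1[OF that] G(2)[of x] by (simp add: Ph_def)
 have PhG: "0 <= Ph n x & Ph n x <= G x" for n x using ct01[of n x] G(2)[of x] M by (simp add: Ph_def)
 have PhG': "\<bar>Ph n x\<bar> <= \<bar>G x\<bar>" for n x using PhG[of n x] by linarith
 have PhL2: "Ph n : L2 mu" for n
  by (rule L2_bound[OF GL2 measurable_cont_E[OF dens_cont_E[OF p(1)]] AE_I2[OF PhG']])
 have Phbd: "bd A (Ph n)" for n by (rule bd_dom[OF G(4) PhG'])
 define out where "out n x = (if el n < x & x < er n then 0 else 1 :: real)" for n x
 have [measurable]: "out n : borel_measurable borel" for n unfolding out_def by measurable
 have [measurable]: "q : borel_measurable borel" "kct n : borel_measurable borel" "p n : borel_measurable borel" for n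
  using L2r_meas[OF qL] L2r_meas[OF kctL] L2r_meas[OF densD(1)[OF p(1)]] by auto
 \<comment> \<open>Inside the window \<open>Ph n\<close> is identically 0, and so is its derivative;
   outside, the square of the difference is estimated by twice the sum of squares.\<close>
 have pb: "AE x in lborel. (p n x)^2 <= 2 * (out n x * (q x)^2) + 2 * M^2 * (kct n x)^2" for n
  using dens_AE_deriv[OF p(1)[of n]]
 proof eventually_elim
  case (elim x)
  show ?case
  proof (cases "el n < x & x < er n")
   case True
   hence "x : I" using exh_J J_sub by blast
   hence D: "(Ph n has_real_derivative p n x) (at x)" using elim by simp
   have "((%_. 0) has_real_derivative p n x) (at x)"
    by (rule has_field_derivative_transform_within_open[OF D, of "{el n<..<er n}"]) (use True Ph0 in auto)
   hence "p n x = 0" using DERIV_unique[OF _ DERIV_const] by blast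
   thus ?thesis by (simp add: out_def)
  next
   case False
   have "(p n x)^2 <= (q x - M * kct n x)^2" using p(2)[of n x] by (simp add: abs_le_square_iff)
   also have "\<dots> <= 2 * (q x)^2 + 2 * (M * kct n x)^2"
    using zero_le_power2[of "q x + M * kct n x"] by (simp add: power2_eq_square algebra_simps)
   finally show ?thesis using False by (simp only: out_def if_False power_mult_distrib mult_1_left)
  qed
 qed
 have iout: "integrable lborel (%x. out n x * (q x)^2)" for n
  by (rule Bochner_Integration.integrable_bound[OF L2r_sq[OF qL]]) (auto simp: out_def)
 have pi: "sqn lborel (p n) <= 2 * (\<integral>x. out n x * (q x)^2 \<partial>lborel) + 2 * M^2 * (4 / real (Suc n))" for n
 proof -
  have "sqn lborel (p n) <= (\<integral>x. 2 * (out n x * (q x)^2) + 2 * M^2 * (kct n x)^2 \<partial>lborel)"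
   by (rule integral_mono_AE[OF L2r_sq[OF densD(1)[OF p(1)]] _ pb]) (use iout L2r_sq[OF kctL] in simp)
  also have "\<dots> = 2 * (\<integral>x. out n x * (q x)^2 \<partial>lborel) + 2 * M^2 * sqn lborel (kct n)" using iout L2r_sq[OF kctL] by simp
  also have "\<dots> <= 2 * (\<integral>x. out n x * (q x)^2 \<partial>lborel) + 2 * M^2 * (4 / real (Suc n))"
   using kcti[of n] by (intro add_left_mono mult_left_mono) auto
  finally show ?thesis .
 qed
 have l1: "(%n. \<integral>x. out n x * (q x)^2 \<partial>lborel) ----> (\<integral>x. 0 \<partial>(lborel :: real measure))"
 proof (rule integral_dominated_convergence[where w="%x. (q x)^2"])
  show "AE x in lborel. (%n. out n x * (q x)^2) ----> 0"
   using AE_J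
  proof eventually_elim
   case (elim x)
   show ?case
   proof (cases "x : I")
    case True
    hence "x : J" using elim by simp
    then obtain N where N: "ALL n>=N. el n < x & x < er n" using el_less_interior by (auto simp: J_def)
    hence "\<forall>\<^sub>F n in sequentially. out n x * (q x)^2 = 0" unfolding eventually_sequentially by (auto simp: out_def)
    thus ?thesis by (rule tendsto_eventually)
   next
    case False
    hence "x ~: A" using A by blast
    thus ?thesis using densD(2)[OF G(1)] by simp
   qed
  qed
  show "integrable lborel (%x. (q x)^2)" by (rule L2r_sq[OF qL])
  show "AE x in lborel. norm (out n x * (q x)^2) <= (q x)^2" for n by (rule AE_I2) (auto simp: out_def)
 qed auto
 have l1s: "(%n. 4 / real (Suc n)) ----> 0"
  using tendsto_mult[OF tendsto_const[of 4] LIMSEQ_inverse_real_of_nat] by (simp add: divide_inverse)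
 have l2: "(%n. sqn mu (Ph n)) ----> (\<integral>x. 0 \<partial>mu)"
 proof (rule integral_dominated_convergence[where w="%x. (G x)^2"])
  show "(%x. (Ph n x)^2) : borel_measurable mu" for n using L2_meas[OF PhL2[of n]] by measurable
  show "integrable mu (%x. (G x)^2)" by (rule L2_int[OF GL2])
  show "AE x in mu. (%n. (Ph n x)^2) ----> 0"
   using AE_space
  proof eventually_elim
   case (elim x)
   hence "\<forall>\<^sub>F n in sequentially. x : Kn n" by (intro Kn_ev) (simp add: space_mu)
   hence "\<forall>\<^sub>F n in sequentially. (Ph n x)^2 = 0" by eventually_elim (simp add: Kn_def Ph0)
   thus ?case by (rule tendsto_eventually)
  qed
  show "AE x in mu. norm ((Ph n x)^2) <= (G x)^2" for n
  proof (rule AE_I2)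
   fix x show "norm ((Ph n x)^2) <= (G x)^2" using PhG[of n x] by (simp add: power_mono)
  qed
 qed simp
 define H where "H n x = G x - Ph n x" for n x
 have Hd: "dens A (H n) (%x. q x - p n x)" for n unfolding H_def[abs_def] by (rule dens_diff[OF G(1) p(1)])
 have H0: "0 <= H n x" "\<bar>H n x\<bar> <= \<bar>G x\<bar>" for n x using PhG[of n x] by (auto simp: H_def)
 have HL2: "H n : L2 mu" for n unfolding H_def[abs_def] by (rule L2_diff[OF GL2 PhL2])
 have Hbd: "bd A (H n)" for n by (rule bd_dom[OF G(4) H0(2)])
 have HM: "H n x = 0" if "ct n x = 0" for n x using that G(2)[of x] by (simp add: H_def Ph_def)
 have aH: "apx A (H n)" for n
 proof (rule apx_vanishing[OF A(2,3) Hd H0(1) HL2 Hbd])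
  assume *: "Lopen & ~ finL A"
  then obtain z where z: "z : E" "ALL x. x <= z --> fst (ll n) x = 0" using ll(5)[of n] by blast
  have "ct n x = 0" if "x <= z" for x
   using z(2) that ct01[of n x] rr(3)[of n x] by (simp add: ct_def)
  thus "EX z:E. ALL x:E. x <= z --> H n x = 0" using HM z(1) by blast
 next
  assume *: "Ropen & ~ finR A"
  then obtain z where z: "z : E" "ALL x. z <= x --> fst (rr n) x = 0" using rr(5)[of n] by blast
  have "ct n x = 0" if "z <= x" for x
   using z(2) that ct01[of n x] ll(3)[of n x] by (simp add: ct_def)
  thus "EX z:E. ALL x:E. z <= x --> H n x = 0" using HM z(1) by blast
 qed
 have E1H: "E1d f (H n) <= 1/2 * (2 * (\<integral>x. out n x * (q x)^2 \<partial>lborel) + 2 * M^2 * (4 / real (Suc n))) + sqn mu (Ph n)" for n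
 proof -
  have ae: "AE x in mu. f x - H n x = Ph n x" using G(3) by eventually_elim (simp add: H_def)
  have fH: "(%x. f x - H n x) : L2 mu" by (rule L2_diff[OF dom_L2[OF f] HL2])
  have "form (%x. f x - H n x) (%x. f x - H n x) <= 1/2 * sqn lborel (p n)"
   by (rule form_le_dens(2)[OF A(2,3) fH p(1) ae Phbd])
  moreover have "sqd mu f (H n) = sqn mu (Ph n)"
   by (rule L2_AE(2)[symmetric, OF fH L2_meas[OF PhL2] ae])
  moreover have "1/2 * sqn lborel (p n) <= 1/2 * (2 * (\<integral>x. out n x * (q x)^2 \<partial>lborel) + 2 * M^2 * (4 / real (Suc n)))"
   by (rule mult_left_mono[OF pi]) simp
  ultimately show ?thesis unfolding E1_def by linarith
 qed
 have E1lim: "(%n. E1d f (H n)) ----> 0"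
 proof (rule tendsto_sandwich[OF _ _ tendsto_const])
  show "\<forall>\<^sub>F n in sequentially. 0 <= E1d f (H n)" using E1_nonneg by simp
  show "\<forall>\<^sub>F n in sequentially. E1d f (H n) <= 1/2 * (2 * (\<integral>x. out n x * (q x)^2 \<partial>lborel) + 2 * M^2 * (4 / real (Suc n))) + sqn mu (Ph n)"
   using E1H by (intro always_eventually allI)
  have "(%n. 1/2 * (2 * (\<integral>x. out n x * (q x)^2 \<partial>lborel) + 2 * M^2 * (4 / real (Suc n))) + sqn mu (Ph n))
   ----> 1/2 * (2 * (\<integral>x. 0 \<partial>(lborel :: real measure)) + 2 * M^2 * 0) + (\<integral>x. 0 \<partial>mu)"
   by (intro tendsto_add tendsto_mult tendsto_const l1 l2 l1s)
  thus "(%n. 1/2 * (2 * (\<integral>x. out n x * (q x)^2 \<partial>lborel) + 2 * M^2 * (4 / real (Suc n))) + sqn mu (Ph n)) ----> 0" by simp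
 qed
 show ?thesis
 proof (rule apx_limit[OF A(3) f])
  fix e :: real assume "e > 0"
  hence "\<forall>\<^sub>F n in sequentially. E1d f (H n) < e" by (rule order_tendstoD[OF E1lim])
  then obtain n where "E1d f (H n) < e" unfolding eventually_sequentially by blast
  thus "EX h. apx A h & E1d f h < e" using aH by blast
 qed
qed

lemma apx_pos:
 assumes A: "A : sets borel" "gapU <= A" "A <= I" and f: "f : dom A" and f0: "!!x. 0 <= f x"
 shows "apx A f"
proof (rule apx_limit[OF A(3) f])
 fix e :: real assume e: "e > 0"
 have "(%n. E1 mu form (%x. max 0 (f x - real n))) ----> 0" by (rule E1_excess_small[OF A(2,3) f f0])
 hence "\<forall>\<^sub>F n in sequentially. E1 mu form (%x. max 0 (f x - real n)) < e" using e by (rule order_tendstoD)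
 then obtain n where n: "E1 mu form (%x. max 0 (f x - real n)) < e" unfolding eventually_sequentially by blast
 let ?T = "%t. min t (real n)"
 have Td: "(%x. ?T (f x)) : dom A" by (rule dom_contraction(1)[OF A(2,3) f]) (auto simp: min_def)
 have "apx A (%x. ?T (f x))" by (rule apx_bounded[OF A Td, of "real n"]) (use f0 in auto)
 moreover have "(%x. f x - ?T (f x)) = (%x. max 0 (f x - real n))" by (auto simp: min_def max_def)
 ultimately show "EX h. apx A h & E1d f h < e" using n by (intro exI[of _ "%x. ?T (f x)"]) simp
qed

theorem dom_apx:
 assumes A: "A : sets borel" "gapU <= A" "A <= I" and f: "f : dom A"
 shows "apx A f"
proof -
 have "(%x. max 0 (f x)) : dom A" by (rule dom_contraction(1)[OF A(2,3) f]) (auto simp: max_def)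
 hence 1: "apx A (%x. max 0 (f x))" by (rule apx_pos[OF A]) simp
 have "(%x. max 0 (- f x)) : dom A" by (rule dom_contraction(1)[where T="%t. max 0 (- t)", OF A(2,3) f]) (auto simp: max_def)
 hence 2: "apx A (%x. max 0 (- f x))" by (rule apx_pos[OF A]) simp
 have "(%x. max 0 (f x) - max 0 (- f x)) = f" by (auto simp: max_def)
 thus ?thesis using apx_diff[OF A(3) 1 2] by simp
qed

end

section \<open>Uniform approximation on \<open>E\<close> and density in L2\<close>

context qd_space
begin

lemma left_margin: "EX N. ALL n>=N. (Lopen --> el n < el n0) & (~ Lopen --> (ALL x:I. el n <= x))"
proof (cases Lopen)
 case True
 obtain y where y: "y : E" "y < el n0" using Lopen_below[OF True el_I] by blast
 obtain N where N: "ALL n>=N. el n <= y & y <= er n" using exh_I[OF E_sub_I[OF y(1)]] by blast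
 have "el n < el n0" if "n >= N" for n using N that y by force
 thus ?thesis using True by blast
next
 case False
 then obtain m where m: "m : E" "ALL x:I. m <= x" using not_Lopen by blast
 obtain N where N: "ALL n>=N. el n <= m & m <= er n" using exh_I[OF E_sub_I[OF m(1)]] by blast
 have "ALL x:I. el n <= x" if "n >= N" for n using N that m by force
 thus ?thesis using False by blast
qed

lemma right_margin: "EX N. ALL n>=N. (Ropen --> er n0 < er n) & (~ Ropen --> (ALL x:I. x <= er n))"
proof (cases Ropen)
 case True
 obtain y where y: "y : E" "er n0 < y" using Ropen_above[OF True er_I] by blast
 obtain N where N: "ALL n>=N. el n <= y & y <= er n" using exh_I[OF E_sub_I[OF y(1)]] by blast
 have "er n0 < er n" if "n >= N" for n using N that y by force
 thus ?thesis using True by blast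
next
 case False
 then obtain m where m: "m : E" "ALL x:I. x <= m" using not_Ropen by blast
 obtain N where N: "ALL n>=N. el n <= m & m <= er n" using exh_I[OF E_sub_I[OF m(1)]] by blast
 have "ALL x:I. x <= er n" if "n >= N" for n using N that m by force
 thus ?thesis using False by blast
qed

text \<open>At an open end the window extends strictly beyond the support, so \<open>f\<close>
  vanishes at the end point of the window itself and can be cut there; at a closed end the window
  reaches the end of \<open>I\<close>.\<close>

lemma Cc_window:
 assumes "f : Cc_on E"
 obtains n where "Lopen ==> ALL x:E. x <= el n --> f x = 0" "~ Lopen ==> ALL x:I. el n <= x"
  "Ropen ==> ALL x:E. er n <= x --> f x = 0" "~ Ropen ==> ALL x:I. x <= er n"
proof -
 obtain K where K: "compact K" "K <= E" "ALL x:E - K. f x = 0" using assms by (auto simp: Cc_on_def)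
 obtain n0 where n0: "K <= {el n0..er n0}" by (rule compact_sub_exh[OF K(1,2)])
 obtain N1 where N1: "ALL n>=N1. (Lopen --> el n < el n0) & (~ Lopen --> (ALL x:I. el n <= x))" using left_margin by blast
 obtain N2 where N2: "ALL n>=N2. (Ropen --> er n0 < er n) & (~ Ropen --> (ALL x:I. x <= er n))" using right_margin by blast
 define n where "n = max N1 N2"
 have f0: "f x = 0" if "x : E" "x < el n0 | er n0 < x" for x using K(3) n0 that by force
 show ?thesis
 proof (rule that[of n])
  assume Lopen
  hence "el n < el n0" using N1 by (simp add: n_def)
  thus "ALL x:E. x <= el n --> f x = 0" using f0 by force
 next
  assume "~ Lopen" thus "ALL x:I. el n <= x" using N1 by (simp add: n_def)
 next
  assume Ropen
  hence "er n0 < er n" using N2 by (simp add: n_def)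
  thus "ALL x:E. er n <= x --> f x = 0" using f0 by force
 next
  assume "~ Ropen" thus "ALL x:I. x <= er n" using N2 by (simp add: n_def)
 qed
qed

lemma polynomial_Lipschitz:
 assumes p: "real_polynomial_function p"
 shows "EX L>=0. ALL s:{a..b}. ALL t:{a..b}. \<bar>p s - p t\<bar> <= L * \<bar>s - t\<bar>"
proof -
 obtain p' where p': "real_polynomial_function p'" "!!x. (p has_real_derivative p' x) (at x)"
  using has_real_derivative_polynomial_function[OF p] by blast
 have "continuous_on {a..b} p'"
  using continuous_on_polymonial_function[of p'] p'(1) by (simp add: real_polynomial_function_eq)
 hence "bounded (p' ` {a..b})" by (intro compact_imp_bounded compact_continuous_image) auto
 then obtain L where L: "L > 0" "ALL x:{a..b}. \<bar>p' x\<bar> <= L" by (auto simp: bounded_pos)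
 have *: "\<bar>p t - p s\<bar> <= L * \<bar>t - s\<bar>" if st: "s : {a..b}" "t : {a..b}" "s < t" for s t
 proof -
  obtain z where z: "s < z" "z < t" "p t - p s = (t - s) * p' z"
   using MVT2[of s t p p'] st(3) p'(2) by blast
  have "\<bar>p' z\<bar> <= L" using L z st by auto
  hence "\<bar>t - s\<bar> * \<bar>p' z\<bar> <= \<bar>t - s\<bar> * L" by (rule mult_left_mono) simp
  thus ?thesis by (simp add: z(3) abs_mult mult.commute)
 qed
 have "\<bar>p s - p t\<bar> <= L * \<bar>s - t\<bar>" if "s : {a..b}" "t : {a..b}" for s t
  using *[of s t] *[of t s] that by (cases s t rule: linorder_cases) (auto simp: abs_minus_commute)
 thus ?thesis using L(1) by (intro exI[of _ L]) auto
qed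

text \<open>In the coordinate \<open>sg\<close>, the measure of \<open>A\<close> counted from the
  left end of the window, \<open>f\<close> becomes a continuous function on a compact set;
  admissibility makes \<open>sg\<close> injective. A polynomial in \<open>sg\<close> is Lipschitz in
  \<open>sg\<close>, so its increments are dominated by a multiple of the measure of
  \<open>A\<close>, which yields a density living on \<open>A\<close>.\<close>

lemma uniform_approx:
 assumes A: "adm A" and f: "f : Cc_on E" and e: "e > 0"
 shows "EX g:dom A Int Cc_on E. ALL x:E. \<bar>f x - g x\<bar> < e & (f x = 0 --> g x = 0)"
proof -
 note A' = admD[OF A]
 obtain n where n: "Lopen ==> ALL x:E. x <= el n --> f x = 0" "~ Lopen ==> ALL x:I. el n <= x"
  "Ropen ==> ALL x:E. er n <= x --> f x = 0" "~ Ropen ==> ALL x:I. x <= er n"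
  using Cc_window[OF f] by blast
 define al be where "al = el n" and "be = er n"
 have ab: "al : E" "be : E" "al < be" "al : I" "be : I" using el_E er_E el_er E_sub_I by (auto simp: al_def be_def)
 define k0 where "k0 = (indicator (A Int {al..be}) :: real => real)"
 have k0f: "emeasure lborel (A Int {al..be}) < \<infinity>"
  by (rule le_less_trans[OF emeasure_mono[of _ "{al..be}"]]) (auto simp: emeasure_lborel_Icc_eq)
 have k0L: "L2r k0" unfolding k0_def by (rule L2r_indicator_finite) (use A' k0f in auto)
 have k0A: "k0 x = 0" if "x ~: A" for x using that by (simp add: k0_def)
 define sg where "sg y = 0 + (if al <= y then pint k0 al y else - pint k0 y al)" for y
 have sgd: "dens A sg k0" unfolding sg_def[abs_def] by (rule dens_of_L2[OF k0L k0A])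
 have k0m: "k0 : borel_measurable borel" by (rule L2r_meas[OF k0L])
 have sgal: "sg al = 0"
 proof -
  have "pint k0 al al = (LBINT t:{al<..<al}. k0 t)" by (rule pint_Ioo[OF k0m])
  thus ?thesis by (simp add: sg_def set_lebesgue_integral_def)
 qed
 have sgl: "sg x = sg al" if "x : I" "x <= al" for x
 proof -
  have "sg al - sg x = (LBINT t:{x<..<al}. k0 t)" using densD(3)[OF sgd that(1) ab(4) that(2)] pint_Ioo[OF k0m] by simp
  also have "\<dots> = (LBINT t:{x<..<al}. 0)" by (rule set_integral_cong') (simp add: k0_def)
  finally show ?thesis by (simp add: set_lebesgue_integral_def)
 qed
 have sgr: "sg x = sg be" if "x : I" "be <= x" for x
 proof -
  have "sg x - sg be = (LBINT t:{be<..<x}. k0 t)" using densD(3)[OF sgd ab(5) that] pint_Ioo[OF k0m] by simp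
  also have "\<dots> = (LBINT t:{be<..<x}. 0)" by (rule set_integral_cong') (simp add: k0_def)
  finally show ?thesis by (simp add: set_lebesgue_integral_def)
 qed
 have sgdiff: "sg y - sg x = measure lborel (A Int {x..y})" if "al <= x" "x <= y" "y <= be" for x y
 proof -
  have "x : I" "y : I" using I_convex[OF ab(4,5)] that by auto
  hence "sg y - sg x = pint k0 x y" using densD(3)[OF sgd] that by simp
  also have "\<dots> = (\<integral>t. indicator (A Int {x..y}) t \<partial>lborel)"
   unfolding set_lebesgue_integral_def by (rule Bochner_Integration.integral_cong) (use that in \<open>auto simp: k0_def indicator_def\<close>)
  finally show ?thesis by simp
 qed
 have sgstrict: "sg x < sg y" if "al <= x" "x < y" "y <= be" for x y
 proof -
  have xy: "x : I" "y : I" using I_convex[OF ab(4,5)] that by auto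
  have "0 < emeasure lborel (A Int {x..y})" using A xy that by (simp add: adm_def)
  moreover have "emeasure lborel (A Int {x..y}) < \<infinity>"
   by (rule le_less_trans[OF emeasure_mono[of _ "{x..y}"]]) (auto simp: emeasure_lborel_Icc_eq)
  ultimately have "0 < measure lborel (A Int {x..y})" unfolding measure_def by (simp add: enn2real_positive_iff)
  thus ?thesis using sgdiff[of x y] that by simp
 qed
 have inj: "inj_on sg (Kn n)"
 proof (rule inj_onI)
  fix x y assume xy: "x : Kn n" "y : Kn n" "sg x = sg y"
  thus "x = y" using sgstrict[of x y] sgstrict[of y x] by (cases x y rule: linorder_cases) (auto simp: Kn_def al_def be_def)
 qed
 define ta where "ta = inv_into (Kn n) sg"
 have ta: "ta (sg x) = x" if "x : Kn n" for x unfolding ta_def by (rule inv_into_f_f[OF inj that])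
 have sgc: "continuous_on (Kn n) sg" by (rule continuous_on_subset[OF dens_cont_E[OF sgd] Kn_sub])
 have cta: "continuous_on (sg ` Kn n) ta" by (rule continuous_on_inv[OF sgc Kn_compact]) (use ta in blast)
 have fc: "continuous_on (Kn n) f" using f Kn_sub unfolding Cc_on_def by (auto intro: continuous_on_subset)
 have taim: "ta ` sg ` Kn n = Kn n" using ta by force
 have cf: "continuous_on (sg ` Kn n) (%y. f (ta y))"
  by (rule continuous_on_compose2[OF fc cta]) (use taim in blast)
 have cS: "compact (sg ` Kn n)" by (rule compact_continuous_image[OF sgc Kn_compact])
 define ep where "ep = e / 3"
 have ep: "ep > 0" using e by (simp add: ep_def)
 obtain p where p: "real_polynomial_function p" "!!y. y : sg ` Kn n ==> \<bar>f (ta y) - p y\<bar> < ep"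
  using Stone_Weierstrass_real_polynomial_function[OF cS cf ep] by blast
 have pf: "\<bar>f x - p (sg x)\<bar> < ep" if "x : Kn n" for x using p(2)[of "sg x"] ta[OF that] that by simp
 obtain L where L: "L >= 0" "ALL s:{0..sg be}. ALL t:{0..sg be}. \<bar>p s - p t\<bar> <= L * \<bar>s - t\<bar>" using polynomial_Lipschitz[OF p(1)] by blast
 have sgrng: "sg x : {0..sg be}" if "x : I" for x
 proof -
  consider "x <= al" | "al <= x" "x <= be" | "be <= x" by linarith
  thus ?thesis
  proof cases
   case 1
   thus ?thesis using sgl[OF that] sgal sgstrict[of al be] ab by simp
  next
   case 2
   have "0 <= sg x - sg al" using 2 sgdiff[of al x] by simp
   moreover have "0 <= sg be - sg x" using 2 sgdiff[of x be] by simp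
   ultimately show ?thesis using sgal by simp
  next
   case 3
   thus ?thesis using sgr[OF that] sgal sgstrict[of al be] ab by simp
  qed
 qed
 \<comment> \<open>Soft threshold: a contraction that moves values by at most \<open>ep\<close> and
   kills the polynomial where \<open>f\<close> is 0, since its values there are below
   \<open>ep\<close>. The total error stays below \<open>2 * ep\<close>, hence below
   \<open>e\<close>.\<close>
 define th where "th t = max 0 (t - ep) - max 0 (- t - ep)" for t
 have thL: "\<bar>th s - th t\<bar> <= \<bar>s - t\<bar>" for s t using ep by (auto simp: th_def max_def)
 have th0: "th t = 0" if "\<bar>t\<bar> < ep" for t using that by (auto simp: th_def max_def)
 have thid: "\<bar>th t - t\<bar> <= ep" for t using ep by (auto simp: th_def max_def)
 define Ph where "Ph x = th (p (sg x))" for x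
 have m: "L2r (%t. L * k0 t)" by (rule L2r_cmult[OF k0L])
 have m0: "0 <= L * k0 t" for t using L(1) by (simp add: k0_def)
 have mA: "L * k0 t = 0" if "t ~: A" for t using k0A[OF that] by simp
 have bnd: "\<bar>Ph y - Ph x\<bar> <= pint (%t. L * k0 t) x y" if xy: "x : I" "y : I" "x <= y" for x y
 proof -
  have "\<bar>Ph y - Ph x\<bar> <= \<bar>p (sg y) - p (sg x)\<bar>" unfolding Ph_def by (rule thL)
  also have "\<dots> <= L * \<bar>sg y - sg x\<bar>" using L(2) sgrng[OF xy(1)] sgrng[OF xy(2)] by blast
  also have "sg y - sg x = pint k0 x y" by (rule densD(3)[OF sgd xy])
  also have "\<bar>pint k0 x y\<bar> = pint k0 x y"
   unfolding set_lebesgue_integral_def by (rule abs_of_nonneg, rule integral_nonneg_AE) (simp add: k0_def)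
  finally show ?thesis by simp
 qed
 obtain q where q: "dens A Ph q" using dens_of_bound[OF m m0 mA bnd] by blast
 have z: "Ph x = 0" if x: "x : E" "f x = 0" for x
 proof -
  have in0: "Ph x = 0" if "x : Kn n" "f x = 0" for x
   unfolding Ph_def by (rule th0) (use pf[OF that(1)] that(2) in simp)
  have aK: "al : Kn n" "be : Kn n" using ab by (auto simp: Kn_def al_def be_def)
  consider "x : Kn n" | "x < al" | "be < x" using x(1) by (force simp: Kn_def al_def be_def)
  thus ?thesis
  proof cases
   case 1
   thus ?thesis using in0 x by blast
  next
   case 2
   hence "Lopen" using n(2) E_sub_I[OF x(1)] unfolding al_def by force
   hence "f al = 0" using n(1) ab by (simp add: al_def)
   hence "Ph al = 0" using in0[OF aK(1)] by simp
   thus ?thesis using sgl[OF E_sub_I[OF x(1)]] 2 by (simp add: Ph_def)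
  next
   case 3
   hence "Ropen" using n(4) E_sub_I[OF x(1)] unfolding be_def by force
   hence "f be = 0" using n(3) ab by (simp add: be_def)
   hence "Ph be = 0" using in0[OF aK(2)] by simp
   thus ?thesis using sgr[OF E_sub_I[OF x(1)]] 3 by (simp add: Ph_def)
  qed
 qed
 have near: "\<bar>f x - Ph x\<bar> < e" if x: "x : E" for x
 proof (cases "x : Kn n")
  case True
  have "\<bar>f x - p (sg x)\<bar> < ep" by (rule pf[OF True])
  moreover have "\<bar>Ph x - p (sg x)\<bar> <= ep" unfolding Ph_def by (rule thid)
  ultimately show ?thesis using e unfolding ep_def by linarith
 next
  case False
  hence "x < al | be < x" using x by (force simp: Kn_def al_def be_def)
  hence "f x = 0"
  proof
   assume 2: "x < al"
   hence "Lopen" using n(2) E_sub_I[OF x] unfolding al_def by force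
   thus ?thesis using n(1) x 2 by (simp add: al_def)
  next
   assume 3: "be < x"
   hence "Ropen" using n(4) E_sub_I[OF x] unfolding be_def by force
   thus ?thesis using n(3) x 3 by (simp add: be_def)
  qed
  thus ?thesis using z[OF x] e by simp
 qed
 have l: "EX a:E. ALL x:E. x <= a --> Ph x = 0" if Lopen
  using n(1)[OF that] z ab(1) unfolding al_def by blast
 have r: "EX a:E. ALL x:E. a <= x --> Ph x = 0" if Ropen
  using n(3)[OF that] z ab(2) unfolding be_def by blast
 have "Ph : dom A Int Cc_on E" using Cc_dom(1,4)[OF A'(2,3) q l r] by blast
 thus ?thesis using near z by blast
qed

lemma L2_triangle:
 assumes f: "f : L2 mu" and g: "g : L2 mu" and h: "h : L2 mu"
 shows "sqd mu f h <= 2 * sqd mu f g + 2 * sqd mu g h"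
proof -
 have i: "integrable mu (%x. (f x - g x)^2)" "integrable mu (%x. (g x - h x)^2)" "integrable mu (%x. (f x - h x)^2)"
  using L2_int[OF L2_diff[OF f g]] L2_int[OF L2_diff[OF g h]] L2_int[OF L2_diff[OF f h]] by auto
 have "sqd mu f h <= (\<integral>x. 2 * (f x - g x)^2 + 2 * (g x - h x)^2 \<partial>mu)"
 proof (rule integral_mono[OF i(3)])
  show "integrable mu (%x. 2 * (f x - g x)^2 + 2 * (g x - h x)^2)" using i by simp
  show "(f x - h x)^2 <= 2 * (f x - g x)^2 + 2 * (g x - h x)^2" for x
   using zero_le_power2[of "f x - 2 * g x + h x"] by (simp add: power2_eq_square algebra_simps)
 qed
 thus ?thesis using i by simp
qed

definition apL :: "real set => (real => real) => bool" where
 "apL A f \<longleftrightarrow> f : L2 mu & (ALL e>0. EX g:dom A. sqd mu f g < e)"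

lemma apL_limit:
 assumes f: "f : L2 mu" and h: "!!e. e > 0 ==> EX h. apL A h & sqd mu f h < e"
 shows "apL A f"
 unfolding apL_def
proof (intro conjI f allI impI)
 fix e :: real assume e: "e > 0"
 hence e4: "e/4 > 0" by simp
 obtain h where h: "apL A h" "sqd mu f h < e/4" using h[OF e4] by blast
 obtain w where w: "w : dom A" "sqd mu h w < e/4" using h(1) e4 unfolding apL_def by blast
 have "h : L2 mu" using h(1) by (simp add: apL_def)
 hence "sqd mu f w < e" using L2_triangle[OF f _ dom_L2[OF w(1)], of h] h(2) w(2) by linarith
 thus "EX g:dom A. sqd mu f g < e" using w(1) by blast
qed

lemma apL_seq:
 assumes f: "f : L2 mu" and h: "!!n. apL A (h n)" and l: "(%n. sqd mu f (h n)) ----> 0"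
 shows "apL A f"
proof (rule apL_limit[OF f])
 fix e :: real assume "e > 0"
 hence "\<forall>\<^sub>F n in sequentially. sqd mu f (h n) < e" by (rule order_tendstoD[OF l])
 then obtain n where "sqd mu f (h n) < e" unfolding eventually_sequentially by blast
 thus "EX h. apL A h & sqd mu f h < e" using h by blast
qed

lemma apL_dom:
 assumes w: "integrable mu w" and f: "f : L2 mu" and h: "!!n. apL A (h n)"
  and c: "!!x. x : E ==> (%n. h n x) ----> f x" and b: "!!n x. x : E ==> (f x - h n x)^2 <= w x"
 shows "apL A f"
proof (rule apL_seq[OF f h])
 have hL: "h n : L2 mu" for n using h by (simp add: apL_def)
 have "(%n. sqd mu f (h n)) ----> (\<integral>x. 0 \<partial>mu)"
 proof (rule integral_dominated_convergence[where w=w])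
  show "(%x. (f x - h n x)^2) : borel_measurable mu" for n using L2_meas[OF L2_diff[OF f hL[of n]]] by measurable
  show "AE x in mu. (%n. (f x - h n x)^2) ----> 0"
  proof (rule AE_I2)
   fix x assume "x : space mu"
   hence "(%n. (f x - h n x)^2) ----> (f x - f x)^2" by (intro tendsto_power tendsto_diff tendsto_const c) (simp add: space_mu)
   thus "(%n. (f x - h n x)^2) ----> 0" by simp
  qed
  show "AE x in mu. norm ((f x - h n x)^2) <= w x" for n by (rule AE_I2) (use b in \<open>simp add: space_mu\<close>)
 qed (use w in auto)
 thus "(%n. sqd mu f (h n)) ----> 0" by simp
qed

lemma apL_add:
 assumes f: "apL A f" and g: "apL A g" shows "apL A (%x. f x + g x)"
 unfolding apL_def
proof (intro conjI allI impI)
 have L: "f : L2 mu" "g : L2 mu" using f g by (auto simp: apL_def)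
 show "(%x. f x + g x) : L2 mu" by (rule L2_add[OF L])
 fix e :: real assume e: "e > 0"
 hence e4: "e/4 > 0" by simp
 obtain u where u: "u : dom A" "sqd mu f u < e/4" using f e4 unfolding apL_def by blast
 obtain v where v: "v : dom A" "sqd mu g v < e/4" using g e4 unfolding apL_def by blast
 have "(\<integral>x. ((f x + g x) - (u x + v x))^2 \<partial>mu) <= 2 * (\<integral>x. ((f x + g x) - (u x + g x))^2 \<partial>mu) + 2 * (\<integral>x. ((u x + g x) - (u x + v x))^2 \<partial>mu)"
  by (rule L2_triangle[OF L2_add[OF L] L2_add[OF dom_L2[OF u(1)] L(2)] L2_add[OF dom_L2[OF u(1)] dom_L2[OF v(1)]]])
 hence "(\<integral>x. ((f x + g x) - (u x + v x))^2 \<partial>mu) < e" using u(2) v(2) by simp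
 thus "EX h:dom A. (\<integral>x. (f x + g x - h x)^2 \<partial>mu) < e" using dom_add[OF u(1) v(1)] by (intro bexI[of _ "%x. u x + v x"]) auto
qed

lemma apL_cmult:
 assumes f: "apL A f" shows "apL A (%x. c * f x)"
 unfolding apL_def
proof (intro conjI allI impI)
 have L: "f : L2 mu" using f by (auto simp: apL_def)
 show "(%x. c * f x) : L2 mu" by (rule L2_cmult[OF L])
 fix e :: real assume e: "e > 0"
 hence e4: "e / (c^2 + 1) > 0" by (simp add: add_nonneg_pos)
 obtain u where u: "u : dom A" "sqd mu f u < e / (c^2 + 1)" using f e4 unfolding apL_def by blast
 define X where "X = sqd mu f u"
 have X: "0 <= X" "X * (c^2 + 1) < e" using u(2) by (simp_all add: X_def pos_less_divide_eq add_nonneg_pos)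
 have "(%x. (c * f x - c * u x)^2) = (%x. c^2 * (f x - u x)^2)" by (simp add: right_diff_distrib[symmetric] power_mult_distrib)
 hence "(\<integral>x. (c * f x - c * u x)^2 \<partial>mu) = c^2 * X" by (simp add: X_def)
 also have "\<dots> <= X * (c^2 + 1)" using X(1) by (simp add: algebra_simps)
 finally have "(\<integral>x. (c * f x - c * u x)^2 \<partial>mu) < e" using X(2) by linarith
 thus "EX h:dom A. (\<integral>x. (c * f x - h x)^2 \<partial>mu) < e" using dom_cmult[OF u(1)] by (intro bexI[of _ "%x. c * u x"]) auto
qed

lemma apL_zero: "apL A (%_. 0)"
 unfolding apL_def using dom_zero dom_L2[OF dom_zero] by (intro conjI allI impI bexI[of _ "%_. 0"]) auto

lemma apL_sum: "finite S ==> (!!i. i : S ==> apL A (f i)) ==> apL A (%x. \<Sum>i\<in>S. f i x)"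
proof (induction S rule: finite_induct)
 case empty
 thus ?case using apL_zero by simp
next
 case (insert i S)
 thus ?case using apL_add[of A "f i" "%x. \<Sum>i\<in>S. f i x"] by simp
qed

text \<open>Uniform closeness controls the L2 distance only over a set of finite measure. That the
  approximant vanishes wherever \<open>f\<close> does confines the error to the compact set
  \<open>K\<close>.\<close>

lemma apL_Cc:
 assumes A: "adm A" and f: "f : Cc_on E" shows "apL A f"
 unfolding apL_def
proof (intro conjI allI impI)
 show fL: "f : L2 mu" by (rule Cc_L2[OF f])
 obtain K where K: "compact K" "K <= E" "ALL x:E - K. f x = 0" using f by (auto simp: Cc_on_def)
 have KS: "K : sets mu" using sets_mu_Int[OF borel_compact[OF K(1)]] K(2) by (simp add: Int_absorb1)
 have Kf: "emeasure mu K < \<infinity>" using rad K unfolding radon_on_def by blast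
 fix e :: real assume e: "e > 0"
 define M where "M = measure mu K"
 have M: "M >= 0" by (simp add: M_def)
 define d where "d = sqrt (e / (M + 1))"
 have d: "d > 0" "d^2 = e / (M + 1)" using e M by (simp_all add: d_def)
 obtain g where g: "g : dom A" "g : Cc_on E" "ALL x:E. \<bar>f x - g x\<bar> < d & (f x = 0 --> g x = 0)"
  using uniform_approx[OF A f d(1)] by blast
 have "sqd mu f g <= (\<integral>x. d^2 * indicator K x \<partial>mu)"
 proof (rule integral_mono)
  show "integrable mu (%x. (f x - g x)^2)" by (rule L2_int[OF L2_diff[OF fL dom_L2[OF g(1)]]])
  show "integrable mu (%x. d^2 * indicator K x)" by (intro integrable_mult_right integrable_real_indicator KS Kf)
  fix x assume "x : space mu"
  hence x: "x : E" by (simp add: space_mu)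
  show "(f x - g x)^2 <= d^2 * indicator K x"
  proof (cases "x : K")
   case True
   have "\<bar>f x - g x\<bar> <= \<bar>d\<bar>" using g(3) x by force
   thus ?thesis using True by (simp add: abs_le_square_iff)
  next
   case False
   hence "f x = 0" using K x by blast
   thus ?thesis using g(3) x by simp
  qed
 qed
 also have "\<dots> = e / (M + 1) * M" using K(2) by (simp add: d(2) M_def space_mu Int_absorb2)
 also have "\<dots> < e" using e M by (simp add: divide_less_eq)
 finally show "EX g:dom A. sqd mu f g < e" using g(1) by blast
qed

lemma ind_L2: "B : sets mu ==> B <= Kn n ==> indicator B : L2 mu"
proof -
 assume B: "B : sets mu" "B <= Kn n"
 have "emeasure mu B < \<infinity>" by (rule le_less_trans[OF emeasure_mono[OF B(2) Kn_sets] Kn_finite])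
 hence "integrable mu (indicator B :: real => real)" by (intro integrable_real_indicator B)
 thus ?thesis using B(1) by (intro L2_I) (auto simp: power2_eq_square indicator_inter_arith[symmetric])
qed

text \<open>At an open end a later window leaves room beyond this one. At a closed end no point of
  \<open>E\<close> lies beyond a later window, and the margin 1 is arbitrary.\<close>

lemma Kn_neighbourhood: "EX dl>0. EX N. ALL t:E. el n - dl <= t & t <= er n + dl --> t : Kn N"
proof -
 obtain N1 where N1: "ALL m>=N1. (Lopen --> el m < el n) & (~ Lopen --> (ALL x:I. el m <= x))" using left_margin by blast
 obtain N2 where N2: "ALL m>=N2. (Ropen --> er n < er m) & (~ Ropen --> (ALL x:I. x <= er m))" using right_margin by blast
 define N where "N = max N1 N2"
 define d1 where "d1 = (if Lopen then el n - el N else 1)"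
 define d2 where "d2 = (if Ropen then er N - er n else 1)"
 have d: "d1 > 0" "d2 > 0" using N1 N2 by (auto simp: d1_def d2_def N_def)
 have "t : Kn N" if t: "t : E" "el n - min d1 d2 <= t" "t <= er n + min d1 d2" for t
 proof -
  have "el N <= t"
  proof (cases Lopen)
   case True
   thus ?thesis using t(2) by (auto simp: d1_def)
  next
   case False
   thus ?thesis using N1 E_sub_I[OF t(1)] by (simp add: N_def)
  qed
  moreover have "t <= er N"
  proof (cases Ropen)
   case True
   thus ?thesis using t(3) by (auto simp: d2_def)
  next
   case False
   thus ?thesis using N2 E_sub_I[OF t(1)] by (simp add: N_def)
  qed
  ultimately show ?thesis using t(1) by (simp add: Kn_def)
 qed
 thus ?thesis using d by (intro exI[of _ "min d1 d2"] conjI exI[of _ N]) auto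
qed

text \<open>Continuous functions that fall off with the distance to \<open>C\<close> at rate
  \<open>(j + 1) / dl\<close> tend to the indicator; this normalization makes all of them vanish
  outside one window of finite measure.\<close>

lemma apL_compact:
 assumes A: "adm A" and C: "compact C" "C <= Kn n" shows "apL A (indicator C)"
proof (cases "C = {}")
 case True
 hence "indicator C = (%_. 0 :: real)" by (simp add: fun_eq_iff)
 thus ?thesis using apL_zero by simp
next
 case False
 obtain dl N where dl: "dl > 0" "!!t. t : E ==> el n - dl <= t ==> t <= er n + dl ==> t : Kn N" using Kn_neighbourhood by blast
 define ph where "ph j t = max 0 (1 - (real j + 1) / dl * infdist t C)" for j :: nat and t
 have near: "t : Kn N" if t: "t : E" "infdist t C <= dl" for t
 proof -
  obtain c where c: "c : C" "infdist t C = dist t c" using infdist_attains_inf[OF compact_imp_closed[OF C(1)] False] by blast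
  hence "el n <= c" "c <= er n" "\<bar>t - c\<bar> <= dl" using C(2) t(2) by (auto simp: Kn_def dist_real_def)
  thus ?thesis by (intro dl(2) t(1)) auto
 qed
 have ph0: "ph j t = 0" if t: "t : E" "t ~: Kn N" for j t
 proof -
  have "dl < infdist t C" using near t by force
  hence "1 * dl <= (real j + 1) * infdist t C" using dl(1) by (intro mult_mono) auto
  hence "1 <= (real j + 1) / dl * infdist t C" using dl(1) by (simp add: field_simps)
  thus ?thesis by (simp add: ph_def)
 qed
 have phC: "ph j : Cc_on E" for j
 proof -
  have "continuous_on E (ph j)" unfolding ph_def by (intro continuous_intros)
  moreover have "ALL x:E - Kn N. ph j x = 0" using ph0 by simp
  ultimately show ?thesis unfolding Cc_on_def using Kn_compact[of N] Kn_sub[of N] by (intro CollectI conjI exI[of _ "Kn N"])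
 qed
 have ph01: "0 <= ph j t & ph j t <= 1" for j t using dl(1) infdist_nonneg[of t C] by (auto simp: ph_def)
 have CKN: "C <= Kn N"
 proof
  fix x assume "x : C"
  hence "x : E" "el n <= x" "x <= er n" using C(2) by (auto simp: Kn_def)
  thus "x : Kn N" using dl(1) by (intro dl(2)) auto
 qed
 have CS: "C : sets mu"
 proof -
  have "C <= E" using C(2) Kn_sub by blast
  thus ?thesis using sets_mu_Int[OF borel_compact[OF C(1)]] by (simp add: Int_absorb1)
 qed
 show ?thesis
 proof (rule apL_dom[where w="indicator (Kn N)" and h=ph])
  show "integrable mu (indicator (Kn N) :: real => real)" by (rule integrable_real_indicator[OF Kn_sets Kn_finite])
  show "indicator C : L2 mu" by (rule ind_L2[OF CS C(2)])
  show "apL A (ph j)" for j by (rule apL_Cc[OF A phC])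
  show "(%j. ph j x) ----> indicator C x" if "x : E" for x
  proof (cases "x : C")
   case True
   thus ?thesis by (simp add: ph_def)
  next
   case False
   hence "infdist x C > 0" using in_closed_iff_infdist_zero[OF compact_imp_closed[OF C(1)] \<open>C ~= {}\<close>, of x] infdist_nonneg[of x C] by simp
   hence p: "infdist x C / dl > 0" using dl(1) by simp
   obtain J where J: "1 / (infdist x C / dl) < real J" using reals_Archimedean2 by blast
   have "ph j x = 0" if "j >= J" for j
   proof -
    have "1 / (infdist x C / dl) < real j + 1" using J that by linarith
    hence "1 < (real j + 1) * (infdist x C / dl)" using p by (simp only: pos_divide_less_eq)
    hence "1 < (real j + 1) / dl * infdist x C" by (simp only: times_divide_eq_left times_divide_eq_right)
    thus ?thesis by (simp add: ph_def)
   qed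
   hence "\<forall>\<^sub>F j in sequentially. ph j x = indicator C x" using False unfolding eventually_sequentially by auto
   thus ?thesis by (rule tendsto_eventually)
  qed
  show "(indicator C x - ph j x)^2 <= indicator (Kn N) x" if "x : E" for j x
  proof (cases "x : Kn N")
   case True
   have "\<bar>indicator C x - ph j x\<bar> <= 1" using ph01[of j x] by (auto simp: indicator_def)
   hence "(indicator C x - ph j x)^2 <= 1" by (simp add: abs_square_le_1)
   thus ?thesis using True by simp
  next
   case False
   thus ?thesis using ph0[OF that False] CKN by (auto simp: indicator_def)
  qed
 qed
qed

text \<open>Dynkin's argument with closed half-lines as generator: their intersections with a window
  are compact, and approximability passes to complements within the window and to disjoint
  unions.\<close>

lemma apL_indicator:
 assumes A: "adm A" and B: "B : sets borel" shows "apL A (indicator (Kn n Int B))"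
proof -
 have bs: "sets (borel :: real measure) = sigma_sets UNIV (range atMost)"
  by (simp add: borel_eq_atMost)
 have "Int_stable (range (atMost :: real => real set))"
  proof (rule Int_stableI_image)
  fix i j :: real
  show "EX k:UNIV. {..i} Int {..j} = {..k}" using Int_atMost[of i j] by blast
 qed
 moreover have "range (atMost :: real => real set) <= Pow UNIV" by auto
 moreover have "B : sigma_sets UNIV (range atMost)" using B bs by simp
 ultimately show ?thesis
 proof (induction rule: sigma_sets_induct_disjoint)
  case (basic B)
  then obtain x where x: "B = {..x}" by auto
  have "compact (Kn n Int B)" unfolding x by (intro compact_Int_closed Kn_compact) auto
  thus ?case by (rule apL_compact[OF A]) auto
 next
  case empty
  have "(indicator (Kn n Int {}) :: real => real) = (%_. 0)" by auto
  thus ?case using apL_zero by simp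
 next
  case (compl B)
  have 1: "apL A (indicator (Kn n))" by (rule apL_compact[OF A Kn_compact subset_refl])
  have "(indicator (Kn n Int (UNIV - B)) :: real => real) = (%x. indicator (Kn n) x + (-1) * indicator (Kn n Int B) x)"
   by (auto simp: indicator_def)
  thus ?case using apL_add[OF 1 apL_cmult[OF compl(2), of "-1"]] by simp
 next
  case (union B)
  have Bm: "B i : sets borel" for i using union(2) bs by auto
  have fin: "apL A (indicator (Kn n Int (\<Union>i<m. B i)))" for m
  proof (induction m)
   case 0
   have "(indicator (Kn n Int (\<Union>i<0. B i)) :: real => real) = (%_. 0)" by auto
   thus ?case using apL_zero by simp
  next
   case (Suc m)
   have "B i Int B m = {}" if "i < m" for i using disjoint_family_onD[OF union(1), of i m] that by simp
   hence "(\<Union>i<m. B i) Int B m = {}" by blast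
   hence "(indicator (Kn n Int (\<Union>i<Suc m. B i)) :: real => real) = (%x. indicator (Kn n Int (\<Union>i<m. B i)) x + indicator (Kn n Int B m) x)"
    by (auto simp: indicator_def fun_eq_iff less_Suc_eq)
   thus ?case using apL_add[OF Suc union(3)[of m]] by simp
  qed
  show ?case
  proof (rule apL_dom[where w="indicator (Kn n)" and h="%m. indicator (Kn n Int (\<Union>i<m. B i))"])
   show "integrable mu (indicator (Kn n) :: real => real)" by (rule integrable_real_indicator[OF Kn_sets Kn_finite])
   have "Kn n Int (\<Union>i. B i) : sets mu"
   proof -
    have "E Int ({el n..er n} Int (\<Union>i. B i)) : sets mu" by (rule sets_mu_Int) (use Bm in auto)
    thus ?thesis by (simp add: Kn_def Int_assoc)
   qed
   thus "indicator (Kn n Int (\<Union>i. B i)) : L2 mu" by (rule ind_L2) auto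
   show "apL A (indicator (Kn n Int (\<Union>i<m. B i)))" for m by (rule fin)
   show "(%m. indicator (Kn n Int (\<Union>i<m. B i)) x) ----> (indicator (Kn n Int (\<Union>i. B i)) x :: real)" for x
   proof (cases "x : Kn n Int (\<Union>i. B i)")
    case True
    then obtain i where "x : Kn n" "x : B i" by blast
    hence "ALL m>=Suc i. (indicator (Kn n Int (\<Union>i<m. B i)) x :: real) = indicator (Kn n Int (\<Union>i. B i)) x"
     by (auto simp: indicator_def)
    hence "\<forall>\<^sub>F m in sequentially. (indicator (Kn n Int (\<Union>i<m. B i)) x :: real) = indicator (Kn n Int (\<Union>i. B i)) x"
     unfolding eventually_sequentially by blast
    thus ?thesis by (rule tendsto_eventually)
   next
    case False
    hence "(indicator (Kn n Int (\<Union>i<m. B i)) x :: real) = indicator (Kn n Int (\<Union>i. B i)) x" for m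
     by (auto simp: indicator_def)
    thus ?thesis by simp
   qed
   show "(indicator (Kn n Int (\<Union>i. B i)) x - indicator (Kn n Int (\<Union>i<m. B i)) x)^2 <= (indicator (Kn n) x :: real)" for m x
    by (auto simp: indicator_def)
  qed
 qed
qed

theorem dom_dense_L2:
 assumes A: "adm A" and f: "f : L2 mu" shows "apL A f"
proof -
 have fm: "f : borel_measurable mu" by (rule L2_meas[OF f])
 obtain s where s: "!!i. simple_function mu (s i)" "!!x. x : space mu ==> (%i. s i x) ----> f x"
  "!!i x. x : space mu ==> dist (s i x) 0 <= 2 * dist (f x) 0"
  using borel_measurable_implies_sequence_metric[OF fm, of 0] by blast
 define h where "h i x = s i x * indicator (Kn i) x" for i x
 have ha: "apL A (%x. \<Sum>y\<in>s i ` space mu. y * indicator (Kn i Int (s i -` {y} Int space mu)) x)" for i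
 proof (rule apL_sum)
  show "finite (s i ` space mu)" by (rule simple_functionD(1)[OF s(1)])
  fix y
  have "s i -` {y} Int space mu : sets mu" by (rule simple_functionD(2)[OF s(1)])
  then obtain B where B: "B : sets borel" "s i -` {y} Int space mu = E Int B" using sets_muE by blast
  have "Kn i Int (s i -` {y} Int space mu) = Kn i Int B" unfolding B(2) using Kn_sub by blast
  thus "apL A (%x. y * indicator (Kn i Int (s i -` {y} Int space mu)) x)"
   using apL_cmult[OF apL_indicator[OF A B(1), of i], of y] by simp
 qed
 have heq: "(\<Sum>y\<in>s i ` space mu. y * indicator (Kn i Int (s i -` {y} Int space mu)) x) = h i x" if x: "x : E" for i x
 proof -
  have "(\<Sum>y\<in>s i ` space mu. y * indicator (Kn i Int (s i -` {y} Int space mu)) x) = (\<Sum>y\<in>s i ` space mu. if y = s i x then h i x else 0)"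
   by (rule sum.cong) (use x in \<open>auto simp: h_def indicator_def space_mu\<close>)
  also have "\<dots> = h i x" using simple_functionD(1)[OF s(1)[of i]] x by (simp add: space_mu)
  finally show ?thesis .
 qed
 show ?thesis
 proof (rule apL_dom[where w="%x. 9 * (f x)^2" and h="%i x. \<Sum>y\<in>s i ` space mu. y * indicator (Kn i Int (s i -` {y} Int space mu)) x", OF _ f ha])
  show "integrable mu (%x. 9 * (f x)^2)" using L2_int[OF f] by simp
  fix x assume x: "x : E"
  have "(%i. h i x) ----> f x"
  proof (rule Lim_transform_eventually)
   show "(%i. s i x) ----> f x" using s(2) x by (simp add: space_mu)
   show "\<forall>\<^sub>F i in sequentially. s i x = h i x" using Kn_ev[OF x] by eventually_elim (simp add: h_def)
  qed
  thus "(%i. \<Sum>y\<in>s i ` space mu. y * indicator (Kn i Int (s i -` {y} Int space mu)) x) ----> f x" using heq[OF x] by simp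
  fix i
  have "\<bar>s i x\<bar> <= 2 * \<bar>f x\<bar>" using s(3)[of x i] x by (simp add: space_mu)
  \<comment> \<open>The simple functions are bounded by twice \<open>|f|\<close>, which gives the
    factor 3 inside the window; outside it the error is \<open>|f|\<close> itself.\<close>
  hence "\<bar>f x - h i x\<bar> <= \<bar>3 * f x\<bar>" by (cases "x : Kn i") (auto simp: h_def)
  hence "(f x - h i x)^2 <= (3 * f x)^2" by (simp only: abs_le_square_iff)
  thus "(f x - (\<Sum>y\<in>s i ` space mu. y * indicator (Kn i Int (s i -` {y} Int space mu)) x))^2 <= 9 * (f x)^2"
   unfolding heq[OF x] by (simp add: power_mult_distrib)
 qed
qed

lemma den_AE_cong:
 assumes ae: "AE x in mu. f x = g x" shows "den f = den g"
proof -
 have "(AE x in mu. f x = h x) \<longleftrightarrow> (AE x in mu. g x = h x)" for h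
  using ae by (auto elim: eventually_elim2)
 thus ?thesis by (simp add: den_def)
qed

lemma dom_AE:
 assumes f: "f : dom A" and g: "g : L2 mu" and ae: "AE x in mu. f x = g x" shows "g : dom A"
proof -
 obtain u k where u: "cdens A u k" "AE x in mu. f x = u x" "bd A u" by (rule domE[OF f])
 have "AE x in mu. g x = u x" using u(2) ae by eventually_elim simp
 thus ?thesis by (rule domI[OF g u(1) _ u(3)])
qed

theorem regular_dirichlet_dom:
 assumes A: "adm A" shows "regular_dirichlet_form E mu (dom A) form"
proof -
 note A' = admD[OF A]
 have "dirichlet_form mu (dom A) form"
  unfolding dirichlet_form_def
 proof (intro conjI ballI allI impI)
  show "dom A <= L2 mu" using dom_L2 by blast
  show "g : dom A" if "f : dom A" "g : L2 mu" "AE x in mu. f x = g x" for f g by (rule dom_AE[OF that])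
  show "form f h = form g h" if "AE x in mu. f x = g x" for f g h by (simp add: form_def den_AE_cong[OF that])
  show "(%x. 0) : dom A" by (rule dom_zero)
  show "(%x. f x + g x) : dom A" if "f : dom A" "g : dom A" for f g by (rule dom_add[OF that])
  show "(%x. c * f x) : dom A" if "f : dom A" for c f by (rule dom_cmult[OF that])
  show "form (%x. f x + g x) h = form f h + form g h" if "f : dom A" "g : dom A" "h : dom A" for f g h by (rule form_add[OF A'(3) that])
  show "form (%x. c * f x) g = c * form f g" if "f : dom A" "g : dom A" for c f g by (rule form_cmult[OF A'(3) that])
  show "form f g = form g f" for f g by (rule form_sym)
  show "0 <= form f f" for f by (rule form_nonneg)
  show "EX g:dom A. sqd mu f g < e" if "f : L2 mu" "0 < e" for f e
   using dom_dense_L2[OF A that(1)] that(2) by (simp add: apL_def)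
  show "EX f:dom A. (%n. E1d (u n) f) ----> 0"
   if "(ALL n. u n : dom A) & (ALL e>0. EX N. ALL m>=N. ALL n>=N. E1d (u n) (u m) < e)" for u :: "nat => rfun"
   by (rule dom_closed[OF A'(1,3)]) (use that in auto)
  fix f assume f: "f : dom A"
  have T: "\<bar>min 1 (max 0 s) - min 1 (max 0 t)\<bar> <= \<bar>s - t\<bar>" for s t :: real by (auto simp: min_def max_def)
  show "(%x. min 1 (max 0 (f x))) : dom A" by (rule dom_contraction(1)[OF A'(2,3) f T]) simp
  show "form (%x. min 1 (max 0 (f x))) (%x. min 1 (max 0 (f x))) <= form f f"
   by (rule dom_contraction(2)[OF A'(2,3) f T]) simp
 qed
 moreover have "EX g:dom A Int Cc_on E. E1d f g < e" if "f : dom A" "e > 0" for f e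
  using dom_apx[OF A' that(1)] that(2) by (simp add: apx_def)
 moreover have "EX g:dom A Int Cc_on E. ALL x:E. \<bar>f x - g x\<bar> < e" if "f : Cc_on E" "e > 0" for f e
  using uniform_approx[OF A that] by blast
 ultimately show ?thesis unfolding regular_dirichlet_form_def by blast
qed

end

section \<open>The quasidiffusion form\<close>

text \<open>Difference quotients need an open set. The interiors of the intervals cover
  \<open>U\<close> up to countably many end points, at which values do not affect
  measurability.\<close>

lemma borel_measurable_deriv_UN_Icc:
 fixes c d :: "nat => real" and g :: "real => real"
 assumes U: "U = (\<Union>n. {c n..d n})" and g: "!!n. continuous_on {c n..d n} g"
 shows "(%x. indicator U x * deriv g x) : borel_measurable borel"
proof -
 define W where "W = (\<Union>n. {c n<..<d n})"
 have W: "open W" unfolding W_def by auto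
 have "continuous_on W g" unfolding W_def
 proof (rule continuous_on_open_UN)
  show "continuous_on {c n<..<d n} g" for n by (rule continuous_on_subset[OF g[of n]]) auto
 qed auto
 hence m: "(%x. indicator W x * deriv g x) : borel_measurable borel" by (rule borel_measurable_deriv_on[OF W])
 have WU: "W <= U" unfolding W_def U by (intro UN_mono) auto
 have co: "countable (range c Un range d)" by simp
 have "U - W <= range c Un range d"
 proof
  fix x assume x: "x : U - W"
  then obtain n where n: "c n <= x" "x <= d n" unfolding U by auto
  have "~ (c n < x & x < d n)" using x unfolding W_def by auto
  hence "x = c n | x = d n" using n by auto
  thus "x : range c Un range d" by auto
 qed
 hence "x : range c Un range d" if "x : U" "x ~: W" for x using that by blast
 hence eq: "indicator W x * deriv g x = indicator U x * deriv g x" if "x ~: range c Un range d" for x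
  using that WU by (auto simp: indicator_def)
 show ?thesis
  by (rule measurable_discrete_difference[OF m co, of "%x. indicator U x * deriv g x"]) (use eq in auto)
qed

context qd_space
begin

lemma continuous_on_IccI:
 assumes "loc_abs_cont_on I g" "x : I" "y : I" shows "continuous_on {x..y} g"
 using assms Icc_sub_I[of x y] unfolding loc_abs_cont_on_def by (intro abs_cont_continuous) blast

lemma deriv_I_measurable:
 assumes g: "loc_abs_cont_on I g" shows "(%x. indicator I x * deriv g x) : borel_measurable borel"
proof (rule borel_measurable_deriv_UN_Icc[OF I_UN])
 show "continuous_on {el n..er n} g" for n by (rule continuous_on_IccI[OF g el_I er_I])
qed

lemma H1e_rep_dens:
 assumes g: "H1e_rep E g" shows "dens I g (%x. indicator I x * deriv g x)"
proof -
 have ac: "loc_abs_cont_on I g" and sq: "set_integrable lborel I (%x. (deriv g x)^2)" using g unfolding H1e_rep_def by auto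
 note m = deriv_I_measurable[OF ac]
 have "(%x. (indicator I x * deriv g x)^2) = (%x. indicator I x *\<^sub>R (deriv g x)^2)" by (auto simp: indicator_def)
 hence "L2r (%x. indicator I x * deriv g x)" using m sq unfolding L2r_def set_integrable_def by simp
 moreover have "g y - g x = pint (%x. indicator I x * deriv g x) x y" if xy: "x : I" "y : I" "x <= y" for x y
 proof -
  have sub: "{x..y} <= I" by (rule Icc_sub_I[OF xy(1,2)])
  hence "abs_cont_on {x..y} g" using ac unfolding loc_abs_cont_on_def by blast
  hence "g y - g x = pint (deriv g) x y" by (rule abs_cont_deriv(2)) (use xy in auto)
  also have "\<dots> = pint (%x. indicator I x * deriv g x) x y" by (rule set_integral_cong') (use sub in auto)
  finally show ?thesis .
 qed
 ultimately show ?thesis unfolding dens_def by simp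
qed

lemma dens_loc_abs_cont:
 assumes d: "dens A g q" shows "loc_abs_cont_on I g"
 unfolding loc_abs_cont_on_def
proof (intro allI impI)
 fix c d' assume s: "{c..d'} <= I"
 have m: "L2r (%t. \<bar>q t\<bar>)" using L2r_bound(1)[OF densD(1)[OF d], of "%t. \<bar>q t\<bar>"] L2r_meas[OF densD(1)[OF d]] by simp
 show "abs_cont_on {c..d'} g"
 proof (rule abs_cont_on_of_bound[OF m])
  fix x y assume xy: "c <= x" "x <= y" "y <= d'"
  hence "x : I" "y : I" using s by auto
  thus "\<bar>g y - g x\<bar> <= pint (%t. \<bar>q t\<bar>) x y" by (rule dens_abs_bound[OF d _ _ xy(2)])
 qed
qed

lemma dens_H1e_rep:
 assumes d: "dens A g q" shows "H1e_rep E g"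
proof -
 note ac = dens_loc_abs_cont[OF d]
 note m = deriv_I_measurable[OF ac]
 have q: "q : borel_measurable borel" by (rule L2r_meas[OF densD(1)[OF d]])
 have "AE x in lborel. (indicator I x * q x)^2 = (indicator I x * deriv g x)^2"
  using dens_AE_deriv[OF d]
 proof eventually_elim
  case (elim x)
  show ?case
  proof (cases "x : I")
   case True
   thus ?thesis using DERIV_imp_deriv elim by force
  qed simp
 qed
 moreover have "integrable lborel (%x. (indicator I x * q x)^2)" by (rule L2r_sq[OF L2r_indicator[OF densD(1)[OF d] I_borel]])
 ultimately have "integrable lborel (%x. (indicator I x * deriv g x)^2)"
  by (subst integrable_cong_AE[where g="%x. (indicator I x * q x)^2"]) (use m q in auto)
 moreover have "(%x. (indicator I x * deriv g x)^2) = (%x. indicator I x *\<^sub>R (deriv g x)^2)" by (auto simp: indicator_def)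
 ultimately show ?thesis using ac unfolding H1e_rep_def set_integrable_def by simp
qed

section \<open>Boundary conditions as limits along filters\<close>

lemma not_in_E_lft: "Lopen ==> x : I ==> lft E < ereal x"
 using lft_le_I[of x] unfolding Lopen_def Ival_def by (auto simp: order_le_less)

lemma not_in_E_rgt:
 assumes "Ropen" "x : I" shows "ereal x < rgt E"
proof (rule le_neq_trans[OF rgt_ge_I[OF assms(2)]])
 show "ereal x ~= rgt E"
 proof
  assume e: "ereal x = rgt E"
  hence "x : E" using assms(2) by (simp add: Ival_def)
  hence "ereal x : ereal ` E" by (rule imageI)
  thus False using e assms(1) by (simp add: Ropen_def)
 qed
qed

lemma lft_not_PInf: "lft E ~= \<infinity>" using lft_less_rgt by auto
lemma rgt_not_MInf: "rgt E ~= -\<infinity>" using lft_less_rgt by auto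

lemma in_I_left: "lft E < ereal x ==> x <= y ==> y : E ==> x : I"
proof -
 assume a: "lft E < ereal x" "x <= y" "y : E"
 show "x : I"
 proof (cases "x = y")
  case False
  hence "ereal x < ereal y" using a(2) by simp
  hence "ereal x < rgt E" using rgt_ge[OF a(3)] by (rule less_le_trans)
  thus ?thesis using a(1) by (simp add: Ival_def)
 qed (use a E_sub_I in simp)
qed

lemma in_I_right: "ereal x < rgt E ==> y <= x ==> y : E ==> x : I"
proof -
 assume a: "ereal x < rgt E" "y <= x" "y : E"
 show "x : I"
 proof (cases "x = y")
  case False
  hence "ereal y < ereal x" using a(2) by simp
  hence "lft E < ereal x" using lft_le[OF a(3)] by (rule le_less_trans[rotated])
  thus ?thesis using a(1) by (simp add: Ival_def)
 qed (use a E_sub_I in simp)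
qed

text \<open>Merges the cases \<open>at_bot\<close> and \<open>at_right\<close> into a statement
  about points of \<open>I\<close> below some point of \<open>E\<close>, close to the way
  \<open>LB\<close> is phrased.\<close>

lemma eventually_left_filter:
 assumes L: Lopen
 shows "eventually P (left_filter E) \<longleftrightarrow> (EX x0:E. ALL x:I. x <= x0 --> P x)"
proof (cases "lft E = -\<infinity>")
 case True
 hence f: "left_filter E = at_bot" by (simp add: left_filter_def)
 show ?thesis unfolding f eventually_at_bot_linorder
 proof
  assume "EX N. ALL n<=N. P n"
  then obtain N where N: "ALL n<=N. P n" by blast
  obtain y where y: "y : E" "y < N" using ex_E_below[of N] True by auto
  have "ALL x:I. x <= y --> P x" using N y(2) by auto
  thus "EX x0:E. ALL x:I. x <= x0 --> P x" using y(1) by blast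
 next
  assume "EX x0:E. ALL x:I. x <= x0 --> P x"
  then obtain x0 where x0: "x0 : E" "ALL x:I. x <= x0 --> P x" by blast
  have "P n" if "n <= x0" for n
  proof -
   have "n : I" by (rule in_I_left[OF _ that x0(1)]) (simp add: True)
   thus ?thesis using x0(2) that by blast
  qed
  thus "EX N. ALL n<=N. P n" by blast
 qed
next
 case False
 then obtain a where a: "lft E = ereal a" using lft_not_PInf by (cases "lft E") auto
 have f: "left_filter E = at_right a" using a by (simp add: left_filter_def)
 show ?thesis unfolding f eventually_at_right_field
 proof
  assume "EX b>a. ALL y>a. y < b --> P y"
  then obtain b where b: "b > a" "ALL y>a. y < b --> P y" by blast
  obtain y where y: "y : E" "y < b" using ex_E_below[of b] b(1) a by auto
  have "P x" if "x : I" "x <= y" for x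
  proof -
   have "x > a" using not_in_E_lft[OF L that(1)] a by simp
   thus ?thesis using b(2) that y(2) by auto
  qed
  thus "EX x0:E. ALL x:I. x <= x0 --> P x" using y(1) by blast
 next
  assume "EX x0:E. ALL x:I. x <= x0 --> P x"
  then obtain x0 where x0: "x0 : E" "ALL x:I. x <= x0 --> P x" by blast
  have "x0 > a" using not_in_E_lft[OF L E_sub_I[OF x0(1)]] a by simp
  moreover have "P y" if "y > a" "y < x0" for y
  proof -
   have "y : I" by (rule in_I_left[OF _ _ x0(1)]) (use a that in auto)
   thus ?thesis using x0(2) that by auto
  qed
  ultimately show "EX b>a. ALL y>a. y < b --> P y" by blast
 qed
qed

lemma eventually_right_filter:
 assumes R: Ropen
 shows "eventually P (right_filter E) \<longleftrightarrow> (EX x0:E. ALL x:I. x0 <= x --> P x)"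
proof (cases "rgt E = \<infinity>")
 case True
 hence f: "right_filter E = at_top" by (simp add: right_filter_def)
 show ?thesis unfolding f eventually_at_top_linorder
 proof
  assume "EX N. ALL n>=N. P n"
  then obtain N where N: "ALL n>=N. P n" by blast
  obtain y where y: "y : E" "N < y" using ex_E_above[of N] True by auto
  have "ALL x:I. y <= x --> P x" using N y(2) by auto
  thus "EX x0:E. ALL x:I. x0 <= x --> P x" using y(1) by blast
 next
  assume "EX x0:E. ALL x:I. x0 <= x --> P x"
  then obtain x0 where x0: "x0 : E" "ALL x:I. x0 <= x --> P x" by blast
  have "P n" if "x0 <= n" for n
  proof -
   have "n : I" by (rule in_I_right[OF _ that x0(1)]) (simp add: True)
   thus ?thesis using x0(2) that by blast
  qed
  thus "EX N. ALL n>=N. P n" by blast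
 qed
next
 case False
 then obtain a where a: "rgt E = ereal a" using rgt_not_MInf by (cases "rgt E") auto
 have f: "right_filter E = at_left a" using a by (simp add: right_filter_def)
 show ?thesis unfolding f eventually_at_left_field
 proof
  assume "EX b<a. ALL y>b. y < a --> P y"
  then obtain b where b: "b < a" "ALL y>b. y < a --> P y" by blast
  obtain y where y: "y : E" "b < y" using ex_E_above[of b] b(1) a by auto
  have "P x" if "x : I" "y <= x" for x
  proof -
   have "x < a" using not_in_E_rgt[OF R that(1)] a by simp
   thus ?thesis using b(2) that y(2) by auto
  qed
  thus "EX x0:E. ALL x:I. x0 <= x --> P x" using y(1) by blast
 next
  assume "EX x0:E. ALL x:I. x0 <= x --> P x"
  then obtain x0 where x0: "x0 : E" "ALL x:I. x0 <= x --> P x" by blast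
  have "x0 < a" using not_in_E_rgt[OF R E_sub_I[OF x0(1)]] a by simp
  moreover have "P y" if "y < a" "y > x0" for y
  proof -
   have "y : I" by (rule in_I_right[OF _ _ x0(1)]) (use a that in auto)
   thus ?thesis using x0(2) that by auto
  qed
  ultimately show "EX b<a. ALL y>b. y < a --> P y" by blast
 qed
qed

lemma left_limit_imp_LB:
 assumes L: Lopen and t: "(g \<longlongrightarrow> 0) (left_filter E)" shows "LB g"
 unfolding LB_def
proof (intro allI impI)
 fix e :: real assume e: "e > 0"
 have "eventually (%x. dist (g x) 0 < e) (left_filter E)" by (rule tendstoD[OF t e])
 thus "EX x0:E. ALL x:E. x <= x0 --> \<bar>g x\<bar> < e" using E_sub_I unfolding eventually_left_filter[OF L] by fastforce
qed

lemma right_limit_imp_RB: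
 assumes R: Ropen and t: "(g \<longlongrightarrow> 0) (right_filter E)" shows "RB g"
 unfolding RB_def
proof (intro allI impI)
 fix e :: real assume e: "e > 0"
 have "eventually (%x. dist (g x) 0 < e) (right_filter E)" by (rule tendstoD[OF t e])
 thus "EX x0:E. ALL x:E. x0 <= x --> \<bar>g x\<bar> < e" using E_sub_I unfolding eventually_right_filter[OF R] by fastforce
qed

lemma cdens_gap_abs_less:
 assumes d: "cdens A g k" and p: "p : gaps E" and x: "fst p <= x" "x <= snd p"
  and b: "\<bar>g (fst p)\<bar> < e" "\<bar>g (snd p)\<bar> < e"
 shows "\<bar>g x\<bar> < e"
proof -
 have ab: "fst p < snd p" using gapsD[OF p] by simp
 define t where "t = (x - fst p) / (snd p - fst p)"
 have t: "0 <= t" "t <= 1" using ab x by (auto simp: t_def field_simps)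
 have "g x = g (fst p) + (g (snd p) - g (fst p)) * t"
  using cdens_gap_linear[OF d p x] by (simp add: slope_def t_def)
 hence gx: "g x = (1 - t) * g (fst p) + t * g (snd p)" by (simp add: algebra_simps)
 have "g x < e"
 proof (rule convex_bound_lt[of "g (fst p)" e "g (snd p)" "1 - t" t, folded gx])
  show "g (fst p) < e" "g (snd p) < e" using b by auto
 qed (use t in auto)
 moreover have "- g x < e"
 proof -
  have gx': "- g x = (1 - t) * (- g (fst p)) + t * (- g (snd p))" using gx by simp
  show ?thesis unfolding gx' by (rule convex_bound_lt) (use b t in auto)
 qed
 ultimately show ?thesis by auto
qed

text \<open>\<open>LB\<close> speaks of points of \<open>E\<close> only. As \<open>x0\<close> is in
  \<open>E\<close>, a gap containing a point left of \<open>x0\<close> has both ends in that region,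
  and a linear function is bounded by its end values.\<close>

lemma LB_imp_left_limit:
 assumes L: Lopen and d: "cdens A g k" and b: "LB g" shows "(g \<longlongrightarrow> 0) (left_filter E)"
proof (rule tendstoI)
 fix e :: real assume "e > 0"
 then obtain x0 where x0: "x0 : E" "!!x. x : E ==> x <= x0 ==> \<bar>g x\<bar> < e" using b unfolding LB_def by blast
 have "\<bar>g x\<bar> < e" if x: "x : I" "x <= x0" for x
 proof (cases "x : E")
  case False
  obtain p where p: "p : gaps E" "fst p < x" "x < snd p" by (rule gap_ex[OF x(1) False])
  have "snd p <= x0" using gapsD[OF p(1)] x0(1) x(2) p(2) by fastforce
  hence "\<bar>g (fst p)\<bar> < e" "\<bar>g (snd p)\<bar> < e" using gapsD[OF p(1)] x0(2)[of "fst p"] x0(2)[of "snd p"] by auto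
  thus ?thesis by (rule cdens_gap_abs_less[OF d p(1) less_imp_le[OF p(2)] less_imp_le[OF p(3)]])
 qed (use x0 x in simp)
 thus "eventually (%x. dist (g x) 0 < e) (left_filter E)" unfolding eventually_left_filter[OF L] using x0(1) by auto
qed

lemma RB_imp_right_limit:
 assumes R: Ropen and d: "cdens A g k" and b: "RB g" shows "(g \<longlongrightarrow> 0) (right_filter E)"
proof (rule tendstoI)
 fix e :: real assume "e > 0"
 then obtain x0 where x0: "x0 : E" "!!x. x : E ==> x0 <= x ==> \<bar>g x\<bar> < e" using b unfolding RB_def by blast
 have "\<bar>g x\<bar> < e" if x: "x : I" "x0 <= x" for x
 proof (cases "x : E")
  case False
  obtain p where p: "p : gaps E" "fst p < x" "x < snd p" by (rule gap_ex[OF x(1) False])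
  have "x0 <= fst p" using gapsD[OF p(1)] x0(1) x(2) p(3) by fastforce
  hence "\<bar>g (fst p)\<bar> < e" "\<bar>g (snd p)\<bar> < e" using gapsD[OF p(1)] x0(2)[of "fst p"] x0(2)[of "snd p"] by auto
  thus ?thesis by (rule cdens_gap_abs_less[OF d p(1) less_imp_le[OF p(2)] less_imp_le[OF p(3)]])
 qed (use x0 x in simp)
 thus "eventually (%x. dist (g x) 0 < e) (right_filter E)" unfolding eventually_right_filter[OF R] using x0(1) by auto
qed

text \<open>For \<open>A = I\<close> finite measure near an open end means that the end point is
  finite, which recovers the boundary condition of the quasidiffusion.\<close>

lemma finL_I: "finL I \<longleftrightarrow> Lopen & \<bar>lft E\<bar> ~= \<infinity>"
proof
 assume f: "finL I"
 then obtain x where x: "x : E" "emeasure lborel (I Int {..x}) < \<infinity>" and L: Lopen unfolding finL_def by blast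
 have "lft E ~= -\<infinity>"
 proof
  assume l: "lft E = -\<infinity>"
  have "{..x} <= I"
  proof
   fix y assume "y : {..x}"
   thus "y : I" by (intro in_I_left[OF _ _ x(1)]) (auto simp: l)
  qed
  hence "I Int {..x} = {..x}" by blast
  hence fin: "emeasure lborel {..x} < \<infinity>" using x(2) by simp
  have "ennreal (real n) <= emeasure lborel {..x}" for n :: nat
  proof -
   have "ennreal (real n) = emeasure lborel {x - real n..x}" by simp
   also have "\<dots> <= emeasure lborel {..x}" by (rule emeasure_mono) auto
   finally show ?thesis .
  qed
  moreover obtain n :: nat where "emeasure lborel {..x} < of_nat n" using fin ennreal_Ex_less_of_nat by auto
  ultimately show False by (metis ennreal_of_nat_eq_real_of_nat not_less)
 qed
 thus "Lopen & \<bar>lft E\<bar> ~= \<infinity>" using L lft_not_PInf by auto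
next
 assume a: "Lopen & \<bar>lft E\<bar> ~= \<infinity>"
 then obtain l where l: "lft E = ereal l" by (cases "lft E") auto
 obtain x where x: "x : E" using E_nonempty by blast
 have "I Int {..x} <= {l..x}" using lft_le_I l by auto
 hence "emeasure lborel (I Int {..x}) <= emeasure lborel {l..x}" by (rule emeasure_mono) simp
 also have "\<dots> < \<infinity>" using emeasure_lborel_Icc_eq[of l x] by simp
 finally show "finL I" unfolding finL_def using a x by blast
qed

lemma finR_I: "finR I \<longleftrightarrow> Ropen & \<bar>rgt E\<bar> ~= \<infinity>"
proof
 assume f: "finR I"
 then obtain x where x: "x : E" "emeasure lborel (I Int {x..}) < \<infinity>" and R: Ropen unfolding finR_def by blast
 have "rgt E ~= \<infinity>"
 proof
  assume l: "rgt E = \<infinity>"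
  have "{x..} <= I"
  proof
   fix y assume "y : {x..}"
   thus "y : I" by (intro in_I_right[OF _ _ x(1)]) (auto simp: l)
  qed
  hence "I Int {x..} = {x..}" by blast
  hence fin: "emeasure lborel {x..} < \<infinity>" using x(2) by simp
  have "ennreal (real n) <= emeasure lborel {x..}" for n :: nat
  proof -
   have "ennreal (real n) = emeasure lborel {x..x + real n}" by simp
   also have "\<dots> <= emeasure lborel {x..}" by (rule emeasure_mono) auto
   finally show ?thesis .
  qed
  moreover obtain n :: nat where "emeasure lborel {x..} < of_nat n" using fin ennreal_Ex_less_of_nat by auto
  ultimately show False by (metis ennreal_of_nat_eq_real_of_nat not_less)
 qed
 thus "Ropen & \<bar>rgt E\<bar> ~= \<infinity>" using R rgt_not_MInf by auto
next
 assume a: "Ropen & \<bar>rgt E\<bar> ~= \<infinity>"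
 then obtain l where l: "rgt E = ereal l" by (cases "rgt E") auto
 obtain x where x: "x : E" using E_nonempty by blast
 have "I Int {x..} <= {x..l}" using rgt_ge_I l by auto
 hence "emeasure lborel (I Int {x..}) <= emeasure lborel {x..l}" by (rule emeasure_mono) simp
 also have "\<dots> < \<infinity>" using emeasure_lborel_Icc_eq[of x l] by simp
 finally show "finR I" unfolding finR_def using a x by blast
qed

lemma gapU_sub_I: "gapU <= I" using gapU_eq by blast

lemma LB_cong: "(!!x. x : E ==> g x = h x) ==> LB g ==> LB h"
 by (erule LB_dom) simp
lemma RB_cong: "(!!x. x : E ==> g x = h x) ==> RB g ==> RB h"
 by (erule RB_dom) simp

lemma qd_domain_eq: "qd_domain E mu = dom I"
proof (intro set_eqI iffI)
 fix f assume f: "f : qd_domain E mu"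
 have "f : L2 mu & (EX g. H1e_rep E g & (AE x in mu. f x = g x)
   & (Lopen & \<bar>lft E\<bar> ~= \<infinity> --> (g \<longlongrightarrow> 0) (left_filter E)) & (Ropen & \<bar>rgt E\<bar> ~= \<infinity> --> (g \<longlongrightarrow> 0) (right_filter E)))"
  using f unfolding qd_domain_def Lopen_def Ropen_def mem_Collect_eq .
 then obtain g where g: "f : L2 mu" "H1e_rep E g" "AE x in mu. f x = g x"
   "Lopen & \<bar>lft E\<bar> ~= \<infinity> --> (g \<longlongrightarrow> 0) (left_filter E)" "Ropen & \<bar>rgt E\<bar> ~= \<infinity> --> (g \<longlongrightarrow> 0) (right_filter E)"
  by (elim exE conjE) rule
 obtain g' where g': "cdens I g' (Pk g (%x. indicator I x * deriv g x))" "!!x. x : E ==> g' x = g x"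
  by (rule canonical[OF H1e_rep_dens[OF g(2)] gapU_sub_I]) blast
 have ae: "AE x in mu. f x = g' x" using g(3) AE_space by eventually_elim (simp add: g'(2) space_mu)
 have "bd I g'" unfolding bd_def finL_I finR_I
 proof (intro conjI impI)
  assume "Lopen & \<bar>lft E\<bar> ~= \<infinity>"
  thus "LB g'" by (intro LB_cong[OF _ left_limit_imp_LB[of g]]) (use g g'(2) in auto)
 next
  assume "Ropen & \<bar>rgt E\<bar> ~= \<infinity>"
  thus "RB g'" by (intro RB_cong[OF _ right_limit_imp_RB[of g]]) (use g g'(2) in auto)
 qed
 thus "f : dom I" by (rule domI[OF g(1) g'(1) ae])
next
 fix f assume f: "f : dom I"
 obtain g k where g: "cdens I g k" "AE x in mu. f x = g x" "bd I g" by (rule domE[OF f]) blast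
 have "H1e_rep E g" by (rule dens_H1e_rep[OF cdens_dens[OF g(1)]])
 moreover have "Lopen & \<bar>lft E\<bar> ~= \<infinity> --> (g \<longlongrightarrow> 0) (left_filter E)"
  using g(3) LB_imp_left_limit[OF _ g(1)] by (simp add: bd_def finL_I)
 moreover have "Ropen & \<bar>rgt E\<bar> ~= \<infinity> --> (g \<longlongrightarrow> 0) (right_filter E)"
  using g(3) RB_imp_right_limit[OF _ g(1)] by (simp add: bd_def finR_I)
 ultimately show "f : qd_domain E mu"
  unfolding qd_domain_def Lopen_def Ropen_def mem_Collect_eq using g(2) dom_L2[OF f] by (intro conjI exI[of _ g])
qed

text \<open>On a gap both averages are constant, and the product of slopes times the length equals
  the product of jumps divided by the length. This is where the jump part becomes an
  integral.\<close>

lemma Pk_integral_split: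
 assumes d: "dens A g q" "dens B h r"
 shows "(\<integral>t. Pk g q t * Pk h r t \<partial>lborel) = (LBINT t:-gapU. q t * r t)
  + infsum (%p. (g (snd p) - g (fst p)) * (h (snd p) - h (fst p)) / (snd p - fst p)) (gaps E)"
proof -
 have i: "integrable lborel (%t. Pk g q t * Pk h r t)" by (rule L2r_mult[OF Pk_L2(1)[OF d(1)] Pk_L2(1)[OF d(2)]])
 have "(LBINT t:-gapU. Pk g q t * Pk h r t) = (LBINT t:-gapU. q t * r t)"
  by (rule set_integral_cong') (simp add: Pk_def)
 moreover have "(LBINT t:gapU. Pk g q t * Pk h r t) = infsum (%p. (g (snd p) - g (fst p)) * (h (snd p) - h (fst p)) / (snd p - fst p)) (gaps E)"
 proof -
  have "set_integrable lborel gapU (%t. Pk g q t * Pk h r t)"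
   unfolding set_integrable_def by (rule integrable_mult_indicator[OF _ i]) simp
  from has_sum_gaps[OF this]
  have "(LBINT t:gapU. Pk g q t * Pk h r t) = infsum (%p. LBINT t:{fst p<..<snd p}. Pk g q t * Pk h r t) (gaps E)"
   by (rule infsumI[symmetric])
  also have "\<dots> = infsum (%p. (g (snd p) - g (fst p)) * (h (snd p) - h (fst p)) / (snd p - fst p)) (gaps E)"
  proof (rule infsum_cong)
   fix p assume p: "p : gaps E"
   have ab: "fst p < snd p" using gapsD[OF p] by simp
   have "(LBINT t:{fst p<..<snd p}. Pk g q t * Pk h r t) = (LBINT t:{fst p<..<snd p}. slope g p * slope h p)"
    by (rule set_integral_cong') (simp add: Pk_gap[OF p])
   also have "\<dots> = (slope g p * slope h p) * (snd p - fst p)" using ab by (simp add: set_integral_const)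
   also have "\<dots> = (g (snd p) - g (fst p)) * (h (snd p) - h (fst p)) / (snd p - fst p)" using ab by (simp add: slope_def)
   finally show "(LBINT t:{fst p<..<snd p}. Pk g q t * Pk h r t) = (g (snd p) - g (fst p)) * (h (snd p) - h (fst p)) / (snd p - fst p)" .
  qed
  finally show ?thesis .
 qed
 ultimately show ?thesis using split_gapU[OF i] by simp
qed

lemma form_eq_dens:
 assumes A: "gapU <= A" "A <= I" and d: "dens A g q" "dens A h r" and ae: "AE x in mu. f x = g x" "AE x in mu. f' x = h x"
 shows "form f f' = 1/2 * (LBINT t:-gapU. q t * r t)
  + 1/2 * infsum (%p. (g (snd p) - g (fst p)) * (h (snd p) - h (fst p)) / (snd p - fst p)) (gaps E)"
proof -
 obtain g' where g': "cdens A g' (Pk g q)" "!!x. x : E ==> g' x = g x" by (rule canonical[OF d(1) A(1)]) blast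
 obtain h' where h': "cdens A h' (Pk h r)" "!!x. x : E ==> h' x = h x" by (rule canonical[OF d(2) A(1)]) blast
 have "AE x in mu. f x = g' x" using ae(1) AE_space by eventually_elim (simp add: g'(2) space_mu)
 moreover have "AE x in mu. f' x = h' x" using ae(2) AE_space by eventually_elim (simp add: h'(2) space_mu)
 ultimately have "form f f' = 1/2 * (\<integral>t. Pk g q t * Pk h r t \<partial>lborel)" by (rule form_eq[OF A(2) A(2) g'(1) h'(1)])
 thus ?thesis by (simp only: Pk_integral_split[OF d] distrib_left)
qed

lemma qd_form_eq:
 assumes f: "f : dom I" and h: "h : dom I" shows "qd_form E mu f h = form f h"
proof -
 have ex: "EX g. H1e_rep E g & (AE x in mu. f x = g x)" if "f : dom I" for f
 proof -
  have "f : qd_domain E mu" using that qd_domain_eq by simp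
  thus ?thesis unfolding qd_domain_def by blast
 qed
 define gf where "gf = (SOME g. H1e_rep E g & (AE x in mu. f x = g x))"
 define gh where "gh = (SOME g. H1e_rep E g & (AE x in mu. h x = g x))"
 have gf: "H1e_rep E gf" "AE x in mu. f x = gf x" using someI_ex[OF ex[OF f]] unfolding gf_def by blast+
 have gh: "H1e_rep E gh" "AE x in mu. h x = gh x" using someI_ex[OF ex[OF h]] unfolding gh_def by blast+
 have "(LBINT t:-gapU. (indicator I t * deriv gf t) * (indicator I t * deriv gh t)) = (LINT x:E|lborel. deriv gf x * deriv gh x)"
  unfolding set_lebesgue_integral_def
 proof (rule bintegral_cong)
  fix t
  have "t : E \<longleftrightarrow> t ~: gapU & t : I" using gapU_eq E_sub_I by blast
  thus "indicator (- gapU) t *\<^sub>R (indicator I t * deriv gf t * (indicator I t * deriv gh t)) = indicator E t *\<^sub>R (deriv gf t * deriv gh t)"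
   by (simp add: indicator_def)
 qed
 thus ?thesis
  using form_eq_dens[OF gapU_sub_I subset_refl H1e_rep_dens[OF gf(1)] H1e_rep_dens[OF gh(1)] gf(2) gh(2)]
  unfolding qd_form_def gf_def[symmetric] gh_def[symmetric] Let_def by simp
qed

lemma finL_mono: "A <= B ==> B : sets borel ==> finL B ==> finL A"
proof -
 assume AB: "A <= B" "B : sets borel" "finL B"
 then obtain x where x: "Lopen" "x : E" "emeasure lborel (B Int {..x}) < \<infinity>" unfolding finL_def by blast
 have "emeasure lborel (A Int {..x}) <= emeasure lborel (B Int {..x})" by (rule emeasure_mono) (use AB in auto)
 thus "finL A" unfolding finL_def using x order_le_less_trans by blast
qed

lemma finR_mono: "A <= B ==> B : sets borel ==> finR B ==> finR A"
proof -
 assume AB: "A <= B" "B : sets borel" "finR B"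
 then obtain x where x: "Ropen" "x : E" "emeasure lborel (B Int {x..}) < \<infinity>" unfolding finR_def by blast
 have "emeasure lborel (A Int {x..}) <= emeasure lborel (B Int {x..})" by (rule emeasure_mono) (use AB in auto)
 thus "finR A" unfolding finR_def using x order_le_less_trans by blast
qed

text \<open>Passing to a larger set can only drop boundary conditions: finite measure of
  \<open>B\<close> near an end implies the same for \<open>A\<close>.\<close>

lemma dom_mono:
 assumes "A <= B" "B : sets borel" shows "dom A <= dom B"
proof
 fix f assume f: "f : dom A"
 obtain g k where g: "cdens A g k" "AE x in mu. f x = g x" "bd A g" by (rule domE[OF f]) blast
 have "bd B g" using g(3) finL_mono[OF assms] finR_mono[OF assms] unfolding bd_def by blast
 thus "f : dom B" by (rule domI[OF dom_L2[OF f] cdens_mono[OF g(1) assms(1)] g(2)])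
qed

end

section \<open>Scale functions\<close>

lemma measure_eqI_Ioc:
 fixes M N :: "real measure"
 assumes M: "sets M = sets borel" and N: "sets N = sets borel"
  and eq: "!!a b. a <= b ==> emeasure M {a<..b} = emeasure N {a<..b}" and fin: "!!a b. emeasure M {a<..b} ~= \<infinity>"
 shows "M = N"
proof -
 let ?G = "range (%(a, b). {a<..b::real})"
 have b: "sets (borel :: real measure) = sigma_sets UNIV ?G" by (subst borel_sigma_sets_Ioc) simp
 show ?thesis
 proof (rule measure_eqI_generator_eq[where E="?G" and \<Omega>=UNIV and A="%n. {- real n<..real n}"])
  show "Int_stable ?G"
  proof (rule Int_stableI_image)
   fix i j :: "real \<times> real"
   show "EX k:UNIV. (case i of (a, b) => {a<..b}) Int (case j of (a, b) => {a<..b}) = (case k of (a, b) => {a<..b})"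
    by (rule bexI[of _ "(max (fst i) (fst j), min (snd i) (snd j))"]) (auto split: prod.splits)
  qed
  show "emeasure M X = emeasure N X" if XG: "X : ?G" for X
  proof -
   obtain p where "X = (case p of (a, b) => {a<..b})" using XG by blast
   then obtain a b where X: "X = {a<..b}" by (cases p) simp
   show ?thesis
   proof (cases "a <= b")
    case False
    thus ?thesis by (simp add: X)
   qed (simp add: X eq)
  qed
  show "(\<Union>i. {- real i<..real i}) = UNIV"
  proof -
   have "x : (\<Union>i. {- real i<..real i})" for x
   proof -
    obtain n where "\<bar>x\<bar> < real n" using reals_Archimedean2 by blast
    thus ?thesis by (intro UN_I[of n]) auto
   qed
   thus ?thesis by blast
  qed
  show "range (%n. {- real n<..real n}) <= ?G" by (auto intro!: image_eqI[of _ _ "(- real _, real _)"])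
 qed (use M N b fin in auto)
qed

context
 fixes A :: "real set"
 assumes A[measurable]: "A : sets borel"
begin

lemma mI_finite: "emeasure lborel (A Int {x..y}) < \<infinity>"
proof -
 have "emeasure lborel (A Int {x..y}) <= emeasure lborel {x..y}" by (rule emeasure_mono) auto
 also have "\<dots> < \<infinity>" using emeasure_lborel_Icc_eq[of x y] by simp
 finally show ?thesis .
qed

lemma emeasure_mI: "emeasure lborel (A Int {x..y}) = ennreal (measure lborel (A Int {x..y}))"
 using mI_finite[of x y] by (intro emeasure_eq_ennreal_measure) auto

lemma mI_le: "x <= y ==> measure lborel (A Int {x..y}) <= y - x"
proof -
 assume xy: "x <= y"
 have "ennreal (measure lborel (A Int {x..y})) <= emeasure lborel {x..y}" unfolding emeasure_mI[symmetric] by (rule emeasure_mono) auto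
 thus "measure lborel (A Int {x..y}) <= y - x" using xy by simp
qed

lemma mI_self: "measure lborel (A Int {x..x}) = 0"
 using mI_le[of x x] measure_nonneg[of lborel "A Int {x..x}"] by linarith

lemma mI_add: assumes xyz: "x <= y" "y <= z" shows "measure lborel (A Int {x..z}) = measure lborel (A Int {x..y}) + measure lborel (A Int {y..z})"
proof -
 have "ennreal (measure lborel (A Int {x..z})) = emeasure lborel (A Int {x..y} Un A Int {y<..z})"
  unfolding emeasure_mI[symmetric] by (rule arg_cong[where f="emeasure lborel"]) (use xyz in auto)
 also have "\<dots> = emeasure lborel (A Int {x..y}) + emeasure lborel (A Int {y<..z})"
  by (rule plus_emeasure[symmetric]) auto
 also have "emeasure lborel (A Int {y<..z}) = emeasure lborel (A Int {y..z})"
  by (rule emeasure_eq_AE) (use AE_lborel_singleton[of y] in \<open>auto elim!: eventually_mono\<close>)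
 finally have "ennreal (measure lborel (A Int {x..z})) = ennreal (measure lborel (A Int {x..y}) + measure lborel (A Int {y..z}))" by (simp add: emeasure_mI)
 thus ?thesis by (simp del: ennreal_plus)
qed

end

text \<open>Common ground of both directions of the correspondence: the set may come from a scale
  function or the scale function from a set. Only increments on \<open>I\<close> are assumed; the
  behaviour of \<open>ext_scale\<close> beyond the ends is derived.\<close>

locale scale_space = qd_space E mu for E :: "real set" and mu :: "real measure" +
 fixes A :: "real set" and s :: "real => real"
 assumes adm: "adm A"
  and S_diff: "x : Ival E ==> y : Ival E ==> x <= y ==> ext_scale E s y - ext_scale E s x = measure lborel (A Int {x..y})"
begin

abbreviation S :: "real => real" where "S \<equiv> ext_scale E s"

abbreviation mA :: "real => real => real" where "mA x y \<equiv> measure lborel (A Int {x..y})"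

lemma A_borel[measurable]: "A : sets borel" and A_gaps: "gapU <= A" and A_I: "A <= I"
 using admD[OF adm] by auto

lemma S_E: "x : E ==> S x = s x"
 by (simp add: ext_scale_def)

lemmas mA_finite = mI_finite[OF A_borel] and emeasure_mA = emeasure_mI[OF A_borel] and mA_le = mI_le[OF A_borel]
 and mA_self = mI_self[OF A_borel] and mA_add = mI_add[OF A_borel]

text \<open>At a finite end outside \<open>E\<close> the extended scale is defined as a limit of
  \<open>s\<close> along \<open>E\<close>. Increments are at most the distance, so the limit exists
  and is the value predicted by the measure of \<open>A\<close>.\<close>

lemma S_left:
 assumes l: "lft E = ereal l" and x: "x <= l" and y: "y : I" shows "S y - S x = mA l y"
proof (cases "l : E")
 case True
 have "S x = S l"
 proof (cases "x : E")
  case True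
  hence "x = l" using lft_le[OF True] l x by simp
  thus ?thesis by simp
 next
  case False
  thus ?thesis using True x by (simp add: ext_scale_def l)
 qed
 moreover have "l <= y" using lft_le_I[OF y] l by simp
 ultimately show ?thesis using S_diff[OF E_sub_I[OF True] y] by simp
next
 case False
 hence L: Lopen unfolding Lopen_def l by auto
 have xE: "x ~: E"
 proof
  assume a: "x : E"
  hence "x = l" using lft_le[OF a] l x by simp
  thus False using False a by simp
 qed
 have gt: "l < z" if "z : I" for z using not_in_E_lft[OF L that] l by simp
 have "(s \<longlongrightarrow> S y - mA l y) (at l within E)"
 proof (rule tendstoI)
  fix e :: real assume e: "e > 0"
  show "\<forall>\<^sub>F z in at l within E. dist (s z) (S y - mA l y) < e"
   unfolding eventually_at
  proof (intro exI[of _ "min e (y - l)"] conjI ballI impI)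
   show "min e (y - l) > 0" using e gt[OF y] by simp
   fix z assume z: "z : E" "z ~= l & dist z l < min e (y - l)"
   have zl: "l < z" by (rule gt[OF E_sub_I[OF z(1)]])
   hence zy: "z < y" "z - l < e" using z(2) by (auto simp: dist_real_def)
   have "S y - S z = mA z y" by (rule S_diff[OF E_sub_I[OF z(1)] y]) (use zy in simp)
   moreover have "mA l y = mA l z + mA z y" by (rule mA_add) (use zl zy in auto)
   ultimately have "s z - (S y - mA l y) = mA l z" using S_E[OF z(1)] by simp
   thus "dist (s z) (S y - mA l y) < e" using mA_le[of l z] zl zy measure_nonneg[of lborel "A Int {l..z}"] by (simp add: dist_real_def)
  qed
 qed
 moreover have "~ trivial_limit (at l within E)"
  unfolding trivial_limit_within not_not islimpt_approachable
 proof (intro allI impI)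
  fix e :: real assume e: "0 < e"
  obtain z where z: "z : E" "z < l + e" using ex_E_below[of "l + e"] l e by auto
  have "l < z" by (rule gt[OF E_sub_I[OF z(1)]])
  thus "EX x':E. x' ~= l & dist x' l < e" using z by (intro bexI[of _ z]) (auto simp: dist_real_def)
 qed
 ultimately have "Lim (at l within E) s = S y - mA l y" by (rule tendsto_Lim[rotated])
 hence "S x = S y - mA l y" using xE x False by (subst ext_scale_def) (simp add: l)
 thus ?thesis by simp
qed

lemma S_right:
 assumes r: "rgt E = ereal r" and x: "r <= x" and y: "y : I" shows "S x - S y = mA y r"
proof (cases "r : E")
 case True
 have "S x = S r"
 proof (cases "x : E")
  case True
  hence "x = r" using rgt_ge[OF True] r x by simp
  thus ?thesis by simp
 next
  case False
  have "~ ereal x <= lft E"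
  proof
   assume "ereal x <= lft E"
   also note lft_less_rgt
   finally show False using r x by simp
  qed
  thus ?thesis using False True x by (simp add: ext_scale_def r)
 qed
 moreover have "y <= r" using rgt_ge_I[OF y] r by simp
 ultimately show ?thesis using S_diff[OF y E_sub_I[OF True]] by simp
next
 case False
 hence R: Ropen unfolding Ropen_def r by auto
 have xE: "x ~: E"
 proof
  assume a: "x : E"
  hence "x = r" using rgt_ge[OF a] r x by simp
  thus False using False a by simp
 qed
 have gt: "z < r" if "z : I" for z using not_in_E_rgt[OF R that] r by simp
 have "(s \<longlongrightarrow> S y + mA y r) (at r within E)"
 proof (rule tendstoI)
  fix e :: real assume e: "e > 0"
  show "\<forall>\<^sub>F z in at r within E. dist (s z) (S y + mA y r) < e"
   unfolding eventually_at
  proof (intro exI[of _ "min e (r - y)"] conjI ballI impI)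
   show "min e (r - y) > 0" using e gt[OF y] by simp
   fix z assume z: "z : E" "z ~= r & dist z r < min e (r - y)"
   have zl: "z < r" by (rule gt[OF E_sub_I[OF z(1)]])
   hence zy: "y < z" "r - z < e" using z(2) by (auto simp: dist_real_def)
   have "S z - S y = mA y z" by (rule S_diff[OF y E_sub_I[OF z(1)]]) (use zy in simp)
   moreover have "mA y r = mA y z + mA z r" by (rule mA_add) (use zl zy in auto)
   ultimately have "(S y + mA y r) - s z = mA z r" using S_E[OF z(1)] by simp
   thus "dist (s z) (S y + mA y r) < e" using mA_le[of z r] zl zy measure_nonneg[of lborel "A Int {z..r}"] unfolding dist_real_def by linarith
  qed
 qed
 moreover have "~ trivial_limit (at r within E)"
  unfolding trivial_limit_within not_not islimpt_approachable
 proof (intro allI impI)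
  fix e :: real assume e: "0 < e"
  obtain z where z: "z : E" "r - e < z" using ex_E_above[of "r - e"] r e by auto
  have "z < r" by (rule gt[OF E_sub_I[OF z(1)]])
  thus "EX x':E. x' ~= r & dist x' r < e" using z by (intro bexI[of _ z]) (auto simp: dist_real_def)
 qed
 ultimately have "Lim (at r within E) s = S y + mA y r" by (rule tendsto_Lim[rotated])
 moreover have "~ ereal x <= lft E"
 proof
  assume "ereal x <= lft E"
  also note lft_less_rgt
  finally show False using r x by simp
 qed
 ultimately have "S x = S y + mA y r" using xE x False by (subst ext_scale_def) (simp add: r)
 thus ?thesis by simp
qed

lemma I_cases:
 obtains "x : I" | l where "lft E = ereal l" "x <= l" | r where "rgt E = ereal r" "r <= x"
proof (cases "x : I")
 case False
 then consider "ereal x <= lft E" | "rgt E <= ereal x" unfolding Ival_def by force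
 thus ?thesis
 proof cases
  case 1
  thus ?thesis using that(2) lft_not_PInf by (cases "lft E") auto
 next
  case 2
  thus ?thesis using that(3) rgt_not_MInf by (cases "rgt E") auto
 qed
qed (use that in blast)

text \<open>Beyond a finite end of \<open>I\<close> the scale is constant and, since
  \<open>A\<close> lies in \<open>I\<close>, the measure of \<open>A\<close> no longer grows. The
  identity is needed on the entire line because the Stieltjes measure is built from a function on
  the line.\<close>

lemma S_diff_all: assumes xy: "x <= y" shows "S y - S x = mA x y"
proof -
 obtain z where z: "z : I" using E_nonempty E_sub_I by blast
 define D where "D x = (if z <= x then mA z x else - mA x z)" for x
 have SD: "S x - S z = D x" for x
 proof (cases x rule: I_cases)
  case 1
  thus ?thesis using S_diff[OF z 1] S_diff[OF 1 z] by (auto simp: D_def)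
 next
  case (2 l)
  have lz: "l <= z" using lft_le_I[OF z] 2 by simp
  have "emeasure lborel (A Int {x..l}) = emeasure lborel ({} :: real set)"
  proof (rule emeasure_eq_AE)
   have "t ~: A Int {x..l}" if "t ~= l" for t
   proof
    assume "t : A Int {x..l}"
    thus False using lft_le_I[of t] A_I 2(1) that by auto
   qed
   thus "AE t in lborel. t : A Int {x..l} \<longleftrightarrow> t : {}" using AE_lborel_singleton[of l] by (auto elim!: eventually_mono)
  qed auto
  hence "mA x l = 0" by (simp add: measure_def)
  hence m: "mA x z = mA l z" using mA_add[OF 2(2) lz] by simp
  have "S z - S x = mA l z" by (rule S_left[OF 2 z])
  moreover have "x = z" if "z <= x" using that 2(2) lz by simp
  ultimately show ?thesis using m mA_self by (auto simp: D_def)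
 next
  case (3 r)
  have zr: "z <= r" using rgt_ge_I[OF z] 3 by simp
  have "emeasure lborel (A Int {r..x}) = emeasure lborel ({} :: real set)"
  proof (rule emeasure_eq_AE)
   have "t ~: A Int {r..x}" if "t ~= r" for t
   proof
    assume "t : A Int {r..x}"
    thus False using rgt_ge_I[of t] A_I 3(1) that by auto
   qed
   thus "AE t in lborel. t : A Int {r..x} \<longleftrightarrow> t : {}" using AE_lborel_singleton[of r] by (auto elim!: eventually_mono)
  qed auto
  hence "mA r x = 0" by (simp add: measure_def)
  hence m: "mA z x = mA z r" using mA_add[OF zr 3(2)] by simp
  have "S x - S z = mA z r" by (rule S_right[OF 3 z])
  thus ?thesis using m zr 3(2) by (auto simp: D_def)
 qed
 have "D y - D x = mA x y"
 proof -
  consider "z <= x" | "x < z" "z <= y" | "y < z" by linarith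
  thus ?thesis
  proof cases
   case 1
   thus ?thesis using mA_add[OF 1 xy] xy by (simp add: D_def)
  next
   case 2
   thus ?thesis using mA_add[of x z y] by (simp add: D_def)
  next
   case 3
   thus ?thesis using mA_add[OF xy less_imp_le[OF 3]] xy by (simp add: D_def)
  qed
 qed
 thus ?thesis using SD[of x] SD[of y] by simp
qed

lemma S_mono: "x <= y ==> S x <= S y"
 using S_diff_all[of x y] measure_nonneg[of lborel "A Int {x..y}"] by linarith

lemma S_lip: "\<bar>S x - S y\<bar> <= \<bar>x - y\<bar>"
proof (cases "x <= y")
 case True
 thus ?thesis using S_diff_all[OF True] mA_le[OF True] measure_nonneg[of lborel "A Int {x..y}"] by linarith
next
 case False
 hence yx: "y <= x" by simp
 show ?thesis using S_diff_all[OF yx] mA_le[OF yx] measure_nonneg[of lborel "A Int {y..x}"] yx by linarith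
qed

lemma S_cont: "continuous_on UNIV S"
 unfolding continuous_on_iff
proof (intro ballI allI impI)
 fix x e :: real assume "0 < e"
 moreover have "dist (S x') (S x) <= dist x' x" for x' using S_lip[of x' x] by (simp add: dist_real_def)
 ultimately show "EX d>0. ALL x':UNIV. dist x' x < d --> dist (S x') (S x) < e" by (intro exI[of _ e]) (auto intro: le_less_trans)
qed

lemma S_meas[measurable]: "S : borel_measurable borel"
 using borel_measurable_continuous_onI[OF S_cont] .

lemma S_strict: assumes "x : I" "y : I" "x < y" shows "S x < S y"
proof -
 have "0 < emeasure lborel (A Int {x..y})" using adm assms unfolding adm_def by blast
 hence "0 < mA x y" by (simp add: emeasure_mA)
 thus ?thesis using S_diff_all[of x y] assms by simp
qed

lemma S_less_iff: "x : I ==> y : I ==> S x < S y \<longleftrightarrow> x < y"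
 using S_strict[of x y] S_mono[of y x] by linarith

lemma S_le_iff: "x : I ==> y : I ==> S x <= S y \<longleftrightarrow> x <= y"
 using S_less_iff[of y x] by linarith

lemma S_inj: "inj_on S I"
 using S_less_iff by (intro inj_onI) (metis less_irrefl not_less_iff_gr_or_eq)

lemma S_IVT: assumes "x <= y" "S x <= c" "c <= S y" obtains t where "x <= t" "t <= y" "S t = c"
 using IVT'[OF assms(2,3,1) continuous_on_subset[OF S_cont]] by blast

lemma ls_measure_eq: "ls_measure E s = density lborel (indicator A)"
proof (rule measure_eqI_Ioc)
 have c: "continuous (at_right a) S" for a
  using S_cont by (auto simp: continuous_on_eq_continuous_at continuous_at_imp_continuous_at_within)
 have e: "emeasure (ls_measure E s) {a<..b} = ennreal (if a <= b then S b - S a else 0)" for a b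
  unfolding ls_measure_def by (rule emeasure_interval_measure_Ioc_eq[OF S_mono c])
 thus "emeasure (ls_measure E s) {a<..b} ~= \<infinity>" for a b by simp
 fix a b :: real assume ab: "a <= b"
 have "emeasure (density lborel (indicator A)) {a<..b} = emeasure lborel (A Int {a<..b})" by (rule emeasure_restricted) auto
 also have "\<dots> = emeasure lborel (A Int {a..b})"
  by (rule emeasure_eq_AE) (use AE_lborel_singleton[of a] in \<open>auto elim!: eventually_mono\<close>)
 also have "\<dots> = ennreal (S b - S a)" using S_diff_all[OF ab] by (simp add: emeasure_mA)
 finally show "emeasure (ls_measure E s) {a<..b} = emeasure (density lborel (indicator A)) {a<..b}" using e ab by simp
qed (auto simp: ls_measure_def)

text \<open>Change of variables. It suffices to test half-open intervals: their ends are clamped to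
  the image and pulled back by the intermediate value theorem, and the measure of \<open>A\<close>
  between the preimages is the increment of \<open>S\<close>.\<close>

lemma push_forward:
 assumes xy: "x : I" "y : I" "x <= y"
 shows "distr (density lborel (indicator (A Int {x..y}))) borel S = density lborel (indicator {S x..S y})"
proof (rule measure_eqI_Ioc)
 have Sxy: "S x <= S y" by (rule S_mono[OF xy(3)])
 have L: "emeasure (distr (density lborel (indicator (A Int {x..y}))) borel S) B = emeasure lborel (A Int {x..y} Int S -` B)" if B: "B : sets borel" for B
 proof -
  have SB: "S -` B : sets borel" using measurable_sets[OF S_meas B] by simp
  have "emeasure (distr (density lborel (indicator (A Int {x..y}))) borel S) B = emeasure (density lborel (indicator (A Int {x..y}))) (S -` B Int space (density lborel (indicator (A Int {x..y}))))"
   by (rule emeasure_distr) (use B in simp_all)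
  also have "\<dots> = emeasure (density lborel (indicator (A Int {x..y}))) (S -` B)" by simp
  also have "\<dots> = emeasure lborel (A Int {x..y} Int S -` B)" by (rule emeasure_restricted) (use SB in auto)
  finally show ?thesis .
 qed
 show "emeasure (distr (density lborel (indicator (A Int {x..y}))) borel S) {a<..b} ~= \<infinity>" for a b
 proof -
  have SB: "S -` {a<..b} : sets borel" using measurable_sets[OF S_meas, of "{a<..b}"] by simp
  have "emeasure lborel (A Int {x..y} Int S -` {a<..b}) <= emeasure lborel (A Int {x..y})" by (rule emeasure_mono) (use SB in auto)
  also have "\<dots> < \<infinity>" by (rule mA_finite)
  finally show ?thesis by (simp add: L)
 qed
 fix a b :: real assume ab: "a <= b"
 define a' where "a' = max (S x) (min a (S y))"
 define b' where "b' = max (S x) (min b (S y))"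
 have ab': "S x <= a'" "a' <= b'" "b' <= S y" using ab Sxy by (auto simp: a'_def b'_def)
 obtain al where al: "x <= al" "al <= y" "S al = a'" using S_IVT[OF xy(3) ab'(1) order_trans[OF ab'(2,3)]] by blast
 obtain be where be: "x <= be" "be <= y" "S be = b'" using S_IVT[OF xy(3) order_trans[OF ab'(1,2)] ab'(3)] by blast
 have I': "t : I" if "x <= t" "t <= y" for t using I_convex[OF xy(1,2)] that by blast
 have albe: "al <= be" using S_le_iff[OF I'[OF al(1,2)] I'[OF be(1,2)]] al(3) be(3) ab'(2) by simp
 have SB: "S -` {a<..b} : sets borel" using measurable_sets[OF S_meas, of "{a<..b}"] by simp
 have "emeasure lborel (A Int {x..y} Int S -` {a<..b}) = emeasure lborel (A Int {al..be})"
 proof (rule emeasure_eq_AE)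
  have eq: "t : A Int {x..y} Int S -` {a<..b} \<longleftrightarrow> t : A Int {al..be}" if t: "t ~= x" "t ~= al" for t
  proof (cases "x <= t & t <= y")
   case True
   have ti: "t : I" using I' True by blast
   have tx: "S x < S t" by (rule S_strict[OF xy(1) ti]) (use True t in simp)
   have ty: "S t <= S y" using True by (intro S_mono) simp
   have "a < S t \<longleftrightarrow> a' < S t" using tx ty by (auto simp: a'_def max_def min_def)
   also have "\<dots> \<longleftrightarrow> al <= t" using S_less_iff[OF I'[OF al(1,2)] ti] al(3) t(2) by auto
   finally have 1: "a < S t \<longleftrightarrow> al <= t" .
   have "S t <= b \<longleftrightarrow> S t <= b'" using tx ty by (auto simp: b'_def max_def min_def)
   also have "\<dots> \<longleftrightarrow> t <= be" using S_le_iff[OF ti I'[OF be(1,2)]] be(3) by simp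
   finally show ?thesis using 1 True by auto
  next
   case False
   thus ?thesis using al be by auto
  qed
  show "AE t in lborel. t : A Int {x..y} Int S -` {a<..b} \<longleftrightarrow> t : A Int {al..be}"
   using AE_lborel_singleton[of x] AE_lborel_singleton[of al] by eventually_elim (rule eq)
 qed (use SB in auto)
 also have "\<dots> = ennreal (b' - a')" using S_diff_all[OF albe] al(3) be(3) by (simp add: emeasure_mA)
 also have "\<dots> = emeasure lborel {a'..b'}" using ab'(2) by simp
 also have "\<dots> = emeasure lborel ({S x..S y} Int {a<..b})"
 proof (rule emeasure_eq_AE)
  have eq: "t : {a'..b'} \<longleftrightarrow> t : {S x..S y} Int {a<..b}" if "t ~= a'" "t ~= S x" for t
   using that Sxy ab by (auto simp: a'_def b'_def max_def min_def split: if_splits)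
  show "AE t in lborel. t : {a'..b'} \<longleftrightarrow> t : {S x..S y} Int {a<..b}"
   using AE_lborel_singleton[of a'] AE_lborel_singleton[of "S x"] by eventually_elim (rule eq)
 qed auto
 also have "\<dots> = emeasure (density lborel (indicator {S x..S y})) {a<..b}" by (rule emeasure_restricted[symmetric]) auto
 finally show "emeasure (distr (density lborel (indicator (A Int {x..y}))) borel S) {a<..b} = emeasure (density lborel (indicator {S x..S y})) {a<..b}"
  by (simp add: L)
qed auto

lemma push_integral:
 fixes ph :: "real => real"
 assumes xy: "x : I" "y : I" "x <= y" and m[measurable]: "ph : borel_measurable borel"
 shows "set_integrable lborel (A Int {x..y}) (%t. ph (S t)) \<longleftrightarrow> set_integrable lborel {S x..S y} ph"
  and "(LBINT t:A Int {x..y}. ph (S t)) = (LBINT u:{S x..S y}. ph u)"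
proof -
 have d: "density lborel (indicator B) = density lborel (%x. ennreal (indicator B x))" for B :: "real set"
  by (simp add: ennreal_indicator)
 let ?M = "density lborel (indicator (A Int {x..y}))"
 have Sm: "S : measurable ?M borel" by simp
 have "set_integrable lborel (A Int {x..y}) (%t. ph (S t)) \<longleftrightarrow> integrable ?M (%t. ph (S t))"
  unfolding set_integrable_def d by (rule integrable_density[symmetric]) auto
 also have "\<dots> \<longleftrightarrow> integrable (distr ?M borel S) ph" by (rule integrable_distr_eq[symmetric, OF Sm]) simp
 also have "\<dots> \<longleftrightarrow> integrable (density lborel (indicator {S x..S y})) ph" unfolding push_forward[OF xy] ..
 also have "\<dots> \<longleftrightarrow> set_integrable lborel {S x..S y} ph"
  unfolding set_integrable_def d by (rule integrable_density) auto
 finally show "set_integrable lborel (A Int {x..y}) (%t. ph (S t)) \<longleftrightarrow> set_integrable lborel {S x..S y} ph" .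
 have "(LBINT t:A Int {x..y}. ph (S t)) = integral\<^sup>L ?M (%t. ph (S t))"
  unfolding set_lebesgue_integral_def d by (rule integral_density[symmetric]) auto
 also have "\<dots> = integral\<^sup>L (distr ?M borel S) ph" by (rule integral_distr[symmetric, OF Sm]) simp
 also have "\<dots> = integral\<^sup>L (density lborel (indicator {S x..S y})) ph" unfolding push_forward[OF xy] ..
 also have "\<dots> = (LBINT u:{S x..S y}. ph u)"
  unfolding set_lebesgue_integral_def d by (rule integral_density) auto
 finally show "(LBINT t:A Int {x..y}. ph (S t)) = (LBINT u:{S x..S y}. ph u)" .
qed

text \<open>The restriction to \<open>A\<close> is essential: the rest of \<open>I\<close> is mapped
  to a null set, on which \<open>P\<close> may fail throughout.\<close>

lemma push_AE:
 assumes P: "AE u in lborel. P u" shows "AE t in lborel. t : A --> P (S t)"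
proof -
 have n: "AE t in lborel. t : A Int {el n..er n} --> P (S t)" for n
 proof -
  let ?M = "density lborel (indicator (A Int {el n..er n})) :: real measure"
  have "AE u in distr ?M borel S. P u"
   unfolding push_forward[OF el_I er_I less_imp_le[OF el_er]]
   by (subst AE_density) (use P in \<open>auto elim!: eventually_mono\<close>)
  hence "AE t in ?M. P (S t)" by (rule AE_distrD[rotated]) simp
  hence "AE t in lborel. 0 < (indicator (A Int {el n..er n}) t :: ennreal) --> P (S t)" by (subst (asm) AE_density) auto
  thus ?thesis by eventually_elim (simp add: indicator_def)
 qed
 have "AE t in lborel. ALL n. t : A Int {el n..er n} --> P (S t)" unfolding AE_all_countable using n by blast
 thus ?thesis
 proof eventually_elim
  case (elim t)
  show ?case
  proof
   assume t: "t : A"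
   hence "t : (\<Union>n. {el n..er n})" using A_I I_UN by blast
   thus "P (S t)" using elim t by blast
  qed
 qed
qed

abbreviation U :: "real set" where "U \<equiv> S ` I"

lemma S_image: assumes "x : I" "y : I" "x <= y" shows "S ` {x..y} = {S x..S y}"
proof
 show "S ` {x..y} <= {S x..S y}" using S_mono by auto
 show "{S x..S y} <= S ` {x..y}"
 proof
  fix c assume "c : {S x..S y}"
  then obtain t where "x <= t" "t <= y" "S t = c" using S_IVT[OF assms(3), of c] by auto
  thus "c : S ` {x..y}" by (intro image_eqI[of _ _ t]) auto
 qed
qed

lemma U_UN: "U = (\<Union>n. {S (el n)..S (er n)})"
proof -
 have "U = (\<Union>n. S ` {el n..er n})" by (subst I_UN) (rule image_UN)
 thus ?thesis using S_image[OF el_I er_I less_imp_le[OF el_er]] by simp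
qed

lemma U_borel[measurable]: "U : sets borel"
 unfolding U_UN by measurable

lemma Icc_sub_U: assumes "x : I" "y : I" "x <= y" shows "{S x..S y} <= U"
 using S_image[OF assms] Icc_sub_I[OF assms(1,2)] by blast

lemma deriv_U_measurable:
 assumes g: "loc_abs_cont_on U g" shows "(%x. indicator U x * deriv g x) : borel_measurable borel"
proof (rule borel_measurable_deriv_UN_Icc[OF U_UN])
 fix n
 have "{S (el n)..S (er n)} <= U" by (rule Icc_sub_U[OF el_I er_I less_imp_le[OF el_er]])
 thus "continuous_on {S (el n)..S (er n)} g" using g unfolding loc_abs_cont_on_def by (intro abs_cont_continuous) blast
qed

lemma ls_set_integrable:
 fixes h :: "real => real"
 assumes "(%x. indicator I x * h x) : borel_measurable borel"
 shows "set_integrable (ls_measure E s) I h \<longleftrightarrow> integrable lborel (%t. indicator A t * h t)"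
proof -
 have d: "density lborel (indicator A) = density lborel (%x. ennreal (indicator A x))"
  by (simp add: ennreal_indicator)
 have "set_integrable (ls_measure E s) I h \<longleftrightarrow> integrable lborel (%t. indicator A t *\<^sub>R (indicator I t *\<^sub>R h t))"
  unfolding set_integrable_def ls_measure_eq d by (rule integrable_density) (use assms in auto)
 also have "(%t. indicator A t *\<^sub>R (indicator I t *\<^sub>R h t)) = (%t. indicator A t * h t)"
  by (intro ext) (use A_I in \<open>auto split: split_indicator\<close>)
 finally show ?thesis .
qed

text \<open>The chain rule in integrated form: the increment of \<open>g\<close> over the image
  interval is transported back by the change of variables, so the composition never has to be
  differentiated.\<close>

lemma H1es_rep_dens:
 assumes g: "H1es_rep E s g" shows "dens A (%x. g (S x)) (%t. indicator A t * deriv g (S t))"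
proof -
 have ac: "loc_abs_cont_on U g" and sq: "set_integrable (ls_measure E s) I (%x. (deriv g (S x))^2)" using g unfolding H1es_rep_def by auto
 define ph where "ph u = indicator U u * deriv g u" for u
 have ph[measurable]: "ph : borel_measurable borel" unfolding ph_def by (rule deriv_U_measurable[OF ac])
 have phS: "indicator B t * deriv g (S t) = indicator B t * ph (S t)" if "B <= I" for B t using that by (auto simp: ph_def indicator_def)
 have "(%x. indicator I x * (deriv g (S x))^2) = (%x. indicator I x * (ph (S x))^2)" by (auto simp: ph_def indicator_def)
 hence "(%x. indicator I x * (deriv g (S x))^2) : borel_measurable borel" by simp
 from ls_set_integrable[OF this] sq have "integrable lborel (%t. indicator A t * (deriv g (S t))^2)" by simp
 moreover have "(%t. indicator A t * (deriv g (S t))^2) = (%t. (indicator A t * deriv g (S t))^2)" by (auto simp: indicator_def)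
 moreover have "(%t. indicator A t * deriv g (S t)) : borel_measurable borel" unfolding phS[OF A_I] by measurable
 ultimately have "L2r (%t. indicator A t * deriv g (S t))" unfolding L2r_def by simp
 moreover have "g (S y) - g (S x) = pint (%t. indicator A t * deriv g (S t)) x y" if xy: "x : I" "y : I" "x <= y" for x y
 proof -
  have sub: "{S x..S y} <= U" by (rule Icc_sub_U[OF xy])
  hence "abs_cont_on {S x..S y} g" using ac unfolding loc_abs_cont_on_def by blast
  hence "g (S y) - g (S x) = pint (deriv g) (S x) (S y)" by (rule abs_cont_deriv(2)) (use S_mono[OF xy(3)] in auto)
  also have "\<dots> = pint ph (S x) (S y)" by (rule set_integral_cong') (use sub in \<open>auto simp: ph_def\<close>)
  also have "\<dots> = (LBINT t:A Int {x..y}. ph (S t))" by (rule push_integral(2)[OF xy ph, symmetric])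
  also have "\<dots> = pint (%t. indicator A t * deriv g (S t)) x y"
   unfolding phS[OF A_I] set_lebesgue_integral_def by (intro Bochner_Integration.integral_cong) (auto simp: indicator_def)
  finally show ?thesis .
 qed
 ultimately show ?thesis unfolding dens_def by simp
qed

text \<open>\<open>g\<close> is \<open>G\<close> read in the scale coordinate, with density
  \<open>k\<close> composed with the inverse of \<open>S\<close>. The inverse is monotone, hence
  Borel, and the change of variables transports integrals and square integrability.\<close>

lemma dens_H1es_rep:
 assumes d: "dens A G k" obtains g where "H1es_rep E s g" "!!x. x : I ==> g (S x) = G x"
proof -
 define T where "T = inv_into I S"
 have TS: "T (S x) = x" if "x : I" for x unfolding T_def by (rule inv_into_f_f[OF S_inj that])
 define g where "g u = G (T u)" for u
 have gS: "g (S x) = G x" if "x : I" for x using TS[OF that] by (simp add: g_def)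
 have k[measurable]: "k : borel_measurable borel" by (rule L2r_meas[OF densD(1)[OF d]])
 have kA: "k t = indicator A t * k t" for t using densD(2)[OF d, of t] by (cases "t : A") simp_all
 \<comment> \<open>Setting the inverse to 0 off the image makes it a Borel function on the whole
   line.\<close>
 define T' where "T' u = (if u : U then T u else 0)" for u
 have T'[measurable]: "T' : borel_measurable borel"
 proof -
  have "mono_on U T"
  proof (rule mono_onI)
   fix u v assume uv: "u : U" "v : U" "u <= v"
   then obtain x y where "x : I" "y : I" "u = S x" "v = S y" by blast
   thus "T u <= T v" using TS S_le_iff uv(3) by simp
  qed
  hence "T : borel_measurable (restrict_space borel U)" by (rule borel_measurable_mono_on_fnc)
  thus ?thesis unfolding T'_def by (subst (asm) measurable_restrict_space_iff[of _ _ 0]) auto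
 qed
 define ka where "ka u = k (T' u)" for u
 have ka[measurable]: "ka : borel_measurable borel" unfolding ka_def by measurable
 have kaS: "ka (S t) = k t" if "t : I" for t using TS[OF that] that by (simp add: ka_def T'_def)
 have kaSA: "(LBINT t:A Int {x..y}. f (ka (S t))) = (LBINT t:A Int {x..y}. f (k t))" for x y and f :: "real => real"
  by (rule set_integral_cong') (use kaS A_I in auto)
 have kp: "(LBINT t:A Int {x..y}. k t) = pint k x y" for x y
  unfolding set_lebesgue_integral_def by (intro Bochner_Integration.integral_cong) (use densD(2)[OF d] in \<open>auto simp: indicator_def\<close>)
 have gd: "g (S y) - g (S x) = pint ka (S x) (S y)" if xy: "x : I" "y : I" "x <= y" for x y
 proof -
  have "g (S y) - g (S x) = pint k x y" using gS xy densD(3)[OF d xy] by simp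
  also have "\<dots> = (LBINT t:A Int {x..y}. ka (S t))" using kaSA[of x y "%z. z"] kp by simp
  also have "\<dots> = pint ka (S x) (S y)" by (rule push_integral(2)[OF xy ka])
  finally show ?thesis .
 qed
 have sqi: "set_integrable lborel {S x..S y} (%u. (ka u)^2)" if xy: "x : I" "y : I" "x <= y" for x y
 proof -
  have "integrable lborel (%t. indicator (A Int {x..y}) t *\<^sub>R (k t)^2)"
   by (rule integrable_mult_indicator[OF _ L2r_sq[OF densD(1)[OF d]]]) simp
  moreover have "(%t. indicator (A Int {x..y}) t *\<^sub>R (k t)^2) = (%t. indicator (A Int {x..y}) t *\<^sub>R (ka (S t))^2)"
   by (intro ext) (use kaS A_I in \<open>auto split: split_indicator\<close>)
  ultimately have "set_integrable lborel (A Int {x..y}) (%t. (ka (S t))^2)" unfolding set_integrable_def by simp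
  thus ?thesis by (subst (asm) push_integral(1)[OF xy]) auto
 qed
 have L2ka: "L2r (%u. indicator {S x..S y} u * ka u)" if xy: "x : I" "y : I" "x <= y" for x y
 proof -
  have "(%u. (indicator {S x..S y} u * ka u)^2) = (%u. indicator {S x..S y} u *\<^sub>R (ka u)^2)" by (auto simp: indicator_def)
  thus ?thesis using sqi[OF xy] unfolding L2r_def set_integrable_def by simp
 qed
 have ac: "abs_cont_on {S x..S y} g" if xy: "x : I" "y : I" "x <= y" for x y
 proof (rule abs_cont_on_of_bound)
  let ?m = "%u. \<bar>indicator {S x..S y} u * ka u\<bar>"
  show "L2r ?m" using L2r_bound(1)[OF L2ka[OF xy], of ?m] by simp
  fix u v assume uv: "S x <= u" "u <= v" "v <= S y"
  obtain a where a: "x <= a" "a <= y" "S a = u" using S_IVT[OF xy(3) uv(1) order_trans[OF uv(2,3)]] by blast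
  obtain b where b: "x <= b" "b <= y" "S b = v" using S_IVT[OF xy(3) order_trans[OF uv(1,2)] uv(3)] by blast
  have aI: "a : I" "b : I" using I_convex[OF xy(1,2)] a b by blast+
  have ab: "a <= b" using S_le_iff[OF aI] a b uv(2) by simp
  have "\<bar>g v - g u\<bar> = \<bar>pint ka u v\<bar>" using gd[OF aI ab] a b by simp
  also have "pint ka u v = pint (%u. indicator {S x..S y} u * ka u) u v" by (rule set_integral_cong') (use uv in auto)
  also have "\<bar>\<dots>\<bar> <= pint ?m u v"
  proof -
   have "set_integrable lborel {u..v} (%u. indicator {S x..S y} u * ka u)" by (rule L2r_Icc[OF L2ka[OF xy]])
   from set_integral_norm_bound[OF this] show ?thesis by simp
  qed
  finally show "\<bar>g v - g u\<bar> <= pint ?m u v" .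
 qed
 have lac: "loc_abs_cont_on U g"
  unfolding loc_abs_cont_on_def
 proof (intro allI impI)
  fix c d assume cd: "{c..d} <= U"
  show "abs_cont_on {c..d} g"
  proof (cases "c <= d")
   case True
   hence "c : U" "d : U" using cd by auto
   then obtain x y where xy: "x : I" "y : I" "c = S x" "d = S y" by blast
   hence "x <= y" using S_le_iff True by simp
   thus ?thesis using ac xy by simp
  next
   case False
   \<comment> \<open>The interval is empty: only the empty family qualifies, and its sum is
     0.\<close>
   hence "{c..d} = {S (el 0)..S (el 0)} - {S (el 0)}" by auto
   thus ?thesis using False by (simp add: abs_cont_on_def) (metis less_numeral_extra(1) lessThan_0 not_gr0 sum.empty)
  qed
 qed
 have der: "AE u in lborel. u : {S (el n)<..<S (er n)} --> (g has_real_derivative ka u) (at u)" for n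
 proof -
  note n = el_I[of n] er_I[of n] less_imp_le[OF el_er[of n]]
  define h where "h u = indicator {S (el n)..S (er n)} u * ka u" for u
  have "integrable lborel h"
   using L2r_Icc[OF L2ka[OF n], of "S (el n)" "S (er n)"] unfolding set_integrable_def h_def
   by (rule Bochner_Integration.integrable_cong[THEN iffD1, OF refl, rotated]) (auto simp: indicator_def)
  from lebesgue_differentiation[OF this] show ?thesis
  proof eventually_elim
   case (elim u)
   show ?case
   proof
    assume u: "u : {S (el n)<..<S (er n)}"
    define d where "d = min (u - S (el n)) (S (er n) - u)"
    have "d > 0" using u by (auto simp: d_def)
    moreover have "g z - g y = (LBINT t:{y..z}. h t)" if yz: "u - d < y" "y <= z" "z < u + d" for y z
    proof -
     have y: "S (el n) <= y" "z <= S (er n)" using yz by (auto simp: d_def)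
     obtain a where a: "el n <= a" "a <= er n" "S a = y" using S_IVT[OF n(3) y(1) order_trans[OF yz(2) y(2)]] by blast
     obtain b where b: "el n <= b" "b <= er n" "S b = z" using S_IVT[OF n(3) order_trans[OF y(1) yz(2)] y(2)] by blast
     have aI: "a : I" "b : I" using I_convex[OF n(1,2)] a b by blast+
     have ab: "a <= b" using S_le_iff[OF aI] a b yz(2) by simp
     have "g z - g y = pint ka y z" using gd[OF aI ab] a b by simp
     also have "\<dots> = (LBINT t:{y..z}. h t)" by (rule set_integral_cong') (use y in \<open>auto simp: h_def\<close>)
     finally show ?thesis .
    qed
    ultimately have "(g has_real_derivative h u) (at u)" using elim by blast
    moreover have "h u = ka u" using u by (simp add: h_def)
    ultimately show "(g has_real_derivative ka u) (at u)" by simp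
   qed
  qed
 qed
 have "AE u in lborel. ALL n. u : {S (el n)<..<S (er n)} --> (g has_real_derivative ka u) (at u)" unfolding AE_all_countable using der by blast
 moreover have "AE u in lborel. ALL n. u ~= S (el n)" "AE u in lborel. ALL n. u ~= S (er n)"
  unfolding AE_all_countable by (intro allI AE_lborel_singleton)+
 ultimately have "AE u in lborel. u : U --> deriv g u = ka u"
 proof eventually_elim
  case (elim u)
  show ?case
  proof
   assume "u : U"
   then obtain n where "u : {S (el n)..S (er n)}" unfolding U_UN by blast
   hence "u : {S (el n)<..<S (er n)}" using elim by (auto simp: less_le)
   thus "deriv g u = ka u" using elim DERIV_imp_deriv by blast
  qed
 qed
 from push_AE[OF this] have ae: "AE t in lborel. (indicator A t * k t)^2 = indicator A t * (deriv g (S t))^2"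
 proof eventually_elim
  case (elim t)
  show ?case
  proof (cases "t : A")
   case True
   hence "t : I" using A_I by blast
   thus ?thesis using elim True kaS[of t] by simp
  qed simp
 qed
 define ph where "ph u = indicator U u * deriv g u" for u
 have ph[measurable]: "ph : borel_measurable borel" unfolding ph_def by (rule deriv_U_measurable[OF lac])
 have e1: "(%x. indicator I x * (deriv g (S x))^2) = (%x. indicator I x * (ph (S x))^2)" by (auto simp: ph_def indicator_def)
 have e2: "(%x. indicator A x * (deriv g (S x))^2) = (%x. indicator A x * (ph (S x))^2)"
  by (intro ext) (use A_I in \<open>auto simp: ph_def split: split_indicator\<close>)
 have m1: "(%x. indicator I x * (deriv g (S x))^2) : borel_measurable borel" unfolding e1 by measurable
 have m2: "(%x. indicator A x * (deriv g (S x))^2) : borel_measurable lborel" unfolding e2 by measurable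
 have "integrable lborel (%t. (indicator A t * k t)^2)" unfolding kA[symmetric] by (rule L2r_sq[OF densD(1)[OF d]])
 hence "integrable lborel (%t. indicator A t * (deriv g (S t))^2)"
  by (rule integrable_cong_AE_imp[OF _ m2]) (use ae in \<open>auto elim!: eventually_mono\<close>)
 hence "H1es_rep E s g" unfolding H1es_rep_def using lac ls_set_integrable[OF m1] by simp
 thus ?thesis using gS that by blast
qed

text \<open>A limit bounds the increments of \<open>S\<close> near the end, and thereby the measure
  of \<open>A\<close> there. Conversely, finite measure bounds the monotone function
  \<open>S\<close> from below, so it converges to its infimum.\<close>

lemma S_limit_left: "Lopen ==> (EX c. (S \<longlongrightarrow> c) (left_filter E)) \<longleftrightarrow> finL A"
proof -
 assume L: Lopen
 show ?thesis
 proof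
  assume "EX c. (S \<longlongrightarrow> c) (left_filter E)"
  then obtain c where "(S \<longlongrightarrow> c) (left_filter E)" ..
  hence "eventually (%x. dist (S x) c < 1) (left_filter E)" by (rule tendstoD) simp
  then obtain x0 where x0: "x0 : E" "!!x. x : I ==> x <= x0 ==> dist (S x) c < 1" unfolding eventually_left_filter[OF L] by blast
  have b: "emeasure lborel (A Int {el n..x0}) <= ennreal 2" for n
  proof (cases "el n <= x0")
   case True
   have "S x0 - S (el n) <= 2" using x0(2)[OF E_sub_I[OF x0(1)]] x0(2)[OF el_I True] by (auto simp: dist_real_def)
   thus ?thesis using S_diff_all[OF True] by (simp add: emeasure_mA del: ennreal_numeral)
  qed simp
  have "emeasure lborel (\<Union>n. A Int {el n..x0}) = (SUP n. emeasure lborel (A Int {el n..x0}))"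
  proof (rule SUP_emeasure_incseq[symmetric])
   show "incseq (%n. A Int {el n..x0})" using el_antimono by (fastforce simp: incseq_def)
  qed auto
  also have "\<dots> <= ennreal 2" by (rule SUP_least) (rule b)
  also have "\<dots> < \<infinity>" by simp
  also have "(\<Union>n. A Int {el n..x0}) = A Int {..x0}"
  proof -
   have "EX n. el n <= x" if "x : A" for x using exh_I[of x] A_I that by blast
   thus ?thesis by fastforce
  qed
  finally show "finL A" unfolding finL_def using L x0(1) by blast
 next
  assume "finL A"
  then obtain x0 where x0: "x0 : E" "emeasure lborel (A Int {..x0}) < \<infinity>" unfolding finL_def by blast
  define V where "V = S ` (I Int {..x0})"
  have ne: "V ~= {}" unfolding V_def using E_sub_I[OF x0(1)] by auto
  have bdd: "bdd_below V"
  proof (rule bdd_belowI)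
   fix v assume "v : V"
   then obtain x where x: "x : I" "x <= x0" "v = S x" unfolding V_def by auto
   have "mA x x0 <= measure lborel (A Int {..x0})" by (rule measure_mono_fmeasurable) (use x0(2) in \<open>auto simp: fmeasurable_def\<close>)
   thus "S x0 - measure lborel (A Int {..x0}) <= v" using S_diff_all[OF x(2)] x(3) by simp
  qed
  have "(S \<longlongrightarrow> Inf V) (left_filter E)"
  proof (rule tendstoI)
   fix e :: real assume e: "e > 0"
   hence "Inf V < Inf V + e" by simp
   then obtain v where "v : V" "v < Inf V + e" using cInf_lessD[OF ne] by blast
   then obtain y where y: "y : I" "y <= x0" "S y < Inf V + e" unfolding V_def by auto
   obtain z where z: "z : E" "z < y" using Lopen_below[OF L y(1)] by blast
   have "dist (S x) (Inf V) < e" if x: "x : I" "x <= z" for x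
   proof -
    have "S x : V" unfolding V_def using x z y by auto
    hence "Inf V <= S x" by (rule cInf_lower[OF _ bdd])
    moreover have "S x <= S y" by (rule S_mono) (use x z in simp)
    ultimately show ?thesis using y(3) by (simp add: dist_real_def)
   qed
   thus "eventually (%x. dist (S x) (Inf V) < e) (left_filter E)" unfolding eventually_left_filter[OF L] using z(1) by blast
  qed
  thus "EX c. (S \<longlongrightarrow> c) (left_filter E)" ..
 qed
qed

lemma S_limit_right: "Ropen ==> (EX c. (S \<longlongrightarrow> c) (right_filter E)) \<longleftrightarrow> finR A"
proof -
 assume R: Ropen
 show ?thesis
 proof
  assume "EX c. (S \<longlongrightarrow> c) (right_filter E)"
  then obtain c where "(S \<longlongrightarrow> c) (right_filter E)" ..
  hence "eventually (%x. dist (S x) c < 1) (right_filter E)" by (rule tendstoD) simp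
  then obtain x0 where x0: "x0 : E" "!!x. x : I ==> x0 <= x ==> dist (S x) c < 1" unfolding eventually_right_filter[OF R] by blast
  have b: "emeasure lborel (A Int {x0..er n}) <= ennreal 2" for n
  proof (cases "x0 <= er n")
   case True
   have "S (er n) - S x0 <= 2" using x0(2)[OF E_sub_I[OF x0(1)]] x0(2)[OF er_I True] by (auto simp: dist_real_def)
   thus ?thesis using S_diff_all[OF True] by (simp add: emeasure_mA del: ennreal_numeral)
  qed simp
  have "emeasure lborel (\<Union>n. A Int {x0..er n}) = (SUP n. emeasure lborel (A Int {x0..er n}))"
  proof (rule SUP_emeasure_incseq[symmetric])
   show "incseq (%n. A Int {x0..er n})" using er_mono by (fastforce simp: incseq_def)
  qed auto
  also have "\<dots> <= ennreal 2" by (rule SUP_least) (rule b)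
  also have "\<dots> < \<infinity>" by simp
  also have "(\<Union>n. A Int {x0..er n}) = A Int {x0..}"
  proof -
   have "EX n. x <= er n" if "x : A" for x using exh_I[of x] A_I that by blast
   thus ?thesis by fastforce
  qed
  finally show "finR A" unfolding finR_def using R x0(1) by blast
 next
  assume "finR A"
  then obtain x0 where x0: "x0 : E" "emeasure lborel (A Int {x0..}) < \<infinity>" unfolding finR_def by blast
  define V where "V = S ` (I Int {x0..})"
  have ne: "V ~= {}" unfolding V_def using E_sub_I[OF x0(1)] by auto
  have bdd: "bdd_above V"
  proof (rule bdd_aboveI)
   fix v assume "v : V"
   then obtain x where x: "x : I" "x0 <= x" "v = S x" unfolding V_def by auto
   have "mA x0 x <= measure lborel (A Int {x0..})" by (rule measure_mono_fmeasurable) (use x0(2) in \<open>auto simp: fmeasurable_def\<close>)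
   thus "v <= S x0 + measure lborel (A Int {x0..})" using S_diff_all[OF x(2)] x(3) by simp
  qed
  have "(S \<longlongrightarrow> Sup V) (right_filter E)"
  proof (rule tendstoI)
   fix e :: real assume e: "e > 0"
   hence "Sup V - e < Sup V" by simp
   then obtain v where "v : V" "Sup V - e < v" using less_cSupD[OF ne] by blast
   then obtain y where y: "y : I" "x0 <= y" "Sup V - e < S y" unfolding V_def by auto
   obtain z where z: "z : E" "y < z" using Ropen_above[OF R y(1)] by blast
   have "dist (S x) (Sup V) < e" if x: "x : I" "z <= x" for x
   proof -
    have "S x : V" unfolding V_def using x z y by auto
    hence "S x <= Sup V" by (rule cSup_upper[OF _ bdd])
    moreover have "S y <= S x" by (rule S_mono) (use x z in simp)
    ultimately show ?thesis using y(3) by (simp add: dist_real_def)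
   qed
   thus "eventually (%x. dist (S x) (Sup V) < e) (right_filter E)" unfolding eventually_right_filter[OF R] using z(1) by blast
  qed
  thus "EX c. (S \<longlongrightarrow> c) (right_filter E)" ..
 qed
qed

lemma finL_iff: "finL A \<longleftrightarrow> Lopen & (EX c. (S \<longlongrightarrow> c) (left_filter E))"
 using S_limit_left by (auto simp: finL_def)

lemma finR_iff: "finR A \<longleftrightarrow> Ropen & (EX c. (S \<longlongrightarrow> c) (right_filter E))"
 using S_limit_right by (auto simp: finR_def)

lemma qds_domain_eq: "qds_domain E mu s = dom A"
proof (intro set_eqI iffI)
 fix f assume f: "f : qds_domain E mu s"
 have "f : L2 mu & (EX g. H1es_rep E s g & (AE x in mu. f x = g (S x))
   & (finL A --> ((%x. g (S x)) \<longlongrightarrow> 0) (left_filter E)) & (finR A --> ((%x. g (S x)) \<longlongrightarrow> 0) (right_filter E)))"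
  using f unfolding qds_domain_def finL_iff finR_iff Lopen_def Ropen_def mem_Collect_eq .
 then obtain g where g: "f : L2 mu" "H1es_rep E s g" "AE x in mu. f x = g (S x)"
   "finL A --> ((%x. g (S x)) \<longlongrightarrow> 0) (left_filter E)" "finR A --> ((%x. g (S x)) \<longlongrightarrow> 0) (right_filter E)"
  by (elim exE conjE) rule
 obtain g' where g': "cdens A g' (Pk (%x. g (S x)) (%t. indicator A t * deriv g (S t)))" "!!x. x : E ==> g' x = g (S x)"
  by (rule canonical[OF H1es_rep_dens[OF g(2)] A_gaps]) blast
 have ae: "AE x in mu. f x = g' x" using g(3) AE_space by eventually_elim (simp add: g'(2) space_mu)
 have "bd A g'" unfolding bd_def
 proof (intro conjI impI)
  assume "finL A"
  thus "LB g'" by (intro LB_cong[OF _ left_limit_imp_LB[of "%x. g (S x)"]]) (use g g'(2) finL_iff in auto)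
 next
  assume "finR A"
  thus "RB g'" by (intro RB_cong[OF _ right_limit_imp_RB[of "%x. g (S x)"]]) (use g g'(2) finR_iff in auto)
 qed
 thus "f : dom A" by (rule domI[OF g(1) g'(1) ae])
next
 fix f assume f: "f : dom A"
 obtain G k where G: "cdens A G k" "AE x in mu. f x = G x" "bd A G" by (rule domE[OF f]) blast
 obtain g where g: "H1es_rep E s g" "!!x. x : I ==> g (S x) = G x" using dens_H1es_rep[OF cdens_dens[OF G(1)]] by blast
 have ae: "AE x in mu. f x = g (S x)" using G(2) AE_space by eventually_elim (simp add: g(2) E_sub_I space_mu)
 have l: "finL A --> ((%x. g (S x)) \<longlongrightarrow> 0) (left_filter E)"
 proof
  assume a: "finL A"
  hence L: Lopen by (simp add: finL_def)
  have "(G \<longlongrightarrow> 0) (left_filter E)" using G(3) a by (intro LB_imp_left_limit[OF L G(1)]) (simp add: bd_def)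
  moreover have "eventually (%x. G x = g (S x)) (left_filter E)" unfolding eventually_left_filter[OF L] using E_nonempty g(2) by auto
  ultimately show "((%x. g (S x)) \<longlongrightarrow> 0) (left_filter E)" by (rule Lim_transform_eventually)
 qed
 have r: "finR A --> ((%x. g (S x)) \<longlongrightarrow> 0) (right_filter E)"
 proof
  assume a: "finR A"
  hence R: Ropen by (simp add: finR_def)
  have "(G \<longlongrightarrow> 0) (right_filter E)" using G(3) a by (intro RB_imp_right_limit[OF R G(1)]) (simp add: bd_def)
  moreover have "eventually (%x. G x = g (S x)) (right_filter E)" unfolding eventually_right_filter[OF R] using E_nonempty g(2) by auto
  ultimately show "((%x. g (S x)) \<longlongrightarrow> 0) (right_filter E)" by (rule Lim_transform_eventually)
 qed
 show "f : qds_domain E mu s"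
  unfolding qds_domain_def mem_Collect_eq
  using dom_L2[OF f] g(1) ae l[unfolded finL_iff Lopen_def] r[unfolded finR_iff Ropen_def] by (intro conjI exI[of _ g])
qed

text \<open>Gaps are contained in \<open>A\<close>, so the scale has slope one on them and the
  denominators of the two jump sums coincide.\<close>

lemma s_gap: assumes p: "p : gaps E" shows "s (snd p) - s (fst p) = snd p - fst p"
proof -
 have p': "fst p : E" "snd p : E" "fst p < snd p" using gapsD[OF p] by auto
 have "{fst p<..<snd p} <= A" using A_gaps p unfolding gapU_def by blast
 hence "emeasure lborel {fst p<..<snd p} <= emeasure lborel (A Int {fst p..snd p})" by (intro emeasure_mono) auto
 hence "snd p - fst p <= mA (fst p) (snd p)" using p'(3) by (simp add: emeasure_mA)
 hence "mA (fst p) (snd p) = snd p - fst p" using mA_le[OF less_imp_le[OF p'(3)]] by simp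
 thus ?thesis using S_diff_all[OF less_imp_le[OF p'(3)]] S_E p' by simp
qed

lemma qds_form_eq:
 assumes f: "f : dom A" and h: "h : dom A" shows "qds_form E mu s f h = form f h"
proof -
 have ex: "EX g. H1es_rep E s g & (AE x in mu. f x = g (S x))" if "f : dom A" for f
 proof -
  have "f : qds_domain E mu s" using that qds_domain_eq by simp
  thus ?thesis unfolding qds_domain_def by blast
 qed
 define gf where "gf = (SOME g. H1es_rep E s g & (AE x in mu. f x = g (S x)))"
 define gh where "gh = (SOME g. H1es_rep E s g & (AE x in mu. h x = g (S x)))"
 have gf: "H1es_rep E s gf" "AE x in mu. f x = gf (S x)" using someI_ex[OF ex[OF f]] unfolding gf_def by blast+
 have gh: "H1es_rep E s gh" "AE x in mu. h x = gh (S x)" using someI_ex[OF ex[OF h]] unfolding gh_def by blast+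
 note df = H1es_rep_dens[OF gf(1)] and dh = H1es_rep_dens[OF gh(1)]
 have mf: "(%t. indicator A t * deriv gf (S t)) : borel_measurable borel" "(%t. indicator A t * deriv gh (S t)) : borel_measurable borel"
  using L2r_meas[OF densD(1)[OF df]] L2r_meas[OF densD(1)[OF dh]] .
 have d: "density lborel (indicator A) = density lborel (%x. ennreal (indicator A x))"
  by (simp add: ennreal_indicator)
 define ph where "ph g u = indicator U u * deriv g u" for g :: "real => real" and u
 have ph[measurable]: "ph gf : borel_measurable borel" "ph gh : borel_measurable borel"
  unfolding ph_def using gf(1) gh(1) by (auto intro!: deriv_U_measurable simp: H1es_rep_def)
 have eE: "(%t. indicator E t *\<^sub>R (deriv gf (S t) * deriv gh (S t))) = (%t. indicator E t * (ph gf (S t) * ph gh (S t)))"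
  using E_sub_I by (auto simp: ph_def indicator_def)
 have "(LINT x:E|ls_measure E s. deriv gf (S x) * deriv gh (S x)) = (\<integral>t. indicator A t *\<^sub>R (indicator E t *\<^sub>R (deriv gf (S t) * deriv gh (S t))) \<partial>lborel)"
  unfolding set_lebesgue_integral_def ls_measure_eq d by (rule integral_density) (unfold eE, measurable)
 also have "\<dots> = (LBINT t:-gapU. (indicator A t * deriv gf (S t)) * (indicator A t * deriv gh (S t)))"
  unfolding set_lebesgue_integral_def
 proof (rule bintegral_cong)
  fix t
  have "t : E \<longleftrightarrow> t ~: gapU" if "t : A" using gapU_eq E_sub_I A_I that by blast
  thus "indicator A t *\<^sub>R (indicator E t *\<^sub>R (deriv gf (S t) * deriv gh (S t)))
    = indicator (- gapU) t *\<^sub>R (indicator A t * deriv gf (S t) * (indicator A t * deriv gh (S t)))"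
   by (auto simp: indicator_def)
 qed
 finally have 1: "(LINT x:E|ls_measure E s. deriv gf (S x) * deriv gh (S x))
  = (LBINT t:-gapU. (indicator A t * deriv gf (S t)) * (indicator A t * deriv gh (S t)))" .
 have 2: "infsum (%p. (gf (S (snd p)) - gf (S (fst p))) * (gh (S (snd p)) - gh (S (fst p))) / (s (snd p) - s (fst p))) (gaps E)
  = infsum (%p. (gf (S (snd p)) - gf (S (fst p))) * (gh (S (snd p)) - gh (S (fst p))) / (snd p - fst p)) (gaps E)"
  by (rule infsum_cong) (simp add: s_gap)
 show ?thesis
  unfolding form_eq_dens[OF A_gaps A_I df dh gf(2) gh(2)] qds_form_def gf_def[symmetric] gh_def[symmetric] Let_def 1 2 ..
qed

end

text \<open>A Fukushima subspace carries an arbitrary function that agrees with the given form on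
  the domain only, so the two cannot be rewritten into each other. Every clause evaluates the form
  at elements of \<open>F\<close>, because \<open>F\<close> is a linear space stable under the unit
  contraction.\<close>

lemma dirichlet_form_cong:
 assumes D: "dirichlet_form mu F Ef" and eq: "!!f g. f : F ==> g : F ==> Ef' f g = Ef f g"
 shows "dirichlet_form mu F Ef'"
proof -
 note d = D[unfolded dirichlet_form_def]
 have add: "(%x. f x + g x) : F" if "f : F" "g : F" for f g using d that by blast
 have cm: "(%x. c * f x) : F" if "f : F" for c f using d that by blast
 have diff: "(%x. f x - g x) : F" if "f : F" "g : F" for f g using add[OF that(1) cm[OF that(2), of "-1"]] by simp
 have unit: "(%x. min 1 (max 0 (f x))) : F" if "f : F" for f using d that by blast
 have E1: "E1 mu Ef' (%x. f x - g x) = E1 mu Ef (%x. f x - g x)" if "f : F" "g : F" for f g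
  unfolding E1_def using eq[OF diff[OF that] diff[OF that]] by simp
 have ae: "ALL f:F. ALL g:F. ALL h:F. (AE x in mu. f x = g x) --> Ef f h = Ef g h"
  and a: "ALL f:F. ALL g:F. ALL h:F. Ef (%x. f x + g x) h = Ef f h + Ef g h"
  and c: "ALL c. ALL f:F. ALL g:F. Ef (%x. c * f x) g = c * Ef f g"
  and s: "ALL f:F. ALL g:F. Ef f g = Ef g f" and n: "ALL f:F. 0 <= Ef f f"
  and m: "ALL f:F. (%x. min 1 (max 0 (f x))) : F & Ef (%x. min 1 (max 0 (f x))) (%x. min 1 (max 0 (f x))) <= Ef f f"
  and cl: "ALL u::nat => rfun. (ALL n. u n : F) & (ALL e>0. EX N. ALL m>=N. ALL n>=N. E1 mu Ef (%x. u n x - u m x) < e)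
   --> (EX f:F. (%n. E1 mu Ef (%x. u n x - f x)) ----> 0)"
  using d by - (elim conjE, assumption)+
 have 1: "ALL f:F. ALL g:F. ALL h:F. (AE x in mu. f x = g x) --> Ef' f h = Ef' g h"
 proof (intro ballI impI)
  fix f g h assume f: "f : F" "g : F" "h : F" "AE x in mu. f x = g x"
  hence "Ef f h = Ef g h" using ae by blast
  thus "Ef' f h = Ef' g h" using eq[OF f(1,3)] eq[OF f(2,3)] by simp
 qed
 have 2: "ALL f:F. ALL g:F. ALL h:F. Ef' (%x. f x + g x) h = Ef' f h + Ef' g h"
  using a by (simp add: eq add)
 have 3: "ALL c. ALL f:F. ALL g:F. Ef' (%x. c * f x) g = c * Ef' f g" using c by (simp add: eq cm)
 have 4: "ALL f:F. ALL g:F. Ef' f g = Ef' g f" using s by (simp add: eq)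
 have 5: "ALL f:F. 0 <= Ef' f f" using n by (simp add: eq)
 have 6: "ALL f:F. (%x. min 1 (max 0 (f x))) : F & Ef' (%x. min 1 (max 0 (f x))) (%x. min 1 (max 0 (f x))) <= Ef' f f"
  using m unit by (simp add: eq)
 have 7: "ALL u::nat => rfun. (ALL n. u n : F) & (ALL e>0. EX N. ALL m>=N. ALL n>=N. E1 mu Ef' (%x. u n x - u m x) < e)
   --> (EX f:F. (%n. E1 mu Ef' (%x. u n x - f x)) ----> 0)"
 proof (intro allI impI)
  fix u :: "nat => rfun"
  assume u: "(ALL n. u n : F) & (ALL e>0. EX N. ALL m>=N. ALL n>=N. E1 mu Ef' (%x. u n x - u m x) < e)"
  hence uF: "u n : F" for n by blast
  have "ALL e>0. EX N. ALL m>=N. ALL n>=N. E1 mu Ef (%x. u n x - u m x) < e" using u by (simp add: E1[OF uF uF])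
  then obtain f where "f : F" "(%n. E1 mu Ef (%x. u n x - f x)) ----> 0" using cl uF by blast
  thus "EX f:F. (%n. E1 mu Ef' (%x. u n x - f x)) ----> 0" using E1[OF uF] by (intro bexI[of _ f]) simp_all
 qed
 from d show ?thesis unfolding dirichlet_form_def
  by (elim conjE) (intro conjI; (assumption | rule 1 2 3 4 5 6 7))
qed

lemma regular_dirichlet_form_cong:
 assumes D: "regular_dirichlet_form E mu F Ef" and eq: "!!f g. f : F ==> g : F ==> Ef' f g = Ef f g"
 shows "regular_dirichlet_form E mu F Ef'"
proof -
 have d: "dirichlet_form mu F Ef" using D unfolding regular_dirichlet_form_def by blast
 have add: "(%x. f x + g x) : F" if "f : F" "g : F" for f g using d[unfolded dirichlet_form_def] that by blast
 have cm: "(%x. c * f x) : F" if "f : F" for c f using d[unfolded dirichlet_form_def] that by blast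
 have diff: "(%x. f x - g x) : F" if "f : F" "g : F" for f g using add[OF that(1) cm[OF that(2), of "-1"]] by simp
 have E1: "E1 mu Ef' (%x. f x - g x) = E1 mu Ef (%x. f x - g x)" if "f : F" "g : F" for f g
  unfolding E1_def using eq[OF diff[OF that] diff[OF that]] by simp
 have a: "ALL f:F. ALL e>0. EX g:F Int Cc_on E. E1 mu Ef (%x. f x - g x) < e"
  and b: "ALL f:Cc_on E. ALL e>0. EX g:F Int Cc_on E. ALL x:E. \<bar>f x - g x\<bar> < e"
  using D unfolding regular_dirichlet_form_def by blast+
 have "ALL f:F. ALL e>0. EX g:F Int Cc_on E. E1 mu Ef' (%x. f x - g x) < e"
 proof (intro ballI allI impI)
  fix f and e :: real assume f: "f : F" "0 < e"
  obtain g where g: "g : F Int Cc_on E" "E1 mu Ef (%x. f x - g x) < e" using a f by blast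
  thus "EX g:F Int Cc_on E. E1 mu Ef' (%x. f x - g x) < e" using E1[OF f(1), of g] by (intro bexI[of _ g]) auto
 qed
 thus ?thesis unfolding regular_dirichlet_form_def using dirichlet_form_cong[OF d eq] b by blast
qed

section \<open>Correspondence between scale functions and admissible sets\<close>

context qd_space
begin

lemma dom_sub_dom_I: "adm A ==> dom A <= dom I"
 by (rule dom_mono[OF admD(3) I_borel])

lemma fukushima_dom:
 assumes A: "adm A" and e: "!!f g. f : dom A ==> g : dom A ==> E' f g = form f g"
 shows "fukushima_subspace E mu (qd_domain E mu) (qd_form E mu) (dom A) E'"
 unfolding fukushima_subspace_def qd_domain_eq
proof (intro conjI ballI)
 show "regular_dirichlet_form E mu (dom A) E'" by (rule regular_dirichlet_form_cong[OF regular_dirichlet_dom[OF A] e])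
 show "dom A <= dom I" by (rule dom_sub_dom_I[OF A])
 thus "E' f g = qd_form E mu f g" if f: "f : dom A" "g : dom A" for f g
  using e[OF f] qd_form_eq[OF subsetD subsetD, OF _ f(1) _ f(2)] by simp
qed

lemma pint_indicator: "A : sets borel ==> pint (indicator A) x y = measure lborel (A Int {x..y})"
proof -
 assume "A : sets borel"
 have "pint (indicator A) x y = (\<integral>t. indicator (A Int {x..y}) t \<partial>lborel)"
  unfolding set_lebesgue_integral_def by (rule Bochner_Integration.integral_cong) (auto simp: indicator_def)
 thus ?thesis by simp
qed

text \<open>As the derivative is 0 or 1 almost everywhere, increments of the scale are measures of
  the set where it is 1. Strict monotonicity then says that this set meets every interval in
  positive measure.\<close>

lemma scale_S_imp_scale_space:
 assumes s: "s : scale_S E" shows "EX A. scale_space E mu A s"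
proof -
 let ?S = "ext_scale E s"
 have st: "strict_mono_on I ?S" and ac: "loc_abs_cont_on I ?S"
  and d01: "AE x in lborel. x : I --> (?S has_real_derivative 0) (at x) | (?S has_real_derivative 1) (at x)"
  and dg: "!!x. x : I - E ==> (?S has_real_derivative 1) (at x)"
  using s unfolding scale_S_def by auto
 define h where "h x = indicator I x * deriv ?S x" for x
 have h[measurable]: "h : borel_measurable borel" unfolding h_def by (rule deriv_I_measurable[OF ac])
 \<comment> \<open>Only interior points are collected: at an end of \<open>I\<close> the derivative
   would involve the constant continuation.\<close>
 define A where "A = J Int {x. h x = 1}"
 have JI: "x : I" if "x : J" for x using that J_sub by blast
 have Ab[measurable]: "A : sets borel"
  unfolding A_def using J_open by (intro sets.Int) auto
 have AI: "A <= I" using J_sub by (auto simp: A_def)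
 have gA: "gapU <= A"
 proof
  fix x assume "x : gapU"
  hence x: "x : I - E" using gapU_eq by simp
  hence "x : J" by (auto simp: Ival_def J_def)
  moreover have "h x = 1" using DERIV_imp_deriv[OF dg[OF x]] x by (simp add: h_def)
  ultimately show "x : A" by (simp add: A_def)
 qed
 have hA: "AE x in lborel. x : I --> h x = indicator A x"
  using d01 AE_J
 proof eventually_elim
  case (elim x)
  show ?case
  proof
   assume x: "x : I"
   hence "x : J" using elim by simp
   moreover have "deriv ?S x = 0 | deriv ?S x = 1" using elim(1) x DERIV_imp_deriv by blast
   ultimately show "h x = indicator A x" using x by (auto simp: h_def A_def)
  qed
 qed
 have df: "?S y - ?S x = measure lborel (A Int {x..y})" if xy: "x : I" "y : I" "x <= y" for x y
 proof -
  have sub: "{x..y} <= I" by (rule Icc_sub_I[OF xy(1,2)])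
  hence "abs_cont_on {x..y} ?S" using ac unfolding loc_abs_cont_on_def by blast
  hence "?S y - ?S x = pint (deriv ?S) x y" by (rule abs_cont_deriv(2)) (use xy in auto)
  also have "\<dots> = pint h x y" by (rule set_integral_cong') (use sub in \<open>auto simp: h_def\<close>)
  also have "\<dots> = pint (indicator A) x y"
   unfolding set_lebesgue_integral_def
   by (rule integral_cong_AE) (use hA sub in \<open>auto elim!: eventually_mono simp: indicator_def\<close>)
  also have "\<dots> = measure lborel (A Int {x..y})" by (rule pint_indicator[OF Ab])
  finally show ?thesis .
 qed
 have "0 < emeasure lborel (A Int {x..y})" if xy: "x : I" "y : I" "x < y" for x y
 proof -
  have "?S x < ?S y" by (rule strict_mono_onD[OF st xy])
  hence "0 < measure lborel (A Int {x..y})" using df[OF xy(1,2)] xy(3) by simp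
  thus ?thesis by (simp add: emeasure_mI[OF Ab])
 qed
 hence "adm A" unfolding adm_def using Ab gA AI by blast
 hence "scale_space E mu A s" using df by unfold_locales
 thus ?thesis ..
qed

lemma gap_ext_scale:
 assumes p: "p : gaps E" and x: "fst p < x" "x < snd p"
 shows "ext_scale E s x = s (fst p) + (s (snd p) - s (fst p)) / (snd p - fst p) * (x - fst p)"
proof -
 have xI: "x : I" using gap_sub_I[OF p] x by auto
 have xE: "x ~: E" by (rule gap_inter_E[OF p x])
 have "lft E < ereal x" "ereal x < rgt E" using xI xE by (auto simp: Ival_def)
 moreover have "(THE p. p : gaps E & fst p < x & x < snd p) = p"
  using p x gap_unique by (intro the_equality) blast+
 ultimately show ?thesis using xE by (simp add: ext_scale_def not_le[symmetric])
qed

text \<open>The scale is the signed measure of \<open>A\<close> from a base point. What has to be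
  checked is that \<open>ext_scale\<close>, defined on gaps by linear interpolation, reproduces it
  there; it does because \<open>A\<close> contains the gaps.\<close>

lemma adm_imp_scale_space:
 assumes A: "adm A" shows "EX s:scale_S E. scale_space E mu A s"
proof -
 note Ab[measurable] = admD(1)[OF A] and gA = admD(2)[OF A] and AI = admD(3)[OF A]
 let ?m = "%x y. measure lborel (A Int {x..y})"
 define z where "z = el 0"
 define s where "s x = (if z <= x then ?m z x else - ?m x z)" for x
 have sd: "s y - s x = ?m x y" if xy: "x <= y" for x y
 proof -
  consider "z <= x" | "x < z" "z <= y" | "y < z" by linarith
  thus ?thesis
  proof cases
   case 1
   thus ?thesis using mI_add[OF Ab 1 xy] xy by (simp add: s_def)
  next
   case 2
   thus ?thesis using mI_add[OF Ab, of x z y] by (simp add: s_def)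
  next
   case 3
   thus ?thesis using mI_add[OF Ab xy less_imp_le[OF 3]] xy by (simp add: s_def)
  qed
 qed
 let ?S = "ext_scale E s"
 have mg: "?m x y = y - x" if p: "p : gaps E" and xy: "fst p <= x" "x <= y" "y <= snd p" for p x y
 proof -
  have "{fst p<..<snd p} <= A" using gA p unfolding gapU_def by blast
  hence "{x<..<y} <= A" using xy by fastforce
  hence "emeasure lborel {x<..<y} <= emeasure lborel (A Int {x..y})" by (intro emeasure_mono) auto
  hence "y - x <= ?m x y" using xy(2) by (simp add: emeasure_mI[OF Ab])
  thus ?thesis using mI_le[OF Ab xy(2)] by simp
 qed
 have Ss: "?S x = s x" if x: "x : I" for x
 proof (cases "x : E")
  case False
  obtain p where p: "p : gaps E" "fst p < x" "x < snd p" by (rule gap_ex[OF x False])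
  have ab: "fst p < snd p" using gapsD[OF p(1)] by simp
  have "s (snd p) - s (fst p) = snd p - fst p" using sd[of "fst p" "snd p"] mg[OF p(1), of "fst p" "snd p"] ab by simp
  moreover have "s x - s (fst p) = x - fst p" using sd[of "fst p" x] mg[OF p(1), of "fst p" x] p by simp
  ultimately show ?thesis using gap_ext_scale[OF p, of s] ab by simp
 qed (simp add: ext_scale_def)
 have Sd: "?S y - ?S x = ?m x y" if "x : I" "y : I" "x <= y" for x y using Ss that sd by simp
 have "scale_space E mu A s" using A Sd by unfold_locales
 then interpret X: scale_space E mu A s .
 have "continuous_on E ?S" by (rule continuous_on_subset[OF X.S_cont]) simp
 hence c: "continuous_on E s" by (rule continuous_on_cong[THEN iffD1, OF refl, rotated]) (simp add: X.S_E)
 have mI: "strict_mono_on I ?S" using X.S_strict by (intro strict_mono_onI) blast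
 have mE: "strict_mono_on E s" using X.S_strict E_sub_I X.S_E by (intro strict_mono_onI) metis
 have ac: "loc_abs_cont_on I ?S"
  unfolding loc_abs_cont_on_def
 proof (intro allI impI)
  fix c d
  show "abs_cont_on {c..d} ?S"
  proof (rule abs_cont_on_of_bound)
   show "L2r (indicator {c..d})" by (rule L2r_indicator_finite) (simp_all add: emeasure_lborel_Icc_eq)
   fix x y assume xy: "c <= x" "x <= y" "y <= d"
   have "\<bar>?S y - ?S x\<bar> <= y - x" using X.S_lip[of y x] xy(2) by simp
   also have "\<dots> = pint (%_. 1) x y" using pint_const[OF xy(2), of 1] by simp
   also have "\<dots> = pint (indicator {c..d}) x y" by (rule set_integral_cong') (use xy in auto)
   finally show "\<bar>?S y - ?S x\<bar> <= pint (indicator {c..d}) x y" .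
  qed
 qed
 have n: "AE x in lborel. x : {el n<..<er n} --> (?S has_real_derivative indicator A x) (at x)" for n
 proof -
  define h where "h t = (indicator (A Int {el n..er n}) t :: real)" for t
  have "integrable lborel h" unfolding h_def by (rule integrable_real_indicator) (use mI_finite[OF Ab] in auto)
  from lebesgue_differentiation[OF this] show ?thesis
  proof eventually_elim
   case (elim x)
   show ?case
   proof
    assume x: "x : {el n<..<er n}"
    define d where "d = min (x - el n) (er n - x)"
    have "d > 0" using x by (auto simp: d_def)
    moreover have "?S v - ?S u = (LBINT t:{u..v}. h t)" if uv: "x - d < u" "u <= v" "v < x + d" for u v
    proof -
     have y: "el n <= u" "v <= er n" using uv by (auto simp: d_def)
     have "?S v - ?S u = ?m u v" by (rule X.S_diff_all[OF uv(2)])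
     also have "\<dots> = pint (indicator A) u v" by (rule pint_indicator[OF Ab, symmetric])
     also have "\<dots> = (LBINT t:{u..v}. h t)" by (rule set_integral_cong') (use y in \<open>auto simp: h_def indicator_def\<close>)
     finally show ?thesis .
    qed
    ultimately have "(?S has_real_derivative h x) (at x)" using elim by blast
    moreover have "h x = indicator A x" using x by (simp add: h_def indicator_def)
    ultimately show "(?S has_real_derivative indicator A x) (at x)" by simp
   qed
  qed
 qed
 have "AE x in lborel. ALL n. x : {el n<..<er n} --> (?S has_real_derivative indicator A x) (at x)"
  unfolding AE_all_countable using n by blast
 hence ae: "AE x in lborel. x : I --> (?S has_real_derivative 0) (at x) | (?S has_real_derivative 1) (at x)"
  using AE_J
 proof eventually_elim
  case (elim x)
  show ?case
  proof
   assume "x : I"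
   hence "x : J" using elim by simp
   then obtain n where "el n < x" "x < er n" using J_exh by blast
   hence "(?S has_real_derivative indicator A x) (at x)" using elim(1) by auto
   thus "(?S has_real_derivative 0) (at x) | (?S has_real_derivative 1) (at x)" by (cases "x : A") auto
  qed
 qed
 have g: "(?S has_real_derivative 1) (at x)" if x: "x : I - E" for x
 proof -
  obtain p where p: "p : gaps E" "fst p < x" "x < snd p" using gap_ex[of x] x by blast
  have "((%t. ?S (fst p) + (t - fst p)) has_real_derivative 1) (at x)" by (auto intro!: derivative_eq_intros)
  thus ?thesis
  proof (rule has_field_derivative_transform_within_open[where S="{fst p<..<snd p}"])
   fix t assume t: "t : {fst p<..<snd p}"
   have "?S t - ?S (fst p) = t - fst p" using X.S_diff_all[of "fst p" t] mg[OF p(1), of "fst p" t] t by simp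
   thus "?S (fst p) + (t - fst p) = ?S t" by simp
  qed (use p in auto)
 qed
 have "s : scale_S E" unfolding scale_S_def using c mE mI ac ae g by blast
 thus ?thesis using X.scale_space_axioms by blast
qed

end

section \<open>Fukushima subspaces\<close>

text \<open>\<open>R\<close> is linear but not assumed closed, so \<open>q\<close> is the limit of a
  minimizing sequence. It is named as a pointwise \<open>lim\<close> of members of \<open>R\<close>,
  which lets it inherit their pointwise properties.\<close>

lemma L2_projection:
 assumes R: "!!k. k : R ==> L2r k" and comb: "!!k l c. k : R ==> l : R ==> (%x. k x + c * l x) : R"
  and ne: "R ~= {}" and T: "L2r T"
 obtains u q where "!!n. u n : R" "q = (%x. lim (%n. u n x))" "L2r q" "AE x in lborel. (%n. u n x) ----> q x"
  "(%n. sqd lborel (u n) q) ----> 0" "!!k. k : R ==> (\<integral>x. (T x - q x) * k x \<partial>lborel) = 0"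
proof -
 define D where "D k = sqd lborel T k" for k
 define d where "d = Inf (D ` R)"
 have D0: "0 <= D k" for k by (simp add: D_def)
 hence bdd: "bdd_below (D ` R)" by (intro bdd_belowI[of _ 0]) auto
 have dD: "d <= D k" if "k : R" for k unfolding d_def by (rule cInf_lower[OF _ bdd]) (use that in simp)
 have "ALL n. EX k. k : R & D k < d + 1 / real (Suc n)"
 proof
  fix n
  have "Inf (D ` R) < d + 1 / real (Suc n)" by (simp add: d_def)
  thus "EX k. k : R & D k < d + 1 / real (Suc n)" using cInf_lessD[of "D ` R"] ne by blast
 qed
 then obtain w where w: "!!n. w n : R" "!!n. D (w n) < d + 1 / real (Suc n)" by (rule choice[elim_format]) blast
 have sqi: "integrable lborel (%x. (p x - k x)^2)" if "L2r p" "L2r k" for p k by (rule L2r_sq[OF L2r_diff[OF that]])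
 have mi: "integrable lborel (%x. (T x - p x) * k x)" if "L2r p" "L2r k" for p k by (rule L2r_mult[OF L2r_diff[OF T that(1)] that(2)])
 have par: "sqd lborel (w n) (w m) <= 2 / real (Suc n) + 2 / real (Suc m)" for n m
 proof -
  \<comment> \<open>The midpoint of \<open>w n\<close> and \<open>w m\<close>, written with the one
    operation available on \<open>R\<close>. The parallelogram law bounds their distance by how far
    both exceed the infimum.\<close>
  define hm where "hm = (%x. w n x + (1/2) * (w m x + (-1) * w n x))"
  have h: "hm : R" unfolding hm_def by (intro comb w)
  have "sqd lborel (w n) (w m) = (\<integral>x. 2 * (T x - w n x)^2 + 2 * (T x - w m x)^2 - 4 * (T x - hm x)^2 \<partial>lborel)"
   by (rule bintegral_cong) (simp add: hm_def power2_eq_square algebra_simps)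
  also have "\<dots> = 2 * D (w n) + 2 * D (w m) - 4 * D hm"
   unfolding D_def by (subst Bochner_Integration.integral_diff) (use sqi[OF T R[OF w(1)[of n]]] sqi[OF T R[OF w(1)[of m]]] sqi[OF T R[OF h]] in simp_all)
  also have "\<dots> <= 2 * (d + 1 / real (Suc n)) + 2 * (d + 1 / real (Suc m)) - 4 * d"
  proof -
   have "2 * x + 2 * y - 4 * z <= 2 * (d + a) + 2 * (d + b) - 4 * d" if "x < d + a" "y < d + b" "d <= z" for x y z a b
    using that by (simp add: algebra_simps)
   from this[OF w(2) w(2) dD[OF h]] show ?thesis .
  qed
  finally show ?thesis by simp
 qed
 have cau: "EX N. ALL m>=N. ALL n>=N. sqd lborel (w n) (w m) < e" if e: "e > 0" for e
 proof -
  obtain N where N: "4 / e < real N" using reals_Archimedean2 by blast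
  have "sqd lborel (w n) (w m) < e" if "m >= N" "n >= N" for m n
  proof -
   have b: "2 / real (Suc i) < e / 2" if "i >= N" for i
   proof -
    have "4 / e < real (Suc i)" using N that by simp
    thus ?thesis using e by (simp add: field_simps)
   qed
   show ?thesis using par[of n m] b[OF that(1)] b[OF that(2)] by linarith
  qed
  thus ?thesis by blast
 qed
 obtain r where r: "strict_mono r" "(%x. lim (%j. w (r j) x)) : borel_measurable lborel"
   "AE x in lborel. (%j. w (r j) x) ----> lim (%j. w (r j) x)" "integrable lborel (%x. (lim (%j. w (r j) x))^2)"
   "(%n. \<integral>x. (w n x - lim (%j. w (r j) x))^2 \<partial>lborel) ----> 0"
  by (rule L2_complete[OF _ L2r_sq[OF R[OF w(1)]] cau]) (use L2r_meas[OF R[OF w(1)]] in simp_all)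
 define q where "q x = lim (%j. w (r j) x)" for x
 have q: "L2r q" using r(2,4) by (simp add: L2r_def q_def[abs_def])
 have l: "(%n. sqd lborel (w n) q) ----> 0" using r(5) by (simp add: q_def)
 have orth: "(\<integral>x. (T x - q x) * k x \<partial>lborel) = 0" if k: "k : R" for k
 proof -
  define c where "c = sqn lborel k"
  have c: "0 <= c" by (simp add: c_def)
  define b where "b n = (\<integral>x. (T x - w n x) * k x \<partial>lborel)" for n
  \<comment> \<open>Minimality up to \<open>1 / Suc n\<close> along the line through
    \<open>w n\<close> in direction \<open>k\<close> is a quadratic inequality in \<open>t\<close>;
    its discriminant makes \<open>b n\<close> small.\<close>
  have "(b n)^2 <= 1 / real (Suc n) * c" for n
  proof (rule quadratic_nonneg_discriminant[OF _ c])
   fix t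
   have "D (%x. w n x + t * k x) = (\<integral>x. (T x - w n x)^2 - 2 * t * ((T x - w n x) * k x) + t^2 * (k x)^2 \<partial>lborel)"
    unfolding D_def by (rule bintegral_cong) (simp add: power2_eq_square algebra_simps)
   also have "\<dots> = D (w n) - 2 * t * b n + t^2 * c"
    unfolding D_def b_def c_def using sqi[OF T R[OF w(1)[of n]]] mi[OF R[OF w(1)[of n]] R[OF k]] L2r_sq[OF R[OF k]] by simp
   finally show "0 <= 1 / real (Suc n) - 2 * t * b n + t^2 * c"
    using dD[OF comb[OF w(1)[of n] k, of t]] w(2)[of n] by linarith
  qed
  moreover have "(%n. 1 / real (Suc n) * c) ----> 0"
   using tendsto_mult_left_zero[OF LIMSEQ_inverse_real_of_nat, of c] by (simp add: divide_inverse)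
  ultimately have "(%n. (b n)^2) ----> 0"
   by (intro tendsto_sandwich[OF _ _ tendsto_const[of 0], of "%n. (b n)^2"]) auto
  moreover have "(%n. ((\<integral>x. (T x - q x) * k x \<partial>lborel) - b n)^2) ----> 0"
  proof (rule tendsto_sandwich[OF _ _ tendsto_const])
   have "((\<integral>x. (T x - q x) * k x \<partial>lborel) - b n)^2 <= sqd lborel (w n) q * c" for n
   proof -
    have "(\<integral>x. (T x - q x) * k x \<partial>lborel) - b n = (\<integral>x. (T x - q x) * k x - (T x - w n x) * k x \<partial>lborel)"
     unfolding b_def by (rule Bochner_Integration.integral_diff[symmetric]) (intro mi q R w k)+
    also have "\<dots> = (\<integral>x. (w n x - q x) * k x \<partial>lborel)"
     by (rule bintegral_cong) (simp add: algebra_simps)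
    also have "\<dots>^2 <= sqd lborel (w n) q * c"
     unfolding c_def using L2r_diff[OF R[OF w(1)[of n]] q] R[OF k] by (intro integral_Cauchy_Schwarz) (auto simp: L2r_def)
    finally show ?thesis .
   qed
   thus "\<forall>\<^sub>F n in sequentially. ((\<integral>x. (T x - q x) * k x \<partial>lborel) - b n)^2 <= sqd lborel (w n) q * c" by simp
   show "(%n. sqd lborel (w n) q * c) ----> 0" by (rule tendsto_mult_left_zero[OF l])
  qed simp
  ultimately have "b ----> 0" "(%n. (\<integral>x. (T x - q x) * k x \<partial>lborel) - b n) ----> 0" by simp_all
  from tendsto_add[OF this] show ?thesis by (simp add: LIMSEQ_const_iff)
 qed
 show ?thesis
 proof (rule that[of "%n. w (r n)" q])
  show "(%n. sqd lborel (w (r n)) q) ----> 0" using LIMSEQ_subseq_LIMSEQ[OF l r(1)] by (simp add: o_def)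
 qed (use w(1) q orth r(3) in \<open>simp_all add: q_def[abs_def]\<close>)
qed

locale fukushima = qd_space E mu for E :: "real set" and mu :: "real measure" +
 fixes F :: "(real => real) set"
 assumes reg: "regular_dirichlet_form E mu F form" and sub: "F <= dom I"
begin

lemma F_facts:
 "F <= L2 mu" "ALL f:F. ALL g:L2 mu. (AE x in mu. f x = g x) --> g : F"
 "ALL f:F. ALL g:F. (%x. f x + g x) : F" "ALL c. ALL f:F. (%x. c * f x) : F"
 "ALL f:F. (%x. min 1 (max 0 (f x))) : F & form (%x. min 1 (max 0 (f x))) (%x. min 1 (max 0 (f x))) <= form f f"
 "ALL u::nat => rfun. (ALL n. u n : F) & (ALL e>0. EX N. ALL m>=N. ALL n>=N. E1d (u n) (u m) < e)
  --> (EX f:F. (%n. E1d (u n) f) ----> 0)"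
 "ALL f:F. ALL e>0. EX g:F Int Cc_on E. E1d f g < e"
 "ALL f:Cc_on E. ALL e>0. EX g:F Int Cc_on E. ALL x:E. \<bar>f x - g x\<bar> < e"
 using reg unfolding regular_dirichlet_form_def dirichlet_form_def by - (elim conjE, assumption)+

lemma F_L2: "f : F ==> f : L2 mu" using F_facts(1) by blast

lemma F_AE: "f : F ==> g : L2 mu ==> AE x in mu. f x = g x ==> g : F" using F_facts(2) by blast

lemma F_add: "f : F ==> g : F ==> (%x. f x + g x) : F" using F_facts(3) by blast

lemma F_cmult: "f : F ==> (%x. c * f x) : F" using F_facts(4) by blast

lemma F_unit: "f : F ==> (%x. min 1 (max 0 (f x))) : F" using F_facts(5) by blast

lemma F_core: "f : F ==> e > 0 ==> EX g:F Int Cc_on E. E1d f g < e" using F_facts(7) by blast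

lemma F_uniform: "f : Cc_on E ==> e > 0 ==> EX g:F Int Cc_on E. ALL x:E. \<bar>f x - g x\<bar> < e" using F_facts(8) by blast

text \<open>Closedness of \<open>F\<close> in usable form: approximants within
  \<open>1 / Suc n\<close> are Cauchy, and their limit in \<open>F\<close> agrees with
  \<open>f\<close> almost everywhere since the L2 part of the distance is 0.\<close>

lemma F_limit:
 assumes f: "f : dom I" and ap: "!!e. e > 0 ==> EX u:F. E1d f u < e"
 shows "f : F"
proof -
 have "ALL n. EX u. u : F & E1d f u < 1 / real (Suc n)"
 proof
  fix n
  show "EX u. u : F & E1d f u < 1 / real (Suc n)" using ap[of "1 / real (Suc n)"] by auto
 qed
 then obtain u where u: "!!n. u n : F" "!!n. E1d f (u n) < 1 / real (Suc n)" by (rule choice[elim_format]) blast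
 have uI: "u n : dom I" for n using u(1) sub by blast
 have sw: "E1d (u n) f = E1d f (u n)" for n
 proof -
  have "form (%x. u n x - f x) (%x. u n x - f x) = form (%x. f x - u n x) (%x. f x - u n x)"
   using form_quad_diff[OF subset_refl uI[of n] f] form_quad_diff[OF subset_refl f uI[of n]] form_sym[of f "u n"] by simp
  thus ?thesis unfolding E1_def by (simp add: power2_commute)
 qed
 have "ALL e>0. EX N. ALL m>=N. ALL n>=N. E1d (u n) (u m) < e"
 proof (intro allI impI)
  fix e :: real assume e: "e > 0"
  obtain N where N: "4 / e < real N" using reals_Archimedean2 by blast
  have b: "1 / real (Suc i) < e / 4" if "i >= N" for i
  proof -
   have "4 / e < real (Suc i)" using N that by simp
   thus ?thesis using e by (simp add: field_simps)
  qed
  have "E1d (u n) (u m) < e" if "m >= N" "n >= N" for m n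
   using E1_triangle[OF subset_refl uI[of n] f uI[of m]] sw[of n] u(2)[of n] u(2)[of m] b[OF that(1)] b[OF that(2)] by linarith
  thus "EX N. ALL m>=N. ALL n>=N. E1d (u n) (u m) < e" by blast
 qed
 then obtain f' where f': "f' : F" "(%n. E1d (u n) f') ----> 0" using F_facts(6) u(1) by blast
 have f'I: "f' : dom I" using f'(1) sub by blast
 have "(%n. 2 * (1 / real (Suc n)) + 2 * E1d (u n) f') ----> 2 * 0 + 2 * 0"
  using LIMSEQ_inverse_real_of_nat f'(2) by (intro tendsto_intros) (simp_all add: divide_inverse)
 moreover have "E1d f f' <= 2 * (1 / real (Suc n)) + 2 * E1d (u n) f'" for n
  using E1_triangle[OF subset_refl f uI[of n] f'I] u(2)[of n] by linarith
 ultimately have "E1d f f' <= 2 * 0 + 2 * 0" by (intro LIMSEQ_le_const) auto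
 moreover have "0 <= sqd mu f f'" by simp
 ultimately have "sqd mu f f' = 0"
  unfolding E1_def using form_nonneg[of "%x. f x - f' x"] by linarith
 hence "AE x in mu. (f x - f' x)^2 = 0"
  by (subst (asm) integral_nonneg_eq_0_iff_AE[OF L2_int[OF L2_diff[OF dom_L2[OF f] F_L2[OF f'(1)]]]]) auto
 hence "AE x in mu. f' x = f x" by eventually_elim simp
 thus ?thesis by (rule F_AE[OF f'(1) dom_L2[OF f]])
qed

lemma F_congE: assumes f: "f : F" and e: "!!x. x : E ==> g x = f x" shows "g : F"
proof -
 have "g : borel_measurable mu" using L2_meas[OF F_L2[OF f]] by (rule measurable_cong[THEN iffD1, rotated]) (simp add: e space_mu)
 moreover have ae: "AE x in mu. f x = g x" by (rule AE_I2) (simp add: e space_mu)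
 ultimately have "g : L2 mu" by (rule L2_AE(1)[OF F_L2[OF f]])
 thus ?thesis using F_AE[OF f _ ae] by blast
qed

lemma Cc_congE: assumes f: "f : Cc_on E" and e: "!!x. x : E ==> g x = f x" shows "g : Cc_on E"
proof -
 obtain K where K: "continuous_on E f" "compact K" "K <= E" "ALL x:E - K. f x = 0" using f unfolding Cc_on_def by blast
 have "continuous_on E g" using K(1) by (rule continuous_on_cong[THEN iffD1, OF refl, rotated]) (simp add: e)
 moreover have "ALL x:E - K. g x = 0" using K(4) e by simp
 ultimately show ?thesis unfolding Cc_on_def using K(2,3) by blast
qed

lemma Cc_comb: assumes "f : Cc_on E" "g : Cc_on E" shows "(%x. f x + c * g x) : Cc_on E"
proof -
 obtain K where K: "continuous_on E f" "compact K" "K <= E" "ALL x:E - K. f x = 0" using assms(1) unfolding Cc_on_def by blast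
 obtain L where L: "continuous_on E g" "compact L" "L <= E" "ALL x:E - L. g x = 0" using assms(2) unfolding Cc_on_def by blast
 have "continuous_on E (%x. f x + c * g x)" by (intro continuous_intros K L)
 moreover have "ALL x:E - (K Un L). f x + c * g x = 0" using K(4) L(4) by simp
 ultimately show ?thesis unfolding Cc_on_def using compact_Un[OF K(2) L(2)] K(3) L(3) by (intro CollectI conjI exI[of _ "K Un L"]) auto
qed

lemma Cc_compose:
 assumes f: "f : Cc_on E" and T: "continuous_on UNIV T" "T 0 = 0" shows "(%x. T (f x)) : Cc_on E"
proof -
 obtain K where K: "continuous_on E f" "compact K" "K <= E" "ALL x:E - K. f x = 0" using f unfolding Cc_on_def by blast
 have "continuous_on E (%x. T (f x))" by (rule continuous_on_compose2[OF T(1) K(1)]) simp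
 moreover have "ALL x:E - K. T (f x) = 0" using K(4) T(2) by simp
 ultimately show ?thesis unfolding Cc_on_def using K(2,3) by blast
qed

lemma Cc_bounded: assumes f: "f : Cc_on E" obtains M where "M > 0" "!!x. x : E ==> \<bar>f x\<bar> <= M"
proof -
 obtain K where K: "continuous_on E f" "compact K" "K <= E" "ALL x:E - K. f x = 0" using f unfolding Cc_on_def by blast
 have "bounded (f ` K)" by (intro compact_imp_bounded compact_continuous_image continuous_on_subset[OF K(1,3)] K(2))
 then obtain M where M: "M > 0" "!!y. y : f ` K ==> norm y <= M" unfolding bounded_pos by blast
 have "\<bar>f x\<bar> <= M" if x: "x : E" for x
 proof (cases "x : K")
  case True
  thus ?thesis using M(2)[of "f x"] by simp
 qed (use K(4) x M(1) in simp)
 thus ?thesis using that M(1) by blast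
qed

section \<open>Lattice operations and cuts in the core\<close>

abbreviation Fc :: "(real => real) set" where "Fc \<equiv> F Int Cc_on E"

lemma Fc_comb: "f : Fc ==> g : Fc ==> (%x. f x + c * g x) : Fc"
 using F_add F_cmult Cc_comb by blast

lemma Fc_congE: "f : Fc ==> (!!x. x : E ==> g x = f x) ==> g : Fc"
 using F_congE[of f g] Cc_congE[of f g] by blast

text \<open>Only the unit contraction is given; scaling yields clamping at any positive level. Since
  elements of the core are bounded, positive parts, minima and excesses follow from it.\<close>

lemma Fc_clamp: assumes f: "f : Fc" and c: "c > 0" shows "(%x. min c (max 0 (f x))) : Fc"
proof
 have "(%x. c * min 1 (max 0 ((1 / c) * f x))) : F" using f by (intro F_cmult F_unit) blast
 moreover have "(%x. c * min 1 (max 0 ((1 / c) * f x))) = (%x. min c (max 0 (f x)))"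
  using c by (auto simp: fun_eq_iff min_def max_def field_simps)
 ultimately show "(%x. min c (max 0 (f x))) : F" by simp
 show "(%x. min c (max 0 (f x))) : Cc_on E"
  using f c by (intro Cc_compose[of f "%t. min c (max 0 t)"] continuous_intros) auto
qed

lemma Fc_pos: assumes f: "f : Fc" shows "(%x. max 0 (f x)) : Fc"
proof -
 obtain M where M: "M > 0" "!!x. x : E ==> \<bar>f x\<bar> <= M" using Cc_bounded[of f] f by blast
 show ?thesis
 proof (rule Fc_congE[OF Fc_clamp[OF f M(1)]])
  show "max 0 (f x) = min M (max 0 (f x))" if "x : E" for x using M(1) M(2)[OF that] by auto
 qed
qed

lemma Fc_min: assumes f: "f : Fc" and g: "g : Fc" shows "(%x. min (f x) (g x)) : Fc"
proof -
 have "(%x. f x + (-1) * max 0 (f x + (-1) * g x)) : Fc" by (intro Fc_comb Fc_pos f g)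
 thus ?thesis by (rule Fc_congE) auto
qed

lemma Fc_excess: assumes f: "f : Fc" and c: "c > 0" shows "(%x. max 0 (f x - c)) : Fc"
proof -
 have "(%x. max 0 (f x) + (-1) * min c (max 0 (f x))) : Fc" by (intro Fc_comb Fc_pos Fc_clamp f c)
 thus ?thesis by (rule Fc_congE) (use c in auto)
qed

text \<open>Core membership depends on values on \<open>E\<close> alone, so a core function may be
  replaced by its linear interpolation on gaps, which comes with a density constant on gaps.\<close>

definition Cd :: "(real => real) => (real => real) => bool" where
 "Cd g k \<longleftrightarrow> g : Fc & cdens I g k"

lemma CdD: "Cd g k ==> g : Fc" "Cd g k ==> cdens I g k" "Cd g k ==> dens I g k" "Cd g k ==> L2r k"
 by (auto simp: Cd_def cdens_def dest: densD(1))

lemma Fc_Cd: assumes v: "v : Fc" obtains g k where "Cd g k" "!!x. x : E ==> g x = v x"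
proof -
 have vI: "v : dom I" using v sub by blast
 obtain g k where g: "cdens I g k" "AE x in mu. v x = g x" by (rule domE[OF vI]) blast
 have "continuous_on E v" using v by (simp add: Cc_on_def)
 hence "g x = v x" if "x : E" for x using cont_AE_eq[OF _ dens_cont_E[OF cdens_dens[OF g(1)]] g(2) that] by simp
 thus ?thesis using that[of g k] Fc_congE[OF v, of g] g(1) by (simp add: Cd_def)
qed

lemma Cd_comb: "Cd g k ==> Cd h l ==> Cd (%x. g x + c * h x) (%x. k x + c * l x)"
 unfolding Cd_def using Fc_comb[of g h c] cdens_add[OF _ cdens_cmult] by blast

lemma Cc_bd: assumes f: "f : Cc_on E" and e: "!!x. x : E ==> h x = f x" shows "bd A h"
proof (rule Cc_window[OF f])
 fix n assume w: "Lopen ==> ALL x:E. x <= el n --> f x = 0" "Ropen ==> ALL x:E. er n <= x --> f x = 0"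
 show "bd A h" unfolding bd_def LB_def RB_def finL_def finR_def
  using w el_E[of n] er_E[of n] e by (metis abs_zero)
qed

lemma Cc_domI: assumes f: "f : Cc_on E" and h: "cdens A h l" and e: "!!x. x : E ==> h x = f x" shows "f : dom A"
 by (rule domI[OF Cc_L2[OF f] h _ Cc_bd[OF f e]]) (auto intro!: AE_I2 simp: e space_mu)

text \<open>The zero at \<open>p\<close> makes the cut continuous, and \<open>p\<close> being in
  \<open>E\<close> keeps each gap on one side of it, so constancy on gaps survives.\<close>

lemma cdens_cut:
 assumes d: "cdens A g k" and p: "p : E" "g p = 0"
 shows "cdens A (%x. if x <= p then g x else 0) (%x. indicator {..p} x * k x)"
proof -
 have pI: "p : I" by (rule E_sub_I[OF p(1)])
 note dd = cdens_dens[OF d]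
 have "(if y <= p then g y else 0) - (if x <= p then g x else 0) = pint (%x. indicator {..p} x * k x) x y"
  if xy: "x : I" "y : I" "x <= y" for x y
 proof -
  consider "y <= p" | "x <= p" "p < y" | "p < x" by linarith
  thus ?thesis
  proof cases
   case 1
   have "pint (%x. indicator {..p} x * k x) x y = pint k x y" by (rule set_integral_cong') (use 1 in auto)
   thus ?thesis using 1 xy densD(3)[OF dd xy] by simp
  next
   case 2
   have "pint (%x. indicator {..p} x * k x) x y = pint k x p"
    unfolding set_lebesgue_integral_def by (rule bintegral_cong) (use 2 in \<open>auto simp: indicator_def\<close>)
   thus ?thesis using 2 densD(3)[OF dd xy(1) pI 2(1)] p(2) by simp
  next
   case 3
   have "pint (%x. indicator {..p} x * k x) x y = pint (%_. 0) x y" by (rule set_integral_cong') (use 3 in auto)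
   thus ?thesis using 3 xy by simp
  qed
 qed
 moreover have "L2r (%x. indicator {..p} x * k x)" by (rule L2r_indicator[OF densD(1)[OF dd]]) simp
 ultimately have "dens A (%x. if x <= p then g x else 0) (%x. indicator {..p} x * k x)"
  unfolding dens_def using densD(2)[OF dd] by simp
 moreover have "gconst (%x. indicator {..p} x * k x)"
  unfolding gconst_def
 proof (intro ballI allI impI)
  fix pp x y assume pp: "pp : gaps E" and xy: "fst pp < x & x < snd pp & fst pp < y & y < snd pp"
  have "k x = k y" using cdens_gconst[OF d] pp xy unfolding gconst_def by blast
  moreover have "p <= fst pp | snd pp <= p" using gapsD[OF pp] p(1) by blast
  ultimately show "indicator {..p} x * k x = indicator {..p} y * k y" using xy by (auto simp: indicator_def)
 qed
 ultimately show ?thesis by (simp add: cdens_def)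
qed

lemma continuous_cut:
 assumes w: "continuous_on E w" "w p = 0" shows "continuous_on E (%x. if x <= p then w x else (0::real))"
 by (rule continuous_on_cases_le[where h="%x. x"]) (auto intro!: continuous_intros continuous_on_subset[OF w(1)] simp: w(2))

lemma Cc_cut: assumes w: "w : Cc_on E" "w p = 0" shows "(%x. if x <= p then w x else 0) : Cc_on E"
proof -
 obtain K where K: "continuous_on E w" "compact K" "K <= E" "ALL x:E - K. w x = 0" using w unfolding Cc_on_def by blast
 have "ALL x:E - K. (if x <= p then w x else 0) = 0" using K(4) by simp
 thus ?thesis unfolding Cc_on_def using continuous_cut[OF K(1) w(2)] K(2,3) by blast
qed

text \<open>The excess of w over e is cut at p by taking its minimum with a multiple of an element of F uniformly close
 to the continuous function w / e on {..p}, extended by 0; then e tends to 0.\<close>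
lemma Fc_cut_pos:
 assumes w: "w : Fc" and w0: "!!x. x : E ==> 0 <= w x" and p: "p : E" "w p = 0"
 shows "(%x. if x <= p then w x else 0) : Fc"
proof
 let ?f = "%x. if x <= p then w x else 0"
 show fC: "?f : Cc_on E" using w p by (intro Cc_cut) auto
 obtain g k where g: "Cd g k" "!!x. x : E ==> g x = w x" using Fc_Cd[OF w] by blast
 have "g p = 0" using g(2)[OF p(1)] p(2) by simp
 from cdens_cut[OF CdD(2)[OF g(1)] p(1) this] have fI: "?f : dom I" by (rule Cc_domI[OF fC]) (simp add: g(2))
 obtain M where M: "M > 0" "!!x. x : E ==> \<bar>w x\<bar> <= M" using Cc_bounded[of w] w by blast
 show "?f : F"
 proof (rule F_limit[OF fI])
  fix e :: real assume e: "e > 0"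
  have "(%n. E1 mu form (%x. min (?f x) (1 / real (Suc n)))) ----> 0"
   by (rule E1_min_small[OF gapU_sub_I subset_refl fI]) (simp add: w0)
  hence "\<forall>\<^sub>F n in sequentially. E1 mu form (%x. min (?f x) (1 / real (Suc n))) < e" using e by (rule order_tendstoD)
  then obtain n where n: "E1 mu form (%x. min (?f x) (1 / real (Suc n))) < e" unfolding eventually_sequentially by blast
  define ep where "ep = 1 / real (Suc n)"
  have ep: "ep > 0" by (simp add: ep_def)
  have "(%x. 1 / ep * ?f x) : Cc_on E" by (rule Cc_compose[OF fC]) (use ep in \<open>auto intro!: continuous_intros\<close>)
  \<comment> \<open>If \<open>x <= p\<close> and \<open>w x\<close> exceeds \<open>ep\<close>, the
    target exceeds 1 and so \<open>v\<close> exceeds 3/4; beyond \<open>p\<close> the target is 0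
    and \<open>v\<close> is below 1/4. Subtracting 1/4 separates the two cases, and the factor
    \<open>4 * M\<close> lifts the first above the bound \<open>M\<close> of
    \<open>w\<close>.\<close>
  then obtain v where v: "v : Fc" "!!x. x : E ==> \<bar>1 / ep * ?f x - v x\<bar> < 1 / 4" using F_uniform[of _ "1/4"] by fastforce
  \<comment> \<open>The multiple by \<open>4 * M\<close>, spelled as a sum because
    \<open>Fc_comb\<close> keeps its first summand with coefficient 1.\<close>
  have "(%x. max 0 (v x - 1/4) + (4 * M - 1) * max 0 (v x - 1/4)) : Fc" by (intro Fc_comb Fc_excess v) auto
  from Fc_min[OF Fc_excess[OF w ep] this]
  have "(%x. if x <= p then max 0 (w x - ep) else 0) : Fc"
  proof (rule Fc_congE)
   fix x assume x: "x : E"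
   have ps: "max 0 (v x - 1/4) + (4 * M - 1) * max 0 (v x - 1/4) = 4 * M * max 0 (v x - 1/4)" by (simp add: algebra_simps)
   have nn: "0 <= 4 * M * max 0 (v x - 1/4)" using M(1) by simp
   show "(if x <= p then max 0 (w x - ep) else 0) = min (max 0 (w x - ep)) (max 0 (v x - 1/4) + (4 * M - 1) * max 0 (v x - 1/4))"
   proof (cases "x <= p")
    case False
    hence "max 0 (v x - 1/4) = 0" using v(2)[OF x] by auto
    thus ?thesis using False by simp
   next
    case True
    show ?thesis
    proof (cases "w x <= ep")
     case le: True
     hence "max 0 (w x - ep) = 0" by simp
     thus ?thesis using True nn unfolding ps by simp
    next
     case False
     hence "1 < 1 / ep * w x" using ep by (simp add: field_simps)
     moreover have "\<bar>1 / ep * w x - v x\<bar> < 1 / 4" using v(2)[OF x] True by simp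
     ultimately have "3/4 < v x" by linarith
     hence "1/4 <= max 0 (v x - 1/4)" by simp
     hence "4 * M * (1/4) <= 4 * M * max 0 (v x - 1/4)" by (rule mult_left_mono) (use M(1) in simp)
     moreover have "max 0 (w x - ep) <= M" using M(2)[OF x] ep M(1) by auto
     ultimately have "max 0 (w x - ep) <= 4 * M * max 0 (v x - 1/4)" by linarith
     thus ?thesis using True unfolding ps by simp
    qed
   qed
  qed
  moreover have "(%x. ?f x - (if x <= p then max 0 (w x - ep) else 0)) = (%x. min (?f x) (1 / real (Suc n)))"
   unfolding ep_def[symmetric] using ep by (auto simp: fun_eq_iff min_def max_def)
  ultimately show "EX u:F. E1 mu form (%x. ?f x - u x) < e"
   using n by (intro bexI[of _ "%x. if x <= p then max 0 (w x - ep) else 0"]) auto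
 qed
qed

lemma Fc_cut: assumes w: "w : Fc" and p: "p : E" "w p = 0" shows "(%x. if x <= p then w x else 0) : Fc"
proof -
 \<comment> \<open>Zero is produced first, so that the negative part can be taken of
   \<open>0 - w\<close> in the shape that \<open>Fc_comb\<close> accepts.\<close>
 have z: "(%x. w x + (-1) * w x) : Fc" by (intro Fc_comb w)
 have n: "(%x. max 0 ((w x + (-1) * w x) + (-1) * w x)) : Fc" by (intro Fc_comb Fc_pos z w)
 have 1: "(%x. if x <= p then max 0 (w x) else 0) : Fc" by (rule Fc_cut_pos[OF Fc_pos[OF w] _ p(1)]) (auto simp: p)
 have 2: "(%x. if x <= p then max 0 ((w x + (-1) * w x) + (-1) * w x) else 0) : Fc" by (rule Fc_cut_pos[OF n _ p(1)]) (auto simp: p)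
 show ?thesis by (rule Fc_congE[OF Fc_comb[OF 1 2, of "-1"]]) auto
qed

lemma Cd_cut: "Cd g k ==> p : E ==> g p = 0 ==> Cd (%x. if x <= p then g x else 0) (%x. indicator {..p} x * k x)"
 unfolding Cd_def using Fc_cut[of g p] cdens_cut[of I g k p] by blast

text \<open>A plateau of height 2 over the window is approximated within 1 and the result clamped at
  1. On the window the approximant exceeds 1, so the clamped function is exactly 1 there and its
  density vanishes inside.\<close>

lemma bump:
 obtains b kb where "Cd b kb" "!!x. x : Kn n ==> b x = 1" "AE x in lborel. x : {el n<..<er n} --> kb x = 0"
proof -
 obtain d N where d: "d > 0" "!!t. t : E ==> el n - d <= t ==> t <= er n + d ==> t : Kn N" using Kn_neighbourhood by blast
 define h where "h t = 2 * max 0 (1 - (max 0 (el n - t) + max 0 (t - er n)) / d)" for t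
 have "h t = 0" if "t : E - Kn N" for t
 proof -
  have "t < el n - d | er n + d < t" using d(2)[of t] that by fastforce
  hence "d <= max 0 (el n - t) + max 0 (t - er n)" by auto
  hence "1 <= (max 0 (el n - t) + max 0 (t - er n)) / d" using d(1) by simp
  thus ?thesis by (simp add: h_def)
 qed
 moreover have "continuous_on E h" unfolding h_def by (intro continuous_intros) (use d in auto)
 ultimately have "h : Cc_on E" unfolding Cc_on_def using Kn_compact[of N] Kn_sub[of N] by blast
 then obtain v where v: "v : Fc" "!!x. x : E ==> \<bar>h x - v x\<bar> < 1" using F_uniform[of h 1] by auto
 obtain b kb where b: "Cd b kb" "!!x. x : E ==> b x = min 1 (max 0 (v x))" using Fc_Cd[OF Fc_clamp[OF v(1), of 1]] by auto
 have b1: "b x = 1" if "x : Kn n" for x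
 proof -
  have x: "x : E" "el n <= x" "x <= er n" using that by (auto simp: Kn_def)
  hence "h x = 2" by (simp add: h_def)
  thus ?thesis using v(2)[OF x(1)] b(2)[OF x(1)] by auto
 qed
 note eI = el_I[of n] er_I[of n]
 have bI: "b x = 1" if x: "el n <= x" "x <= er n" for x
 proof (cases "x : E")
  case False
  obtain p where p: "p : gaps E" "fst p < x" "x < snd p" using gap_ex[OF I_convex[OF eI x] False] by blast
  have "el n <= fst p" "snd p <= er n" using gapsD[OF p(1)] el_E[of n] er_E[of n] x p by force+
  hence "b (fst p) = 1" "b (snd p) = 1" using gapsD[OF p(1)] by (auto intro!: b1 simp: Kn_def)
  thus ?thesis using cdens_gap_linear[OF CdD(2)[OF b(1)] p(1), of x] p by (simp add: slope_def)
 qed (use b1 x in \<open>simp add: Kn_def\<close>)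
 have "AE x in lborel. x : {el n<..<er n} --> kb x = 0"
 proof (rule integral_zero_imp_AE_zero[OF dens_Icc[OF CdD(3)[OF b(1)]]])
  fix x assume x: "el n <= x" "x <= er n"
  show "pint kb (el n) x = 0" using densD(3)[OF CdD(3)[OF b(1)] eI(1) I_convex[OF eI x] x(1)] bI[OF x] bI[of "el n"] less_imp_le[OF el_er] by simp
 qed
 thus ?thesis using that b(1) b1 by blast
qed

text \<open>A tent of height 1 at \<open>x\<close>, of radius at most the distance to
  \<open>y\<close>, is approximated within 1/2 by an element of the core.\<close>

lemma separation:
 assumes x: "x : E" "y : E" "x ~= y" obtains g k where "Cd g k" "g x ~= g y"
proof -
 obtain n where n: "el n <= x" "x <= er n" using exh_I[OF E_sub_I[OF x(1)]] by blast
 obtain d N where d: "d > 0" "!!t. t : E ==> el n - d <= t ==> t <= er n + d ==> t : Kn N" using Kn_neighbourhood by blast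
 define r where "r = min d \<bar>x - y\<bar>"
 have r: "r > 0" using d x by (simp add: r_def)
 define h where "h t = max 0 (1 - \<bar>t - x\<bar> / r)" for t
 have h0: "h t = 0" if "r <= \<bar>t - x\<bar>" for t using that r by (simp add: h_def)
 have "h t = 0" if "t : E - Kn N" for t
 proof -
  have "t < el n - d | er n + d < t" using d(2)[of t] that by fastforce
  thus ?thesis using n by (intro h0) (auto simp: r_def)
 qed
 moreover have "continuous_on E h" unfolding h_def by (intro continuous_intros) (use r in auto)
 ultimately have "h : Cc_on E" unfolding Cc_on_def using Kn_compact[of N] Kn_sub[of N] by blast
 then obtain v where v: "v : Fc" "!!x. x : E ==> \<bar>h x - v x\<bar> < 1/2" using F_uniform[of h "1/2"] by auto
 have "h x = 1" "h y = 0" using h0[of y] by (auto simp: h_def r_def)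
 hence "v x ~= v y" using v(2)[OF x(1)] v(2)[OF x(2)] by auto
 thus ?thesis using Fc_Cd[OF v(1)] that x by metis
qed

text \<open>A cut needs a zero at \<open>p\<close>. Subtracting \<open>g p\<close> times a bump
  produces one, and after the cut the same multiple is restored; the bump is constant on the window,
  so neither change is visible in the densities there.\<close>

lemma localize:
 assumes g: "Cd g k" and p: "p : Kn n"
 obtains g' k' where "Cd g' k'" "AE x in lborel. x : {el n<..<er n} --> k' x = indicator {..p} x * k x"
proof -
 obtain b kb where b: "Cd b kb" "!!x. x : Kn n ==> b x = 1" "AE x in lborel. x : {el n<..<er n} --> kb x = 0" using bump by blast
 have pE: "p : E" using p Kn_sub by blast
 have 1: "Cd (%x. g x + (- g p) * b x) (%x. k x + (- g p) * kb x)" by (rule Cd_comb[OF g b(1)])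
 have "g p + (- g p) * b p = 0" using b(2)[OF p] by simp
 from Cd_comb[OF Cd_cut[OF 1 pE this] b(1), of "g p"] obtain g' where
  "Cd g' (%x. indicator {..p} x * (k x + (- g p) * kb x) + g p * kb x)" by blast
 moreover have "AE x in lborel. x : {el n<..<er n} --> indicator {..p} x * (k x + (- g p) * kb x) + g p * kb x = indicator {..p} x * k x"
  using b(3) by eventually_elim simp
 ultimately show ?thesis using that by blast
qed

section \<open>Projections on a window and the set carrying the densities\<close>

lemma gconst_window: "gconst (%x. indicator {el n..er n} x * (1::real))"
 unfolding gconst_def
proof (intro ballI allI impI)
 fix p x y assume p: "p : gaps E" and xy: "fst p < x & x < snd p & fst p < y & y < snd p"
 have "el n <= fst p | snd p <= el n" "er n <= fst p | snd p <= er n" using gapsD[OF p] el_E er_E by blast+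
 thus "indicator {el n..er n} x * (1::real) = indicator {el n..er n} y * 1" using xy by (auto simp: indicator_def)
qed

lemma gconst_mult: "gconst k ==> gconst l ==> gconst (%x. k x * l x)"
 unfolding gconst_def by metis

text \<open>The limit q is a pointwise limit of densities, hence again constant on gaps. This is what allows us to pass from
 integrals over [el n, p] with p in E to arbitrary upper bounds.\<close>
lemma window_projection:
 assumes T: "L2r T" "gconst T"
 obtains G K q where "!!j. Cd (G j) (K j)" "L2r q" "gconst q" "!!x. x ~: {el n..er n} ==> q x = 0"
  "AE x in lborel. x : {el n..er n} --> (%j. K j x) ----> q x"
  "(%j. \<integral>x. (indicator {el n..er n} x * K j x - q x)^2 \<partial>lborel) ----> 0"
  "!!g k. Cd g k ==> AE x in lborel. x : {el n<..<er n} --> (T x - q x) * k x = 0"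
proof -
 let ?w = "%k x. indicator {el n..er n} x * (k x :: real)"
 define R where "R = {?w k | g k. Cd g k}"
 have 1: "L2r k" if "k : R" for k using that CdD(4) unfolding R_def by (auto intro!: L2r_indicator)
 have 2: "(%x. k x + c * l x) : R" if "k : R" "l : R" for k l c
 proof -
  obtain g k' h l' where gh: "Cd g k'" "Cd h l'" "k = ?w k'" "l = ?w l'" using \<open>k : R\<close> \<open>l : R\<close> unfolding R_def by blast
  have "(%x. k x + c * l x) = ?w (%x. k' x + c * l' x)" unfolding gh by (simp add: algebra_simps)
  moreover have "?w (%x. k' x + c * l' x) : R"
   unfolding R_def by (rule CollectI) (intro exI conjI, rule refl, rule Cd_comb[OF gh(1,2)])
  ultimately show ?thesis by simp
 qed
 obtain b kb where "Cd b kb" using bump by blast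
 hence 3: "R ~= {}" unfolding R_def by blast
 obtain u q where u: "!!n. u n : R" "q = (%x. lim (%n. u n x))" "L2r q" "AE x in lborel. (%n. u n x) ----> q x"
  "(%n. sqd lborel (u n) q) ----> 0" "!!k. k : R ==> (\<integral>x. (T x - q x) * k x \<partial>lborel) = 0"
  using L2_projection[OF 1 2 3 T(1)] by blast
 have "ALL j. EX GK. Cd (fst GK) (snd GK) & u j = ?w (snd GK)"
 proof
  fix j
  obtain g k where "Cd g k" "u j = ?w k" using u(1)[of j] unfolding R_def by blast
  thus "EX GK. Cd (fst GK) (snd GK) & u j = ?w (snd GK)" by (intro exI[of _ "(g, k)"]) simp
 qed
 then obtain GK where GK: "!!j. Cd (fst (GK j)) (snd (GK j))" "!!j. u j = ?w (snd (GK j))" by (rule choice[elim_format]) blast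
 have uc: "gconst (u j)" for j
  using gconst_mult[OF gconst_window cdens_gconst[OF CdD(2)[OF GK(1)[of j]]]] unfolding GK(2) by simp
 have qc: "gconst q" unfolding gconst_def
 proof (intro ballI allI impI)
  fix p x y assume p: "p : gaps E" "fst p < x & x < snd p & fst p < y & y < snd p"
  hence "u j x = u j y" for j using uc[of j] unfolding gconst_def by blast
  thus "q x = q y" by (simp add: u(2))
 qed
 have q0: "q x = 0" if "x ~: {el n..er n}" for x using that GK(2) by (simp add: u(2) lim_zero_seq)
 have loc: "AE x in lborel. x : {el n<..<er n} --> (T x - q x) * k x = 0" if g: "Cd g k" for g k
 proof -
  define j where "j x = (T x - q x) * k x" for x
  have ji: "integrable lborel j" unfolding j_def by (rule L2r_mult[OF L2r_diff[OF T(1) u(3)] CdD(4)[OF g]])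
  have js: "set_integrable lborel {x..y} j" for x y unfolding set_integrable_def by (rule integrable_mult_indicator[OF _ ji]) simp
  have jc: "gconst j" unfolding gconst_def j_def
   using T(2) qc cdens_gconst[OF CdD(2)[OF g]] unfolding gconst_def by metis
  \<comment> \<open>Orthogonality is tested against the density localized at \<open>p\<close>, which
    leaves the integral of \<open>j\<close> up to \<open>p\<close>.\<close>
  have jE: "pint j (el n) p = 0" if p: "p : Kn n" for p
  proof -
   obtain g' k' where g': "Cd g' k'" "AE x in lborel. x : {el n<..<er n} --> k' x = indicator {..p} x * k x" using localize[OF g p] by blast
   have [measurable]: "k' : borel_measurable borel" "k : borel_measurable borel" "T : borel_measurable borel" "q : borel_measurable borel"
    using L2r_meas CdD(4)[OF g'(1)] CdD(4)[OF g] T(1) u(3) by blast+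
   have [measurable]: "j : borel_measurable borel" unfolding j_def by measurable
   have "?w k' : R" unfolding R_def using g'(1) by blast
   from u(6)[OF this] have "0 = (\<integral>x. (T x - q x) * ?w k' x \<partial>lborel)" by simp
   also have "\<dots> = pint j (el n) p"
    unfolding set_lebesgue_integral_def
   proof (rule integral_cong_AE)
    show "AE x in lborel. (T x - q x) * ?w k' x = indicator {el n..p} x *\<^sub>R j x"
     using g'(2) AE_lborel_singleton[of "el n"] AE_lborel_singleton[of "er n"]
    proof eventually_elim
     case (elim x)
     thus ?case using p by (cases "x : {el n<..<er n}") (auto simp: j_def indicator_def Kn_def)
    qed
   qed auto
   finally show ?thesis by simp
  qed
  have "AE x in lborel. x : {el n<..<er n} --> j x = 0"
  proof (rule integral_zero_imp_AE_zero[OF js])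
   fix x assume x: "el n <= x" "x <= er n"
   show "pint j (el n) x = 0"
   proof (cases "x : E")
    case False
    note eI = el_I[of n] er_I[of n]
    obtain p where p: "p : gaps E" "fst p < x" "x < snd p" using gap_ex[OF I_convex[OF eI x] False] by blast
    have pe: "el n <= fst p" "snd p <= er n" using gapsD[OF p(1)] el_E[of n] er_E[of n] x p by force+
    have pK: "fst p : Kn n" "snd p : Kn n" using gapsD[OF p(1)] pe by (auto simp: Kn_def)
    \<comment> \<open>Within a gap \<open>j\<close> is constant and its primitive linear. The
      primitive vanishes at both ends of the gap, which are in \<open>E\<close>, so the constant is
      0.\<close>
    have c: "pint j (fst p) y = j x * (y - fst p)" if y: "fst p <= y" "y <= snd p" for y
    proof -
     have "pint j (fst p) y = (LBINT t:{fst p<..<y}. j t)" using ji by (intro pint_Ioo) simp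
     also have "\<dots> = (LBINT t:{fst p<..<y}. j x)"
     proof (rule set_integral_cong')
      fix t assume "t : {fst p<..<y}"
      hence "fst p < t & t < snd p & fst p < x & x < snd p" using p y by simp
      thus "j t = j x" using jc p(1) unfolding gconst_def by blast
     qed
     also have "\<dots> = j x * (y - fst p)" using y by (simp add: set_integral_const)
     finally show ?thesis .
    qed
    have ab: "fst p < snd p" using p by simp
    have "pint j (el n) (snd p) = pint j (el n) (fst p) + pint j (fst p) (snd p)" by (rule pint_add[OF js pe(1) less_imp_le[OF ab]])
    hence "j x * (snd p - fst p) = 0" using jE[OF pK(1)] jE[OF pK(2)] c[OF less_imp_le[OF ab] order_refl] by simp
    hence "j x = 0" using ab by simp
    thus ?thesis using pint_add[OF js pe(1) less_imp_le[OF p(2)]] jE[OF pK(1)] c[OF less_imp_le[OF p(2)] less_imp_le[OF p(3)]] by simp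
   qed (use jE x in \<open>simp add: Kn_def\<close>)
  qed
  thus ?thesis by (simp add: j_def)
 qed
 have lim: "AE x in lborel. x : {el n..er n} --> (%j. snd (GK j) x) ----> q x"
  using u(4)
 proof eventually_elim
  case (elim x)
  show ?case
  proof
   assume "x : {el n..er n}"
   thus "(%j. snd (GK j) x) ----> q x" using elim by (simp add: GK(2))
  qed
 qed
 have lim2: "(%j. \<integral>x. (?w (snd (GK j)) x - q x)^2 \<partial>lborel) ----> 0" using u(5) unfolding GK(2) .
 show ?thesis
  by (rule that[of "%j. fst (GK j)" "%j. snd (GK j)" q, OF GK(1) u(3) qc q0 lim lim2 loc])
qed

text \<open>The last two conclusions say that \<open>A\<close> is large enough for all densities and
  no larger than they force it to be. For the latter, \<open>d\<close> times the approximating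
  densities tends to \<open>d\<close> on \<open>{q n = 1}\<close>, while on a gap an element
  separating its end points has nonzero slope.\<close>

lemma active_set:
 obtains A where "adm A" "!!g k. Cd g k ==> AE x in lborel. x ~: A --> k x = 0"
  "!!d n. (!!g k. Cd g k ==> AE x in lborel. x : {el n<..<er n} --> d x * k x = (0::real))
   ==> AE x in lborel. x : {el n<..<er n} --> x : A --> d x = 0"
proof -
 have "ALL n. EX Kq. (ALL j. EX g. Cd g (fst Kq j)) & L2r (snd Kq) & (AE x in lborel. x : {el n..er n} --> (%j. fst Kq j x) ----> snd Kq x)
  & (ALL g k. Cd g k --> (AE x in lborel. x : {el n<..<er n} --> (1 - snd Kq x) * k x = 0))"
 proof
  fix n
  have T: "L2r (%x. indicator {el n..er n} x * (1::real))" using L2r_indicator_finite[of "{el n..er n}"] by (simp add: emeasure_lborel_Icc_eq)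
  obtain G K q where K: "!!j. Cd (G j) (K j)" "L2r q" "AE x in lborel. x : {el n..er n} --> (%j. K j x) ----> q x"
    "!!g k. Cd g k ==> AE x in lborel. x : {el n<..<er n} --> (indicator {el n..er n} x * 1 - q x) * k x = 0"
   by (rule window_projection[OF T gconst_window, of n]) blast
  have "AE x in lborel. x : {el n<..<er n} --> (1 - q x) * k x = 0" if "Cd g k" for g k
   using K(4)[OF that] by eventually_elim auto
  thus "EX Kq. (ALL j. EX g. Cd g (fst Kq j)) & L2r (snd Kq) & (AE x in lborel. x : {el n..er n} --> (%j. fst Kq j x) ----> snd Kq x)
   & (ALL g k. Cd g k --> (AE x in lborel. x : {el n<..<er n} --> (1 - snd Kq x) * k x = 0))"
   using K(1,2,3) by (intro exI[of _ "(K, q)"]) auto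
 qed
 then obtain Kq where Kq: "ALL n. (ALL j. EX g. Cd g (fst (Kq n) j)) & L2r (snd (Kq n)) & (AE x in lborel. x : {el n..er n} --> (%j. fst (Kq n) j x) ----> snd (Kq n) x)
  & (ALL g k. Cd g k --> (AE x in lborel. x : {el n<..<er n} --> (1 - snd (Kq n) x) * k x = 0))"
  by (rule choice[elim_format]) blast
 define K where "K n = fst (Kq n)" for n
 define q where "q n = snd (Kq n)" for n
 have K: "EX g. Cd g (K n j)" for n j using Kq by (simp add: K_def)
 have q: "L2r (q n)" for n using Kq by (simp add: q_def)
 have Kl: "AE x in lborel. x : {el n..er n} --> (%j. K n j x) ----> q n x" for n using Kq by (simp add: K_def q_def)
 have qk: "AE x in lborel. x : {el n<..<er n} --> (1 - q n x) * k x = 0" if "Cd g k" for n g k using Kq that by (simp add: q_def)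
 have [measurable]: "q n : borel_measurable borel" for n by (rule L2r_meas[OF q])
 define A where "A = gapU Un (\<Union>n. {el n..er n} Int {x. q n x = 1})"
 have Ab: "A : sets borel" unfolding A_def by (intro sets.Un sets.countable_UN) auto
 have AI: "A <= I" unfolding A_def using gapU_sub_I Icc_sub_I[OF el_I er_I] by blast
 have off: "AE x in lborel. x ~: A --> k x = 0" if g: "Cd g k" for g k
 proof -
  have "AE x in lborel. ALL n. x : {el n<..<er n} --> (1 - q n x) * k x = 0" unfolding AE_all_countable using qk[OF g] by blast
  thus ?thesis using AE_J
  proof eventually_elim
   case (elim x)
   show ?case
   proof
    assume x: "x ~: A"
    show "k x = 0"
    proof (cases "x : I")
     case True
     then obtain n where n: "el n < x" "x < er n" using elim(2) J_exh by blast
     hence "q n x ~= 1" using x by (auto simp: A_def)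
     thus ?thesis using elim(1) n by auto
    qed (use densD(2)[OF CdD(3)[OF g]] in blast)
   qed
  qed
 qed
 have on: "AE x in lborel. x : {el n<..<er n} --> x : A --> d x = 0"
  if d: "!!g k. Cd g k ==> AE x in lborel. x : {el n<..<er n} --> d x * k x = (0::real)" for d n
 proof -
  have "ALL p:gaps E. EX gk. Cd (fst gk) (snd gk) & fst gk (fst p) ~= fst gk (snd p)"
  proof
   fix p assume "p : gaps E"
   hence "fst p : E" "snd p : E" "fst p ~= snd p" using gapsD by fastforce+
   then obtain g k where "Cd g k" "g (fst p) ~= g (snd p)" by (rule separation)
   thus "EX gk. Cd (fst gk) (snd gk) & fst gk (fst p) ~= fst gk (snd p)" by (intro exI[of _ "(g, k)"]) simp
  qed
  then obtain gk where gk: "!!p. p : gaps E ==> Cd (fst (gk p)) (snd (gk p)) & fst (gk p) (fst p) ~= fst (gk p) (snd p)"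
   by (rule bchoice[elim_format]) blast
  have "AE x in lborel. ALL m j. x : {el n<..<er n} --> d x * K m j x = 0" unfolding AE_all_countable using d K by blast
  moreover have "AE x in lborel. ALL p:gaps E. x : {el n<..<er n} --> d x * snd (gk p) x = 0"
   unfolding AE_ball_countable[OF countable_gaps] using d gk by blast
  moreover have "AE x in lborel. ALL m. x : {el m..er m} --> (%j. K m j x) ----> q m x" unfolding AE_all_countable using Kl by blast
  ultimately show ?thesis
  proof eventually_elim
   case (elim x)
   show ?case
   proof (intro impI)
    assume x: "x : {el n<..<er n}" "x : A"
    show "d x = 0"
    proof (cases "x : gapU")
     case True
     then obtain p where p: "p : gaps E" "fst p < x" "x < snd p" unfolding gapU_def by auto
     have "snd (gk p) x = slope (fst (gk p)) p" using gk[OF p(1)] by (intro cdens_slope[OF CdD(2) p]) blast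
     hence "snd (gk p) x ~= 0" using gk[OF p(1)] p by (auto simp: slope_def)
     thus ?thesis using elim(2) p(1) x(1) by auto
    next
     case False
     then obtain m where m: "x : {el m..er m}" "q m x = 1" using x(2) by (auto simp: A_def)
     have "(%j. d x * K m j x) ----> d x * 1" using elim(3) m by (intro tendsto_mult tendsto_const) auto
     moreover have "(%j. d x * K m j x) = (%_. 0)" using elim(1) x(1) by auto
     ultimately show ?thesis by (simp add: LIMSEQ_const_iff)
    qed
   qed
  qed
 qed
 \<comment> \<open>Between two points of \<open>E\<close> a separating element has nonzero
   increment, impossible if \<open>A\<close> were null there. Otherwise the interval meets a gap in
   a nonempty open piece, contained in \<open>A\<close>.\<close>
 have pos: "0 < emeasure lborel (A Int {x..y})" if xy: "x : I" "y : I" "x < y" for x y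
 proof (cases "x : E & y : E")
  case True
  then obtain g k where g: "Cd g k" "g x ~= g y" using separation[of x y] xy(3) by blast
  show ?thesis
  proof (rule ccontr)
   assume "~ 0 < emeasure lborel (A Int {x..y})"
   hence "A Int {x..y} : null_sets lborel" using Ab by (auto simp: null_sets_def)
   hence "AE t in lborel. t ~: A Int {x..y}" by (rule AE_not_in)
   hence "AE t in lborel. indicator {x..y} t *\<^sub>R k t = 0" using off[OF g(1)] by eventually_elim (auto simp: indicator_def)
   hence "pint k x y = 0" unfolding set_lebesgue_integral_def by (rule integral_eq_zero_AE)
   thus False using densD(3)[OF CdD(3)[OF g(1)] xy(1,2)] xy(3) g(2) by simp
  qed
 next
  case False
  then obtain z where z: "z : I" "z ~: E" "x <= z" "z <= y" using xy by fastforce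
  obtain p where p: "p : gaps E" "fst p < z" "z < snd p" using gap_ex[OF z(1,2)] by blast
  have "{max x (fst p)<..<min y (snd p)} <= A Int {x..y}" using p(1) unfolding A_def gapU_def by fastforce
  hence "emeasure lborel {max x (fst p)<..<min y (snd p)} <= emeasure lborel (A Int {x..y})" using Ab by (intro emeasure_mono) auto
  moreover have "0 < emeasure lborel {max x (fst p)<..<min y (snd p)}" using z p xy(3) by simp
  ultimately show ?thesis by (rule less_le_trans[rotated])
 qed
 have "adm A" unfolding adm_def using Ab AI pos by (auto simp: A_def)
 thus ?thesis using that off on by blast
qed

text \<open>One cut at each open end, the left part being removed by subtraction. At a closed end no
  point of \<open>I\<close> lies outside the window.\<close>

lemma Fc_window_cut:
 assumes w: "w : Fc" and l: "Lopen ==> w (el n) = 0" "~ Lopen ==> ALL x:I. el n <= x"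
  and r: "Ropen ==> w (er n) = 0" "~ Ropen ==> ALL x:I. x <= er n"
 shows "(%x. if el n <= x & x <= er n then w x else 0) : F"
proof -
 let ?v = "%x. if el n <= x then w x else 0"
 have v: "?v : Fc"
 proof (cases Lopen)
  case True
  show ?thesis by (rule Fc_congE[OF Fc_comb[OF w Fc_cut[OF w el_E l(1)[OF True]], of "-1"]]) (use l(1)[OF True] in auto)
 next
  case False
  show ?thesis by (rule Fc_congE[OF w]) (use l(2)[OF False] E_sub_I in auto)
 qed
 have "(%x. if el n <= x & x <= er n then w x else 0) : Fc"
 proof (cases Ropen)
  case True
  have "?v (er n) = 0" using r(1)[OF True] by simp
  from Fc_cut[OF v er_E this] show ?thesis by (rule Fc_congE) auto
 next
  case False
  show ?thesis by (rule Fc_congE[OF v]) (use r(2)[OF False] E_sub_I in auto)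
 qed
 thus ?thesis by blast
qed

text \<open>A function that vanishes at both ends of the window and outside it is controlled by its
  density alone: Cauchy-Schwarz from \<open>el n\<close> bounds its square by length times squared
  norm, and integration costs the finite \<open>mu\<close> measure of the window. The 1/2 is the
  factor in \<open>form\<close>.\<close>

lemma E1_window:
 assumes y: "cdens I y l" "y (el n) = 0" "y (er n) = 0"
  and h: "h : L2 mu" "!!x. x : E ==> h x = (if el n <= x & x <= er n then y x else 0)"
 shows "E1 mu form h <= (1/2 + measure mu (Kn n) * (er n - el n)) * (\<integral>x. (indicator {el n..er n} x * l x)^2 \<partial>lborel)"
proof -
 let ?Z = "\<integral>x. (indicator {el n..er n} x * l x)^2 \<partial>lborel"
 have y1: "cdens I (%x. y x - (if x <= el n then y x else 0)) (%x. l x - indicator {..el n} x * l x)"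
  by (rule cdens_diff[OF y(1) cdens_cut[OF y(1) el_E y(2)]])
 define H where "H x = (if x <= er n then y x - (if x <= el n then y x else 0) else 0)" for x
 define m where "m x = indicator {..er n} x * (l x - indicator {..el n} x * l x)" for x
 have d: "cdens I H m" unfolding H_def[abs_def] m_def[abs_def]
  by (rule cdens_cut[OF y1 er_E]) (use y(3) el_er[of n] in simp)
 have H0: "H (el n) = 0" by (simp add: H_def)
 have hH: "h x = H x" if "x : E" for x using h(2)[OF that] y(2) by (auto simp: H_def)
 have mm: "sqn lborel m <= ?Z"
 proof (rule L2r_int_mono[of "%x. indicator {el n..er n} x * l x" m])
  show "L2r (%x. indicator {el n..er n} x * l x)" by (rule L2r_indicator[OF densD(1)[OF cdens_dens[OF y(1)]]]) simp
  show "L2r m" by (rule densD(1)[OF cdens_dens[OF d]])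
  show "\<bar>m x\<bar> <= \<bar>indicator {el n..er n} x * l x\<bar>" for x by (auto simp: m_def indicator_def)
 qed
 have ae: "AE x in mu. h x = H x" by (rule AE_I2) (simp add: hH space_mu)
 have HK: "(H x)^2 <= indicator (Kn n) x * ((er n - el n) * sqn lborel m)" if x: "x : E" for x
 proof (cases "x : Kn n")
  case True
  hence xx: "el n <= x" "x <= er n" by (auto simp: Kn_def)
  have "(H x - H (el n))^2 <= \<bar>x - el n\<bar> * sqn lborel m"
   by (rule dens_sq_bound'[OF cdens_dens[OF d] el_I E_sub_I[OF x]])
  also have "\<dots> <= (er n - el n) * sqn lborel m" using xx by (intro mult_right_mono) auto
  finally show ?thesis using True by (simp add: H0)
 next
  case False
  thus ?thesis using x by (auto simp: H_def Kn_def)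
 qed
 have "sqn mu H <= (\<integral>x. indicator (Kn n) x * ((er n - el n) * sqn lborel m) \<partial>mu)"
 proof (rule integral_mono_AE)
  have "H : L2 mu" by (rule L2_AE(1)[OF h(1) measurable_cont_E[OF dens_cont_E[OF cdens_dens[OF d]]] ae])
  thus "integrable mu (%x. (H x)^2)" by (rule L2_int)
  show "integrable mu (%x. indicator (Kn n) x * ((er n - el n) * sqn lborel m))"
   by (intro integrable_mult_left integrable_real_indicator Kn_finite Kn_sets)
  show "AE x in mu. (H x)^2 <= indicator (Kn n) x * ((er n - el n) * sqn lborel m)"
   by (rule AE_I2) (simp only: space_mu HK)
 qed
 also have "\<dots> = measure mu (Kn n) * (er n - el n) * sqn lborel m"
  using Kn_sub[of n] by (simp add: space_mu Int_absorb2 mult.assoc)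
 finally have "E1 mu form h <= (1/2 + measure mu (Kn n) * (er n - el n)) * sqn lborel m"
  unfolding E1_rep[OF subset_refl d ae h(1)] by (simp add: algebra_simps)
 also have "\<dots> <= (1/2 + measure mu (Kn n) * (er n - el n)) * ?Z"
  using mm less_imp_le[OF el_er[of n]] by (intro mult_left_mono) auto
 finally show ?thesis .
qed

text \<open>The projection of the density of \<open>f\<close> reproduces it on the window, so
  densities of core elements converge to it there. Their end values need not match those of
  \<open>f\<close>: a separating element corrects the increment, a bump the level. The first
  correction tends to 0, because increments are integrals of densities; the second has no density
  inside the window.\<close>

lemma Cc_dom_sub_F:
 assumes off: "!!g k. Cd g k ==> AE x in lborel. x ~: A --> k x = 0"
  and on: "!!d n. (!!g k. Cd g k ==> AE x in lborel. x : {el n<..<er n} --> d x * k x = (0::real))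
   ==> AE x in lborel. x : {el n<..<er n} --> x : A --> d x = 0"
  and A: "adm A" and f: "f : dom A" "f : Cc_on E"
 shows "f : F"
proof -
 have fI: "f : dom I" using f(1) dom_sub_dom_I[OF A] by blast
 obtain g k where g: "cdens A g k" "AE x in mu. f x = g x" by (rule domE[OF f(1)]) blast
 have "continuous_on E f" using f(2) by (simp add: Cc_on_def)
 hence gE: "g x = f x" if "x : E" for x using cont_AE_eq[OF _ dens_cont_E[OF cdens_dens[OF g(1)]] g(2) that] by simp
 have gI: "cdens I g k" by (rule cdens_mono[OF g(1) admD(3)[OF A]])
 obtain n where n: "Lopen ==> ALL x:E. x <= el n --> f x = 0" "~ Lopen ==> ALL x:I. el n <= x"
   "Ropen ==> ALL x:E. er n <= x --> f x = 0" "~ Ropen ==> ALL x:I. x <= er n" using Cc_window[OF f(2)] by blast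
 let ?w = "%k x. indicator {el n..er n} x * (k x :: real)"
 have kL: "L2r k" by (rule densD(1)[OF cdens_dens[OF g(1)]])
 have T: "L2r (?w k)" "gconst (?w k)"
  using L2r_indicator[OF kL, of "{el n..er n}"] gconst_mult[OF gconst_window cdens_gconst[OF g(1)]] by simp_all
 obtain G K q where K: "!!j. Cd (G j) (K j)" "L2r q" "!!x. x ~: {el n..er n} ==> q x = 0"
   "AE x in lborel. x : {el n..er n} --> (%j. K j x) ----> q x"
   "(%j. \<integral>x. (?w (K j) x - q x)^2 \<partial>lborel) ----> 0"
   "!!g l. Cd g l ==> AE x in lborel. x : {el n<..<er n} --> (?w k x - q x) * l x = 0"
  by (rule window_projection[OF T, of n]) blast
 have "AE x in lborel. ALL j. x ~: A --> K j x = 0" unfolding AE_all_countable using off[OF K(1)] by blast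
 moreover have "AE x in lborel. x : {el n<..<er n} --> x : A --> ?w k x - q x = 0" by (rule on) (rule K(6))
 ultimately have kq: "AE x in lborel. q x = ?w k x"
  using K(4) AE_lborel_singleton[of "el n"] AE_lborel_singleton[of "er n"]
 proof eventually_elim
  case (elim x)
  consider "x ~: {el n..er n}" | "x : {el n<..<er n}" "x : A" | "x : {el n<..<er n}" "x ~: A" using elim(4,5) by fastforce
  thus ?case
  proof cases
   case 1
   thus ?thesis using K(3) by simp
  next
   case 2
   thus ?thesis using elim(2) by auto
  next
   case 3
   hence "(%j. 0) ----> q x" using elim(1,3) by auto
   hence "q x = 0" by (simp add: LIMSEQ_const_iff)
   thus ?thesis using densD(2)[OF cdens_dens[OF g(1)]] 3 by simp
  qed
 qed
 define rh where "rh j = (\<integral>x. (?w (%x. k x - K j x) x)^2 \<partial>lborel)" for j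
 have wL: "L2r (?w (%x. k x - K j x))" for j by (rule L2r_indicator[OF L2r_diff[OF kL CdD(4)[OF K(1)]]]) simp
 have rh_eq: "rh j = (\<integral>x. (?w (K j) x - q x)^2 \<partial>lborel)" for j
  unfolding rh_def
 proof (rule integral_cong_AE)
  show "AE x in lborel. (?w (%x. k x - K j x) x)^2 = (?w (K j) x - q x)^2"
   using kq by eventually_elim (auto simp: indicator_def power2_commute)
 qed (use L2r_meas[OF wL] L2r_meas[OF K(2)] L2r_meas[OF CdD(4)[OF K(1)]] in auto)
 have rh: "rh ----> 0" using K(5) unfolding rh_eq[symmetric] .
 obtain b kb where b: "Cd b kb" "!!x. x : Kn n ==> b x = 1" "AE x in lborel. x : {el n<..<er n} --> kb x = 0" using bump by blast
 have bl: "b (el n) = 1" "b (er n) = 1" using b(2) el_E er_E less_imp_le[OF el_er] by (auto simp: Kn_def)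
 have ne: "el n ~= er n" using el_er[of n] by simp
 obtain v kv where v: "Cd v kv" "v (el n) ~= v (er n)" by (rule separation[OF el_E er_E ne])
 define s where "s = v (er n) - v (el n)"
 \<comment> \<open>The missing increment over the window, measured in units of the nonzero increment
   \<open>s\<close> of \<open>v\<close>.\<close>
 define et where "et j = ((g (er n) - g (el n)) - (G j (er n) - G j (el n))) / s" for j
 have s: "s ~= 0" using v(2) by (simp add: s_def)
 define z where "z j x = G j x + et j * v x + (g (el n) - G j (el n) - et j * v (el n)) * b x" for j x
 define kz where "kz j x = K j x + et j * kv x + (g (el n) - G j (el n) - et j * v (el n)) * kb x" for j x
 have zC: "Cd (z j) (kz j)" for j unfolding z_def[abs_def] kz_def[abs_def] by (intro Cd_comb K(1) v(1) b(1))
 have zl: "z j (el n) = g (el n)" for j by (simp add: z_def bl)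
 have zr: "z j (er n) = g (er n)" for j
 proof -
  have "et j * s = (g (er n) - g (el n)) - (G j (er n) - G j (el n))" using s by (simp add: et_def)
  thus ?thesis by (simp add: z_def bl s_def algebra_simps)
 qed
 let ?Z = "%j x. if el n <= x & x <= er n then z j x else 0"
 have ZF: "?Z j : F" for j
  by (rule Fc_window_cut[OF CdD(1)[OF zC]]) (use n zl zr gE[OF el_E[of n]] gE[OF er_E[of n]] el_E[of n] er_E[of n] in auto)
 define V where "V = sqn lborel kv"
 define C where "C = 1/2 + measure mu (Kn n) * (er n - el n)"
 have C: "0 <= C" using less_imp_le[OF el_er[of n]] by (simp add: C_def)
 have bound: "E1 mu form (%x. f x - ?Z j x) <= C * (2 * rh j + 2 * ((er n - el n) / s^2 * rh j) * V)" for j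
 proof -
  let ?l = "%x. k x - kz j x"
  have yd: "cdens I (%x. g x - z j x) ?l" by (rule cdens_diff[OF gI CdD(2)[OF zC]])
  have hL: "(%x. f x - ?Z j x) : L2 mu" by (rule L2_diff[OF dom_L2[OF fI] F_L2[OF ZF]])
  have "E1 mu form (%x. f x - ?Z j x) <= C * (\<integral>x. (?w ?l x)^2 \<partial>lborel)"
   unfolding C_def
  proof (rule E1_window[OF yd _ _ hL])
   fix x assume x: "x : E"
   have "f x = 0" if o: "~ (el n <= x & x <= er n)"
   proof -
    consider "x < el n" | "er n < x" using o by linarith
    thus ?thesis
    proof cases
     case 1
     hence Lopen using n(2) E_sub_I[OF x] by force
     thus ?thesis using n(1) x 1 by auto
    next
     case 2
     hence Ropen using n(4) E_sub_I[OF x] by force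
     thus ?thesis using n(3) x 2 by auto
    qed
   qed
   thus "f x - ?Z j x = (if el n <= x & x <= er n then g x - z j x else 0)" using gE[OF x] by auto
  qed (use zl zr in auto)
  also have "(\<integral>x. (?w ?l x)^2 \<partial>lborel) <= (\<integral>x. 2 * (?w (%x. k x - K j x) x)^2 + 2 * (et j)^2 * (kv x)^2 \<partial>lborel)"
  proof (rule integral_mono_AE)
   show "integrable lborel (%x. (?w ?l x)^2)" by (rule L2r_sq[OF L2r_indicator[OF L2r_diff[OF kL CdD(4)[OF zC]]]]) simp
   show "integrable lborel (%x. 2 * (?w (%x. k x - K j x) x)^2 + 2 * (et j)^2 * (kv x)^2)" using L2r_sq[OF wL] L2r_sq[OF CdD(4)[OF v(1)]] by simp
   show "AE x in lborel. (?w ?l x)^2 <= 2 * (?w (%x. k x - K j x) x)^2 + 2 * (et j)^2 * (kv x)^2"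
    using b(3) AE_lborel_singleton[of "el n"] AE_lborel_singleton[of "er n"]
   proof eventually_elim
    case (elim x)
    show ?case
    proof (cases "x : {el n..er n}")
     case True
     hence "kb x = 0" using elim by auto
     hence l: "?w ?l x = (k x - K j x) - et j * kv x" using True by (simp add: kz_def)
     have "0 <= ((k x - K j x) + et j * kv x)^2" by simp
     thus ?thesis unfolding l using True by (simp add: power2_eq_square algebra_simps)
    qed simp
   qed
  qed
  also have "\<dots> = 2 * rh j + 2 * (et j)^2 * V" using L2r_sq[OF wL] L2r_sq[OF CdD(4)[OF v(1)]] by (simp add: rh_def V_def)
  also have "(et j)^2 <= (er n - el n) / s^2 * rh j"
  proof -
   note eI = el_I[of n] er_I[of n] less_imp_le[OF el_er[of n]]
   have "(g (er n) - g (el n)) - (G j (er n) - G j (el n)) = pint (%x. k x - K j x) (el n) (er n)"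
    using densD(3)[OF dens_diff[OF cdens_dens[OF gI] CdD(3)[OF K(1)[of j]]] eI] by simp
   also have "\<dots> = (LBINT t:{el n..er n}. ?w (%x. k x - K j x) t)" by (rule set_integral_cong') simp
   finally have "et j = (LBINT t:{el n..er n}. ?w (%x. k x - K j x) t) / s" by (simp add: et_def)
   moreover have "(LBINT t:{el n..er n}. ?w (%x. k x - K j x) t)^2 <= measure lborel {el n..er n} * rh j"
    unfolding rh_def by (rule L2r_set_CS[OF wL]) (simp_all add: emeasure_lborel_Icc_eq)
   ultimately show ?thesis using eI(3) s by (simp add: power_divide divide_right_mono)
  qed
  finally show ?thesis using C by (simp add: V_def mult_left_mono mult_right_mono)
 qed
 have "(%j. C * (2 * rh j + 2 * ((er n - el n) / s^2 * rh j) * V)) ----> C * (2 * 0 + 2 * ((er n - el n) / s^2 * 0) * V)"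
  by (intro tendsto_intros rh)
 hence lim: "(%j. C * (2 * rh j + 2 * ((er n - el n) / s^2 * rh j) * V)) ----> 0" by simp
 show ?thesis
 proof (rule F_limit[OF fI])
  fix e :: real assume "e > 0"
  with lim have "\<forall>\<^sub>F j in sequentially. C * (2 * rh j + 2 * ((er n - el n) / s^2 * rh j) * V) < e" by (rule order_tendstoD)
  then obtain j where "C * (2 * rh j + 2 * ((er n - el n) / s^2 * rh j) * V) < e" unfolding eventually_sequentially by blast
  hence "E1 mu form (%x. f x - ?Z j x) < e" using bound[of j] by linarith
  thus "EX u:F. E1d f u < e" by (intro bexI[of _ "?Z j"] ZF)
 qed
qed

theorem F_eq_dom: "EX A. adm A & F = dom A"
proof -
 obtain A where A: "adm A" and off: "!!g k. Cd g k ==> AE x in lborel. x ~: A --> k x = 0"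
  and on: "!!d n. (!!g k. Cd g k ==> AE x in lborel. x : {el n<..<er n} --> d x * k x = (0::real))
   ==> AE x in lborel. x : {el n<..<er n} --> x : A --> d x = 0" by (rule active_set) blast
 \<comment> \<open>\<open>dom A\<close> satisfies the same assumptions as \<open>F\<close>, so
   \<open>F_limit\<close> is available on both sides and each inclusion need only be checked on
   compactly supported elements.\<close>
 interpret D: fukushima E mu "dom A"
  using regular_dirichlet_dom[OF A] dom_sub_dom_I[OF A] by unfold_locales
 have FcA: "f : dom A" if f: "f : Fc" for f
 proof -
  obtain g k where g: "Cd g k" "!!x. x : E ==> g x = f x" using Fc_Cd[OF f] by blast
  note dd = CdD(3)[OF g(1)] and Ab = admD(1)[OF A]
  have m: "k : borel_measurable borel" by (rule L2r_meas[OF CdD(4)[OF g(1)]])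
  \<comment> \<open>The density is known to vanish off \<open>A\<close> almost everywhere only;
    multiplication by the indicator achieves it at every point, as \<open>dens\<close>
    demands.\<close>
  have ae: "AE x in lborel. k x = indicator A x * k x" using off[OF g(1)] by eventually_elim (auto simp: indicator_def)
  have "g y - g x = pint (%x. indicator A x * k x) x y" if xy: "x : I" "y : I" "x <= y" for x y
   unfolding densD(3)[OF dd xy] set_lebesgue_integral_def
   by (rule integral_cong_AE) (use ae m Ab in \<open>auto elim!: eventually_mono\<close>)
  hence "dens A g (%x. indicator A x * k x)" unfolding dens_def using L2r_indicator[OF CdD(4)[OF g(1)] Ab] by simp
  moreover have "gconst (%x. indicator A x * k x)" unfolding gconst_def
  proof (intro ballI allI impI)
   fix p x y assume p: "p : gaps E" "fst p < x & x < snd p & fst p < y & y < snd p"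
   hence "x : gapU" "y : gapU" unfolding gapU_def by force+
   hence "x : A" "y : A" using admD(2)[OF A] by blast+
   thus "indicator A x * k x = indicator A y * k y" using cdens_gconst[OF CdD(2)[OF g(1)]] p unfolding gconst_def by simp
  qed
  ultimately have "cdens A g (%x. indicator A x * k x)" by (simp add: cdens_def)
  from Cc_domI[OF _ this g(2)] show ?thesis using f by blast
 qed
 have "f : dom A" if f: "f : F" for f
 proof (rule D.F_limit)
  show "f : dom I" using f sub by blast
  show "EX u:dom A. E1d f u < e" if "e > 0" for e using F_core[OF f that] FcA by blast
 qed
 moreover have "f : F" if f: "f : dom A" for f
 proof (rule F_limit)
  show "f : dom I" using f dom_sub_dom_I[OF A] by blast
  have "apx A f" by (rule dom_apx[OF admD[OF A] f])
  have "h : F" if h: "h : dom A" "h : Cc_on E" for h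
  proof (rule Cc_dom_sub_F[OF _ _ A h])
   show "AE x in lborel. x ~: A --> k x = 0" if "Cd g k" for g k by (rule off[OF that])
   show "AE x in lborel. x : {el n<..<er n} --> x : A --> d x = 0"
    if "!!g k. Cd g k ==> AE x in lborel. x : {el n<..<er n} --> d x * k x = (0::real)" for d n
    by (rule on) (rule that)
  qed
  thus "EX u:F. E1d f u < e" if e: "e > 0" for e
   using \<open>apx A f\<close> e unfolding apx_def by (meson IntD1 IntD2)
 qed
 ultimately show ?thesis using A by blast
qed

end

theorem theorem3p2:
  fixes E :: "real set" and \<mu> :: "real measure"
    and F' :: "(real \<Rightarrow> real) set" and E' :: "(real \<Rightarrow> real) \<Rightarrow> (real \<Rightarrow> real) \<Rightarrow> real"
  assumes "class_K E"
    and "space \<mu> = E" and "sets \<mu> = sets (restrict_space borel E)"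
    and "radon_on E \<mu>" and "full_support E \<mu>"
  shows "fukushima_subspace E \<mu> (qd_domain E \<mu>) (qd_form E \<mu>) F' E' \<longleftrightarrow>
    (\<exists>s \<in> scale_S E. F' = qds_domain E \<mu> s \<and>
       (\<forall>f\<in>F'. \<forall>g\<in>F'. E' f g = qds_form E \<mu> s f g))"
proof -
 interpret qd_space E \<mu> using assms by unfold_locales
 show ?thesis
 proof
  assume fs: "fukushima_subspace E \<mu> (qd_domain E \<mu>) (qd_form E \<mu>) F' E'"
  hence r: "regular_dirichlet_form E \<mu> F' E'" and sub: "F' <= dom I"
   and e: "!!f g. f \<in> F' ==> g \<in> F' ==> E' f g = qd_form E \<mu> f g"
   unfolding fukushima_subspace_def qd_domain_eq by auto
  \<comment> \<open>Outside \<open>F'\<close> nothing is known about \<open>E'\<close>; agreement on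
    \<open>F'\<close> is enough to work with \<open>form\<close> from here on.\<close>
  have e': "form f g = E' f g" if f: "f \<in> F'" "g \<in> F'" for f g
   using e[OF f] qd_form_eq[OF subsetD[OF sub f(1)] subsetD[OF sub f(2)]] by simp
  interpret fukushima E \<mu> F' using regular_dirichlet_form_cong[OF r e'] sub by unfold_locales
  obtain A where A: "adm A" "F' = dom A" using F_eq_dom by blast
  obtain s where s: "s \<in> scale_S E" "scale_space E \<mu> A s" using adm_imp_scale_space[OF A(1)] by blast
  interpret scale_space E \<mu> A s by (rule s(2))
  have "ALL f:F'. ALL g:F'. E' f g = qds_form E \<mu> s f g" using e' qds_form_eq A(2) by simp
  thus "EX s:scale_S E. F' = qds_domain E \<mu> s & (ALL f:F'. ALL g:F'. E' f g = qds_form E \<mu> s f g)"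
   using s(1) qds_domain_eq A(2) by blast
 next
  assume "EX s:scale_S E. F' = qds_domain E \<mu> s & (ALL f:F'. ALL g:F'. E' f g = qds_form E \<mu> s f g)"
  then obtain s where s: "s \<in> scale_S E" "F' = qds_domain E \<mu> s" "!!f g. f \<in> F' ==> g \<in> F' ==> E' f g = qds_form E \<mu> s f g" by blast
  obtain A where "scale_space E \<mu> A s" using scale_S_imp_scale_space[OF s(1)] by blast
  then interpret scale_space E \<mu> A s .
  have F: "F' = dom A" using s(2) qds_domain_eq by simp
  show "fukushima_subspace E \<mu> (qd_domain E \<mu>) (qd_form E \<mu>) F' E'"
   unfolding F by (rule fukushima_dom[OF adm]) (use s(3) qds_form_eq F in simp)
 qed
qed



end
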